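(* The group $\Sigma(360\times3)=\langle A,E,W,F\rangle<\mathrm{SU}(3)$ is an inaccessible symmetry for each of the $\mathrm{SU}(3)$ irreducible representations with Dynkin labels $(1,1)$, $(3,0)$, $(0,3)$, $(2,2)$, $(4,1)$, $(1,4)$ and $(3,3)$, which are the non-trivial irreducible representations occurring in $(1,1)^{\otimes K}$ for $K\le3$; hence it decouples arbitrary anisotropic one-, two- and three-body interactions of qutrits under global pulses. Moreover, among the groups $\Delta(12),\Delta(27),\Delta(48)$, $\Delta(6),\Delta(24),\Delta(54)$, $\Sigma(60)$, $\Sigma(168)$, $\Sigma(36\times3)$, $\Sigma(72\times3)$, $\Sigma(216\times3)$, $\Sigma(360\times3)$, only $\Sigma(360\times3)$ is inaccessible to all these irreducible representations.
   Context: Dynkin labels $(d_1,d_2)$ denote the irrep of $\mathrm{SU}(3)$ with highest weight $d_1\mu_1+d_2\mu_2$, with $\mu_1,\mu_2$ the fundamental weights; $(1,0)$ is the standard representation on $\mathbb{C}^3$, $(1,1)$ the adjoint. A finite subgroup $\mathcal{G}<\mathrm{SU}(3)$ is an inaccessible symmetry for (is inaccessible to) a non-trivial irrep if that irrep contains no nonzero vector fixed by $\mathcal{G}$. Decoupling: on $N$ qutrits $\mathrm{SU}(3)$ acts by $\pi(g)=g^{\otimes N}$, and $\mathcal{G}$ decouples an operator $O$ if $\frac{1}{|\mathcal{G}|}\sum_{g\in\mathcal{G}}\pi(g)^\dagger O\pi(g)$ is a multiple of the identity. A $K$-body interaction is a linear combination of products of traceless operators acting on $K$ distinct qutrits (thus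 transforming in $(1,1)^{\otimes K}$); it is anisotropic if it is Hilbert–Schmidt orthogonal to all operators that commute with $\pi(g)$ for every $g\in\mathrm{SU}(3)$. With $\xi_n=e^{2\pi i/n}$, $\nu_1=\frac{-1+\sqrt5}{2}$, $\nu_2=\frac{-1-\sqrt5}{2}$: $A(n)=\mathrm{diag}(1,\xi_n,\xi_n^{-1})$, $A=A(2)$, $C=A(3)$, $D=\mathrm{diag}(\xi_9^2,\xi_9^2,\xi_9^2\xi_3)$, $Y=\mathrm{diag}(\xi_7,\xi_7^2,\xi_7^4)$, $$B=\begin{pmatrix}0&0&-1\\0&-1&0\\-1&0&0\end{pmatrix},\ E=\begin{pmatrix}0&1&0\\0&0&1\\1&0&0\end{pmatrix},\ F=\begin{pmatrix}-1&0&0\\0&0&-\xi_3\\0&-\xi_3^2&0\end{pmatrix},\ W=\tfrac12\begin{pmatrix}-1&\nu_2&\nu_1\\\nu_2&\nu_1&-1\\\nu_1&-1&\nu_2\end{pmatrix},$$ $$V=\tfrac{1}{\sqrt3\,i}\begin{pmatrix}1&1&1\\1&\xi_3&\xi_3^2\\1&\xi_3^2&\xi_3\end{pmatrix},\ X=\tfrac{1}{\sqrt3\,i}\begin{pmatrix}1&1&\xi_3^2\\1&\xi_3&\xi_3\\\xi_3&1&\xi_3\end{pmatrix},$$ $$Z=\tfrac{i}{\sqrt7}\begin{pmatrix}\xi_7^4-\xi_7^3&\xi_7^2-\xi_7^5&\xi_7-\xi_7^6\\\xi_7^2-\xi_7^5&\xi_7-\xi_7^6&\xi_7^4-\xi_7^3\\\xi_7-\xi_7^6&\xi_7^4-\xi_7^3&\xi_7^2-\xi_7^5\end{pmatrix}.$$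 Groups: $\Delta(3n^2)=\langle A(n),E\rangle$ (for $n=2,3,4$: $\Delta(12),\Delta(27),\Delta(48)$), $\Delta(6n^2)=\langle A(n),E,B\rangle$ (for $n=1,2,3$: $\Delta(6),\Delta(24),\Delta(54)$), $\Sigma(60)=\langle E,AW\rangle$, $\Sigma(168)=\langle Y,Z\rangle$, $\Sigma(36\times3)=\langle C,V\rangle$ (order 108), $\Sigma(72\times3)=\langle V,X\rangle$ (order 216), $\Sigma(216\times3)=\langle V,D\rangle$ (order 648), $\Sigma(360\times3)=\langle A,E,W,F\rangle$ (order 1080). *)

theory Defs
  imports
    Jordan_Normal_Form.Schur_Decomposition
    Jordan_Normal_Form.VS_Connect
    "HOL-Algebra.Generated_Groups"
begin

hide_const (open) Multiset.mult

section \<open>The group SU(3) and its irreducible representations\<close>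

definition SU3 :: "complex mat monoid" where
  "SU3 = \<lparr> carrier = {U \<in> carrier_mat 3 3. mat_adjoint U * U = 1\<^sub>m 3 \<and> det U = 1},
           mult = (*), one = 1\<^sub>m 3 \<rparr>"

text \<open>Type \<open>complex mat\<close> carries no topology. Since SU(3) is metrizable, continuity is sequential
  continuity with respect to entrywise convergence.\<close>

definition mat_tendsto :: "nat \<Rightarrow> (nat \<Rightarrow> complex mat) \<Rightarrow> complex mat \<Rightarrow> bool" where
  "mat_tendsto n X M \<longleftrightarrow> (\<forall>i<n. \<forall>j<n. (\<lambda>k. X k $$ (i, j)) \<longlonglongrightarrow> M $$ (i, j))"

definition SU3_rep :: "nat \<Rightarrow> (complex mat \<Rightarrow> complex mat) \<Rightarrow> bool" where
  "SU3_rep n \<rho> \<longleftrightarrow>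
     (\<forall>g \<in> carrier SU3. \<rho> g \<in> carrier_mat n n) \<and>
     \<rho> (1\<^sub>m 3) = 1\<^sub>m n \<and>
     (\<forall>g \<in> carrier SU3. \<forall>h \<in> carrier SU3. \<rho> (g * h) = \<rho> g * \<rho> h) \<and>
     (\<forall>X. \<forall>g \<in> carrier SU3. (\<forall>k. X k \<in> carrier SU3) \<and> mat_tendsto 3 X g
        \<longrightarrow> mat_tendsto n (\<lambda>k. \<rho> (X k)) (\<rho> g))"

definition SU3_irrep :: "nat \<Rightarrow> (complex mat \<Rightarrow> complex mat) \<Rightarrow> bool" where
  "SU3_irrep n \<rho> \<longleftrightarrow> SU3_rep n \<rho> \<and> n > 0 \<and>
     (\<forall>U. VectorSpace.subspace class_ring U (module_vec TYPE(complex) n) \<and>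
          (\<forall>g \<in> carrier SU3. \<forall>v \<in> U. \<rho> g *\<^sub>v v \<in> U)
        \<longrightarrow> U = {0\<^sub>v n} \<or> U = carrier_vec n)"

definition torus :: "complex \<Rightarrow> complex \<Rightarrow> complex mat" where
  "torus s t = mat_of_rows_list 3 [[s, 0, 0], [0, t, 0], [0, 0, inverse (s * t)]]"

text \<open>With \<open>L\<^sub>i\<close> the weight reading off the \<open>i\<close>-th diagonal entry, the fundamental weights are
  \<open>\<mu>\<^sub>1 = L\<^sub>1\<close> and \<open>\<mu>\<^sub>2 = L\<^sub>1 + L\<^sub>2\<close>, and \<open>(m\<^sub>1, m\<^sub>2)\<close> stands for \<open>m\<^sub>1 \<mu>\<^sub>1 + m\<^sub>2 \<mu>\<^sub>2\<close>.\<close>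

definition is_weight :: "nat \<Rightarrow> (complex mat \<Rightarrow> complex mat) \<Rightarrow> int \<times> int \<Rightarrow> bool" where
  "is_weight n \<rho> m \<longleftrightarrow> (\<exists>v \<in> carrier_vec n. v \<noteq> 0\<^sub>v n \<and>
     (\<forall>s t. cmod s = 1 \<and> cmod t = 1 \<longrightarrow>
        \<rho> (torus s t) *\<^sub>v v = (s powi fst m * (s * t) powi snd m) \<cdot>\<^sub>v v))"

text \<open>The simple roots are \<open>L\<^sub>1 - L\<^sub>2 = 2\<mu>\<^sub>1 - \<mu>\<^sub>2\<close> and \<open>L\<^sub>2 - L\<^sub>3 = -\<mu>\<^sub>1 + 2\<mu>\<^sub>2\<close>.\<close>

definition weight_le :: "int \<times> int \<Rightarrow> int \<times> int \<Rightarrow> bool" where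
  "weight_le k m \<longleftrightarrow> (\<exists>a b :: nat.
     fst m - fst k = 2 * int a - int b \<and> snd m - snd k = 2 * int b - int a)"

definition is_highest_weight :: "nat \<Rightarrow> (complex mat \<Rightarrow> complex mat) \<Rightarrow> int \<times> int \<Rightarrow> bool" where
  "is_highest_weight n \<rho> m \<longleftrightarrow> is_weight n \<rho> m \<and> (\<forall>k. is_weight n \<rho> k \<longrightarrow> weight_le k m)"

text \<open>\<open>\<rho>\<close> is (a matrix form of) the irreducible representation with Dynkin labels \<open>d\<close>.\<close>

definition dynkin_irrep :: "nat \<times> nat \<Rightarrow> nat \<Rightarrow> (complex mat \<Rightarrow> complex mat) \<Rightarrow> bool" where
  "dynkin_irrep d n \<rho> \<longleftrightarrow> SU3_irrep n \<rho> \<and> is_highest_weight n \<rho> (int (fst d), int (snd d))"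

text \<open>The irreducible representation with labels \<open>d\<close> is determined only up to equivalence, so the
  condition is imposed on each of its matrix forms.\<close>

definition inaccessible :: "complex mat set \<Rightarrow> nat \<times> nat \<Rightarrow> bool" where
  "inaccessible G d \<longleftrightarrow> (\<forall>n \<rho>. dynkin_irrep d n \<rho> \<longrightarrow>
     \<not> (\<exists>v \<in> carrier_vec n. v \<noteq> 0\<^sub>v n \<and> (\<forall>g \<in> G. \<rho> g *\<^sub>v v = v)))"


section \<open>Tensor products\<close>

definition tensor_mat :: "complex mat \<Rightarrow> complex mat \<Rightarrow> complex mat" (infixr "\<otimes>\<^sub>m" 70) where
  "M \<otimes>\<^sub>m P = mat (dim_row M * dim_row P) (dim_col M * dim_col P)
     (\<lambda>(i, j). M $$ (i div dim_row P, j div dim_col P) * P $$ (i mod dim_row P, j mod dim_col P))"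

definition tensor_list :: "complex mat list \<Rightarrow> complex mat" where
  "tensor_list Ms = foldr (\<otimes>\<^sub>m) Ms (1\<^sub>m 1)"

definition tensor_power :: "nat \<Rightarrow> complex mat \<Rightarrow> complex mat" where
  "tensor_power K M = tensor_list (replicate K M)"

text \<open>An injective intertwiner \<open>T\<close> identifies \<open>\<sigma>\<close> with a subrepresentation of \<open>\<rho>\<close>.\<close>

definition occurs_in ::
  "nat \<Rightarrow> (complex mat \<Rightarrow> complex mat) \<Rightarrow> nat \<Rightarrow> (complex mat \<Rightarrow> complex mat) \<Rightarrow> bool" where
  "occurs_in m \<sigma> n \<rho> \<longleftrightarrow> (\<exists>T \<in> carrier_mat n m.
     (\<forall>v \<in> carrier_vec m. T *\<^sub>v v = 0\<^sub>v n \<longrightarrow> v = 0\<^sub>v m) \<and>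
     (\<forall>g \<in> carrier SU3. \<rho> g * T = T * \<sigma> g))"

definition occurs_in_power :: "nat \<times> nat \<Rightarrow> nat \<times> nat \<Rightarrow> nat \<Rightarrow> bool" where
  "occurs_in_power d e K \<longleftrightarrow> (\<exists>m \<sigma> n \<rho>. dynkin_irrep d m \<sigma> \<and> dynkin_irrep e n \<rho> \<and>
     occurs_in m \<sigma> (n ^ K) (\<lambda>g. tensor_power K (\<rho> g)))"


section \<open>Decoupling of qutrit interactions\<close>

definition mat_trace :: "complex mat \<Rightarrow> complex" where
  "mat_trace M = (\<Sum>i<dim_row M. M $$ (i, i))"

abbreviation qutrit_ops :: "nat \<Rightarrow> complex mat set" where
  "qutrit_ops N \<equiv> carrier_mat (3 ^ N) (3 ^ N)"

definition twirl :: "complex mat set \<Rightarrow> nat \<Rightarrow> complex mat \<Rightarrow> complex mat" where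
  "twirl G N M = mat (3 ^ N) (3 ^ N) (\<lambda>ij. 1 / of_nat (card G) *
     (\<Sum>g\<in>G. (mat_adjoint (tensor_power N g) * M * tensor_power N g) $$ ij))"

definition decouples :: "complex mat set \<Rightarrow> nat \<Rightarrow> complex mat \<Rightarrow> bool" where
  "decouples G N M \<longleftrightarrow> (\<exists>c. twirl G N M = c \<cdot>\<^sub>m 1\<^sub>m (3 ^ N))"

text \<open>The identity fills the sites outside the set \<open>S\<close> of \<open>K\<close> qutrits acted on.\<close>

definition body_products :: "nat \<Rightarrow> nat \<Rightarrow> complex mat set" where
  "body_products N K = {tensor_list Ms | Ms S. length Ms = N \<and> S \<subseteq> {..<N} \<and> card S = K \<and>
     (\<forall>i\<in>S. Ms ! i \<in> carrier_mat 3 3 \<and> mat_trace (Ms ! i) = 0) \<and>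
     (\<forall>i\<in>{..<N} - S. Ms ! i = 1\<^sub>m 3)}"

definition body_interactions :: "nat \<Rightarrow> nat \<Rightarrow> complex mat set" where
  "body_interactions N K =
     LinearCombinations.module.span class_ring (module_mat TYPE(complex) (3 ^ N) (3 ^ N))
       (body_products N K)"

definition anisotropic :: "nat \<Rightarrow> complex mat \<Rightarrow> bool" where
  "anisotropic N M \<longleftrightarrow> (\<forall>P \<in> qutrit_ops N.
     (\<forall>g \<in> carrier SU3. P * tensor_power N g = tensor_power N g * P)
       \<longrightarrow> mat_trace (mat_adjoint P * M) = 0)"


section \<open>The finite subgroups\<close>

abbreviation mat3 :: "complex list list \<Rightarrow> complex mat" where
  "mat3 \<equiv> mat_of_rows_list 3"

definition \<xi> :: "nat \<Rightarrow> complex" where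
  "\<xi> n = cis (2 * pi / real n)"

definition \<nu>\<^sub>1 :: complex where "\<nu>\<^sub>1 = (-1 + complex_of_real (sqrt 5)) / 2"
definition \<nu>\<^sub>2 :: complex where "\<nu>\<^sub>2 = (-1 - complex_of_real (sqrt 5)) / 2"

definition matA :: "nat \<Rightarrow> complex mat" where
  "matA n = mat3 [[1, 0, 0], [0, \<xi> n, 0], [0, 0, inverse (\<xi> n)]]"

definition matB :: "complex mat" where
  "matB = mat3 [[0, 0, -1], [0, -1, 0], [-1, 0, 0]]"

definition matC :: "complex mat" where
  "matC = matA 3"

definition matD :: "complex mat" where
  "matD = mat3 [[\<xi> 9 ^ 2, 0, 0], [0, \<xi> 9 ^ 2, 0], [0, 0, \<xi> 9 ^ 2 * \<xi> 3]]"

definition matE :: "complex mat" where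
  "matE = mat3 [[0, 1, 0], [0, 0, 1], [1, 0, 0]]"

definition matF :: "complex mat" where
  "matF = mat3 [[-1, 0, 0], [0, 0, - \<xi> 3], [0, - (\<xi> 3 ^ 2), 0]]"

definition matV :: "complex mat" where
  "matV = (1 / (complex_of_real (sqrt 3) * \<i>)) \<cdot>\<^sub>m
     mat3 [[1, 1, 1], [1, \<xi> 3, \<xi> 3 ^ 2], [1, \<xi> 3 ^ 2, \<xi> 3]]"

definition matW :: "complex mat" where
  "matW = (1 / 2) \<cdot>\<^sub>m mat3 [[-1, \<nu>\<^sub>2, \<nu>\<^sub>1], [\<nu>\<^sub>2, \<nu>\<^sub>1, -1], [\<nu>\<^sub>1, -1, \<nu>\<^sub>2]]"

definition matX :: "complex mat" where
  "matX = (1 / (complex_of_real (sqrt 3) * \<i>)) \<cdot>\<^sub>m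
     mat3 [[1, 1, \<xi> 3 ^ 2], [1, \<xi> 3, \<xi> 3], [\<xi> 3, 1, \<xi> 3]]"

definition matY :: "complex mat" where
  "matY = mat3 [[\<xi> 7, 0, 0], [0, \<xi> 7 ^ 2, 0], [0, 0, \<xi> 7 ^ 4]]"

definition matZ :: "complex mat" where
  "matZ = (\<i> / complex_of_real (sqrt 7)) \<cdot>\<^sub>m
     mat3 [[\<xi> 7 ^ 4 - \<xi> 7 ^ 3, \<xi> 7 ^ 2 - \<xi> 7 ^ 5, \<xi> 7 - \<xi> 7 ^ 6],
           [\<xi> 7 ^ 2 - \<xi> 7 ^ 5, \<xi> 7 - \<xi> 7 ^ 6, \<xi> 7 ^ 4 - \<xi> 7 ^ 3],
           [\<xi> 7 - \<xi> 7 ^ 6, \<xi> 7 ^ 4 - \<xi> 7 ^ 3, \<xi> 7 ^ 2 - \<xi> 7 ^ 5]]"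

text \<open>\<open>Delta3 n\<close> and \<open>Delta6 n\<close> are \<open>\<Delta>(3n\<^sup>2)\<close> and \<open>\<Delta>(6n\<^sup>2)\<close>: the argument is \<open>n\<close>, not the order.\<close>

definition Delta3 :: "nat \<Rightarrow> complex mat set" where
  "Delta3 n = generate SU3 {matA n, matE}"

definition Delta6 :: "nat \<Rightarrow> complex mat set" where
  "Delta6 n = generate SU3 {matA n, matE, matB}"

definition Sigma60 :: "complex mat set" where
  "Sigma60 = generate SU3 {matE, matA 2 * matW}"

definition Sigma168 :: "complex mat set" where
  "Sigma168 = generate SU3 {matY, matZ}"

definition Sigma36x3 :: "complex mat set" where
  "Sigma36x3 = generate SU3 {matC, matV}"

definition Sigma72x3 :: "complex mat set" where
  "Sigma72x3 = generate SU3 {matV, matX}"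

definition Sigma216x3 :: "complex mat set" where
  "Sigma216x3 = generate SU3 {matV, matD}"

definition Sigma360x3 :: "complex mat set" where
  "Sigma360x3 = generate SU3 {matA 2, matE, matW, matF}"

definition candidate_groups :: "complex mat set set" where
  "candidate_groups =
     {Delta3 2, Delta3 3, Delta3 4, Delta6 1, Delta6 2, Delta6 3, Sigma60, Sigma168,
      Sigma36x3, Sigma72x3, Sigma216x3, Sigma360x3}"

definition interaction_labels :: "(nat \<times> nat) set" where
  "interaction_labels = {(1, 1), (3, 0), (0, 3), (2, 2), (4, 1), (1, 4), (3, 3)}"

end

theory Submission
  imports Defs "HOL-Library.Function_Algebras"
begin

text \<open>Let \<open>v\<close> be a highest weight vector of weight \<open>(a, b)\<close> and \<open>\<phi>\<close> a functional of the same weight. The Euler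
  decomposition of SU(3) into SU(2) factors and the representation theory of SU(2), reduced to the behaviour of functions on the
  circle, give \<open>\<phi> (g v) = g\<^sub>1\<^sub>1 ^ a * cnj g\<^sub>3\<^sub>3 ^ b * \<phi> v\<close> without any use of the Lie algebra.
  So \<open>g \<mapsto> \<phi> (g w)\<close>, for \<open>w\<close> in the span of the orbit of \<open>v\<close>, is a polynomial of bidegree \<open>(a, b)\<close> in
  the first row \<open>x\<close> and the conjugate third row \<open>z\<close> of \<open>g\<close>, restricted to the cone \<open>x\<cdot>z = 0\<close>; it is invariant
  under a subgroup when \<open>w\<close> is. For the seven labels a direct computation shows that no nonzero polynomial on the cone is invariant
  under \<open>A\<close>, \<open>E\<close>, \<open>W\<close>, \<open>F\<close>.
  The twirl of an interaction of at most three bodies has only weights below \<open>(3, 3)\<close>, so a lexicographically maximal weight vector in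
  the span of its orbit belongs to one of the seven labels, which is impossible, or is SU(3)-invariant, which contradicts anisotropy.
  Finiteness holds because \<open>\<Sigma>(360\<times>3)\<close> permutes six conics up to cube roots of unity, and each of the other groups leaves an explicit
  polynomial of bidegree \<open>(3, 3)\<close> invariant: \<open>x\<^sub>1 x\<^sub>2 x\<^sub>3 z\<^sub>1 z\<^sub>2 z\<^sub>3\<close>, a sum over the icosahedral axes, or a polarised invariant of the
  Hessian group or of the Klein quartic.\<close>

section \<open>Matrices in SU(3)\<close>

text \<open>\<open>inaccessible\<close> quantifies over all continuous irreducible matrix
  representations, unitary or not. Everything about them is therefore derived from weight vectors,
  functionals of a given weight and invariant subspaces; inner products enter only for concrete
  tensor powers. The two vectors \<open>x\<close> and \<open>z\<close> arise because the fundamental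
  weights are realised by the entry \<open>g $$ (0, 0)\<close> and by
  \<open>cnj (g $$ (2, 2))\<close>, which is the leading 2 by 2 minor of \<open>g\<close>; the
  equation of the cone is the orthogonality of the first and last rows. Exchanging \<open>x\<close>
  and \<open>z\<close> passes to the dual representation, so five bidegrees cover the seven labels.
  To refute inaccessibility an actual irreducible representation with labels \<open>(3, 3)\<close>
  is required. It is built as the span of the orbit of a highest weight vector in the third tensor
  power of the operators on one qutrit, where multiplicity one of the highest weight together with
  unitarity gives irreducibility. The fixed vector in it is the Riesz dual of an invariant
  polynomial.\<close>

lemma mat_adjoint_carrier [simp]: "A \<in> carrier_mat n m \<Longrightarrow> mat_adjoint A \<in> carrier_mat m n"
  by (auto simp: mat_adjoint_def mat_of_rows_def)

lemma mat_adjoint_dim [simp]: "dim_row (mat_adjoint A) = dim_col A" "dim_col (mat_adjoint A) = dim_row A"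
  by (auto simp: mat_adjoint_def mat_of_rows_def)

lemma mat_adjoint_index [simp]:
  "i < dim_col A \<Longrightarrow> j < dim_row A \<Longrightarrow> mat_adjoint (A :: complex mat) $$ (i, j) = cnj (A $$ (j, i))"
  by (auto simp: mat_adjoint_def mat_of_rows_index vec_index_conjugate)

definition M3 :: "complex \<Rightarrow> complex \<Rightarrow> complex \<Rightarrow> complex \<Rightarrow> complex \<Rightarrow> complex \<Rightarrow> complex \<Rightarrow> complex \<Rightarrow> complex \<Rightarrow> complex mat" where
  "M3 a b c d e f g h i = mat3 [[a, b, c], [d, e, f], [g, h, i]]"

lemma M3_carrier [simp]: "M3 a b c d e f g h i \<in> carrier_mat 3 3"
  by (auto simp: M3_def mat_of_rows_list_def)

lemma M3_dim [simp]: "dim_row (M3 a b c d e f g h i) = 3" "dim_col (M3 a b c d e f g h i) = 3"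
  by (auto simp: M3_def mat_of_rows_list_def)

lemma M3_index [simp]:
  "M3 a b c d e f g h i $$ (0, 0) = a" "M3 a b c d e f g h i $$ (0, 1) = b" "M3 a b c d e f g h i $$ (0, 2) = c"
  "M3 a b c d e f g h i $$ (1, 0) = d" "M3 a b c d e f g h i $$ (1, 1) = e" "M3 a b c d e f g h i $$ (1, 2) = f"
  "M3 a b c d e f g h i $$ (2, 0) = g" "M3 a b c d e f g h i $$ (2, 1) = h" "M3 a b c d e f g h i $$ (2, 2) = i"
  "M3 a b c d e f g h i $$ (0, Suc 0) = b" "M3 a b c d e f g h i $$ (Suc 0, 0) = d"
  "M3 a b c d e f g h i $$ (Suc 0, Suc 0) = e" "M3 a b c d e f g h i $$ (Suc 0, 2) = f"
  "M3 a b c d e f g h i $$ (2, Suc 0) = h"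
  by (auto simp: M3_def mat_of_rows_list_def)

lemma less_3_cases: "(i::nat) < 3 \<longleftrightarrow> i = 0 \<or> i = 1 \<or> i = 2"
  by auto

lemma sum_lessThan_3: "(\<Sum>k<3::nat. f k) = f 0 + f 1 + (f 2 :: 'a :: comm_monoid_add)"
  by (simp add: numeral_3_eq_3 numeral_2_eq_2)

lemma mat_mult_index_sum:
  "A \<in> carrier_mat n m \<Longrightarrow> B \<in> carrier_mat m p \<Longrightarrow> i < n \<Longrightarrow> j < p \<Longrightarrow>
   (A * B) $$ (i, j) = (\<Sum>k<m. A $$ (i, k) * B $$ (k, j) :: complex)"
  by (auto simp: scalar_prod_def atLeast0LessThan intro!: sum.cong)

lemma mult_index_3:
  "A \<in> carrier_mat 3 3 \<Longrightarrow> B \<in> carrier_mat 3 3 \<Longrightarrow> i < 3 \<Longrightarrow> j < 3 \<Longrightarrow>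
   (A * B) $$ (i, j) = A $$ (i, 0) * B $$ (0, j) + A $$ (i, 1) * B $$ (1, j) + A $$ (i, 2) * (B $$ (2, j) :: complex)"
  by (simp add: mat_mult_index_sum[of A 3 3 B 3] sum_lessThan_3 del: index_mult_mat)

lemma mat3_eqI:
  assumes "A \<in> carrier_mat 3 3" "B \<in> carrier_mat 3 3"
    "A $$ (0, 0) = B $$ (0, 0)" "A $$ (0, 1) = B $$ (0, 1)" "A $$ (0, 2) = B $$ (0, 2)"
    "A $$ (1, 0) = B $$ (1, 0)" "A $$ (1, 1) = B $$ (1, 1)" "A $$ (1, 2) = B $$ (1, 2)"
    "A $$ (2, 0) = B $$ (2, 0)" "A $$ (2, 1) = B $$ (2, 1)" "A $$ (2, 2) = B $$ (2, 2)"
  shows "A = B"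
  using assms by (intro eq_matI) (auto simp: less_3_cases)

lemma M3_surj:
  assumes "A \<in> carrier_mat 3 3"
  shows "A = M3 (A $$ (0, 0)) (A $$ (0, 1)) (A $$ (0, 2)) (A $$ (1, 0)) (A $$ (1, 1)) (A $$ (1, 2))
                (A $$ (2, 0)) (A $$ (2, 1)) (A $$ (2, 2))"
  using assms by (intro mat3_eqI) simp_all

lemma M3_eq_iff:
  "M3 a b c d e f g h i = M3 a' b' c' d' e' f' g' h' i' \<longleftrightarrow>
   a = a' \<and> b = b' \<and> c = c' \<and> d = d' \<and> e = e' \<and> f = f' \<and> g = g' \<and> h = h' \<and> i = i'"
  by (metis M3_index(1-9))

lemma M3_mult:
  "M3 a b c d e f g h i * M3 a' b' c' d' e' f' g' h' i' =
   M3 (a * a' + b * d' + c * g') (a * b' + b * e' + c * h') (a * c' + b * f' + c * i')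
      (d * a' + e * d' + f * g') (d * b' + e * e' + f * h') (d * c' + e * f' + f * i')
      (g * a' + h * d' + i * g') (g * b' + h * e' + i * h') (g * c' + h * f' + i * i')"
  by (rule mat3_eqI) (simp_all add: mult_index_3 mult_carrier_mat[of _ 3 3 _ 3] del: index_mult_mat)

lemma M3_one: "1\<^sub>m 3 = M3 1 0 0 0 1 0 0 0 1"
  by (rule mat3_eqI) simp_all

lemma M3_adjoint:
  "mat_adjoint (M3 a b c d e f g h i) =
   M3 (cnj a) (cnj d) (cnj g) (cnj b) (cnj e) (cnj h) (cnj c) (cnj f) (cnj i)"
  by (rule mat3_eqI) simp_all

lemma M3_smult: "x \<cdot>\<^sub>m M3 a b c d e f g h i = M3 (x*a) (x*b) (x*c) (x*d) (x*e) (x*f) (x*g) (x*h) (x*i)"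
  by (rule mat3_eqI) simp_all

lemma det_2: "A \<in> carrier_mat 2 2 \<Longrightarrow> det (A :: complex mat) = A $$ (0, 0) * A $$ (1, 1) - A $$ (0, 1) * A $$ (1, 0)"
  by (subst laplace_expansion_column[of A 2 0])
     (auto simp: numeral_2_eq_2 lessThan_Suc cofactor_def mat_delete_def det_single)

lemma M3_det: "det (M3 a b c d e f g h i) = a * (e * i - f * h) - b * (d * i - f * g) + c * (d * h - e * g)"
proof -
  let ?M = "M3 a b c d e f g h i"
  have d: "det (mat_delete ?M k 0) = mat_delete ?M k 0 $$ (0, 0) * mat_delete ?M k 0 $$ (1, 1)
      - mat_delete ?M k 0 $$ (0, 1) * mat_delete ?M k 0 $$ (1, 0)" for k
    by (rule det_2) (auto simp: mat_delete_def)
  have "det ?M = (\<Sum>k<3. ?M $$ (k, 0) * cofactor ?M k 0)"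
    by (rule laplace_expansion_column) auto
  then show ?thesis
    unfolding sum_lessThan_3 cofactor_def d
    by (simp add: mat_delete_def M3_def mat_of_rows_list_def numeral_2_eq_2 algebra_simps)
qed

lemma SU3_carrier_iff:
  "g \<in> carrier SU3 \<longleftrightarrow> g \<in> carrier_mat 3 3 \<and> mat_adjoint g * g = 1\<^sub>m 3 \<and> det g = 1"
  by (simp add: SU3_def)

lemma SU3_simps [simp]: "mult SU3 = (*)" "one SU3 = 1\<^sub>m 3"
  by (simp_all add: SU3_def)

lemma SU3_mat: "g \<in> carrier SU3 \<Longrightarrow> g \<in> carrier_mat 3 3"
  by (simp add: SU3_carrier_iff)

lemma adjoint_mult_3:
  assumes "A \<in> carrier_mat 3 3" "B \<in> carrier_mat 3 3"
  shows "mat_adjoint (A * B) = mat_adjoint B * mat_adjoint (A :: complex mat)"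
proof -
  obtain a b c d e f g h i where A: "A = M3 a b c d e f g h i" using M3_surj[OF assms(1)] by blast
  obtain a' b' c' d' e' f' g' h' i' where B: "B = M3 a' b' c' d' e' f' g' h' i'" using M3_surj[OF assms(2)] by blast
  show ?thesis unfolding A B M3_mult M3_adjoint M3_eq_iff by (simp add: mult_ac)
qed

lemma adjoint_adjoint: "mat_adjoint (mat_adjoint A) = (A :: complex mat)"
  by (rule eq_matI) simp_all

lemma SU3_adjoint_right: "g \<in> carrier SU3 \<Longrightarrow> g * mat_adjoint g = 1\<^sub>m 3"
  using mat_mult_left_right_inverse[of "mat_adjoint g" 3 g] by (auto simp: SU3_carrier_iff)

lemma SU3_adjoint_left: "g \<in> carrier SU3 \<Longrightarrow> mat_adjoint g * g = 1\<^sub>m 3"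
  by (auto simp: SU3_carrier_iff)

lemma SU3_adjoint [simp]: "g \<in> carrier SU3 \<Longrightarrow> mat_adjoint g \<in> carrier SU3"
  using SU3_adjoint_right[of g] det_mult[of "mat_adjoint g" 3 g]
  by (auto simp: SU3_carrier_iff adjoint_adjoint)

lemma SU3_mult [simp]: "g \<in> carrier SU3 \<Longrightarrow> h \<in> carrier SU3 \<Longrightarrow> g * h \<in> carrier SU3"
proof -
  assume g: "g \<in> carrier SU3" and h: "h \<in> carrier SU3"
  note m = SU3_mat[OF g] SU3_mat[OF h]
  have "mat_adjoint (g * h) * (g * h) = mat_adjoint h * (mat_adjoint g * g) * h"
    using m by (simp add: adjoint_mult_3 mult_carrier_mat[of _ 3 3 _ 3] assoc_mult_mat[of _ 3 3 _ 3 _ 3])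
  also have "\<dots> = 1\<^sub>m 3"
    using g h m by (simp add: SU3_adjoint_left)
  finally show "g * h \<in> carrier SU3"
    using m g h by (simp add: SU3_carrier_iff det_mult[of _ 3])
qed

lemma SU3_one [simp]: "1\<^sub>m 3 \<in> carrier SU3"
  by (simp add: SU3_carrier_iff M3_one M3_adjoint M3_mult M3_det)

lemma SU3_group: "group SU3"
proof (rule groupI)
  fix x y z assume "x \<in> carrier SU3" "y \<in> carrier SU3" "z \<in> carrier SU3"
  then show "x \<otimes>\<^bsub>SU3\<^esub> y \<otimes>\<^bsub>SU3\<^esub> z = x \<otimes>\<^bsub>SU3\<^esub> (y \<otimes>\<^bsub>SU3\<^esub> z)"
    using assoc_mult_mat[of x 3 3 y 3 z 3] by (simp add: SU3_mat)
next
  fix x assume x: "x \<in> carrier SU3"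
  then show "\<exists>y\<in>carrier SU3. y \<otimes>\<^bsub>SU3\<^esub> x = \<one>\<^bsub>SU3\<^esub>"
    using SU3_adjoint_left[OF x] by (auto intro!: bexI[of _ "mat_adjoint x"])
qed (use left_mult_one_mat SU3_mat in auto)

lemma SU3_inv: "g \<in> carrier SU3 \<Longrightarrow> inv\<^bsub>SU3\<^esub> g = mat_adjoint g"
  by (rule group.inv_equality[OF SU3_group]) (auto simp: SU3_adjoint_left)

text \<open>The adjugate \<open>?C\<close> is a left inverse of \<open>g\<close> because the
  determinant is 1, and the adjoint is an inverse as well; cancelling \<open>g\<close> identifies
  the two.\<close>

lemma SU3_cofactor:
  assumes g: "g \<in> carrier SU3"
  defines "a \<equiv> \<lambda>i j. g $$ (i, j)"
  shows "cnj (a 0 0) = a 1 1 * a 2 2 - a 1 2 * a 2 1" "cnj (a 0 1) = a 1 2 * a 2 0 - a 1 0 * a 2 2"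
    "cnj (a 0 2) = a 1 0 * a 2 1 - a 1 1 * a 2 0" "cnj (a 1 0) = a 0 2 * a 2 1 - a 0 1 * a 2 2"
    "cnj (a 1 1) = a 0 0 * a 2 2 - a 0 2 * a 2 0" "cnj (a 1 2) = a 0 1 * a 2 0 - a 0 0 * a 2 1"
    "cnj (a 2 0) = a 0 1 * a 1 2 - a 0 2 * a 1 1" "cnj (a 2 1) = a 0 2 * a 1 0 - a 0 0 * a 1 2"
    "cnj (a 2 2) = a 0 0 * a 1 1 - a 0 1 * a 1 0"
proof -
  note m = SU3_mat[OF g]
  let ?C = "M3 (a 1 1 * a 2 2 - a 1 2 * a 2 1) (a 0 2 * a 2 1 - a 0 1 * a 2 2) (a 0 1 * a 1 2 - a 0 2 * a 1 1)
     (a 1 2 * a 2 0 - a 1 0 * a 2 2) (a 0 0 * a 2 2 - a 0 2 * a 2 0) (a 0 2 * a 1 0 - a 0 0 * a 1 2)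
     (a 1 0 * a 2 1 - a 1 1 * a 2 0) (a 0 1 * a 2 0 - a 0 0 * a 2 1) (a 0 0 * a 1 1 - a 0 1 * a 1 0)"
  have gM: "g = M3 (a 0 0) (a 0 1) (a 0 2) (a 1 0) (a 1 1) (a 1 2) (a 2 0) (a 2 1) (a 2 2)"
    using M3_surj[OF m] by (simp add: a_def)
  have dt: "a 0 0 * (a 1 1 * a 2 2 - a 1 2 * a 2 1) - a 0 1 * (a 1 0 * a 2 2 - a 1 2 * a 2 0)
      + a 0 2 * (a 1 0 * a 2 1 - a 1 1 * a 2 0) = 1"
    using g gM M3_det SU3_carrier_iff by metis
  have "?C * g = 1\<^sub>m 3"
    apply (subst gM)
    apply (simp only: M3_mult M3_one M3_eq_iff)
    by (intro conjI; (simp add: algebra_simps; fail)?; insert dt; Groebner_Basis.algebra)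
  then have "?C * g * mat_adjoint g = mat_adjoint g"
    using m by simp
  then have eq: "?C = mat_adjoint g"
    using m SU3_adjoint_right[OF g] assoc_mult_mat[of ?C 3 3 g 3 "mat_adjoint g" 3] by simp
  have "?C = M3 (cnj (a 0 0)) (cnj (a 1 0)) (cnj (a 2 0)) (cnj (a 0 1)) (cnj (a 1 1)) (cnj (a 2 1))
     (cnj (a 0 2)) (cnj (a 1 2)) (cnj (a 2 2))"
    by (subst eq, subst gM, rule M3_adjoint)
  then show "cnj (a 0 0) = a 1 1 * a 2 2 - a 1 2 * a 2 1" "cnj (a 0 1) = a 1 2 * a 2 0 - a 1 0 * a 2 2"
    "cnj (a 0 2) = a 1 0 * a 2 1 - a 1 1 * a 2 0" "cnj (a 1 0) = a 0 2 * a 2 1 - a 0 1 * a 2 2"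
    "cnj (a 1 1) = a 0 0 * a 2 2 - a 0 2 * a 2 0" "cnj (a 1 2) = a 0 1 * a 2 0 - a 0 0 * a 2 1"
    "cnj (a 2 0) = a 0 1 * a 1 2 - a 0 2 * a 1 1" "cnj (a 2 1) = a 0 2 * a 1 0 - a 0 0 * a 1 2"
    "cnj (a 2 2) = a 0 0 * a 1 1 - a 0 1 * a 1 0"
    unfolding M3_eq_iff by simp_all
qed

lemma M3_SU3I:
  assumes "M3 (cnj a) (cnj d) (cnj g) (cnj b) (cnj e) (cnj h) (cnj c) (cnj f) (cnj i) * M3 a b c d e f g h i = 1\<^sub>m 3"
    "a * (e * i - f * h) - b * (d * i - f * g) + c * (d * h - e * g) = 1"
  shows "M3 a b c d e f g h i \<in> carrier SU3"
  using assms by (simp add: SU3_carrier_iff M3_adjoint M3_det)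

section \<open>Torus, the two simple-root copies of SU(2), Euler decomposition\<close>

lemma torus_M3: "torus s t = M3 s 0 0 0 t 0 0 0 (inverse (s * t))"
  by (simp add: torus_def M3_def)

definition k12 :: "complex \<Rightarrow> complex \<Rightarrow> complex mat" where
  "k12 a b = M3 a b 0 (- cnj b) (cnj a) 0 0 0 1"

definition k23 :: "complex \<Rightarrow> complex \<Rightarrow> complex mat" where
  "k23 a b = M3 1 0 0 0 a b 0 (- cnj b) (cnj a)"

abbreviation on_S3 :: "complex \<Rightarrow> complex \<Rightarrow> bool" where
  "on_S3 a b \<equiv> a * cnj a + b * cnj b = 1"

lemma cmod_1_iff: "cmod z = 1 \<longleftrightarrow> z * cnj z = 1"
  by (metis complex_norm_square cmod_eq_Re norm_ge_zero of_real_1 of_real_eq_iff one_power2 power2_eq_iff_nonneg zero_le_one)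

lemma cmod_1_inverse: "cmod z = 1 \<Longrightarrow> inverse z = cnj z"
  by (metis cmod_1_iff inverse_unique)

lemma torus_SU3 [simp]: "cmod s = 1 \<Longrightarrow> cmod t = 1 \<Longrightarrow> torus s t \<in> carrier SU3"
  unfolding torus_M3
  by (rule M3_SU3I) (auto simp: M3_mult M3_one M3_eq_iff cmod_1_inverse norm_mult cmod_1_iff mult_ac, Groebner_Basis.algebra+)

lemma torus_mult: "torus s t * torus s' t' = torus (s * s') (t * t')"
  by (simp add: torus_M3 M3_mult mult_ac)

lemma torus_1 [simp]: "torus 1 1 = 1\<^sub>m 3"
  by (simp add: torus_M3 M3_one)

lemma k12_SU3 [simp]: "on_S3 a b \<Longrightarrow> k12 a b \<in> carrier SU3"
  unfolding k12_def by (rule M3_SU3I) (auto simp: M3_mult M3_one M3_eq_iff mult_ac add_ac)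

lemma k23_SU3 [simp]: "on_S3 a b \<Longrightarrow> k23 a b \<in> carrier SU3"
  unfolding k23_def by (rule M3_SU3I) (auto simp: M3_mult M3_one M3_eq_iff mult_ac add_ac)

lemma k12_mult: "k12 a b * k12 c d = k12 (a * c - b * cnj d) (a * d + b * cnj c)"
  by (simp add: k12_def M3_mult M3_eq_iff algebra_simps)

lemma k23_mult: "k23 a b * k23 c d = k23 (a * c - b * cnj d) (a * d + b * cnj c)"
  by (simp add: k23_def M3_mult M3_eq_iff algebra_simps)

lemma on_S3_mult: "on_S3 a b \<Longrightarrow> on_S3 c d \<Longrightarrow> on_S3 (a * c - b * cnj d) (a * d + b * cnj c)"
proof -
  assume *: "on_S3 a b" "on_S3 c d"
  have "(a * c - b * cnj d) * cnj (a * c - b * cnj d) + (a * d + b * cnj c) * cnj (a * d + b * cnj c)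
    = (a * cnj a + b * cnj b) * (c * cnj c + d * cnj d)"
    by (simp add: algebra_simps)
  then show ?thesis using * by simp
qed

lemma on_S3_inv: "on_S3 a b \<Longrightarrow> on_S3 (cnj a) (- b)"
  by (simp add: mult_ac)

lemma k12_inv: "on_S3 a b \<Longrightarrow> k12 (cnj a) (- b) * k12 a b = 1\<^sub>m 3"
  "on_S3 a b \<Longrightarrow> k12 a b * k12 (cnj a) (- b) = 1\<^sub>m 3"
  by (simp_all add: k12_mult) (simp_all add: k12_def M3_one M3_eq_iff mult_ac)

text \<open>Supplies the rotation that clears one of two matrix entries: \<open>(y, - x)\<close>
  divided by the norm of \<open>(x, y)\<close>.\<close>

lemma S3_rotation: "\<exists>a b. on_S3 a b \<and> a * x + b * y = 0"
proof (cases "x = 0 \<and> y = 0")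
  case True
  then show ?thesis by (intro exI[of _ 1] exI[of _ 0]) simp
next
  case False
  define r where "r = sqrt ((cmod x)\<^sup>2 + (cmod y)\<^sup>2)"
  have "(cmod x)\<^sup>2 + (cmod y)\<^sup>2 > 0" using False by (simp add: sum_power2_gt_zero_iff)
  then have r: "r > 0" "r\<^sup>2 = (cmod x)\<^sup>2 + (cmod y)\<^sup>2" by (simp_all add: r_def)
  have r2: "complex_of_real r * complex_of_real r = x * cnj x + y * cnj y"
  proof -
    have "complex_of_real (r\<^sup>2) = x * cnj x + y * cnj y"
        by (simp only: r(2) of_real_add complex_norm_square)
    then show ?thesis by (simp only: power2_eq_square of_real_mult)
  qed
  have r0: "complex_of_real r \<noteq> 0" using r by simp
  have "on_S3 (y / of_real r) (- x / of_real r)"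
  proof -
    have "y / of_real r * cnj (y / of_real r) + (- x / of_real r) * cnj (- x / of_real r)
        = (x * cnj x + y * cnj y) / (of_real r * of_real r)"
      by (simp add: add_divide_distrib)
    then show ?thesis using r0 by (simp add: r2[symmetric])
  qed
  moreover have "y / of_real r * x + (- x / of_real r) * y = 0" by simp
  ultimately show ?thesis by blast
qed

text \<open>Rotations by \<open>k12\<close> from the left and from the right clear the corners
  \<open>(0, 2)\<close> and \<open>(2, 0)\<close>. Orthogonality of the first and last rows of the
  rest \<open>h\<close> then reads \<open>h $$ (0, 1) * cnj (h $$ (2, 1)) = 0\<close>, so
  \<open>h\<close> is block diagonal: a scalar followed by a 2 by 2 block, or the reverse.\<close>

lemma SU3_euler:
  assumes g: "g \<in> carrier SU3"
  shows "\<exists>a b s t c d a' b'. on_S3 a b \<and> cmod s = 1 \<and> cmod t = 1 \<and> on_S3 c d \<and> on_S3 a' b' \<and>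
    g = k12 a b * torus s t * k23 c d * k12 a' b'"
proof -
  obtain a0 b0 where ab0: "on_S3 a0 b0" "a0 * g $$ (0, 2) + b0 * g $$ (1, 2) = 0"
    using S3_rotation by blast
  define g1 where "g1 = k12 a0 b0 * g"
  have g1: "g1 \<in> carrier SU3" unfolding g1_def using ab0 g by simp
  have g102: "g1 $$ (0, 2) = 0"
    using ab0(2) SU3_mat[OF g] SU3_mat[OF k12_SU3[OF ab0(1)]] unfolding g1_def
    by (simp add: mult_index_3 del: index_mult_mat) (simp add: k12_def)
  obtain a1' b1' where ab1': "on_S3 a1' b1'" "a1' * g1 $$ (2, 0) + b1' * g1 $$ (2, 1) = 0"
    using S3_rotation by blast
  \<comment> \<open>Column 0 of \<open>k12 a1 b1\<close> is \<open>(a1, - cnj b1, 0)\<close>, hence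
    the sign and the conjugate.\<close>
  define a1 b1 where "a1 = a1'" and "b1 = - cnj b1'"
  have ab1: "on_S3 a1 b1" "a1 * g1 $$ (2, 0) - cnj b1 * g1 $$ (2, 1) = 0"
    using ab1' by (simp_all add: a1_def b1_def mult_ac)
  define h where "h = g1 * k12 a1 b1"
  have hS: "h \<in> carrier SU3" unfolding h_def using ab1 g1 by simp
  have h02: "h $$ (0, 2) = 0"
    using g102 SU3_mat[OF g1] SU3_mat[OF k12_SU3[OF ab1(1)]] unfolding h_def
    by (simp add: mult_index_3 del: index_mult_mat) (simp add: k12_def)
  have h20: "h $$ (2, 0) = 0"
    using ab1(2) SU3_mat[OF g1] SU3_mat[OF k12_SU3[OF ab1(1)]] unfolding h_def
    by (simp add: mult_index_3 del: index_mult_mat) (simp add: k12_def algebra_simps)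
  have gh: "g = k12 (cnj a0) (- b0) * h * k12 (cnj a1) (- b1)"
  proof -
    note m = SU3_mat[OF g] SU3_mat[OF k12_SU3[OF ab0(1)]] SU3_mat[OF k12_SU3[OF ab1(1)]]
      SU3_mat[OF k12_SU3[OF on_S3_inv[OF ab0(1)]]] SU3_mat[OF k12_SU3[OF on_S3_inv[OF ab1(1)]]] SU3_mat[OF g1]
    have "k12 (cnj a0) (- b0) * h * k12 (cnj a1) (- b1) =
      k12 (cnj a0) (- b0) * (g1 * (k12 a1 b1 * k12 (cnj a1) (- b1)))"
      unfolding h_def using m by (simp add: assoc_mult_mat[of _ 3 3 _ 3 _ 3])
    also have "\<dots> = k12 (cnj a0) (- b0) * k12 a0 b0 * g"
      using m ab1 by (simp add: k12_inv g1_def assoc_mult_mat[of _ 3 3 _ 3 _ 3])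
    also have "\<dots> = g" using m ab0 by (simp add: k12_inv)
    finally show ?thesis ..
  qed
  note cof = SU3_cofactor[OF hS]
  have hM: "h = M3 (h $$ (0, 0)) (h $$ (0, 1)) 0 (h $$ (1, 0)) (h $$ (1, 1)) (h $$ (1, 2)) 0 (h $$ (2, 1)) (h $$ (2, 2))"
    using M3_surj[OF SU3_mat[OF hS]] h02 h20 by simp
  have "h * mat_adjoint h = 1\<^sub>m 3" using SU3_adjoint_right[OF hS] .
  moreover have "mat_adjoint h * h = 1\<^sub>m 3" using SU3_adjoint_left[OF hS] .
  moreover obtain p q r w u y v where hh: "h = M3 p q 0 r w u 0 y v" using hM by blast
  ultimately have un: "h $$ (0, 1) * cnj (h $$ (2, 1)) = 0" "h $$ (0, 0) * cnj (h $$ (0, 0)) + h $$ (0, 1) * cnj (h $$ (0, 1)) = 1"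
    "h $$ (2, 1) * cnj (h $$ (2, 1)) + h $$ (2, 2) * cnj (h $$ (2, 2)) = 1"
    and un': "h $$ (0, 0) * cnj (h $$ (0, 0)) + h $$ (1, 0) * cnj (h $$ (1, 0)) = 1"
    "h $$ (1, 2) * cnj (h $$ (1, 2)) + h $$ (2, 2) * cnj (h $$ (2, 2)) = 1"
    unfolding hh by (simp_all add: M3_adjoint M3_mult M3_one M3_eq_iff mult_ac)
  have nz: "z * cnj z = 1 \<Longrightarrow> z \<noteq> 0" for z :: complex by auto
  have "\<exists>a b s t c d. on_S3 a b \<and> cmod s = 1 \<and> cmod t = 1 \<and> on_S3 c d \<and> h = k12 a b * torus s t * k23 c d"
  proof (cases "h $$ (0, 1) = 0")
    case True
    then have u: "h $$ (0, 0) * cnj (h $$ (0, 0)) = 1" using un by simp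
    then have h10: "h $$ (1, 0) = 0" using un' by simp
    let ?s = "h $$ (0, 0)" and ?p = "h $$ (1, 1)" and ?q = "h $$ (1, 2)"
    have s: "cmod ?s = 1" using u by (simp add: cmod_1_iff)
    have pq: "cnj ?p = ?s * h $$ (2, 2)" "cnj ?q = - ?s * h $$ (2, 1)"
      using cof True h02 h20 h10 by auto
    have "on_S3 ?p ?q"
      unfolding pq using cof(1) u by Groebner_Basis.algebra
    moreover have "h = k12 1 0 * torus ?s 1 * k23 ?p ?q"
    proof -
      have e: "h $$ (2, 1) = - (cnj ?s * cnj ?q)" "h $$ (2, 2) = cnj ?s * cnj ?p"
        unfolding pq using u by Groebner_Basis.algebra+
      show ?thesis
        using e True h10 by (subst hM) (simp add: k12_def k23_def torus_M3 M3_mult M3_eq_iff cmod_1_inverse[OF s])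
    qed
    moreover have "on_S3 1 0" "cmod 1 = 1" by simp_all
    ultimately show ?thesis using s by blast
  next
    case False
    then have h21: "h $$ (2, 1) = 0" using un by simp
    then have v: "h $$ (2, 2) * cnj (h $$ (2, 2)) = 1" using un by simp
    then have h12: "h $$ (1, 2) = 0" using un' by simp
    let ?v = "h $$ (2, 2)"
    have vv: "cmod ?v = 1" using v by (simp add: cmod_1_iff)
    have c: "cnj (h $$ (0, 1)) = - h $$ (1, 0) * ?v" "cnj (h $$ (0, 0)) = h $$ (1, 1) * ?v"
      using cof h02 h20 h12 h21 by auto
    have on: "on_S3 (h $$ (0, 0)) (h $$ (0, 1) * ?v)"
      using un(2) v by (simp add: mult_ac)
    have "h = k12 (h $$ (0, 0)) (h $$ (0, 1) * ?v) * torus 1 (cnj ?v) * k23 1 0"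
    proof -
      have e: "h $$ (1, 0) = - (cnj (h $$ (0, 1)) * cnj ?v)" "h $$ (1, 1) = cnj (h $$ (0, 0)) * cnj ?v"
        unfolding c using v by Groebner_Basis.algebra+
      have i: "inverse (cnj ?v) = ?v" using v by (simp add: inverse_unique mult.commute)
      have b: "h $$ (0, 1) = h $$ (0, 1) * ?v * cnj ?v" using v by Groebner_Basis.algebra
      show ?thesis
        by (subst hM) (use e b[symmetric] h21 h12 i in \<open>simp add: k12_def k23_def torus_M3 M3_mult M3_eq_iff\<close>)
    qed
    then show ?thesis using on vv by (intro exI conjI) auto
  qed
  then obtain a b s t c d where abst: "on_S3 a b" "cmod s = 1" "cmod t = 1" "on_S3 c d"
    "h = k12 a b * torus s t * k23 c d" by blast
  define a2 b2 where "a2 = cnj a0 * a + b0 * cnj b" and "b2 = cnj a0 * b - b0 * cnj a"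
  have k2: "k12 (cnj a0) (- b0) * k12 a b = k12 a2 b2" by (simp add: k12_mult a2_def b2_def)
  have S2: "on_S3 a2 b2" using on_S3_mult[OF on_S3_inv[OF ab0(1)] abst(1)] by (simp add: a2_def b2_def)
  note m = SU3_mat[OF k12_SU3[OF on_S3_inv[OF ab0(1)]]] SU3_mat[OF k12_SU3[OF on_S3_inv[OF ab1(1)]]]
    SU3_mat[OF k12_SU3[OF abst(1)]] SU3_mat[OF torus_SU3[OF abst(2,3)]] SU3_mat[OF k23_SU3[OF abst(4)]] SU3_mat[OF k12_SU3[OF S2]]
  have "g = k12 a2 b2 * torus s t * k23 c d * k12 (cnj a1) (- b1)"
    unfolding gh abst(5) k2[symmetric] using m by (simp add: assoc_mult_mat[of _ 3 3 _ 3 _ 3])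
  then show ?thesis using S2 abst on_S3_inv[OF ab1(1)] by blast
qed

text \<open>The middle row is the vector product of \<open>z\<close> with the conjugate of
  \<open>x\<close>. Thus every point of the cone with both vectors of norm 1 comes from a group
  element.\<close>

lemma SU3_first_last_row:
  assumes x: "x1 * cnj x1 + x2 * cnj x2 + x3 * cnj x3 = 1" and z: "z1 * cnj z1 + z2 * cnj z2 + z3 * cnj z3 = 1"
    and xz: "x1 * z1 + x2 * z2 + x3 * z3 = 0"
  shows "M3 x1 x2 x3 (z2 * cnj x3 - z3 * cnj x2) (z3 * cnj x1 - z1 * cnj x3) (z1 * cnj x2 - z2 * cnj x1)
     (cnj z1) (cnj z2) (cnj z3) \<in> carrier SU3" (is "?M \<in> _")
proof -
  have xz': "cnj x1 * cnj z1 + cnj x2 * cnj z2 + cnj x3 * cnj z3 = 0"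
    using arg_cong[OF xz, of cnj] by simp
  have "?M * mat_adjoint ?M = 1\<^sub>m 3"
    unfolding M3_adjoint M3_mult M3_one M3_eq_iff complex_cnj_diff complex_cnj_mult complex_cnj_cnj
    by (intro conjI; (simp add: algebra_simps; fail)?; insert x z xz xz'; Groebner_Basis.algebra)
  then have "mat_adjoint ?M * ?M = 1\<^sub>m 3"
    by (intro mat_mult_left_right_inverse[of ?M 3]) auto
  moreover have "det ?M = 1"
    unfolding M3_det using x z xz xz' by Groebner_Basis.algebra
  ultimately show ?thesis by (simp add: SU3_carrier_iff)
qed

section \<open>Weight space decomposition\<close>

text \<open>Vectors are functions on an arbitrary index type rather than \<open>complex vec\<close>,
  so that tensor powers can be indexed by lists of indices.\<close>

definition scl :: "complex \<Rightarrow> ('i \<Rightarrow> complex) \<Rightarrow> 'i \<Rightarrow> complex" where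
  "scl c v = (\<lambda>i. c * v i)"

definition csubspace :: "('i \<Rightarrow> complex) set \<Rightarrow> bool" where
  "csubspace U \<longleftrightarrow> 0 \<in> U \<and> (\<forall>u\<in>U. \<forall>v\<in>U. u + v \<in> U) \<and> (\<forall>c. \<forall>u\<in>U. scl c u \<in> U)"

lemma csubspaceD:
  assumes "csubspace U"
  shows "0 \<in> U" "u \<in> U \<Longrightarrow> v \<in> U \<Longrightarrow> u + v \<in> U" "u \<in> U \<Longrightarrow> scl c u \<in> U"
  using assms by (auto simp: csubspace_def)

lemma csubspace_sum: "csubspace U \<Longrightarrow> (\<And>x. x \<in> S \<Longrightarrow> f x \<in> U) \<Longrightarrow> (\<Sum>x\<in>S. f x) \<in> U"
  by (induction S rule: infinite_finite_induct) (auto simp: csubspaceD)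

lemma csubspace_diff: "csubspace U \<Longrightarrow> u \<in> U \<Longrightarrow> v \<in> U \<Longrightarrow> u - v \<in> U"
proof -
  assume "csubspace U" "u \<in> U" "v \<in> U"
  then have "u + scl (-1) v \<in> U" by (intro csubspaceD)
  moreover have "u + scl (-1) v = u - v" by (rule ext) (simp add: scl_def)
  ultimately show "u - v \<in> U" by (simp only:)
qed

lemma sum_fun_apply: "(\<Sum>x\<in>S. f x) i = (\<Sum>x\<in>S. f x i)"
  by (induction S rule: infinite_finite_induct) auto

lemma scl_apply: "scl c v i = c * v i"
  by (simp add: scl_def)

lemma scl_simps [simp]: "scl 1 v = v" "scl 0 v = 0" "scl c 0 = 0"
  "scl c (scl d v) = scl (c * d) v"
  by (auto simp: scl_def fun_eq_iff)

lemma scl_add: "scl c (u + v) = scl c u + scl c v" "scl (c + d) v = scl c v + scl d v"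
  by (auto simp: scl_def fun_eq_iff algebra_simps)

lemma scl_sum: "scl c (\<Sum>x\<in>S. f x) = (\<Sum>x\<in>S. scl c (f x))"
  by (auto simp: scl_def fun_eq_iff sum_fun_apply sum_distrib_left)

lemma scl_eq_scl: "v \<noteq> 0 \<Longrightarrow> scl c v = scl d v \<longleftrightarrow> c = d"
  by (auto simp: fun_eq_iff scl_apply)

definition chr :: "int \<times> int \<Rightarrow> complex \<Rightarrow> complex \<Rightarrow> complex" where
  "chr \<nu> s t = s powi fst \<nu> * (s * t) powi snd \<nu>"

lemma powi_unit_inj:
  assumes "\<And>z::complex. cmod z = 1 \<Longrightarrow> z powi a = z powi b"
  shows "a = b"
proof (rule ccontr)
  assume ab: "a \<noteq> b"
  \<comment> \<open>At this point the quotient of the two powers is -1.\<close>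
  let ?z = "cis (pi / of_int (a - b))"
  have "?z powi a = ?z powi b" by (rule assms) simp
  then have "?z powi (a - b) = 1" by (simp add: power_int_diff)
  moreover have "?z powi (a - b) = cis pi" using ab by (subst cis_power_int) simp
  ultimately show False by simp
qed

lemma chr_inj:
  assumes "\<And>s t. cmod s = 1 \<Longrightarrow> cmod t = 1 \<Longrightarrow> chr \<mu> s t = chr \<nu> s t"
  shows "\<mu> = \<nu>"
proof -
  have "snd \<mu> = snd \<nu>" by (rule powi_unit_inj) (use assms[of 1] in \<open>simp add: chr_def\<close>)
  moreover have "fst \<mu> = fst \<nu>"
  proof (rule powi_unit_inj)
    fix z :: complex assume z: "cmod z = 1"
    then have "z * inverse z = 1" by (auto simp: field_simps)
    then show "z powi fst \<mu> = z powi fst \<nu>"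
      using assms[of z "inverse z"] z by (simp add: chr_def norm_inverse)
  qed
  ultimately show ?thesis by (simp add: prod_eq_iff)
qed

lemma chr_nz: "cmod s = 1 \<Longrightarrow> cmod t = 1 \<Longrightarrow> chr \<nu> s t \<noteq> 0"
  by (auto simp: chr_def)

section \<open>Spectral decomposition of circle subgroups\<close>

definition is_circle :: "(complex \<Rightarrow> complex mat) \<Rightarrow> bool" where
  "is_circle c \<longleftrightarrow> (\<forall>z. cmod z = 1 \<longrightarrow> c z \<in> carrier SU3) \<and> c 1 = 1\<^sub>m 3 \<and>
     (\<forall>z w. cmod z = 1 \<longrightarrow> cmod w = 1 \<longrightarrow> c (z * w) = c z * c w) \<and>
     (\<forall>X z. (\<forall>n. cmod (X n) = 1) \<longrightarrow> cmod z = 1 \<longrightarrow> X \<longlonglongrightarrow> z \<longrightarrow> mat_tendsto 3 (\<lambda>n. c (X n)) (c z))"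

lemma mat_tendsto_M3:
  assumes "a \<longlonglongrightarrow> a'" "b \<longlonglongrightarrow> b'" "c \<longlonglongrightarrow> c'" "d \<longlonglongrightarrow> d'" "e \<longlonglongrightarrow> e'" "f \<longlonglongrightarrow> f'" "g \<longlonglongrightarrow> g'" "h \<longlonglongrightarrow> h'" "i \<longlonglongrightarrow> i'"
  shows "mat_tendsto 3 (\<lambda>n. M3 (a n) (b n) (c n) (d n) (e n) (f n) (g n) (h n) (i n)) (M3 a' b' c' d' e' f' g' h' i')"
  using assms unfolding mat_tendsto_def less_3_cases by auto

lemma is_circle_torus1: "is_circle (\<lambda>z. torus z 1)"
  unfolding is_circle_def
  by (simp add: torus_mult)
     (auto simp: torus_M3 intro!: mat_tendsto_M3 tendsto_intros)

lemma is_circle_torus2: "is_circle (\<lambda>z. torus 1 z)"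
  unfolding is_circle_def
  by (simp add: torus_mult)
     (auto simp: torus_M3 intro!: mat_tendsto_M3 tendsto_intros)

text \<open>The representation space consists of the functions supported on the finite set \<open>I\<close>, and \<open>A g\<close> is the matrix of \<open>g\<close>.\<close>

locale su3_rep =
  fixes I :: "'i set" and A :: "complex mat \<Rightarrow> 'i \<Rightarrow> 'i \<Rightarrow> complex"
  assumes finI: "finite I"
    and A_one: "i \<in> I \<Longrightarrow> j \<in> I \<Longrightarrow> A (1\<^sub>m 3) i j = (if i = j then 1 else 0)"
    and A_mult: "g \<in> carrier SU3 \<Longrightarrow> h \<in> carrier SU3 \<Longrightarrow> i \<in> I \<Longrightarrow> k \<in> I \<Longrightarrow>
      A (g * h) i k = (\<Sum>j\<in>I. A g i j * A h j k)"
    and A_cont: "(\<And>n. X n \<in> carrier SU3) \<Longrightarrow> g \<in> carrier SU3 \<Longrightarrow> mat_tendsto 3 X g \<Longrightarrow> i \<in> I \<Longrightarrow> j \<in> I \<Longrightarrow>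
      (\<lambda>n. A (X n) i j) \<longlonglongrightarrow> A g i j"
begin

definition V :: "('i \<Rightarrow> complex) set" where
  "V = {v. \<forall>i. i \<notin> I \<longrightarrow> v i = 0}"

definition R :: "complex mat \<Rightarrow> ('i \<Rightarrow> complex) \<Rightarrow> 'i \<Rightarrow> complex" where
  "R g v = (\<lambda>i. if i \<in> I then \<Sum>j\<in>I. A g i j * v j else 0)"

definition wt :: "int \<times> int \<Rightarrow> ('i \<Rightarrow> complex) \<Rightarrow> bool" where
  "wt \<nu> v \<longleftrightarrow> v \<in> V \<and> (\<forall>s t. cmod s = 1 \<longrightarrow> cmod t = 1 \<longrightarrow> R (torus s t) v = scl (chr \<nu> s t) v)"

definition invariant_sub :: "('i \<Rightarrow> complex) set \<Rightarrow> bool" where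
  "invariant_sub U \<longleftrightarrow> csubspace U \<and> U \<subseteq> V \<and> (\<forall>g\<in>carrier SU3. \<forall>u\<in>U. R g u \<in> U)"

lemma V_csubspace: "csubspace V"
  by (auto simp: csubspace_def V_def scl_apply)

lemma R_in_V [simp]: "R g v \<in> V"
  by (auto simp: V_def R_def)

lemma invariant_V: "invariant_sub V"
  by (auto simp: invariant_sub_def V_csubspace)

lemma R_add: "R g (u + v) = R g u + R g v"
  by (auto simp: R_def fun_eq_iff scl_apply algebra_simps sum.distrib)

lemma R_scl: "R g (scl c v) = scl c (R g v)"
  by (auto simp: R_def fun_eq_iff scl_apply sum_distrib_left mult_ac)

lemma R_zero [simp]: "R g 0 = 0"
  by (auto simp: R_def fun_eq_iff scl_apply)

lemma R_sum: "R g (\<Sum>x\<in>S. f x) = (\<Sum>x\<in>S. R g (f x))"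
  by (induction S rule: infinite_finite_induct) (simp_all only: R_add R_zero sum.infinite sum.empty sum.insert simp_thms)

lemma R_diff: "R g (u - v) = R g u - R g v"
  by (auto simp: R_def fun_eq_iff scl_apply algebra_simps sum_subtractf)

lemma R_one: "v \<in> V \<Longrightarrow> R (1\<^sub>m 3) v = v"
  using finI by (auto simp: R_def V_def fun_eq_iff scl_apply A_one if_distrib[of "\<lambda>x. x * _"] cong: if_cong)

lemma R_mult: "g \<in> carrier SU3 \<Longrightarrow> h \<in> carrier SU3 \<Longrightarrow> R (g * h) v = R g (R h v)"
proof -
  assume g: "g \<in> carrier SU3" and h: "h \<in> carrier SU3"
  have "(\<Sum>k\<in>I. A (g * h) i k * v k) = (\<Sum>j\<in>I. A g i j * (\<Sum>k\<in>I. A h j k * v k))" if i: "i \<in> I" for i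
  proof -
    have "(\<Sum>k\<in>I. A (g * h) i k * v k) = (\<Sum>k\<in>I. \<Sum>j\<in>I. A g i j * A h j k * v k)"
      by (rule sum.cong) (simp_all add: A_mult[OF g h i] sum_distrib_right)
    also have "\<dots> = (\<Sum>j\<in>I. \<Sum>k\<in>I. A g i j * A h j k * v k)" by (rule sum.swap)
    finally show ?thesis by (simp add: sum_distrib_left mult.assoc)
  qed
  then show ?thesis by (auto simp: R_def fun_eq_iff scl_apply)
qed

lemma R_inv_cancel: "g \<in> carrier SU3 \<Longrightarrow> v \<in> V \<Longrightarrow> R (mat_adjoint g) (R g v) = v"
  "g \<in> carrier SU3 \<Longrightarrow> v \<in> V \<Longrightarrow> R g (R (mat_adjoint g) v) = v"
  by (simp_all flip: R_mult add: SU3_adjoint_left SU3_adjoint_right R_one)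

lemma R_tendsto:
  assumes "\<And>n. X n \<in> carrier SU3" "g \<in> carrier SU3" "mat_tendsto 3 X g"
  shows "(\<lambda>n. R (X n) v i) \<longlonglongrightarrow> R g v i"
  using A_cont[OF assms] by (auto simp: R_def intro!: tendsto_intros)

text \<open>Compare at a coordinate \<open>i0\<close> where \<open>u\<close> has maximal modulus:
  there \<open>(l - 1) * u i0\<close> is a sum of \<open>card I\<close> terms, each at most
  \<open>\<epsilon>\<close> times that modulus.\<close>

lemma near_identity_eigenvalue:
  assumes u: "u \<in> V" "u \<noteq> 0" and ev: "R g u = scl l u"
    and near: "\<And>i j. i \<in> I \<Longrightarrow> j \<in> I \<Longrightarrow> cmod (A g i j - (if i = j then 1 else 0)) \<le> \<epsilon>" and \<epsilon>: "of_nat (card I) * \<epsilon> \<le> 1 / 2"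
  shows "cmod (l - 1) \<le> 1 / 2"
proof -
  obtain i1 where i1: "u i1 \<noteq> 0" using u by (auto simp: fun_eq_iff scl_apply)
  then have "i1 \<in> I" using u by (auto simp: V_def)
  then have "Max ((\<lambda>i. cmod (u i)) ` I) \<in> (\<lambda>i. cmod (u i)) ` I" using finI by (intro Max_in) auto
  then obtain i0 where i0: "i0 \<in> I" "cmod (u i0) = Max ((\<lambda>i. cmod (u i)) ` I)" by auto
  have mx: "cmod (u i) \<le> cmod (u i0)" if "i \<in> I" for i
    unfolding i0(2) using that finI by (intro Max_ge) auto
  have pos: "cmod (u i0) > 0" using mx[OF \<open>i1 \<in> I\<close>] i1 by (smt (verit) norm_le_zero_iff)
  have "(l - 1) * u i0 = (\<Sum>j\<in>I. (A g i0 j - (if i0 = j then 1 else 0)) * u j)"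
  proof -
    have "l * u i0 = (\<Sum>j\<in>I. A g i0 j * u j)"
      using fun_cong[OF ev, of i0] i0 by (simp add: R_def scl_apply)
    moreover have "u i0 = (\<Sum>j\<in>I. (if i0 = j then 1 else 0) * u j)"
      using i0 finI by (simp add: if_distrib[of "\<lambda>x. x * _"] cong: if_cong)
    ultimately show ?thesis by (simp add: algebra_simps sum_subtractf)
  qed
  then have "cmod (l - 1) * cmod (u i0) = cmod (\<Sum>j\<in>I. (A g i0 j - (if i0 = j then 1 else 0)) * u j)"
    by (metis norm_mult)
  also have "\<dots> \<le> (\<Sum>j\<in>I. cmod ((A g i0 j - (if i0 = j then 1 else 0)) * u j))" by (rule norm_sum)
  also have "\<dots> \<le> (\<Sum>j\<in>I. \<epsilon> * cmod (u i0))"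
  proof (rule sum_mono)
    fix j assume j: "j \<in> I"
    have "0 \<le> \<epsilon>" using near[OF i0(1) i0(1)] norm_ge_zero order_trans by blast
    then show "cmod ((A g i0 j - (if i0 = j then 1 else 0)) * u j) \<le> \<epsilon> * cmod (u i0)"
      unfolding norm_mult using near[OF i0(1) j] mx[OF j] by (intro mult_mono) auto
  qed
  also have "\<dots> = (of_nat (card I) * \<epsilon>) * cmod (u i0)" by simp
  also have "\<dots> \<le> 1 / 2 * cmod (u i0)" using \<epsilon> pos by (intro mult_right_mono) auto
  finally show ?thesis using pos by simp
qed

text \<open>The points \<open>cis (2 * pi / 2 ^ r)\<close> tend to 1 and only finitely many matrix
  entries have to converge, so one \<open>r0\<close> serves all of them.\<close>

lemma circle_near_identity:
  assumes c: "is_circle c"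
  shows "\<exists>r0\<ge>1. \<forall>r\<ge>r0. \<forall>u\<in>V. \<forall>l. u \<noteq> 0 \<longrightarrow> R (c (cis (2 * pi / 2 ^ r))) u = scl l u \<longrightarrow> cmod (l - 1) \<le> 1 / 2"
proof -
  define \<epsilon> where "\<epsilon> = 1 / (2 * real (card I) + 1)"
  have eps: "\<epsilon> > 0" "real (card I) * \<epsilon> \<le> 1 / 2" by (auto simp: \<epsilon>_def field_simps)
  let ?X = "\<lambda>r::nat. cis (2 * pi / 2 ^ r)"
  have "(\<lambda>r::nat. 2 * pi * (1 / 2) ^ r) \<longlonglongrightarrow> 2 * pi * 0" by (intro tendsto_intros LIMSEQ_realpow_zero) auto
  then have "(\<lambda>r::nat. 2 * pi / 2 ^ r) \<longlonglongrightarrow> 0" by (simp add: power_divide)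
  then have "(\<lambda>r. cis (2 * pi / 2 ^ r)) \<longlonglongrightarrow> cis 0"
    unfolding cis_conv_exp by (intro tendsto_exp tendsto_mult tendsto_const tendsto_of_real)
  then have X: "?X \<longlonglongrightarrow> 1" by simp
  have cX: "\<And>r. c (?X r) \<in> carrier SU3" and c1: "c 1 = 1\<^sub>m 3" and t: "mat_tendsto 3 (\<lambda>r. c (?X r)) (c 1)"
    using c X unfolding is_circle_def by (auto simp del: One_nat_def) (metis norm_cis norm_one)
  have "\<forall>\<^sub>F r in sequentially. \<forall>ij\<in>I \<times> I. cmod (A (c (?X r)) (fst ij) (snd ij) - (if fst ij = snd ij then 1 else 0)) \<le> \<epsilon>"
  proof (subst eventually_ball_finite_distrib, goal_cases)
    case 1 show ?case using finI by simp
  next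
    case 2
    show ?case
    proof
      fix ij assume ij: "ij \<in> I \<times> I"
      then have "(\<lambda>r. A (c (?X r)) (fst ij) (snd ij)) \<longlonglongrightarrow> (if fst ij = snd ij then 1 else 0)"
        using A_cont[OF cX _ t, of "fst ij" "snd ij"] A_one[of "fst ij" "snd ij"] by (auto simp: c1)
      then have "\<forall>\<^sub>F r in sequentially. dist (A (c (?X r)) (fst ij) (snd ij)) (if fst ij = snd ij then 1 else 0) < \<epsilon>"
        using eps(1) by (rule tendstoD)
      then show "\<forall>\<^sub>F r in sequentially. cmod (A (c (?X r)) (fst ij) (snd ij) - (if fst ij = snd ij then 1 else 0)) \<le> \<epsilon>"
        by eventually_elim (simp add: dist_norm)
    qed
  qed
  then obtain r1 where r1: "\<And>r i j. r \<ge> r1 \<Longrightarrow> i \<in> I \<Longrightarrow> j \<in> I \<Longrightarrow> cmod (A (c (?X r)) i j - (if i = j then 1 else 0)) \<le> \<epsilon>"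
    unfolding eventually_sequentially by fastforce
  show ?thesis
  proof (intro exI[of _ "max 1 r1"] conjI allI ballI impI)
    fix r u l assume "max 1 r1 \<le> r" "u \<in> V" "u \<noteq> 0" "R (c (?X r)) u = scl l u"
    then show "cmod (l - 1) \<le> 1 / 2"
      using near_identity_eigenvalue[of u "c (?X r)" l, OF _ _ _ r1 eps(2)] by simp
  qed simp
qed

text \<open>Near the identity an eigenvalue of a square root is determined by the eigenvalue of the square, so an
  eigenvector of one element of order \<open>2 ^ r0\<close> is an eigenvector of all elements of 2-power order, hence of
  the whole circle.\<close>

lemma circle_eigenvector:
  assumes c: "is_circle c" and r0: "r0 \<ge> 1"
    and near: "\<forall>r\<ge>r0. \<forall>u\<in>V. \<forall>l. u \<noteq> 0 \<longrightarrow> R (c (cis (2 * pi / 2 ^ r))) u = scl l u \<longrightarrow> cmod (l - 1) \<le> 1 / 2"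
    and u: "u \<in> V" "R (c (cis (2 * pi / 2 ^ r0))) u = scl (cis (2 * pi / 2 ^ r0) powi j) u"
    and j: "\<bar>j\<bar> \<le> 2 ^ (r0 - 1)" and z: "cmod z = 1"
  shows "R (c z) u = scl (z powi j) u"
proof -
  define \<zeta> where "\<zeta> r = cis (2 * pi / 2 ^ r)" for r :: nat
  have \<zeta>: "cmod (\<zeta> r) = 1" "\<zeta> (Suc r) * \<zeta> (Suc r) = \<zeta> r" "\<zeta> r \<noteq> 0" for r
    by (auto simp: \<zeta>_def cis_mult field_simps)
  have cS: "cmod z = 1 \<Longrightarrow> c z \<in> carrier SU3" and cm: "cmod z = 1 \<Longrightarrow> cmod w = 1 \<Longrightarrow> c (z * w) = c z * c w" and c1: "c 1 = 1\<^sub>m 3" for z w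
    using c by (auto simp: is_circle_def)
  have dy: "R (c (\<zeta> r)) u = scl (\<zeta> r powi j) u" if "r \<ge> r0" for r
    using that
  proof (induction r rule: dec_induct)
    case base then show ?case using u by (simp add: \<zeta>_def)
  next
    case (step r)
    define S where "S = R (c (\<zeta> (Suc r)))"
    define l where "l = \<zeta> (Suc r) powi j"
    have l2: "l * l = \<zeta> r powi j"
      unfolding l_def by (simp add: power_int_mult_distrib[symmetric] \<zeta>)
    have SS: "S (S u) = scl (l * l) u"
      using step \<zeta> cS cm unfolding S_def l2 by (metis R_mult)
    \<comment> \<open>\<open>S - l\<close> and \<open>S + l\<close> have product zero on
      \<open>u\<close>, so \<open>w\<close> is an eigenvector for \<open>- l\<close> unless it
      vanishes. The bound on \<open>j\<close> gives \<open>Re l \<ge> 0\<close>, which keeps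
      \<open>- l\<close> at distance at least 1 from 1.\<close>
    define w where "w = S u + scl (- l) u"
    have wV: "w \<in> V" unfolding w_def S_def using u V_csubspace by (simp add: csubspaceD)
    have "S w = scl (l * l) u + scl (- l) (S u)"
      unfolding w_def by (simp add: S_def R_add R_scl SS[unfolded S_def])
    also have "\<dots> = scl (- l) w" unfolding w_def scl_add by (simp add: add.commute)
    finally have ev: "S w = scl (- l) w" .
    have "w = 0"
    proof (rule ccontr)
      assume "w \<noteq> 0"
      then have le: "cmod (- l - 1) \<le> 1 / 2"
        using near[rule_format, of "Suc r" w "- l"] ev wV step unfolding S_def \<zeta>_def by simp
      have "l = cis (of_int j * (2 * pi / 2 ^ Suc r))" unfolding l_def \<zeta>_def cis_power_int by simp
      then have Rel: "Re l = cos (of_int j * (2 * pi / 2 ^ Suc r))" by simp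
      have "\<bar>of_int j * (2 * pi / 2 ^ Suc r)\<bar> \<le> pi / 2"
      proof -
        have "real_of_int \<bar>j\<bar> \<le> of_int (2 ^ (r0 - 1))" using j by (intro of_int_le_iff[THEN iffD2])
        then have jr: "real_of_int \<bar>j\<bar> \<le> 2 ^ (r0 - 1)" by simp
        have "(2::real) ^ (r0 - 1) \<le> 2 ^ (r - 1)" using step by (intro power_increasing) auto
        with jr have "real_of_int \<bar>j\<bar> \<le> 2 ^ (r - 1)" by (rule order_trans)
        moreover have "(2::real) ^ Suc r = 4 * 2 ^ (r - 1)" using step r0 by (cases r) auto
        ultimately have "real_of_int \<bar>j\<bar> * (2 * pi / 2 ^ Suc r) \<le> 2 ^ (r - 1) * (2 * pi / (4 * 2 ^ (r - 1)))"
          by (simp only:) (intro mult_right_mono, auto)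
        then show ?thesis by (simp add: abs_mult)
      qed
      then have "Re l \<ge> 0" unfolding Rel by (intro cos_ge_zero; simp only: abs_le_iff; linarith)
      then have "1 \<le> \<bar>Re (- l - 1)\<bar>" by simp
      also have "\<dots> \<le> cmod (- l - 1)" by (rule abs_Re_le_cmod)
      finally show False using le by simp
    qed
    then have "S u = scl l u" unfolding w_def by (auto simp: fun_eq_iff scl_apply)
    then show ?case by (simp add: S_def l_def)
  qed
  have pw: "R (c (\<zeta> r ^ k)) u = scl ((\<zeta> r ^ k) powi j) u" if "r \<ge> r0" for r k
  proof (induction k)
    case 0 then show ?case by (simp add: c1 R_one u)
  next
    case (Suc k)
    have "R (c (\<zeta> r ^ Suc k)) u = R (c (\<zeta> r)) (R (c (\<zeta> r ^ k)) u)"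
      by (simp add: cm \<zeta> norm_power R_mult cS)
    then show ?case by (simp add: Suc R_scl dy[OF that] power_int_mult_distrib mult.commute)
  qed
  \<comment> \<open>The shift by a full turn makes \<open>x\<close> nonnegative, so taking
    \<open>nat\<close> of the floor loses nothing; \<open>k r / 2 ^ r\<close> are dyadic
    approximations of \<open>x\<close> from below.\<close>
  define x where "x = (Arg z + 2 * pi) / (2 * pi)"
  have x0: "x \<ge> 0" using Arg_bounded[of z] by (auto simp: x_def)
  have zx: "z = cis (2 * pi * x)"
    using z rcis_cmod_Arg[of z] by (simp add: x_def rcis_def cis_mult[symmetric])
  define k where "k r = nat \<lfloor>x * 2 ^ r\<rfloor>" for r :: nat
  have k: "real (k r) \<le> x * 2 ^ r" "x * 2 ^ r < real (k r) + 1" for r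
    using x0 unfolding k_def by (auto simp: of_nat_nat)
  have lim: "(\<lambda>r. real (k r) / 2 ^ r) \<longlonglongrightarrow> x"
  proof (rule tendsto_sandwich)
    show "(\<lambda>r. x - (1 / 2) ^ r) \<longlonglongrightarrow> x"
      using tendsto_diff[OF tendsto_const LIMSEQ_realpow_zero[of "1/2"], of x] by simp
    show "\<forall>\<^sub>F r in sequentially. x - (1 / 2) ^ r \<le> real (k r) / 2 ^ r"
    proof (intro always_eventually allI)
      fix r
      have "(x * 2 ^ r - 1) / 2 ^ r \<le> real (k r) / 2 ^ r"
        using k(2)[of r] by (intro divide_right_mono) auto
      then show "x - (1 / 2) ^ r \<le> real (k r) / 2 ^ r" by (simp add: diff_divide_distrib power_divide)
    qed
    show "\<forall>\<^sub>F r in sequentially. real (k r) / 2 ^ r \<le> x"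
      using k(1) by (auto simp: field_simps intro!: always_eventually)
  qed auto
  have \<zeta>k: "\<zeta> r ^ k r = cis (2 * pi * (real (k r) / 2 ^ r))" for r
    unfolding \<zeta>_def DeMoivre by (simp add: field_simps)
  have lz: "(\<lambda>r. \<zeta> r ^ k r) \<longlonglongrightarrow> z"
    unfolding zx \<zeta>k cis_conv_exp using lim by (intro tendsto_intros)
  have lz': "(\<lambda>n. \<zeta> (n + r0) ^ k (n + r0)) \<longlonglongrightarrow> z"
    using LIMSEQ_ignore_initial_segment[OF lz] .
  have "mat_tendsto 3 (\<lambda>n. c (\<zeta> (n + r0) ^ k (n + r0))) (c z)"
    using c z lz' unfolding is_circle_def by (auto simp: norm_power \<zeta>)
  then have "(\<lambda>n. R (c (\<zeta> (n + r0) ^ k (n + r0))) u i) \<longlonglongrightarrow> R (c z) u i" for i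
    using R_tendsto cS z by (simp add: norm_power \<zeta>)
  moreover have "(\<lambda>n. R (c (\<zeta> (n + r0) ^ k (n + r0))) u i) \<longlonglongrightarrow> scl (z powi j) u i" for i
    using z by (simp add: pw scl_apply) (intro tendsto_intros lz', auto)
  ultimately show ?thesis using LIMSEQ_unique by blast
qed

text \<open>The projections to the weight spaces of a circle are kept as explicit combinations of
  finitely many elements of that circle. In this form they preserve every invariant subspace and
  commute with whatever commutes with the circle.\<close>

definition circle_decomp ::
  "(complex \<Rightarrow> complex mat) \<Rightarrow> int set \<Rightarrow> nat \<Rightarrow> (int \<Rightarrow> nat \<Rightarrow> complex) \<Rightarrow> (nat \<Rightarrow> complex) \<Rightarrow> bool" where
  "circle_decomp c J N a \<omega> \<longleftrightarrow> finite J \<and> (\<forall>k. cmod (\<omega> k) = 1) \<and>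
    (\<forall>v\<in>V. v = (\<Sum>j\<in>J. \<Sum>k<N. scl (a j k) (R (c (\<omega> k)) v)) \<and>
      (\<forall>j\<in>J. \<forall>z. cmod z = 1 \<longrightarrow> R (c z) (\<Sum>k<N. scl (a j k) (R (c (\<omega> k)) v)) =
         scl (z powi j) (\<Sum>k<N. scl (a j k) (R (c (\<omega> k)) v))))"

text \<open>Discrete Fourier transform on the cyclic subgroup of order \<open>2 ^ r0\<close>: by
  \<open>circle_eigenvector\<close> its eigenvectors are already eigenvectors of the whole
  circle.\<close>

lemma circle_projections:
  assumes c: "is_circle c"
  shows "\<exists>J N a \<omega>. circle_decomp c J N a \<omega>"
proof -
  obtain r0 where r0: "r0 \<ge> 1" and near: "\<forall>r\<ge>r0. \<forall>u\<in>V. \<forall>l. u \<noteq> 0 \<longrightarrow> R (c (cis (2 * pi / 2 ^ r))) u = scl l u \<longrightarrow> cmod (l - 1) \<le> 1 / 2"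
    using circle_near_identity[OF c] by blast
  define N where "N = (2::nat) ^ r0"
  define h where "h = (2::nat) ^ (r0 - 1)"
  have N: "N > 0" "N = 2 * h" using r0 by (cases r0; simp add: N_def h_def)+
  define \<zeta> where "\<zeta> = cis (2 * pi / real N)"
  have \<zeta>1: "cmod \<zeta> = 1" "\<zeta> \<noteq> 0" by (auto simp: \<zeta>_def)
  have \<zeta>N: "\<zeta> ^ N = 1" using N by (simp add: \<zeta>_def DeMoivre)
  have \<zeta>m: "\<zeta> ^ m \<noteq> 1" if "0 < m" "m < N" for m
  proof
    assume "\<zeta> ^ m = 1"
    then have "cis (2 * pi * (real m / real N)) = 1" by (simp add: \<zeta>_def DeMoivre field_simps)
    then have "cos (2 * pi * (real m / real N)) = 1" by (metis cis.sel(1) one_complex.sel(1))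
    then obtain x :: int where "2 * pi * (real m / real N) = of_int x * 2 * pi" by (auto simp: cos_one_2pi_int)
    then have "2 * pi * (real m / real N) = 2 * pi * of_int x" by (simp only: mult_ac)
    then have "real m / real N = of_int x" by (subst (asm) mult_cancel_left) simp
    then have "real m = of_int x * real N" using N by (simp add: field_simps)
    then have "int m = x * int N" by (metis of_int_eq_iff of_int_mult of_int_of_nat_eq)
    then have "N dvd m" by (metis dvd_triv_right int_dvd_int_iff)
    then show False using that by (auto dest: dvd_imp_le)
  qed
  have cS: "cmod z = 1 \<Longrightarrow> c z \<in> carrier SU3" and cm: "cmod z = 1 \<Longrightarrow> cmod w = 1 \<Longrightarrow> c (z * w) = c z * c w" and c1: "c 1 = 1\<^sub>m 3" for z w
    using c by (auto simp: is_circle_def)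
  \<comment> \<open>Representatives of the residues modulo \<open>N\<close> centred at 0, so that
    \<open>\<bar>j\<bar> \<le> 2 ^ (r0 - 1)\<close> as \<open>circle_eigenvector\<close>
    demands.\<close>
  define J where "J = (\<lambda>l. int l - int h) ` {..<N}"
  define a where "a j k = inverse (of_nat N) * (\<zeta> ^ k) powi (- j)" for j k
  define P where "P j v = (\<Sum>k<N. scl (a j k) (R (c (\<zeta> ^ k)) v))" for j v
  have pk: "cmod (\<zeta> ^ k) = 1" for k by (simp add: norm_power \<zeta>1)
  have PV: "P j v \<in> V" for j v
    unfolding P_def by (intro csubspace_sum[OF V_csubspace] csubspaceD[OF V_csubspace]) auto
  have ev: "R (c \<zeta>) (P j v) = scl (\<zeta> powi j) (P j v)" if "v \<in> V" for j v
  proof -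
    define f where "f k = scl (a j k) (R (c (\<zeta> ^ k)) v)" for k
    have f: "R (c \<zeta>) (f k) = scl (\<zeta> powi j) (f (Suc k))" for k
    proof -
      have "R (c \<zeta>) (f k) = scl (a j k) (R (c (\<zeta> ^ Suc k)) v)"
        unfolding f_def R_scl using \<zeta>1 pk by (simp add: cm R_mult cS)
      moreover have "a j k = \<zeta> powi j * a j (Suc k)"
        using \<zeta>1 by (simp add: a_def power_int_mult_distrib power_int_minus field_simps)
      ultimately show ?thesis by (simp add: f_def)
    qed
    \<comment> \<open>The summands are periodic in \<open>k\<close>, so the generator of the cyclic
      group only shifts the sum.\<close>
    have "f N = f 0" unfolding f_def a_def \<zeta>N by simp
    then have "(\<Sum>k<N. f (Suc k)) = (\<Sum>k<N. f k)"
      using sum.lessThan_Suc_shift[of f N] sum.lessThan_Suc[of f N] by (metis add.commute add_left_cancel)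
    then show ?thesis unfolding P_def f_def[symmetric] R_sum f by (simp flip: scl_sum)
  qed
  have j: "\<bar>j\<bar> \<le> 2 ^ (r0 - 1)" if jJ: "j \<in> J" for j
  proof -
    obtain l where "l < N" "j = int l - int h" using jJ unfolding J_def by blast
    then have "\<bar>j\<bar> \<le> int h" using N by linarith
    then show ?thesis by (simp add: h_def)
  qed
  have "R (c z) (P j v) = scl (z powi j) (P j v)" if "v \<in> V" "j \<in> J" "cmod z = 1" for j v z
    using circle_eigenvector[OF c r0 near PV _ j[OF that(2)] that(3)] ev[OF that(1)] by (simp add: \<zeta>_def N_def)
  moreover have "(\<Sum>j\<in>J. P j v) = v" if v: "v \<in> V" for v
  proof -
    \<comment> \<open>The geometric sum over roots of unity leaves only \<open>k = 0\<close>, so the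
      projections add up to the identity.\<close>
    have s: "(\<Sum>j\<in>J. a j k) = (if k = 0 then 1 else 0)" if "k < N" for k
    proof -
      have "(\<Sum>j\<in>J. a j k) = (\<Sum>l<N. a (int l - int h) k)"
        unfolding J_def by (subst sum.reindex) (auto simp: inj_on_def)
      also have "\<dots> = (\<Sum>l<N. inverse (of_nat N) * (\<zeta> ^ k) ^ h * (inverse (\<zeta> ^ k)) ^ l)"
        using \<zeta>1 by (intro sum.cong) (simp_all add: a_def power_int_diff power_inverse field_simps)
      also have "\<dots> = inverse (of_nat N) * (\<zeta> ^ k) ^ h * (\<Sum>l<N. (inverse (\<zeta> ^ k)) ^ l)"
        by (simp add: sum_distrib_left)
      also have "\<dots> = (if k = 0 then 1 else 0)"
      proof (cases "k = 0")
        case False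
        have "inverse (\<zeta> ^ k) \<noteq> 1" using \<zeta>m[of k] False that by simp
        moreover have "(inverse (\<zeta> ^ k)) ^ N = 1"
          by (metis \<zeta>N inverse_1 mult.commute power_inverse power_mult power_one)
        ultimately show ?thesis using False by (simp add: geometric_sum)
      qed (use N in simp)
      finally show ?thesis .
    qed
    have "(\<Sum>j\<in>J. P j v) = (\<Sum>k<N. \<Sum>j\<in>J. scl (a j k) (R (c (\<zeta> ^ k)) v))"
      unfolding P_def by (rule sum.swap)
    also have "\<dots> = (\<Sum>k<N. scl (\<Sum>j\<in>J. a j k) (R (c (\<zeta> ^ k)) v))"
      by (intro sum.cong) (auto simp: fun_eq_iff scl_apply sum_fun_apply sum_distrib_right)
    also have "\<dots> = (\<Sum>k<N. if k = 0 then v else 0)"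
      by (intro sum.cong) (auto simp: s c1 R_one v)
    also have "\<dots> = v" using N by simp
    finally show ?thesis .
  qed
  moreover have "finite J" by (simp add: J_def)
  ultimately show ?thesis
    using pk unfolding P_def circle_decomp_def by (intro exI[of _ J] exI[of _ N] exI[of _ a] exI[of _ "\<lambda>k. \<zeta> ^ k"]) auto
qed

lemma torus_commute:
  assumes "cmod s = 1" "cmod t = 1" "cmod s' = 1" "cmod t' = 1"
  shows "R (torus s t) (R (torus s' t') v) = R (torus s' t') (R (torus s t) v)"
  using assms by (metis R_mult mult.commute torus_SU3 torus_mult)

definition weight_projs ::
  "(int \<times> int) set \<Rightarrow> (int \<times> int \<Rightarrow> ('i \<Rightarrow> complex) \<Rightarrow> 'i \<Rightarrow> complex) \<Rightarrow> bool" where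
  "weight_projs M P \<longleftrightarrow> finite M \<and>
    (\<forall>\<nu> u v. P \<nu> (u + v) = P \<nu> u + P \<nu> v) \<and> (\<forall>\<nu> c u. P \<nu> (scl c u) = scl c (P \<nu> u)) \<and>
    (\<forall>\<nu> U u. invariant_sub U \<longrightarrow> u \<in> U \<longrightarrow> P \<nu> u \<in> U) \<and>
    (\<forall>\<nu> s t u. cmod s = 1 \<longrightarrow> cmod t = 1 \<longrightarrow> P \<nu> (R (torus s t) u) = R (torus s t) (P \<nu> u)) \<and>
    (\<forall>v\<in>V. v = (\<Sum>\<nu>\<in>M. P \<nu> v)) \<and> (\<forall>v\<in>V. \<forall>\<nu>. wt \<nu> (P \<nu> v)) \<and>
    (\<forall>\<mu> \<nu> v. wt \<nu> v \<longrightarrow> P \<mu> v = (if \<mu> = \<nu> then v else 0)) \<and>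
    (\<forall>\<nu> v. wt \<nu> v \<longrightarrow> v \<noteq> 0 \<longrightarrow> \<nu> \<in> M)"

text \<open>Compose the projections for the two coordinate circles. Each commutes with the torus, so
  the images are simultaneous eigenvectors; \<open>chr_inj\<close> separates different
  weights.\<close>

theorem weight_projections: "\<exists>M P. weight_projs M P"
proof -
  let ?c1 = "\<lambda>z. torus z 1" and ?c2 = "\<lambda>z. torus 1 z"
  obtain J1 N1 a1 w1 where c1: "circle_decomp ?c1 J1 N1 a1 w1"
    using circle_projections[OF is_circle_torus1] by blast
  have J1: "finite J1" and w1: "\<And>k. cmod (w1 k) = 1"
    and d1: "\<And>v. v \<in> V \<Longrightarrow> v = (\<Sum>j\<in>J1. \<Sum>k<N1. scl (a1 j k) (R (?c1 (w1 k)) v))"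
    and e1: "\<And>v j z. v \<in> V \<Longrightarrow> j \<in> J1 \<Longrightarrow> cmod z = 1 \<Longrightarrow> R (?c1 z) (\<Sum>k<N1. scl (a1 j k) (R (?c1 (w1 k)) v)) =
         scl (z powi j) (\<Sum>k<N1. scl (a1 j k) (R (?c1 (w1 k)) v))"
    using c1 unfolding circle_decomp_def by blast+
  obtain J2 N2 a2 w2 where c2: "circle_decomp ?c2 J2 N2 a2 w2"
    using circle_projections[OF is_circle_torus2] by blast
  have J2: "finite J2" and w2: "\<And>k. cmod (w2 k) = 1"
    and d2: "\<And>v. v \<in> V \<Longrightarrow> v = (\<Sum>j\<in>J2. \<Sum>k<N2. scl (a2 j k) (R (?c2 (w2 k)) v))"
    and e2: "\<And>v j z. v \<in> V \<Longrightarrow> j \<in> J2 \<Longrightarrow> cmod z = 1 \<Longrightarrow> R (?c2 z) (\<Sum>k<N2. scl (a2 j k) (R (?c2 (w2 k)) v)) =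
         scl (z powi j) (\<Sum>k<N2. scl (a2 j k) (R (?c2 (w2 k)) v))"
    using c2 unfolding circle_decomp_def by blast+
  define P1 where "P1 j v = (\<Sum>k<N1. scl (a1 j k) (R (?c1 (w1 k)) v))" for j v
  define P2 where "P2 j v = (\<Sum>k<N2. scl (a2 j k) (R (?c2 (w2 k)) v))" for j v
  have lin: "P1 j (u + v) = P1 j u + P1 j v" "P2 j (u + v) = P2 j u + P2 j v"
    "P1 j (scl c u) = scl c (P1 j u)" "P2 j (scl c u) = scl c (P2 j u)" for j u v c
    unfolding P1_def P2_def R_add R_scl scl_add scl_sum by (simp_all add: sum.distrib mult.commute)
  have inv: "P1 j u \<in> U" "P2 j u \<in> U" if "invariant_sub U" "u \<in> U" for j u U
    unfolding P1_def P2_def using that w1 w2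
    by (auto simp: invariant_sub_def intro!: csubspace_sum csubspaceD(3))
  have inV: "P1 j v \<in> V" "P2 j v \<in> V" for j v
    unfolding P1_def P2_def
    by (auto intro!: csubspace_sum csubspaceD(3) V_csubspace)
  have com: "P1 j (R (torus s t) u) = R (torus s t) (P1 j u)" "P2 j (R (torus s t) u) = R (torus s t) (P2 j u)"
    if "cmod s = 1" "cmod t = 1" for j s t u
    unfolding P1_def P2_def R_sum R_scl using that w1 w2
    by (auto intro!: sum.cong arg_cong[of _ _ "scl _"] torus_commute)
  define P0 where "P0 ab v = P1 (fst ab) (P2 (snd ab) v)" for ab v
  \<comment> \<open>\<open>chr \<nu> s t\<close> is
    \<open>s powi (fst \<nu> + snd \<nu>) * t powi snd \<nu>\<close>, which gives the exponents on
    the two circles.\<close>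
  define idx where "idx \<nu> = (fst \<nu> + snd \<nu>, snd \<nu>)" for \<nu> :: "int \<times> int"
  define M where "M = {\<nu>. idx \<nu> \<in> J1 \<times> J2}"
  have inj: "inj idx" by (auto simp: inj_def idx_def prod_eq_iff)
  have bij: "idx ` M = J1 \<times> J2"
  proof -
    have "idx (a - b, b) = (a, b)" for a b by (simp add: idx_def)
    then show ?thesis unfolding M_def by (auto simp: image_def) (metis SigmaI)
  qed
  have fM: "finite M"
    using J1 J2 finite_vimageI[OF _ inj, of "J1 \<times> J2"] by (simp add: M_def vimage_def)
  define P where "P \<nu> v = (if \<nu> \<in> M then P0 (idx \<nu>) v else 0)" for \<nu> v
  have Plin: "P \<nu> (u + v) = P \<nu> u + P \<nu> v" "P \<nu> (scl c u) = scl c (P \<nu> u)" for \<nu> u v c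
    by (auto simp: P_def P0_def lin)
  have Pinv: "P \<nu> u \<in> U" if "invariant_sub U" "u \<in> U" for \<nu> u U
    using that inv by (auto simp: P_def P0_def invariant_sub_def csubspace_def)
  have Pcom: "P \<nu> (R (torus s t) u) = R (torus s t) (P \<nu> u)" if "cmod s = 1" "cmod t = 1" for \<nu> s t u
    using that by (auto simp: P_def P0_def com)
  have Psum: "v = (\<Sum>\<nu>\<in>M. P \<nu> v)" if v: "v \<in> V" for v
  proof -
    have P1sum: "P1 j (\<Sum>x\<in>S. f x) = (\<Sum>x\<in>S. P1 j (f x))" for j S and f :: "int \<Rightarrow> 'i \<Rightarrow> complex"
    proof (induction S rule: infinite_finite_induct)
      case (insert x F) then show ?case by (simp only: lin sum.insert simp_thms)
    qed (use lin(3)[of _ 0] in \<open>simp_all only: sum.infinite sum.empty scl_simps simp_thms\<close>)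
    have "v = (\<Sum>j\<in>J1. P1 j v)" unfolding P1_def by (rule d1[OF v])
    also have "\<dots> = (\<Sum>j\<in>J1. P1 j (\<Sum>k\<in>J2. P2 k v))" unfolding P2_def using d2[OF v] by simp
    also have "\<dots> = (\<Sum>j\<in>J1. \<Sum>k\<in>J2. P0 (j, k) v)" by (simp add: P1sum P0_def)
    also have "\<dots> = (\<Sum>ab\<in>J1 \<times> J2. P0 ab v)" by (simp add: sum.cartesian_product)
    also have "\<dots> = (\<Sum>\<nu>\<in>M. P0 (idx \<nu>) v)"
      unfolding bij[symmetric] using inj by (subst sum.reindex) (auto simp: inj_on_def)
    also have "\<dots> = (\<Sum>\<nu>\<in>M. P \<nu> v)" by (auto simp: P_def intro!: sum.cong)
    finally show ?thesis .
  qed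
  have Pwt: "wt \<nu> (P \<nu> v)" if v: "v \<in> V" for \<nu> v
  proof (cases "\<nu> \<in> M")
    case False then show ?thesis by (auto simp: P_def wt_def csubspaceD[OF V_csubspace])
  next
    case True
    let ?u = "P1 (fst \<nu> + snd \<nu>) (P2 (snd \<nu>) v)"
    have ij: "fst \<nu> + snd \<nu> \<in> J1" "snd \<nu> \<in> J2" using True by (auto simp: M_def idx_def)
    have "R (torus s t) ?u = scl (chr \<nu> s t) ?u" if s: "cmod s = 1" and t: "cmod t = 1" for s t
    proof -
      have "R (torus s t) ?u = R (?c1 s) (R (?c2 t) ?u)"
        using s t by (simp flip: R_mult add: torus_mult)
      also have "R (?c2 t) ?u = P1 (fst \<nu> + snd \<nu>) (R (?c2 t) (P2 (snd \<nu>) v))"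
        using t by (simp add: com)
      also have "R (?c2 t) (P2 (snd \<nu>) v) = scl (t powi snd \<nu>) (P2 (snd \<nu>) v)"
        unfolding P2_def by (rule e2[OF v ij(2) t])
      also have "R (?c1 s) (P1 (fst \<nu> + snd \<nu>) (scl (t powi snd \<nu>) (P2 (snd \<nu>) v))) =
          scl (t powi snd \<nu>) (R (?c1 s) ?u)" by (simp add: lin R_scl)
      also have "R (?c1 s) ?u = scl (s powi (fst \<nu> + snd \<nu>)) ?u"
        unfolding P1_def by (rule e1[OF inV(2) ij(1) s])
      moreover have "s \<noteq> 0" using s by auto
      then have "t powi snd \<nu> * s powi (fst \<nu> + snd \<nu>) = chr \<nu> s t"
        by (simp add: chr_def power_int_mult_distrib power_int_add mult_ac)
      ultimately show ?thesis by (simp only: scl_simps)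
    qed
    then show ?thesis using True inV by (auto simp: wt_def P_def P0_def idx_def)
  qed
  have Poff: "P \<mu> v = 0" if w: "wt \<nu> v" and ne: "\<mu> \<noteq> \<nu>" for \<mu> \<nu> v
  proof (rule ccontr)
    assume nz: "P \<mu> v \<noteq> 0"
    have v: "v \<in> V" using w by (simp add: wt_def)
    have "chr \<mu> s t = chr \<nu> s t" if "cmod s = 1" "cmod t = 1" for s t
    proof -
      have "scl (chr \<mu> s t) (P \<mu> v) = R (torus s t) (P \<mu> v)" using Pwt[OF v, of \<mu>] that by (simp add: wt_def)
      also have "\<dots> = P \<mu> (R (torus s t) v)" using Pcom that by simp
      also have "\<dots> = scl (chr \<nu> s t) (P \<mu> v)" using w that by (simp add: wt_def Plin)
      finally show ?thesis using nz by (simp add: scl_eq_scl)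
    qed
    then show False using ne chr_inj by blast
  qed
  have Pon: "\<nu> \<in> M \<and> P \<nu> v = v" if w: "wt \<nu> v" and nz: "v \<noteq> 0" for \<nu> v
  proof -
    have v: "v \<in> V" using w by (simp add: wt_def)
    have "v = (\<Sum>\<mu>\<in>M. if \<mu> = \<nu> then P \<nu> v else 0)"
      by (subst Psum[OF v]) (auto intro!: sum.cong simp: Poff[OF w])
    then have *: "v = (if \<nu> \<in> M then P \<nu> v else 0)" using fM by (simp only: sum.delta)
    then show ?thesis using nz by (metis (full_types))
  qed
  have Pz: "P \<mu> 0 = 0" for \<mu> using Plin(2)[of \<mu> 0] by simp
  have "P \<mu> v = (if \<mu> = \<nu> then v else 0)" if w: "wt \<nu> v" for \<mu> \<nu> v
    using Poff[OF w, of \<mu>] Pon[OF w] Pz by (cases "v = 0") auto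
  then show ?thesis using fM Plin Pinv Pcom Psum Pwt Pon
    unfolding weight_projs_def by (intro exI[of _ M] exI[of _ P]) (intro conjI allI ballI impI; (assumption | blast | metis)?)
qed

end

section \<open>Matrix coefficients along SU(2) strings\<close>

declare plus_fun_apply [simp del] zero_fun_apply [simp del]

lemma infinite_unit_circle: "infinite {z::complex. cmod z = 1}"
proof
  assume "finite {z::complex. cmod z = 1}"
  moreover have "cis ` {0..pi} \<subseteq> {z. cmod z = 1}" by auto
  ultimately have "finite (cis ` {0..pi})" using finite_subset by blast
  moreover have "inj_on cis {0..pi}"
    by (intro inj_onI) (metis atLeastAtMost_iff cis.sel(1) cos_inj_pi)
  ultimately have "finite {0..pi}" using finite_imageD by blast
  then show False using infinite_Icc[of 0 pi] by simp
qed

lemma poly_eq_on_unit_circle: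
  fixes p q :: "complex poly"
  assumes "\<And>z. cmod z = 1 \<Longrightarrow> poly p z = poly q z"
  shows "p = q"
proof (rule ccontr)
  assume "p \<noteq> q"
  then have "finite {z. poly (p - q) z = 0}" by (intro poly_roots_finite) simp
  moreover have "{z. cmod z = 1} \<subseteq> {z. poly (p - q) z = 0}" using assms by auto
  ultimately show False using infinite_unit_circle finite_subset by blast
qed

lemma unit_square_root: "cmod u = 1 \<Longrightarrow> \<exists>l. cmod l = 1 \<and> l * l = u"
  by (rule exI[of _ "csqrt u"]) (simp flip: power2_eq_square add: norm_csqrt)

text \<open>The Bezout identity removes the factors \<open>Y\<close> one at a time; removing a
  single one is an induction on the power of \<open>X\<close>.\<close>

lemma power_dvd_cancel_comaximal:
  fixes X Y P :: "'a :: comm_ring_1"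
  assumes uv: "u * X + v * Y = 1" and dvd: "X ^ n dvd Y ^ k * P"
  shows "X ^ n dvd P"
proof -
  have one: "X ^ n dvd Y * P \<Longrightarrow> X ^ n dvd P" for n P
  proof (induction n)
    case (Suc n)
    then have "X ^ n dvd P" using dvd_trans[OF le_imp_power_dvd[of n "Suc n" X]] by simp
    then have "X ^ Suc n dvd u * (X * P)" by (simp add: mult_dvd_mono dvd_mult)
    moreover have "X ^ Suc n dvd v * (Y * P)" using Suc.prems by (rule dvd_mult)
    ultimately have "X ^ Suc n dvd u * (X * P) + v * (Y * P)" by (rule dvd_add)
    also have "u * (X * P) + v * (Y * P) = (u * X + v * Y) * P" by (simp add: algebra_simps)
    finally show ?case by (simp add: uv)
  qed simp
  show ?thesis using dvd
  proof (induction k)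
    case (Suc k)
    from Suc.prems have "X ^ n dvd Y * (Y ^ k * P)" by (simp only: power_Suc mult.assoc)
    then show ?case by (rule Suc.IH[OF one])
  qed simp
qed

text \<open>On the ellipse \<open>a = C z - S / z\<close> the symmetries force \<open>a ^ k * F (cnj a) = cnj a ^ k * F a\<close>; since \<open>F\<close> is
  a Laurent polynomial in \<open>z\<close> with exponents in \<open>[-k, k]\<close>, coprimality makes it a multiple of \<open>a ^ k\<close>.\<close>

lemma su2_function:
  fixes F :: "complex \<Rightarrow> complex \<Rightarrow> complex" and k :: nat
  assumes F1: "\<And>a b l. on_S3 a b \<Longrightarrow> cmod l = 1 \<Longrightarrow> F (l * l * a) b = l ^ (2 * k) * F a b"
    and F2: "\<And>a b l. on_S3 a b \<Longrightarrow> cmod l = 1 \<Longrightarrow> F a (l * l * b) = F a b"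
    and F3: "\<And>p q. p\<^sup>2 + q\<^sup>2 = (1::real) \<Longrightarrow> \<exists>c::nat \<Rightarrow> complex. \<forall>z. cmod z = 1 \<longrightarrow>
      z ^ k * F (of_real (p\<^sup>2) * z - of_real (q\<^sup>2) / z) (of_real (p * q) * (z + 1 / z)) = (\<Sum>i\<le>2 * k. c i * z ^ i)"
    and ab: "on_S3 a b"
  shows "F a b = a ^ k * F 1 0"
proof -
  define r where "r = cmod a"
  have aa: "a * cnj a = of_real (r\<^sup>2)" "b * cnj b = of_real ((cmod b)\<^sup>2)"
    by (simp_all add: r_def complex_norm_square[symmetric])
  have "complex_of_real (r\<^sup>2 + (cmod b)\<^sup>2) = of_real 1" using ab aa by simp
  then have rb: "r\<^sup>2 + (cmod b)\<^sup>2 = 1" using of_real_eq_iff by blast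
  have "r\<^sup>2 \<le> 1\<^sup>2" using rb zero_le_power2[of "cmod b"] unfolding one_power2 by linarith
  then have r01: "0 \<le> r" "r \<le> 1"
    using power2_le_imp_le[of r 1] by (auto simp: r_def)
  show ?thesis
  proof (cases "r = 0 \<and> k > 0")
    case True
    then have a0: "a = 0" by (simp add: r_def)
    \<comment> \<open>At \<open>a = 0\<close> the rotation symmetry with this \<open>?l\<close>
      multiplies \<open>F\<close> by -1, so \<open>F\<close> vanishes there.\<close>
    let ?l = "cis (pi / (2 * real k))"
    have "?l ^ (2 * k) = -1" using True by (simp add: DeMoivre)
    then have "F 0 b = - F 0 b" using F1[OF ab, of ?l] a0 by simp
    then show ?thesis using True a0 by simp
  next
    case False
    \<comment> \<open>The ellipse is chosen to pass through two points: at \<open>z = 1\<close> it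
      has \<open>a = C - S = r\<close>, the value wanted, and at \<open>z = \<i>\<close> it has
      \<open>a = \<i>\<close>, \<open>b = 0\<close>, which fixes the constant.\<close>
    define C S where "C = (1 + r) / 2" and "S = (1 - r) / 2"
    define p q where "p = sqrt C" and "q = sqrt S"
    have pq: "p\<^sup>2 = C" "q\<^sup>2 = S" "p \<ge> 0" "q \<ge> 0" "C + S = 1" "C - S = r" "C > 0"
      using r01 by (auto simp: p_def q_def C_def S_def field_simps)
    define c' s' where "c' = complex_of_real C" and "s' = complex_of_real S"
    have cs: "c' + s' = 1" "c' - s' = of_real r" "c' \<noteq> 0"
      using pq by (simp_all add: c'_def s'_def flip: of_real_add of_real_diff)
    define A where "A z = c' * z - s' / z" for z
    define B where "B z = complex_of_real (p * q) * (z + 1 / z)" for z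
    obtain c where c: "\<And>z. cmod z = 1 \<Longrightarrow> z ^ k * F (A z) (B z) = (\<Sum>i\<le>2 * k. c i * z ^ i)"
      using F3[of p q] pq unfolding A_def B_def c'_def s'_def by auto
    have cz: "cnj z = 1 / z" "z \<noteq> 0" if "cmod z = 1" for z
      using cmod_1_inverse[OF that] that by (auto simp: inverse_eq_divide)
    have cA: "cnj (A z) = A (1 / z)" "cnj (B z) = B z" "B (1 / z) = B z" if "cmod z = 1" for z
      using cz[OF that] by (auto simp: A_def B_def c'_def s'_def add.commute)
    have onAB: "on_S3 (A z) (B z)" if "cmod z = 1" for z
    proof -
      have pq2: "complex_of_real (p * q) * complex_of_real (p * q) = c' * s'"
        using pq(1,2) by (simp add: c'_def s'_def flip: pq(1,2)) (simp add: power2_eq_square mult_ac)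
      have "B z * B z = c' * s' * ((z + 1 / z) * (z + 1 / z))"
        unfolding B_def pq2[symmetric] by (simp add: algebra_simps)
      moreover have "A z * A (1 / z) + c' * s' * ((z + 1 / z) * (z + 1 / z)) = (c' + s') * (c' + s')"
        using cz(2)[OF that] by (simp add: A_def field_simps)
      ultimately show ?thesis using cA[OF that] cs by simp
    qed
    have key: "A z ^ k * F (A (1 / z)) (B (1 / z)) = A (1 / z) ^ k * F (A z) (B z)" if z: "cmod z = 1" for z
    proof (cases "A z = 0")
      case True
      then have "A (1 / z) = 0" using cA(1)[OF z] by simp
      then show ?thesis using True cA[OF z] by simp
    next
      case nz: False
      \<comment> \<open>A rotation carrying \<open>A z\<close> to its conjugate. As
        \<open>B z\<close> is real, \<open>F1\<close> compares the points of the ellipse for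
        \<open>z\<close> and \<open>1 / z\<close>.\<close>
      define l where "l = cnj (A z) / of_real (cmod (A z))"
      have l1: "cmod l = 1" using nz by (simp add: l_def norm_divide)
      have n2: "complex_of_real (cmod (A z)) * of_real (cmod (A z)) = A z * cnj (A z)"
        using complex_norm_square[of "A z"] by (simp add: power2_eq_square)
      have ll: "l * l * A z = cnj (A z)"
        using nz n2 by (simp add: l_def)
      have "F (cnj (A z)) (B z) = l ^ (2 * k) * F (A z) (B z)"
        using F1[OF onAB[OF z] l1] ll by simp
      moreover have "A z ^ k * l ^ (2 * k) = cnj (A z) ^ k"
        unfolding ll[symmetric] by (simp add: power_mult_distrib power_mult power2_eq_square mult_ac)
      ultimately show ?thesis using cA[OF z] by (simp add: mult.assoc[symmetric])
    qed
    \<comment> \<open>\<open>Pr\<close> reverses the coefficients of \<open>Pz\<close>, that is, it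
      represents the function at \<open>1 / z\<close>; \<open>X\<close> and \<open>Y\<close> are
      \<open>A z\<close> and \<open>A (1 / z)\<close> cleared of denominators.\<close>
    define Pz where "Pz = (\<Sum>i\<le>2 * k. monom (c i) i)"
    define Pr where "Pr = (\<Sum>i\<le>2 * k. monom (c i) (2 * k - i))"
    define X where "X = [:- s', 0, c':]"
    define Y where "Y = [:c', 0, - s':]"
    have Pz: "poly Pz z = z ^ k * F (A z) (B z)" if "cmod z = 1" for z
      using c[OF that] by (simp add: Pz_def poly_sum poly_monom)
    have Pr: "poly Pr z = z ^ k * F (A (1 / z)) (B (1 / z))" if z: "cmod z = 1" for z
    proof -
      have z0: "z \<noteq> 0" using z by auto
      have "poly Pr z = (\<Sum>i\<le>2 * k. z ^ (2 * k) * (c i * (1 / z) ^ i))"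
        unfolding Pr_def poly_sum poly_monom
        by (intro sum.cong) (auto simp: power_diff z0 power_divide)
      also have "\<dots> = z ^ (2 * k) * ((1 / z) ^ k * F (A (1 / z)) (B (1 / z)))"
        using c[of "1 / z"] z by (simp add: sum_distrib_left norm_divide)
      also have "\<dots> = z ^ k * F (A (1 / z)) (B (1 / z))"
        using z0 by (simp add: power_divide mult_2 power_add)
      finally show ?thesis .
    qed
    have XA: "poly X z = z * A z" "poly Y z = z * A (1 / z)" if "cmod z = 1" for z
      using cz(2)[OF that] by (simp_all add: X_def Y_def A_def algebra_simps)
    have "X ^ k * Pr = Y ^ k * Pz"
    proof (rule poly_eq_on_unit_circle)
      fix z :: complex assume z: "cmod z = 1"
      have "poly (X ^ k * Pr) z = z ^ k * z ^ k * (A z ^ k * F (A (1 / z)) (B (1 / z)))"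
        by (simp add: XA z Pr power_mult_distrib mult_ac)
      also have "\<dots> = poly (Y ^ k * Pz) z"
        unfolding key[OF z] by (simp add: XA z Pz power_mult_distrib mult_ac)
      finally show "poly (X ^ k * Pr) z = poly (Y ^ k * Pz) z" .
    qed
    then have "X ^ k dvd Y ^ k * Pz" by (metis dvd_triv_left)
    have "X ^ k dvd Pz"
    proof (cases "k = 0")
      case False
      then have "r > 0" using \<open>\<not> (r = 0 \<and> k > 0)\<close> r01 by auto
      then have ne: "c' * c' - s' * s' \<noteq> 0" using cs square_diff_square_factored[of c' s'] by auto
      \<comment> \<open>The two quadratics are comaximal because \<open>c' * c' - s' * s'\<close>
        equals \<open>r\<close>, which is positive here.\<close>
      define E where "E = inverse (c' * c' - s' * s')"
      have "[:E * s':] * X + [:E * c':] * Y = [:E * (c' * c' - s' * s'):]"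
        by (simp add: X_def Y_def algebra_simps)
      also have "\<dots> = 1" using ne by (simp add: E_def)
      finally show ?thesis using \<open>X ^ k dvd Y ^ k * Pz\<close> by (rule power_dvd_cancel_comaximal)
    qed simp
    then obtain Q where Q: "Pz = X ^ k * Q" by blast
    have dX: "degree (X ^ k) = 2 * k" "X \<noteq> 0"
      using cs by (simp_all add: X_def degree_power_eq)
    have "degree Pz \<le> 2 * k"
      unfolding Pz_def by (intro degree_sum_le) (auto intro: order_trans[OF degree_monom_le])
    then have "degree Q = 0"
      using dX by (cases "Q = 0") (auto simp: Q degree_mult_eq)
    then obtain q0 where q0: "Q = [:q0:]" by (rule degree_eq_zeroE)
    have FA: "F (A z) (B z) = A z ^ k * q0" if z: "cmod z = 1" for z
    proof -
      have "z ^ k * F (A z) (B z) = z ^ k * (A z ^ k * q0)"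
        unfolding Pz[OF z, symmetric] by (simp add: Q q0 XA z power_mult_distrib mult_ac)
      moreover have "z ^ k \<noteq> 0" using cz(2)[OF z] by simp
      ultimately show ?thesis by (simp only: mult_cancel_left simp_thms)
    qed
    have Ai: "A \<i> = \<i>" "B \<i> = 0"
      using cs(1) by (simp_all add: A_def B_def field_simps flip: distrib_left)
    have "F \<i> 0 = \<i> ^ k * F 1 0"
      using F1[of 1 0 "cis (pi / 4)"] by (simp add: cis_mult power_mult power2_eq_square)
    then have q0F: "q0 = F 1 0" using FA[of \<i>] Ai by simp
    have A1: "A 1 = of_real r" "B 1 = of_real (2 * p * q)"
      using cs by (simp_all add: A_def B_def)
    have Fr: "F (of_real r) (of_real (2 * p * q)) = of_real r ^ k * F 1 0"
      using FA[of 1] A1 q0F by simp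
    have bb: "cmod b = 2 * p * q"
    proof (rule power2_eq_imp_eq)
      have "(2 * p * q)\<^sup>2 = 4 * (C * S)" using pq by (simp add: power_mult_distrib)
      also have "\<dots> = (C + S) * (C + S) - (C - S) * (C - S)" by (simp add: algebra_simps)
      also have "\<dots> = 1 - r\<^sup>2" using pq by (simp add: power2_eq_square)
      finally show "(cmod b)\<^sup>2 = (2 * p * q)\<^sup>2" using rb by simp
    qed (use pq in auto)
    have polar: "\<exists>l. cmod l = 1 \<and> x = l * l * of_real (cmod x)" for x
    proof (cases "x = 0")
      case True then show ?thesis by (intro exI[of _ 1]) simp
    next
      case False
      then obtain l where "cmod l = 1" "l * l = x / of_real (cmod x)"
        using unit_square_root[of "x / of_real (cmod x)"] by (auto simp: norm_divide)
      then show ?thesis using False by (intro exI[of _ l]) simp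
    qed
    obtain l1 l2 where l: "cmod l1 = 1" "a = l1 * l1 * of_real r" "cmod l2 = 1" "b = l2 * l2 * of_real (cmod b)"
      using polar[of a] polar[of b] r_def by blast
    have on0: "on_S3 (of_real r) (of_real (cmod b))"
      using rb by (simp add: power2_eq_square flip: of_real_mult of_real_add)
    have on1: "on_S3 (of_real r) b"
      using rb aa by (simp add: power2_eq_square flip: of_real_mult of_real_add)
    have "F a b = l1 ^ (2 * k) * F (of_real r) b" using F1[OF on1 l(1)] l(2) by simp
    also have "F (of_real r) b = F (of_real r) (of_real (cmod b))" using F2[OF on0 l(3)] l(4) by simp
    also have "\<dots> = of_real r ^ k * F 1 0" using Fr bb by simp
    also have "l1 ^ (2 * k) * (of_real r ^ k * F 1 0) = a ^ k * F 1 0"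
    proof -
      have "a ^ k = (l1 * l1 * of_real r) ^ k" using l(2) by simp
      then show ?thesis by (simp add: power_mult_distrib power_mult power2_eq_square mult_ac)
    qed
    finally show ?thesis .
  qed
qed

text \<open>What is needed of the copy \<open>e\<close> of SU(2) attached to a simple root:
  \<open>h\<close> pairs a weight with the coroot, the circle given by \<open>c1\<close>,
  \<open>c2\<close> centralises \<open>e\<close> and acts on the weight \<open>\<nu>\<close> with
  exponent \<open>\<kappa> \<nu>\<close>, and \<open>e 0 1\<close> represents the reflection
  \<open>rfl\<close>. In both instances \<open>h\<close> and \<open>\<kappa>\<close> together
  determine a weight, and the weights with a fixed \<open>\<kappa>\<close> lie on a line in the
  direction of the root.\<close>

locale su2_embed =
  fixes e :: "complex \<Rightarrow> complex \<Rightarrow> complex mat" and \<tau>1 \<tau>2 :: "complex \<Rightarrow> complex" and h :: "int \<times> int \<Rightarrow> int"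
    and c1 c2 :: "complex \<Rightarrow> complex" and \<kappa> :: "int \<times> int \<Rightarrow> int"
    and \<sigma>1 \<sigma>2 :: "complex \<Rightarrow> complex \<Rightarrow> complex" and rfl :: "int \<times> int \<Rightarrow> int \<times> int"
  assumes e_SU3: "on_S3 a b \<Longrightarrow> e a b \<in> carrier SU3"
    and e_mult: "e a b * e c d = e (a * c - b * cnj d) (a * d + b * cnj c)"
    and e_torus: "cmod z = 1 \<Longrightarrow> e z 0 = torus (\<tau>1 z) (\<tau>2 z)"
    and \<tau>: "cmod z = 1 \<Longrightarrow> cmod (\<tau>1 z) = 1" "cmod z = 1 \<Longrightarrow> cmod (\<tau>2 z) = 1" "cmod z = 1 \<Longrightarrow> chr \<nu> (\<tau>1 z) (\<tau>2 z) = z powi h \<nu>"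
    and ctr: "cmod z = 1 \<Longrightarrow> cmod (c1 z) = 1" "cmod z = 1 \<Longrightarrow> cmod (c2 z) = 1" "cmod z = 1 \<Longrightarrow> chr \<nu> (c1 z) (c2 z) = z powi \<kappa> \<nu>"
    and ctr_commute: "cmod z = 1 \<Longrightarrow> torus (c1 z) (c2 z) * e a b = e a b * torus (c1 z) (c2 z)"
    and weyl: "cmod s = 1 \<Longrightarrow> cmod t = 1 \<Longrightarrow> torus s t * e 0 1 = e 0 1 * torus (\<sigma>1 s t) (\<sigma>2 s t)"
    and \<sigma>: "cmod s = 1 \<Longrightarrow> cmod t = 1 \<Longrightarrow> cmod (\<sigma>1 s t) = 1" "cmod s = 1 \<Longrightarrow> cmod t = 1 \<Longrightarrow> cmod (\<sigma>2 s t) = 1"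
      "cmod s = 1 \<Longrightarrow> cmod t = 1 \<Longrightarrow> chr \<nu> (\<sigma>1 s t) (\<sigma>2 s t) = chr (rfl \<nu>) s t"
    and rfl: "\<kappa> (rfl \<nu>) = \<kappa> \<nu>" "h (rfl \<nu>) = - h \<nu>"

lemma powi_unit_simps:
  "cmod s = 1 \<Longrightarrow> s powi (a + b) = s powi a * s powi b"
  "cmod s = 1 \<Longrightarrow> cnj s powi a = s powi (- a)"
  "(s * t) powi a = s powi a * t powi a"
proof -
  show "cmod s = 1 \<Longrightarrow> cnj s powi a = s powi (- a)"
    by (simp add: power_int_minus power_int_inverse flip: cmod_1_inverse)
  show "cmod s = 1 \<Longrightarrow> s powi (a + b) = s powi a * s powi b"
    by (auto intro: power_int_add)
qed (simp add: power_int_mult_distrib)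

interpretation e12: su2_embed k12 "\<lambda>z. z" cnj fst "\<lambda>z. z" "\<lambda>z. z" "\<lambda>\<nu>. fst \<nu> + 2 * snd \<nu>" "\<lambda>s t. t" "\<lambda>s t. s"
  "\<lambda>\<nu>. (- fst \<nu>, fst \<nu> + snd \<nu>)"
proof
  fix z :: complex and \<nu> assume z: "cmod z = 1"
  then have z0: "z * cnj z = 1" by (simp add: cmod_1_iff)
  then have nz: "z \<noteq> 0" by auto
  show "chr \<nu> z (cnj z) = z powi fst \<nu>" by (simp add: chr_def z0)
  show "chr \<nu> z z = z powi (fst \<nu> + 2 * snd \<nu>)"
    unfolding chr_def mult_2 powi_unit_simps(1)[OF z] powi_unit_simps(3) by simp
  show "k12 z 0 = torus z (cnj z)" by (simp add: k12_def torus_M3 z0 M3_eq_iff)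
next
  fix s t :: complex and \<nu> assume s: "cmod s = 1" and t: "cmod t = 1"
  then have nz: "s \<noteq> 0" "t \<noteq> 0" by auto
  show "chr \<nu> t s = chr (- fst \<nu>, fst \<nu> + snd \<nu>) s t"
    using nz by (simp add: chr_def power_int_mult_distrib power_int_add power_int_minus field_simps)
qed (simp_all add: k12_mult, simp_all add: k12_def torus_M3 M3_mult M3_eq_iff)

interpretation e23: su2_embed k23 "\<lambda>z. 1" "\<lambda>z. z" snd "\<lambda>z. inverse (z * z)" "\<lambda>z. z" "\<lambda>\<nu>. - 2 * fst \<nu> - snd \<nu>"
  "\<lambda>s t. s" "\<lambda>s t. inverse (s * t)" "\<lambda>\<nu>. (fst \<nu> + snd \<nu>, - snd \<nu>)"
proof
  fix z :: complex and \<nu> assume z: "cmod z = 1"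
  then have z0: "z * cnj z = 1" by (simp add: cmod_1_iff)
  then have nz: "z \<noteq> 0" by auto
  show "chr \<nu> 1 z = z powi snd \<nu>" by (simp add: chr_def)
  show "chr \<nu> (inverse (z * z)) z = z powi (- 2 * fst \<nu> - snd \<nu>)"
  proof -
    have 1: "- 2 * fst \<nu> - snd \<nu> = - (fst \<nu> + fst \<nu> + snd \<nu>)" by simp
    have 2: "inverse (z * z) * z = inverse z" using nz by (simp add: field_simps)
    show ?thesis
      unfolding chr_def 1 2 power_int_minus power_int_inverse powi_unit_simps(1)[OF z] powi_unit_simps(3) by simp
  qed
  show "k23 z 0 = torus 1 z" using z by (simp add: k23_def torus_M3 cmod_1_inverse M3_eq_iff)
  show "cmod (inverse (z * z)) = 1" using z by (simp add: norm_mult norm_inverse)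
next
  fix s t :: complex and \<nu> assume s: "cmod s = 1" and t: "cmod t = 1"
  then have nz: "s \<noteq> 0" "t \<noteq> 0" by auto
  show "chr \<nu> s (inverse (s * t)) = chr (fst \<nu> + snd \<nu>, - snd \<nu>) s t"
    using nz by (simp add: chr_def power_int_mult_distrib power_int_add power_int_minus power_int_inverse field_simps)
  show "cmod (inverse (s * t)) = 1" using s t by (simp add: norm_mult norm_inverse)
  show "torus s t * k23 0 1 = k23 0 1 * torus s (inverse (s * t))"
    using nz by (simp add: k23_def torus_M3 M3_mult M3_eq_iff)
next
  fix z a b :: complex assume z: "cmod z = 1"
  then have nz: "z \<noteq> 0" by auto
  show "torus (inverse (z * z)) z * k23 a b = k23 a b * torus (inverse (z * z)) z"
    using nz by (simp add: k23_def torus_M3 M3_mult M3_eq_iff)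
qed (simp_all add: k23_mult)

definition linear_on :: "('i \<Rightarrow> complex) set \<Rightarrow> (('i \<Rightarrow> complex) \<Rightarrow> complex) \<Rightarrow> bool" where
  "linear_on U \<phi> \<longleftrightarrow> (\<forall>x\<in>U. \<forall>y\<in>U. \<phi> (x + y) = \<phi> x + \<phi> y) \<and> (\<forall>c. \<forall>x\<in>U. \<phi> (scl c x) = c * \<phi> x)"

lemma linear_on_zero: "csubspace U \<Longrightarrow> linear_on U \<phi> \<Longrightarrow> \<phi> 0 = 0"
  unfolding linear_on_def csubspace_def by (metis mult_zero_left scl_simps(2))

lemma linear_on_sum:
  assumes U: "csubspace U" and \<phi>: "linear_on U \<phi>" and f: "\<And>x. x \<in> S \<Longrightarrow> f x \<in> U"
  shows "\<phi> (\<Sum>x\<in>S. f x) = (\<Sum>x\<in>S. \<phi> (f x))"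
  using f
proof (induction S rule: infinite_finite_induct)
  case (insert x F)
  then have "sum f F \<in> U" by (intro csubspace_sum[OF U]) auto
  then show ?case using insert \<phi> by (simp only: sum.insert simp_thms) (simp add: linear_on_def)
qed (simp_all only: sum.infinite sum.empty linear_on_zero[OF U \<phi>] simp_thms)

context su3_rep
begin

definition "wM = fst (SOME MP. weight_projs (fst MP) (snd MP))"
definition "wP = snd (SOME MP. weight_projs (fst MP) (snd MP))"

lemma weight_projs: "weight_projs wM wP"
  unfolding wM_def wP_def by (rule someI_ex) (use weight_projections in auto)

lemma wP:
  "finite wM" "wP \<nu> (u + v) = wP \<nu> u + wP \<nu> v" "wP \<nu> (scl c u) = scl c (wP \<nu> u)"
  "invariant_sub U \<Longrightarrow> u \<in> U \<Longrightarrow> wP \<nu> u \<in> U"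
  "cmod s = 1 \<Longrightarrow> cmod t = 1 \<Longrightarrow> wP \<nu> (R (torus s t) u) = R (torus s t) (wP \<nu> u)"
  "v \<in> V \<Longrightarrow> (\<Sum>\<nu>\<in>wM. wP \<nu> v) = v" "v \<in> V \<Longrightarrow> wt \<nu> (wP \<nu> v)"
  "wt \<nu> v \<Longrightarrow> wP \<mu> v = (if \<mu> = \<nu> then v else 0)" "wt \<nu> v \<Longrightarrow> v \<noteq> 0 \<Longrightarrow> \<nu> \<in> wM"
  using weight_projs unfolding weight_projs_def by (blast | metis)+

lemma invariantD: "invariant_sub U \<Longrightarrow> csubspace U" "invariant_sub U \<Longrightarrow> U \<subseteq> V"
  "invariant_sub U \<Longrightarrow> g \<in> carrier SU3 \<Longrightarrow> u \<in> U \<Longrightarrow> R g u \<in> U"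
  by (auto simp: invariant_sub_def)

lemma wtD: "wt \<nu> u \<Longrightarrow> u \<in> V" "wt \<nu> u \<Longrightarrow> cmod s = 1 \<Longrightarrow> cmod t = 1 \<Longrightarrow> R (torus s t) u = scl (chr \<nu> s t) u"
  by (auto simp: wt_def)

lemma wt_unique: "wt \<nu> u \<Longrightarrow> wt \<mu> u \<Longrightarrow> u \<noteq> 0 \<Longrightarrow> \<nu> = \<mu>"
  using wP(8)[of \<nu> u \<mu>] wP(8)[of \<mu> u \<mu>] by (auto split: if_splits)

lemma wP_zero: "v \<in> V \<Longrightarrow> \<nu> \<notin> wM \<Longrightarrow> wP \<nu> v = 0"
  using wP(7)[of v \<nu>] wP(9)[of \<nu> "wP \<nu> v"] by blast

text \<open>Fixing \<open>\<kappa>\<close> selects the line through \<open>\<mu>\<close> in the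
  direction of the root, so this bounds \<open>h\<close> along one root string.\<close>

definition top_in_string :: "('i \<Rightarrow> complex) set \<Rightarrow> (int \<times> int \<Rightarrow> int) \<Rightarrow> (int \<times> int \<Rightarrow> int) \<Rightarrow> int \<times> int \<Rightarrow> bool" where
  "top_in_string U \<kappa> h \<mu> \<longleftrightarrow> (\<forall>\<nu> y. y \<in> U \<longrightarrow> y \<noteq> 0 \<longrightarrow> wt \<nu> y \<longrightarrow> \<kappa> \<nu> = \<kappa> \<mu> \<longrightarrow> h \<nu> \<le> h \<mu>)"

lemma weyl_weight:
  assumes "su2_embed e \<tau>1 \<tau>2 h c1 c2 \<kappa> \<sigma>1 \<sigma>2 rfl" "wt \<nu> y"
  shows "wt (rfl \<nu>) (R (e 0 1) y)"
proof -
  interpret su2_embed e \<tau>1 \<tau>2 h c1 c2 \<kappa> \<sigma>1 \<sigma>2 rfl by fact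
  have e01: "e 0 1 \<in> carrier SU3" by (rule e_SU3) simp
  have "R (torus s t) (R (e 0 1) y) = scl (chr (rfl \<nu>) s t) (R (e 0 1) y)" if st: "cmod s = 1" "cmod t = 1" for s t
  proof -
    have "R (torus s t) (R (e 0 1) y) = R (e 0 1) (R (torus (\<sigma>1 s t) (\<sigma>2 s t)) y)"
      using st e01 \<sigma> by (simp flip: R_mult add: weyl)
    then show ?thesis using wtD(2)[OF assms(2)] \<sigma> st by (simp add: R_scl)
  qed
  then show ?thesis by (simp add: wt_def)
qed

text \<open>The reflection \<open>e 0 1\<close> turns a vector of weight \<open>\<nu>\<close> into
  one on the same line with \<open>- h \<nu>\<close>, so the upper bound is also a lower
  bound.\<close>

lemma su2_string_bound:
  assumes em: "su2_embed e \<tau>1 \<tau>2 h c1 c2 \<kappa> \<sigma>1 \<sigma>2 rfl"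
    and U: "invariant_sub U" and top: "top_in_string U \<kappa> h \<mu>" and y: "y \<in> U" "y \<noteq> 0" "wt \<nu> y" "\<kappa> \<nu> = \<kappa> \<mu>"
  shows "\<bar>h \<nu>\<bar> \<le> h \<mu>"
proof -
  interpret su2_embed e \<tau>1 \<tau>2 h c1 c2 \<kappa> \<sigma>1 \<sigma>2 rfl by fact
  have e01: "e 0 1 \<in> carrier SU3" by (rule e_SU3) simp
  have yV: "y \<in> V" using y U invariantD by blast
  have "R (e 0 1) y \<noteq> 0" using R_inv_cancel(1)[OF e01 yV] y by auto
  then have "h (rfl \<nu>) \<le> h \<mu>"
    using top y weyl_weight[OF em y(3)] invariantD(3)[OF U e01 y(1)] rfl(1)[of \<nu>]
    unfolding top_in_string_def by metis
  moreover have "h \<nu> \<le> h \<mu>" using top y unfolding top_in_string_def by metis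
  ultimately show ?thesis by (simp add: rfl)
qed

text \<open>The centralising circle acts on \<open>u\<close> by a scalar and commutes with
  \<open>e\<close>, hence acts on \<open>R (e a b) u\<close> by the same scalar.\<close>

lemma su2_string:
  assumes em: "su2_embed e \<tau>1 \<tau>2 h c1 c2 \<kappa> \<sigma>1 \<sigma>2 rfl"
    and u: "wt \<mu> u" and ab: "on_S3 a b" and ne: "wP \<nu> (R (e a b) u) \<noteq> 0"
  shows "\<kappa> \<nu> = \<kappa> \<mu>"
proof (rule powi_unit_inj)
  interpret su2_embed e \<tau>1 \<tau>2 h c1 c2 \<kappa> \<sigma>1 \<sigma>2 rfl by fact
  fix z :: complex assume z: "cmod z = 1"
  let ?c = "torus (c1 z) (c2 z)" and ?w = "R (e a b) u"
  have cS: "?c \<in> carrier SU3" using ctr z by simp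
  have "R ?c ?w = R (e a b) (R ?c u)"
    using cS e_SU3[OF ab] ctr_commute[OF z] by (simp flip: R_mult)
  also have "\<dots> = scl (z powi \<kappa> \<mu>) ?w"
    using u ctr z by (simp add: wtD R_scl)
  finally have "wP \<nu> (R ?c ?w) = scl (z powi \<kappa> \<mu>) (wP \<nu> ?w)" by (simp add: wP(3))
  moreover have "wP \<nu> (R ?c ?w) = R ?c (wP \<nu> ?w)" using ctr z by (simp add: wP(5))
  moreover have "\<dots> = scl (z powi \<kappa> \<nu>) (wP \<nu> ?w)"
    using wtD(2)[OF wP(7)[OF R_in_V]] ctr z by simp
  ultimately show "z powi \<kappa> \<nu> = z powi \<kappa> \<mu>" using ne scl_eq_scl by metis
qed

text \<open>The function \<open>F a b = \<phi> (R (e a b) u)\<close> meets the hypotheses of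
  \<open>su2_function\<close>: the torus of SU(2) acts through the same character on both sides, and
  the weights met by \<open>R (e a b) u\<close> have \<open>h\<close> between
  \<open>- h \<mu>\<close> and \<open>h \<mu>\<close>.\<close>

lemma su2_matrix_coeff:
  assumes em: "su2_embed e \<tau>1 \<tau>2 h c1 c2 \<kappa> \<sigma>1 \<sigma>2 rfl"
    and U: "invariant_sub U" and top: "top_in_string U \<kappa> h \<mu>" and u: "u \<in> U" "u \<noteq> 0" "wt \<mu> u"
    and \<phi>: "linear_on U \<phi>"
    and \<phi>t: "\<And>z a b. cmod z = 1 \<Longrightarrow> on_S3 a b \<Longrightarrow>
      \<phi> (R (torus (\<tau>1 z) (\<tau>2 z)) (R (e a b) u)) = z powi h \<mu> * \<phi> (R (e a b) u)"
    and ab: "on_S3 a b"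
  shows "\<phi> (R (e a b) u) = a ^ nat (h \<mu>) * \<phi> u"
proof -
  interpret su2_embed e \<tau>1 \<tau>2 h c1 c2 \<kappa> \<sigma>1 \<sigma>2 rfl by fact
  note Us = invariantD(1)[OF U]
  have uV: "u \<in> V" using u U invariantD by blast
  have h0: "h \<mu> \<ge> 0" using su2_string_bound[OF em U top u refl] by force
  define k where "k = nat (h \<mu>)"
  have k: "int k = h \<mu>" using h0 by (simp add: k_def)
  have pk: "z powi h \<mu> = z ^ k" for z :: complex by (simp flip: k)
  define F where "F a b = \<phi> (R (e a b) u)" for a b
  have on10: "cmod z = 1 \<Longrightarrow> on_S3 z 0" for z by (simp add: cmod_1_iff)
  have e0: "R (e z 0) u = scl (z ^ k) u" if "cmod z = 1" for z
    using that u \<tau> by (simp add: e_torus wtD pk)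
  have RU: "on_S3 a b \<Longrightarrow> R (e a b) x \<in> U" if "x \<in> U" for a b x using e_SU3 invariantD(3)[OF U] that by blast
  have left: "\<phi> (R (e z 0) (R (e a b) u)) = z ^ k * F a b" if "cmod z = 1" "on_S3 a b" for z a b
    using \<phi>t[OF that] that by (simp add: e_torus pk F_def)
  have F1: "F (l * l * a) b = l ^ (2 * k) * F a b" if ab: "on_S3 a b" and l: "cmod l = 1" for a b l
  proof -
    have ll: "l * cnj l = 1" using l by (simp add: cmod_1_iff)
    have "e (l * l * a) b = e l 0 * (e a b * e l 0)"
      using ll by (simp add: e_mult mult_ac; (simp add: mult.assoc[symmetric] ll)?)
    then have "R (e (l * l * a) b) u = R (e l 0) (R (e a b) (R (e l 0) u))"
      using ab on10[OF l] e_SU3 by (simp add: R_mult)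
    then have "F (l * l * a) b = l ^ k * \<phi> (R (e l 0) (R (e a b) u))"
      using \<phi> RU[OF RU[OF u(1) ab] on10[OF l]] by (simp add: F_def e0 l R_scl linear_on_def)
    moreover have "l ^ (2 * k) = l ^ k * l ^ k" by (simp add: mult_2 power_add)
    ultimately show ?thesis using left[OF l ab] by simp
  qed
  have F2: "F a (l * l * b) = F a b" if ab: "on_S3 a b" and l: "cmod l = 1" for a b l
  proof -
    have ll: "l * cnj l = 1" using l by (simp add: cmod_1_iff)
    have cl: "cmod (cnj l) = 1" using l by simp
    have "e a (l * l * b) = e l 0 * (e a b * e (cnj l) 0)"
      using ll by (simp add: e_mult mult_ac; (simp add: mult.assoc[symmetric] ll)?)
    then have "R (e a (l * l * b)) u = R (e l 0) (R (e a b) (R (e (cnj l) 0) u))"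
      using ab on10[OF l] on10[OF cl] e_SU3 by (simp add: R_mult)
    then have "F a (l * l * b) = cnj l ^ k * \<phi> (R (e l 0) (R (e a b) u))"
      using \<phi> RU[OF RU[OF u(1) ab] on10[OF l]] by (simp add: F_def e0 l R_scl linear_on_def)
    then have "F a (l * l * b) = (l * cnj l) ^ k * F a b"
      using left[OF l ab] by (simp add: power_mult_distrib mult_ac)
    then show ?thesis using ll by simp
  qed
  have F3: "\<exists>c::nat \<Rightarrow> complex. \<forall>z. cmod z = 1 \<longrightarrow>
      z ^ k * F (of_real (p\<^sup>2) * z - of_real (q\<^sup>2) / z) (of_real (p * q) * (z + 1 / z)) = (\<Sum>i\<le>2 * k. c i * z ^ i)"
    if pq: "p\<^sup>2 + q\<^sup>2 = (1::real)" for p q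
  proof -
    let ?p = "complex_of_real p" and ?q = "complex_of_real q"
    have on: "on_S3 ?p ?q" using pq by (simp add: power2_eq_square flip: of_real_mult of_real_add)
    define w where "w = R (e ?p ?q) u"
    have wU: "w \<in> U" unfolding w_def using RU[OF u(1) on] .
    have wV: "w \<in> V" using wU U invariantD by blast
    define x where "x \<nu> = \<phi> (R (e ?p ?q) (wP \<nu> w))" for \<nu>
    define N where "N = {\<nu>\<in>wM. wP \<nu> w \<noteq> 0}"
    have N1: "finite N" using wP(1) by (simp add: N_def)
    have N2: "\<bar>h \<nu>\<bar> \<le> int k" if "\<nu> \<in> N" for \<nu>
    proof -
      have nz: "wP \<nu> w \<noteq> 0" using that by (simp add: N_def)
      have "\<kappa> \<nu> = \<kappa> \<mu>" by (rule su2_string[OF em u(3) on nz[unfolded w_def]])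
      then show ?thesis unfolding k by (rule su2_string_bound[OF em U top wP(4)[OF U wU] nz wP(7)[OF wV]])
    qed
    note N = N1 N2
    have ws: "w = (\<Sum>\<nu>\<in>N. wP \<nu> w)"
    proof -
      have "(\<Sum>\<nu>\<in>wM. wP \<nu> w) = (\<Sum>\<nu>\<in>N. wP \<nu> w)"
        by (rule sum.mono_neutral_right[OF wP(1)]) (auto simp: N_def)
      then show ?thesis using wP(6)[OF wV] by (simp only:)
    qed
    define c where "c i = (\<Sum>\<nu>\<in>{\<nu>\<in>N. nat (int k + h \<nu>) = i}. x \<nu>)" for i
    have "z ^ k * F (of_real (p\<^sup>2) * z - of_real (q\<^sup>2) / z) (of_real (p * q) * (z + 1 / z)) = (\<Sum>i\<le>2 * k. c i * z ^ i)"
      if z: "cmod z = 1" for z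
    proof -
      have z0: "z \<noteq> 0" "cnj z = 1 / z" using z cmod_1_inverse[OF z] by (auto simp: inverse_eq_divide)
      \<comment> \<open>The ellipse of \<open>su2_function\<close> is the curve
        \<open>e ?p ?q * e z 0 * e ?p ?q\<close>; its middle factor is diagonal on the weight
        components of \<open>w\<close>.\<close>
      have "e (of_real (p\<^sup>2) * z - of_real (q\<^sup>2) / z) (of_real (p * q) * (z + 1 / z)) = e ?p ?q * (e z 0 * e ?p ?q)"
        by (simp add: e_mult power2_eq_square z0(2) algebra_simps)
      then have "F (of_real (p\<^sup>2) * z - of_real (q\<^sup>2) / z) (of_real (p * q) * (z + 1 / z)) = \<phi> (R (e ?p ?q) (R (e z 0) w))"
        using on on10[OF z] e_SU3 by (simp add: F_def R_mult w_def)
      also have "R (e z 0) w = (\<Sum>\<nu>\<in>N. scl (z powi h \<nu>) (wP \<nu> w))"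
        using wtD(2)[OF wP(7)[OF wV]] \<tau> z by (subst ws) (simp add: R_sum e_torus)
      also have "R (e ?p ?q) \<dots> = (\<Sum>\<nu>\<in>N. scl (z powi h \<nu>) (R (e ?p ?q) (wP \<nu> w)))"
        by (simp add: R_sum R_scl)
      also have "\<phi> \<dots> = (\<Sum>\<nu>\<in>N. z powi h \<nu> * x \<nu>)"
        using RU[OF wP(4)[OF U wU] on] csubspaceD(3)[OF Us] \<phi>
        by (subst linear_on_sum[OF Us \<phi>]) (simp_all add: linear_on_def x_def)
      finally have FF: "F (of_real (p\<^sup>2) * z - of_real (q\<^sup>2) / z) (of_real (p * q) * (z + 1 / z)) = (\<Sum>\<nu>\<in>N. z powi h \<nu> * x \<nu>)" .
      have "z ^ k * (z powi h \<nu> * x \<nu>) = x \<nu> * z ^ nat (int k + h \<nu>)" if "\<nu> \<in> N" for \<nu>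
      proof -
        have "z ^ k * z powi h \<nu> = z powi (int k + h \<nu>)" using z0 by (simp add: power_int_add)
        also have "\<dots> = z ^ nat (int k + h \<nu>)" using N(2)[OF that] by (simp add: power_int_def)
        finally show ?thesis by (simp add: mult_ac)
      qed
      then have "z ^ k * F (of_real (p\<^sup>2) * z - of_real (q\<^sup>2) / z) (of_real (p * q) * (z + 1 / z)) =
          (\<Sum>\<nu>\<in>N. x \<nu> * z ^ nat (int k + h \<nu>))"
        unfolding FF sum_distrib_left by (rule sum.cong[OF refl])
      also have "\<dots> = (\<Sum>i\<le>2 * k. \<Sum>\<nu>\<in>{\<nu>\<in>N. nat (int k + h \<nu>) = i}. x \<nu> * z ^ nat (int k + h \<nu>))"
        using N by (intro sum.group[symmetric]) force+
      also have "\<dots> = (\<Sum>i\<le>2 * k. c i * z ^ i)"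
        unfolding c_def sum_distrib_right by (intro sum.cong) auto
      finally show ?thesis .
    qed
    then show ?thesis by blast
  qed
  have "F a b = a ^ k * F 1 0" by (rule su2_function[OF F1 F2 F3 ab])
  moreover have "F 1 0 = \<phi> u" unfolding F_def using e0[of 1] by simp
  ultimately show ?thesis by (simp add: F_def k_def)
qed

lemma su2_top_nonneg:
  assumes "su2_embed e \<tau>1 \<tau>2 h c1 c2 \<kappa> \<sigma>1 \<sigma>2 rfl" "invariant_sub U" "top_in_string U \<kappa> h \<mu>" "u \<in> U" "u \<noteq> 0" "wt \<mu> u"
  shows "0 \<le> h \<mu>"
  using su2_string_bound[OF assms refl] by simp

end

section \<open>Highest weight vectors\<close>

context su3_rep
begin

text \<open>\<open>fst \<nu> + 2 * snd \<nu>\<close> and \<open>2 * fst \<nu> + snd \<nu>\<close>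
  are three times the coefficients of the second and of the first simple root in
  \<open>\<nu>\<close>. A lexicographic maximum exists in every nonzero invariant subspace, while
  dominance over all weights is a consequence of irreducibility, see
  \<open>irreducible_dominated\<close>.\<close>

definition lexmax :: "('i \<Rightarrow> complex) set \<Rightarrow> int \<times> int \<Rightarrow> bool" where
  "lexmax U m \<longleftrightarrow> (\<forall>\<nu> y. y \<in> U \<longrightarrow> y \<noteq> 0 \<longrightarrow> wt \<nu> y \<longrightarrow>
     fst \<nu> + 2 * snd \<nu> < fst m + 2 * snd m \<or>
     (fst \<nu> + 2 * snd \<nu> = fst m + 2 * snd m \<and> 2 * fst \<nu> + snd \<nu> \<le> 2 * fst m + snd m))"

lemma lexmaxD: "lexmax U m \<Longrightarrow> y \<in> U \<Longrightarrow> y \<noteq> 0 \<Longrightarrow> wt \<nu> y \<Longrightarrow>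
     fst \<nu> + 2 * snd \<nu> < fst m + 2 * snd m \<or>
     (fst \<nu> + 2 * snd \<nu> = fst m + 2 * snd m \<and> 2 * fst \<nu> + snd \<nu> \<le> 2 * fst m + snd m)"
  unfolding lexmax_def by blast

lemma linear_on_compose_R: "invariant_sub U \<Longrightarrow> linear_on U \<phi> \<Longrightarrow> g \<in> carrier SU3 \<Longrightarrow> linear_on U (\<lambda>y. \<phi> (R g y))"
  by (auto simp: linear_on_def invariant_sub_def R_add R_scl)

text \<open>The weights met are \<open>m\<close> minus multiples of the first simple root
  \<open>(2, - 1)\<close>, and the string ends at the reflection of \<open>m\<close>.\<close>

lemma k12_string_sum:
  assumes U: "invariant_sub U" and v: "v \<in> U" "v \<noteq> 0" "wt m v" and lm: "lexmax U m" and ab: "on_S3 a b"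
  shows "R (k12 a b) v = (\<Sum>j\<le>nat (fst m). wP (fst m - 2 * int j, snd m + int j) (R (k12 a b) v))"
    and "0 \<le> fst m"
proof -
  define \<kappa> where "\<kappa> = (\<lambda>\<nu>::int \<times> int. fst \<nu> + 2 * snd \<nu>)"
  note em = e12.su2_embed_axioms[folded \<kappa>_def]
  have top: "top_in_string U \<kappa> fst m"
    unfolding top_in_string_def
  proof (intro allI impI)
    fix \<nu> y assume y: "y \<in> U" "y \<noteq> 0" "wt \<nu> y" and k: "\<kappa> \<nu> = \<kappa> m"
    have "2 * fst \<nu> + snd \<nu> \<le> 2 * fst m + snd m" using lexmaxD[OF lm y] k by (auto simp: \<kappa>_def)
    then show "fst \<nu> \<le> fst m" using k by (simp add: \<kappa>_def)
  qed
  show m0: "0 \<le> fst m" by (rule su2_top_nonneg[OF em U top v])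
  define w where "w = R (k12 a b) v"
  have wU: "w \<in> U" unfolding w_def using invariantD(3)[OF U k12_SU3[OF ab] v(1)] .
  then have wV: "w \<in> V" using invariantD(2)[OF U] by blast
  define f where "f j = (fst m - 2 * int j, snd m + int j)" for j
  have inj: "inj_on f {..nat (fst m)}" by (auto simp: inj_on_def f_def)
  have im: "\<nu> \<in> f ` {..nat (fst m)}" if nz: "wP \<nu> w \<noteq> 0" for \<nu>
  proof -
    have k: "\<kappa> \<nu> = \<kappa> m" by (rule su2_string[OF em v(3) ab nz[unfolded w_def]])
    have "\<bar>fst \<nu>\<bar> \<le> fst m" by (rule su2_string_bound[OF em U top wP(4)[OF U wU] nz wP(7)[OF wV] k])
    then have "\<nu> = f (nat (snd \<nu> - snd m))" "nat (snd \<nu> - snd m) \<le> nat (fst m)"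
      using k by (auto simp: f_def \<kappa>_def prod_eq_iff)
    then show ?thesis by blast
  qed
  have "w = (\<Sum>\<nu>\<in>wM. wP \<nu> w)" using wP(6)[OF wV] by simp
  also have "\<dots> = (\<Sum>\<nu>\<in>wM \<union> f ` {..nat (fst m)}. wP \<nu> w)"
    using wP(1) wP_zero[OF wV] by (intro sum.mono_neutral_left) auto
  also have "\<dots> = (\<Sum>\<nu>\<in>f ` {..nat (fst m)}. wP \<nu> w)"
    using wP(1) im by (intro sum.mono_neutral_right) auto
  also have "\<dots> = (\<Sum>j\<le>nat (fst m). wP (f j) w)"
    by (subst sum.reindex[OF inj]) simp
  finally show "R (k12 a b) v = (\<Sum>j\<le>nat (fst m). wP (fst m - 2 * int j, snd m + int j) (R (k12 a b) v))"
    by (simp add: w_def f_def)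
qed

text \<open>By the Euler decomposition only the matrix coefficients along \<open>k12\<close> and \<open>k23\<close> matter: \<open>k12\<close> moves the
  highest weight vector along one \<open>\<alpha>1\<close>-string, and each member of that string is the top of its \<open>\<alpha>2\<close>-string.\<close>

theorem highest_weight_coeff:
  assumes U: "invariant_sub U" and v: "v \<in> U" "v \<noteq> 0" "wt m v" and lm: "lexmax U m"
    and \<phi>: "linear_on U \<phi>" and \<phi>t: "\<And>s t y. cmod s = 1 \<Longrightarrow> cmod t = 1 \<Longrightarrow> y \<in> U \<Longrightarrow> \<phi> (R (torus s t) y) = chr m s t * \<phi> y"
    and g: "g \<in> carrier SU3"
  shows "\<phi> (R g v) = (g $$ (0, 0)) ^ nat (fst m) * cnj (g $$ (2, 2)) ^ nat (snd m) * \<phi> v" (is ?thesis1)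
    and "0 \<le> fst m" "0 \<le> snd m"
proof -
  define \<kappa> where "\<kappa> = (\<lambda>\<nu>::int \<times> int. fst \<nu> + 2 * snd \<nu>)"
  define \<kappa>' where "\<kappa>' = (\<lambda>\<nu>::int \<times> int. - 2 * fst \<nu> - snd \<nu>)"
  note em = e12.su2_embed_axioms[folded \<kappa>_def] and em' = e23.su2_embed_axioms[folded \<kappa>'_def]
  note Us = invariantD(1)[OF U]
  have m1: "0 \<le> fst m" using k12_string_sum(2)[OF U v lm, of 1 0] by simp
  have top: "top_in_string U \<kappa> fst m"
    unfolding top_in_string_def
  proof (intro allI impI)
    fix \<nu> y assume y: "y \<in> U" "y \<noteq> 0" "wt \<nu> y" and k: "\<kappa> \<nu> = \<kappa> m"
    have "2 * fst \<nu> + snd \<nu> \<le> 2 * fst m + snd m" using lexmaxD[OF lm y] k by (auto simp: \<kappa>_def)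
    then show "fst \<nu> \<le> fst m" using k by (simp add: \<kappa>_def)
  qed
  define f where "f j = (fst m - 2 * int j, snd m + int j)" for j
  have top': "top_in_string U \<kappa>' snd (f j)" for j
    unfolding top_in_string_def
  proof (intro allI impI)
    fix \<nu> y assume y: "y \<in> U" "y \<noteq> 0" "wt \<nu> y" and k: "\<kappa>' \<nu> = \<kappa>' (f j)"
    have "fst \<nu> + 2 * snd \<nu> \<le> fst m + 2 * snd m" using lexmaxD[OF lm y] by auto
    then show "snd \<nu> \<le> snd (f j)" using k by (simp add: \<kappa>'_def f_def)
  qed
  have "top_in_string U \<kappa>' snd m" using top'[of 0] by (simp add: f_def)
  then show m2: "0 \<le> snd m" using su2_top_nonneg[OF em' U _ v] by blast
  show "0 \<le> fst m" by (rule m1)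
  define n1 n2 where "n1 = nat (fst m)" and "n2 = nat (snd m)"
  have n: "int n1 = fst m" "int n2 = snd m" using m1 m2 by (auto simp: n1_def n2_def)
  obtain a b s t c d a' b' where ab: "on_S3 a b" "on_S3 c d" "on_S3 a' b'" and st: "cmod s = 1" "cmod t = 1"
    and geq: "g = k12 a b * torus s t * k23 c d * k12 a' b'"
    using SU3_euler[OF g] by blast
  note K = k12_SU3[OF ab(1)] k23_SU3[OF ab(2)] k12_SU3[OF ab(3)] torus_SU3[OF st]
  define w where "w = R (k12 a' b') v"
  have wU: "w \<in> U" unfolding w_def using invariantD(3)[OF U K(3) v(1)] .
  then have wV: "w \<in> V" using invariantD(2)[OF U] by blast
  define y where "y j = wP (f j) w" for j
  have yU: "y j \<in> U" and yw: "wt (f j) (y j)" for j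
    using wP(4)[OF U wU] wP(7)[OF wV] by (auto simp: y_def)
  have ws: "w = (\<Sum>j\<le>n1. y j)"
    using k12_string_sum(1)[OF U v lm ab(3)] by (simp add: w_def y_def f_def n1_def)
  define \<psi> where "\<psi> = (\<lambda>y. \<phi> (R (k12 a b) y))"
  have \<psi>: "linear_on U \<psi>" unfolding \<psi>_def by (rule linear_on_compose_R[OF U \<phi> K(1)])
  have \<psi>c: "\<psi> (R (torus r r) x) = r powi \<kappa> m * \<psi> x" if "cmod r = 1" "x \<in> U" for r x
  proof -
    have "R (k12 a b) (R (torus r r) x) = R (torus r r) (R (k12 a b) x)"
      using e12.ctr_commute[OF that(1)] K(1) that(1) by (simp flip: R_mult)
    then show ?thesis
      using \<phi>t[OF that(1) that(1) invariantD(3)[OF U K(1) that(2)]] e12.ctr(3)[OF that(1)]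
      by (simp add: \<psi>_def \<kappa>_def)
  qed
  \<comment> \<open>After composition with \<open>k12 a b\<close> the functional keeps its weight
    only for the centralising circle. Since \<open>k23\<close> preserves \<open>\<kappa>'\<close>,
    the two exponents \<open>\<kappa>\<close> and \<open>\<kappa>'\<close> still single out the
    weight \<open>f j\<close>.\<close>
  have \<psi>0: "\<psi> x = 0" if x: "x \<in> U" "wt \<nu> x" and ne: "\<kappa> \<nu> \<noteq> \<kappa> m" for x \<nu>
  proof (rule ccontr)
    assume nz: "\<psi> x \<noteq> 0"
    have "\<kappa> \<nu> = \<kappa> m"
    proof (rule powi_unit_inj)
      fix r :: complex assume r: "cmod r = 1"
      have "\<psi> (R (torus r r) x) = r powi \<kappa> \<nu> * \<psi> x"
        using wtD(2)[OF x(2) r r] e12.ctr(3)[OF r] \<psi> x by (simp add: linear_on_def \<kappa>_def)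
      then show "r powi \<kappa> \<nu> = r powi \<kappa> m" using \<psi>c[OF r x(1)] nz by simp
    qed
    then show False using ne by blast
  qed
  have \<psi>t: "\<psi> (R (torus p q) (R (k23 c d) (y j))) = chr (f j) p q * \<psi> (R (k23 c d) (y j))"
    if pq: "cmod p = 1" "cmod q = 1" and cd: "on_S3 c d" for p q c d j
  proof -
    define x where "x = R (k23 c d) (y j)"
    have xU: "x \<in> U" unfolding x_def using invariantD(3)[OF U k23_SU3[OF cd] yU] .
    then have xV: "x \<in> V" using invariantD(2)[OF U] by blast
    have z: "\<psi> (wP \<nu> x) = 0" if "\<nu> \<noteq> f j" for \<nu>
    proof (cases "wP \<nu> x = 0")
      case True then show ?thesis using linear_on_zero[OF Us \<psi>] by simp
    next
      case False
      have "\<kappa>' \<nu> = \<kappa>' (f j)" by (rule su2_string[OF em' yw cd False[unfolded x_def]])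
      then have "\<kappa> \<nu> \<noteq> \<kappa> m" using that by (auto simp: \<kappa>_def \<kappa>'_def f_def prod_eq_iff)
      then show ?thesis using \<psi>0[OF wP(4)[OF U xU] wP(7)[OF xV]] by blast
    qed
    have xs: "x = (\<Sum>\<nu>\<in>wM. wP \<nu> x)" using wP(6)[OF xV] by simp
    have "R (torus p q) x = (\<Sum>\<nu>\<in>wM. scl (chr \<nu> p q) (wP \<nu> x))"
      using wtD(2)[OF wP(7)[OF xV] pq] by (subst xs) (simp add: R_sum)
    then have "\<psi> (R (torus p q) x) = (\<Sum>\<nu>\<in>wM. \<psi> (scl (chr \<nu> p q) (wP \<nu> x)))"
      by (simp only:) (rule linear_on_sum[OF Us \<psi>], rule csubspaceD(3)[OF Us], rule wP(4)[OF U xU])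
    also have "\<dots> = (\<Sum>\<nu>\<in>wM. chr (f j) p q * \<psi> (wP \<nu> x))"
    proof (rule sum.cong[OF refl])
      fix \<nu>
      have "\<psi> (scl (chr \<nu> p q) (wP \<nu> x)) = chr \<nu> p q * \<psi> (wP \<nu> x)"
        using \<psi> wP(4)[OF U xU] by (simp add: linear_on_def)
      then show "\<psi> (scl (chr \<nu> p q) (wP \<nu> x)) = chr (f j) p q * \<psi> (wP \<nu> x)"
        using z[of \<nu>] by (cases "\<nu> = f j") auto
    qed
    also have "\<dots> = chr (f j) p q * \<psi> (\<Sum>\<nu>\<in>wM. wP \<nu> x)"
    proof -
      have "\<psi> (\<Sum>\<nu>\<in>wM. wP \<nu> x) = (\<Sum>\<nu>\<in>wM. \<psi> (wP \<nu> x))"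
        by (rule linear_on_sum[OF Us \<psi>], rule wP(4)[OF U xU])
      then show ?thesis by (simp add: sum_distrib_left)
    qed
    finally show ?thesis using xs by (simp add: x_def)
  qed
  \<comment> \<open>The numbers \<open>X j\<close> are not computed one by one: \<open>gen\<close>
    finds their generating polynomial from the pure \<open>k12\<close> case, where two rotations
    with a torus element between them make one rotation.\<close>
  define X where "X j = \<psi> (y j)" for j
  have step: "\<psi> (R (torus s t) (R (k23 c d) (y j))) = chr (f j) s t * (c ^ (n2 + j) * X j)" for j
  proof (cases "y j = 0")
    case True then show ?thesis using linear_on_zero[OF Us \<psi>] by (simp add: X_def)
  next
    case False
    have "\<psi> (R (k23 c d) (y j)) = c ^ nat (snd (f j)) * X j"
      unfolding X_def
      by (rule su2_matrix_coeff[OF em' U top' yU False yw \<psi> _ ab(2)])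
        (use \<psi>t e23.\<tau>(3) in simp)
    moreover have "nat (snd (f j)) = n2 + j" using m2 by (simp add: f_def nat_add_distrib n2_def)
    ultimately show ?thesis using \<psi>t[OF st ab(2)] by simp
  qed
  have lhs: "\<phi> (R g v) = (\<Sum>j\<le>n1. chr (f j) s t * (c ^ (n2 + j) * X j))"
  proof -
    have "\<phi> (R g v) = \<psi> (R (torus s t) (R (k23 c d) w))"
      unfolding geq \<psi>_def w_def using K by (simp add: R_mult)
    also have "R (torus s t) (R (k23 c d) w) = (\<Sum>j\<le>n1. R (torus s t) (R (k23 c d) (y j)))"
      by (subst ws) (simp add: R_sum)
    also have "\<psi> \<dots> = (\<Sum>j\<le>n1. \<psi> (R (torus s t) (R (k23 c d) (y j))))"
      by (rule linear_on_sum[OF Us \<psi>]) (rule invariantD(3)[OF U K(4)], rule invariantD(3)[OF U K(2)], rule yU)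
    finally show ?thesis by (simp add: step)
  qed
  have on10: "cmod z = 1 \<Longrightarrow> on_S3 z 0" for z by (simp add: cmod_1_iff)
  have gen: "(\<Sum>j\<le>n1. X j * u ^ j) = (a * a' - b * cnj b' * u) ^ n1 * \<phi> v" if u: "cmod u = 1" for u
  proof -
    obtain z where z: "cmod z = 1" "z * z = cnj u" using unit_square_root[of "cnj u"] u by auto
    have z0: "z * cnj z = 1" using z by (simp add: cmod_1_iff)
    have uz: "u = cnj z * cnj z" using arg_cong[OF z(2), of cnj] by simp
    have "k12 a b * (k12 z 0 * k12 a' b') = k12 (a * (z * a') - b * (cnj z * cnj b')) (a * (z * b') + b * (cnj z * cnj a'))"
      by (simp add: k12_mult algebra_simps)
    moreover have "on_S3 (a * (z * a') - b * (cnj z * cnj b')) (a * (z * b') + b * (cnj z * cnj a'))"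
      using on_S3_mult[OF ab(1) on_S3_mult[OF on10[OF z(1)] ab(3)]] by simp
    ultimately have "\<phi> (R (k12 a b * (k12 z 0 * k12 a' b')) v) = (a * (z * a') - b * (cnj z * cnj b')) ^ n1 * \<phi> v"
      unfolding n1_def
      by (simp only:) (rule su2_matrix_coeff[OF em U top v \<phi>], use \<phi>t e12.\<tau>(2,3) invariantD(3)[OF U k12_SU3 v(1)] in auto)
    moreover have "\<phi> (R (k12 a b * (k12 z 0 * k12 a' b')) v) = \<psi> (R (torus z (cnj z)) w)"
      using K on10[OF z(1)] z(1) by (simp add: R_mult \<psi>_def w_def e12.e_torus[OF z(1)])
    moreover have "\<psi> (R (torus z (cnj z)) w) = (\<Sum>j\<le>n1. z powi (fst m - 2 * int j) * X j)"
    proof -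
      have "R (torus z (cnj z)) w = (\<Sum>j\<le>n1. scl (z powi (fst m - 2 * int j)) (y j))"
        using wtD(2)[OF yw, of z "cnj z"] z(1) e12.\<tau>(3)[OF z(1)] by (subst ws) (simp add: R_sum f_def)
      then have "\<psi> (R (torus z (cnj z)) w) = (\<Sum>j\<le>n1. \<psi> (scl (z powi (fst m - 2 * int j)) (y j)))"
        by (simp only:) (rule linear_on_sum[OF Us \<psi>], rule csubspaceD(3)[OF Us], rule yU)
      then show ?thesis using \<psi> yU by (simp add: linear_on_def X_def)
    qed
    ultimately have e: "(\<Sum>j\<le>n1. z powi (fst m - 2 * int j) * X j) = (a * (z * a') - b * (cnj z * cnj b')) ^ n1 * \<phi> v"
      by simp
    have "(\<Sum>j\<le>n1. X j * u ^ j) = cnj z ^ n1 * (\<Sum>j\<le>n1. z powi (fst m - 2 * int j) * X j)"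
      unfolding sum_distrib_left
    proof (rule sum.cong[OF refl])
      fix j
      have "cnj z ^ n1 * z powi (fst m - 2 * int j) = cnj z powi fst m * (z powi fst m * z powi (- (int j + int j)))"
        using powi_unit_simps(1)[OF z(1), of "fst m" "- (int j + int j)"] by (simp flip: n)
      also have "\<dots> = (z * cnj z) powi fst m * (cnj z powi (int j + int j))"
        using powi_unit_simps(2)[OF z(1)] by (simp add: powi_unit_simps(3))
      also have "cnj z powi (int j + int j) = u ^ j"
        using powi_unit_simps(1)[of "cnj z" "int j" "int j"] z(1) unfolding power_int_of_nat uz power_mult_distrib by simp
      also have "(z * cnj z) powi fst m * u ^ j = u ^ j" by (simp add: z0)
      finally show "X j * u ^ j = cnj z ^ n1 * (z powi (fst m - 2 * int j) * X j)" by (simp add: mult_ac)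
    qed
    also have "\<dots> = (cnj z * (a * (z * a') - b * (cnj z * cnj b'))) ^ n1 * \<phi> v"
      by (simp add: e power_mult_distrib)
    also have "cnj z * (a * (z * a') - b * (cnj z * cnj b')) = (z * cnj z) * (a * a') - b * cnj b' * u"
      by (simp add: uz algebra_simps)
    finally show ?thesis by (simp add: z0)
  qed
  \<comment> \<open>Both sides are polynomials in \<open>u\<close>, so the identity extends beyond
    the unit circle; it will be applied to \<open>t * c / s\<close>, whose modulus is that of
    \<open>c\<close>.\<close>
  have gen': "(\<Sum>j\<le>n1. X j * u ^ j) = (a * a' - b * cnj b' * u) ^ n1 * \<phi> v" for u
  proof -
    have "(\<Sum>j\<le>n1. monom (X j) j) = smult (\<phi> v) ([:a * a', - (b * cnj b'):] ^ n1)"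
      by (rule poly_eq_on_unit_circle) (simp add: poly_sum poly_monom gen mult_ac)
    from arg_cong[OF this, of "\<lambda>p. poly p u"] show ?thesis by (simp add: poly_sum poly_monom mult_ac)
  qed
  have nz: "s \<noteq> 0" "t \<noteq> 0" using st by auto
  have "\<phi> (R g v) = (s * t * c) ^ n2 * s ^ n1 * (\<Sum>j\<le>n1. X j * (t * c / s) ^ j)"
    unfolding lhs sum_distrib_left
  proof (rule sum.cong[OF refl])
    fix j
    have "chr (f j) s t = s powi (int n1 - int j) * t powi (int n2 + int j) * s powi int n2"
    proof -
      have "(fst m - 2 * int j) + (snd m + int j) = (fst m - int j) + snd m" by simp
      then have "s powi (fst m - 2 * int j) * s powi (snd m + int j) = s powi (fst m - int j) * s powi snd m"
        by (simp only: powi_unit_simps(1)[OF st(1), symmetric])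
      then show ?thesis
        unfolding chr_def f_def n powi_unit_simps(3) fst_conv snd_conv by Groebner_Basis.algebra
    qed
    also have "\<dots> = s ^ n1 / s ^ j * (t ^ n2 * t ^ j) * s ^ n2"
      using nz by (simp add: power_int_diff power_int_add)
    finally show "chr (f j) s t * (c ^ (n2 + j) * X j) = (s * t * c) ^ n2 * s ^ n1 * (X j * (t * c / s) ^ j)"
      using nz by (simp add: power_add power_mult_distrib power_divide)
  qed
  also have "\<dots> = (s * t * c) ^ n2 * (s * (a * a' - b * cnj b' * (t * c / s))) ^ n1 * \<phi> v"
    by (simp add: gen' power_mult_distrib)
  also have "s * (a * a' - b * cnj b' * (t * c / s)) = g $$ (0, 0)"
    unfolding geq k12_def k23_def torus_M3 M3_mult using nz by (simp add: field_simps)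
  also have "s * t * c = cnj (g $$ (2, 2))"
    unfolding geq k12_def k23_def torus_M3 M3_mult using st
    by (simp add: cmod_1_inverse norm_mult)
  finally show ?thesis1 by (simp add: n1_def n2_def mult_ac)
qed

end

section \<open>Invariant polynomials on the cone\<close>

type_synonym fun6 = "complex \<Rightarrow> complex \<Rightarrow> complex \<Rightarrow> complex \<Rightarrow> complex \<Rightarrow> complex \<Rightarrow> complex"

definition on_cone :: "complex \<Rightarrow> complex \<Rightarrow> complex \<Rightarrow> complex \<Rightarrow> complex \<Rightarrow> complex \<Rightarrow> bool" where
  "on_cone x1 x2 x3 z1 z2 z3 \<longleftrightarrow> x1 * z1 + x2 * z2 + x3 * z3 = 0"

text \<open>\<open>sgn_mean\<close>, \<open>cyc_mean\<close> and \<open>F_mean\<close> average over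
  the diagonal sign matrices of determinant 1, over the powers of \<open>matE\<close>, and over the
  identity and the involution \<open>matF\<close>. An invariant equals its means on the cone, so it
  is enough to compute the means of single products of powers.\<close>

definition sgn_mean :: "fun6 \<Rightarrow> fun6" where
  "sgn_mean P x1 x2 x3 z1 z2 z3 = (P x1 x2 x3 z1 z2 z3 + P x1 (- x2) (- x3) z1 (- z2) (- z3)
     + P (- x1) x2 (- x3) (- z1) z2 (- z3) + P (- x1) (- x2) x3 (- z1) (- z2) z3) / 4"

definition cyc_mean :: "fun6 \<Rightarrow> fun6" where
  "cyc_mean P x1 x2 x3 z1 z2 z3 = (P x1 x2 x3 z1 z2 z3 + P x3 x1 x2 z3 z1 z2 + P x2 x3 x1 z2 z3 z1) / 3"

definition F_mean :: "complex \<Rightarrow> fun6 \<Rightarrow> fun6" where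
  "F_mean w P x1 x2 x3 z1 z2 z3 = (P x1 x2 x3 z1 z2 z3
     + P (- x1) (- (w\<^sup>2 * x3)) (- (w * x2)) (- z1) (- (w * z3)) (- (w\<^sup>2 * z2))) / 2"

definition mono_mean :: "complex \<Rightarrow> fun6 \<Rightarrow> fun6" where
  "mono_mean w P = F_mean w (cyc_mean (sgn_mean P))"

definition cone_inv_W :: "fun6 \<Rightarrow> bool" where
  "cone_inv_W P \<longleftrightarrow> (\<forall>x1 x2 x3 z1 z2 z3. on_cone x1 x2 x3 z1 z2 z3 \<longrightarrow>
      P ((- x1 + \<nu>\<^sub>2 * x2 + \<nu>\<^sub>1 * x3) / 2) ((\<nu>\<^sub>2 * x1 + \<nu>\<^sub>1 * x2 - x3) / 2) ((\<nu>\<^sub>1 * x1 - x2 + \<nu>\<^sub>2 * x3) / 2)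
        ((- z1 + \<nu>\<^sub>2 * z2 + \<nu>\<^sub>1 * z3) / 2) ((\<nu>\<^sub>2 * z1 + \<nu>\<^sub>1 * z2 - z3) / 2) ((\<nu>\<^sub>1 * z1 - z2 + \<nu>\<^sub>2 * z3) / 2)
      = P x1 x2 x3 z1 z2 z3)"

text \<open>The root of unity is a parameter because exchanging \<open>x\<close> and
  \<open>z\<close> replaces it by its square, see \<open>cone_inv_360I\<close>.\<close>

definition cone_inv_360 :: "complex \<Rightarrow> fun6 \<Rightarrow> bool" where
  "cone_inv_360 w P \<longleftrightarrow> cone_inv_W P \<and> (\<forall>x1 x2 x3 z1 z2 z3. on_cone x1 x2 x3 z1 z2 z3 \<longrightarrow>
      P x1 (- x2) (- x3) z1 (- z2) (- z3) = P x1 x2 x3 z1 z2 z3 \<and>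
      P x3 x1 x2 z3 z1 z2 = P x1 x2 x3 z1 z2 z3 \<and>
      P (- x1) (- (w\<^sup>2 * x3)) (- (w * x2)) (- z1) (- (w * z3)) (- (w\<^sup>2 * z2)) = P x1 x2 x3 z1 z2 z3)"

text \<open>The contribution of one orbit vector \<open>R h v\<close>, with the first column of
  \<open>h\<close> as \<open>p\<close> and its conjugate last column as \<open>q\<close>, see
  \<open>cyc_coeff_bihom\<close>. Sums of such products stand in for bihomogeneous
  polynomials.\<close>

definition pow_pair :: "nat \<Rightarrow> nat \<Rightarrow> complex \<Rightarrow> complex \<Rightarrow> complex \<Rightarrow> complex \<Rightarrow> complex \<Rightarrow> complex \<Rightarrow> fun6" where
  "pow_pair a b p1 p2 p3 q1 q2 q3 x1 x2 x3 z1 z2 z3 = (x1 * p1 + x2 * p2 + x3 * p3) ^ a * (z1 * q1 + z2 * q2 + z3 * q3) ^ b"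

definition bihom :: "nat \<Rightarrow> nat \<Rightarrow> fun6 \<Rightarrow> bool" where
  "bihom a b P \<longleftrightarrow> (\<exists>(N::nat set) c p1 p2 p3 q1 q2 q3. finite N \<and> P = (\<lambda>x1 x2 x3 z1 z2 z3.
     \<Sum>i\<in>N. c i * pow_pair a b (p1 i) (p2 i) (p3 i) (q1 i) (q2 i) (q3 i) x1 x2 x3 z1 z2 z3))"

lemma \<nu>_simps: "\<nu>\<^sub>2 = - 1 - \<nu>\<^sub>1" "\<nu>\<^sub>1 * \<nu>\<^sub>1 = 1 - \<nu>\<^sub>1"
proof -
  show "\<nu>\<^sub>2 = - 1 - \<nu>\<^sub>1" by (simp add: \<nu>\<^sub>1_def \<nu>\<^sub>2_def field_simps)
  have "complex_of_real (sqrt 5) * complex_of_real (sqrt 5) = 5"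
    by (simp flip: of_real_mult)
  then show "\<nu>\<^sub>1 * \<nu>\<^sub>1 = 1 - \<nu>\<^sub>1" by (simp add: \<nu>\<^sub>1_def field_simps)
qed

lemma cone_sgn: "cone_inv_360 w P \<Longrightarrow> on_cone x1 x2 x3 z1 z2 z3 \<Longrightarrow> sgn_mean P x1 x2 x3 z1 z2 z3 = P x1 x2 x3 z1 z2 z3"
proof -
  assume P: "cone_inv_360 w P" and c: "on_cone x1 x2 x3 z1 z2 z3"
  have A: "\<And>x1 x2 x3 z1 z2 z3. on_cone x1 x2 x3 z1 z2 z3 \<Longrightarrow> P x1 (- x2) (- x3) z1 (- z2) (- z3) = P x1 x2 x3 z1 z2 z3"
    and E: "\<And>x1 x2 x3 z1 z2 z3. on_cone x1 x2 x3 z1 z2 z3 \<Longrightarrow> P x3 x1 x2 z3 z1 z2 = P x1 x2 x3 z1 z2 z3"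
    using P by (auto simp: cone_inv_360_def)
  have c': "on_cone x3 x1 x2 z3 z1 z2" "on_cone x2 x3 x1 z2 z3 z1" "on_cone (- x1) (- x2) x3 (- z1) (- z2) z3"
     "on_cone (- x1) x2 (- x3) (- z1) z2 (- z3)" "on_cone x2 (- x3) (- x1) z2 (- z3) (- z1)" "on_cone (- x3) (- x1) x2 (- z3) (- z1) z2"
    using c by (simp_all add: on_cone_def algebra_simps)
  have "P (- x1) (- x2) x3 (- z1) (- z2) z3 = P x1 x2 x3 z1 z2 z3"
    using E[OF c'(3)] A[OF c'(1)] E[OF c] by simp
  moreover have "P (- x1) x2 (- x3) (- z1) z2 (- z3) = P x1 x2 x3 z1 z2 z3"
    using E[OF c'(4)] E[OF c'(6)] A[OF c'(2)] E[OF c'(1)] E[OF c] by simp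
  ultimately show ?thesis using A[OF c] by (simp add: sgn_mean_def)
qed

lemma cone_mono_mean:
  assumes P: "cone_inv_360 w P" and w: "w * w = - 1 - w" and c: "on_cone x1 x2 x3 z1 z2 z3"
  shows "mono_mean w P x1 x2 x3 z1 z2 z3 = P x1 x2 x3 z1 z2 z3"
proof -
  have w3: "w * w * w = 1" using w by Groebner_Basis.algebra
  have cyc: "cyc_mean (sgn_mean P) x1 x2 x3 z1 z2 z3 = P x1 x2 x3 z1 z2 z3" if c: "on_cone x1 x2 x3 z1 z2 z3" for x1 x2 x3 z1 z2 z3
  proof -
    have c': "on_cone x3 x1 x2 z3 z1 z2" "on_cone x2 x3 x1 z2 z3 z1"
      using c by (simp_all add: on_cone_def algebra_simps)
    have "P x3 x1 x2 z3 z1 z2 = P x1 x2 x3 z1 z2 z3" "P x2 x3 x1 z2 z3 z1 = P x3 x1 x2 z3 z1 z2"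
      using P c c' unfolding cone_inv_360_def by blast+
    then show ?thesis using cone_sgn[OF P] c c' by (simp add: cyc_mean_def)
  qed
  have "on_cone (- x1) (- (w\<^sup>2 * x3)) (- (w * x2)) (- z1) (- (w * z3)) (- (w\<^sup>2 * z2))"
    using c w3 unfolding on_cone_def power2_eq_square by Groebner_Basis.algebra
  then show ?thesis
    using P c cyc by (simp add: mono_mean_def F_mean_def cone_inv_360_def)
qed

lemma mono_mean_sum:
  "mono_mean w (\<lambda>x1 x2 x3 z1 z2 z3. \<Sum>i\<in>N. c i * T i x1 x2 x3 z1 z2 z3) x1 x2 x3 z1 z2 z3
   = (\<Sum>i\<in>N. c i * mono_mean w (T i) x1 x2 x3 z1 z2 z3)"
proof -
  have "sgn_mean (\<lambda>x1 x2 x3 z1 z2 z3. \<Sum>i\<in>N. c i * T i x1 x2 x3 z1 z2 z3) = (\<lambda>x1 x2 x3 z1 z2 z3. \<Sum>i\<in>N. c i * sgn_mean (T i) x1 x2 x3 z1 z2 z3)" for T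
    by (intro ext) (simp only: sgn_mean_def sum_divide_distrib sum.distrib[symmetric] times_divide_eq_right distrib_left[symmetric])
  moreover have "cyc_mean (\<lambda>x1 x2 x3 z1 z2 z3. \<Sum>i\<in>N. c i * T i x1 x2 x3 z1 z2 z3) = (\<lambda>x1 x2 x3 z1 z2 z3. \<Sum>i\<in>N. c i * cyc_mean (T i) x1 x2 x3 z1 z2 z3)" for T
    by (intro ext) (simp only: cyc_mean_def sum_divide_distrib sum.distrib[symmetric] times_divide_eq_right distrib_left[symmetric])
  moreover have "F_mean w (\<lambda>x1 x2 x3 z1 z2 z3. \<Sum>i\<in>N. c i * T i x1 x2 x3 z1 z2 z3) = (\<lambda>x1 x2 x3 z1 z2 z3. \<Sum>i\<in>N. c i * F_mean w (T i) x1 x2 x3 z1 z2 z3)" for T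
    by (intro ext) (simp only: F_mean_def sum_divide_distrib sum.distrib[symmetric] times_divide_eq_right distrib_left[symmetric])
  ultimately show ?thesis by (simp add: mono_mean_def)
qed

text \<open>The mean is linear, so if the means of all single products lie in the span of three
  forms, then so does every invariant. Bidegrees with fewer forms are filled up with zero.\<close>

lemma cone_reduce:
  assumes P: "cone_inv_360 w P" and w: "w * w = - 1 - w" and bi: "bihom a b P"
    and tm: "\<And>p1 p2 p3 q1 q2 q3. \<exists>K1 K2 K3. \<forall>x1 x2 x3 z1 z2 z3. on_cone x1 x2 x3 z1 z2 z3 \<longrightarrow>
      mono_mean w (pow_pair a b p1 p2 p3 q1 q2 q3) x1 x2 x3 z1 z2 z3 =
      K1 * f1 x1 x2 x3 z1 z2 z3 + K2 * f2 x1 x2 x3 z1 z2 z3 + K3 * (f3 x1 x2 x3 z1 z2 z3 :: complex)"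
  shows "\<exists>K1 K2 K3. \<forall>x1 x2 x3 z1 z2 z3. on_cone x1 x2 x3 z1 z2 z3 \<longrightarrow>
      P x1 x2 x3 z1 z2 z3 = K1 * f1 x1 x2 x3 z1 z2 z3 + K2 * f2 x1 x2 x3 z1 z2 z3 + K3 * f3 x1 x2 x3 z1 z2 z3"
proof -
  obtain N :: "nat set" and c p1 p2 p3 q1 q2 q3 where "finite N" and PN: "P = (\<lambda>x1 x2 x3 z1 z2 z3.
     \<Sum>i\<in>N. c i * pow_pair a b (p1 i) (p2 i) (p3 i) (q1 i) (q2 i) (q3 i) x1 x2 x3 z1 z2 z3)"
    using bi unfolding bihom_def by blast
  have "\<forall>i. \<exists>K1 K2 K3. \<forall>x1 x2 x3 z1 z2 z3. on_cone x1 x2 x3 z1 z2 z3 \<longrightarrow>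
      mono_mean w (pow_pair a b (p1 i) (p2 i) (p3 i) (q1 i) (q2 i) (q3 i)) x1 x2 x3 z1 z2 z3 =
      K1 * f1 x1 x2 x3 z1 z2 z3 + K2 * f2 x1 x2 x3 z1 z2 z3 + K3 * f3 x1 x2 x3 z1 z2 z3"
    using tm by blast
  then obtain K1 K2 K3 where K: "\<And>i x1 x2 x3 z1 z2 z3. on_cone x1 x2 x3 z1 z2 z3 \<Longrightarrow>
      mono_mean w (pow_pair a b (p1 i) (p2 i) (p3 i) (q1 i) (q2 i) (q3 i)) x1 x2 x3 z1 z2 z3 =
      K1 i * f1 x1 x2 x3 z1 z2 z3 + K2 i * f2 x1 x2 x3 z1 z2 z3 + K3 i * f3 x1 x2 x3 z1 z2 z3"
    by (auto simp: choice_iff)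
  have "P x1 x2 x3 z1 z2 z3 = (\<Sum>i\<in>N. c i * K1 i) * f1 x1 x2 x3 z1 z2 z3 + (\<Sum>i\<in>N. c i * K2 i) * f2 x1 x2 x3 z1 z2 z3
      + (\<Sum>i\<in>N. c i * K3 i) * f3 x1 x2 x3 z1 z2 z3"
    if c: "on_cone x1 x2 x3 z1 z2 z3" for x1 x2 x3 z1 z2 z3
  proof -
    have "P x1 x2 x3 z1 z2 z3 = mono_mean w P x1 x2 x3 z1 z2 z3" using cone_mono_mean[OF P w c] by simp
    also have "\<dots> = (\<Sum>i\<in>N. c i * mono_mean w (pow_pair a b (p1 i) (p2 i) (p3 i) (q1 i) (q2 i) (q3 i)) x1 x2 x3 z1 z2 z3)"
      unfolding PN by (rule mono_mean_sum)
    also have "\<dots> = (\<Sum>i\<in>N. c i * K1 i * f1 x1 x2 x3 z1 z2 z3 + c i * K2 i * f2 x1 x2 x3 z1 z2 z3 + c i * K3 i * f3 x1 x2 x3 z1 z2 z3)"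
      by (simp only: K[OF c] distrib_left mult.assoc)
    finally show ?thesis by (simp add: sum.distrib sum_distrib_right)
  qed
  then show ?thesis by blast
qed

text \<open>Signs and cyclic shifts leave only multiples of the equation of the cone, and
  \<open>matF\<close> preserves the cone.\<close>

lemma mean11:
  assumes w: "w * w = - 1 - w" and c: "on_cone x1 x2 x3 z1 z2 z3"
  shows "mono_mean w (pow_pair 1 1 p1 p2 p3 q1 q2 q3) x1 x2 x3 z1 z2 z3 = 0"
proof -
  have s: "sgn_mean (pow_pair 1 1 p1 p2 p3 q1 q2 q3) = (\<lambda>x1 x2 x3 z1 z2 z3. p1 * q1 * x1 * z1 + p2 * q2 * x2 * z2 + p3 * q3 * x3 * z3)"
    by (intro ext) (simp add: sgn_mean_def pow_pair_def field_simps)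
  have t: "cyc_mean (sgn_mean (pow_pair 1 1 p1 p2 p3 q1 q2 q3)) =
     (\<lambda>x1 x2 x3 z1 z2 z3. (p1 * q1 + p2 * q2 + p3 * q3) / 3 * (x1 * z1 + x2 * z2 + x3 * z3))"
    by (intro ext) (unfold cyc_mean_def s, simp add: field_simps)
  have w3: "w * w * w = 1" using w by Groebner_Basis.algebra
  have "(- x1) * (- z1) + (- (w\<^sup>2 * x3)) * (- (w * z3)) + (- (w * x2)) * (- (w\<^sup>2 * z2)) = 0"
    using c w3 unfolding on_cone_def power2_eq_square by Groebner_Basis.algebra
  then show ?thesis
    using c unfolding mono_mean_def F_mean_def t on_cone_def by simp
qed

text \<open>Signs leave only the monomial \<open>x1 * x2 * x3\<close>, and \<open>matF\<close>
  reverses its sign.\<close>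

lemma mean30:
  assumes w: "w * w = - 1 - w"
  shows "mono_mean w (pow_pair 3 0 p1 p2 p3 q1 q2 q3) x1 x2 x3 z1 z2 z3 = 0"
proof -
  have s: "sgn_mean (pow_pair 3 0 p1 p2 p3 q1 q2 q3) = (\<lambda>x1 x2 x3 z1 z2 z3. 6 * p1 * p2 * p3 * (x1 * x2 * x3))"
    by (intro ext) (simp add: sgn_mean_def pow_pair_def power3_eq_cube field_simps)
  have t: "cyc_mean (sgn_mean (pow_pair 3 0 p1 p2 p3 q1 q2 q3)) = (\<lambda>x1 x2 x3 z1 z2 z3. 6 * p1 * p2 * p3 * (x1 * x2 * x3))"
    by (intro ext) (simp add: cyc_mean_def s field_simps)
  have w3: "w * w * w = 1" using w by Groebner_Basis.algebra
  have "(- x1) * (- (w\<^sup>2 * x3)) * (- (w * x2)) = - (x1 * x2 * x3)"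
    using w3 unfolding power2_eq_square by Groebner_Basis.algebra
  then show ?thesis unfolding mono_mean_def F_mean_def t by Groebner_Basis.algebra
qed

lemma mean22:
  assumes w: "w * w = - 1 - w"
  shows "\<exists>K1 K2 K3. \<forall>x1 x2 x3 z1 z2 z3. on_cone x1 x2 x3 z1 z2 z3 \<longrightarrow>
      mono_mean w (pow_pair 2 2 p1 p2 p3 q1 q2 q3) x1 x2 x3 z1 z2 z3 =
      K1 * (x1\<^sup>2 * z1\<^sup>2 + x2\<^sup>2 * z2\<^sup>2 + x3\<^sup>2 * z3\<^sup>2)
      + K2 * (x1\<^sup>2 * (z2\<^sup>2 + w\<^sup>2 * z3\<^sup>2) + x2\<^sup>2 * (z3\<^sup>2 + w\<^sup>2 * z1\<^sup>2) + x3\<^sup>2 * (z1\<^sup>2 + w\<^sup>2 * z2\<^sup>2)) + K3 * 0"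
proof -
  define a0 where "a0 = (p1\<^sup>2 * q1\<^sup>2 + p2\<^sup>2 * q2\<^sup>2 + p3\<^sup>2 * q3\<^sup>2) / 3"
  define a1 where "a1 = (p1\<^sup>2 * q2\<^sup>2 + p2\<^sup>2 * q3\<^sup>2 + p3\<^sup>2 * q1\<^sup>2) / 3"
  define a2 where "a2 = (p1\<^sup>2 * q3\<^sup>2 + p2\<^sup>2 * q1\<^sup>2 + p3\<^sup>2 * q2\<^sup>2) / 3"
  define k where "k = 4 * (p1 * p2 * q1 * q2 + p2 * p3 * q2 * q3 + p3 * p1 * q3 * q1) / 3"
  have s: "sgn_mean (pow_pair 2 2 p1 p2 p3 q1 q2 q3) = (\<lambda>x1 x2 x3 z1 z2 z3.
      (p1\<^sup>2 * x1\<^sup>2 + p2\<^sup>2 * x2\<^sup>2 + p3\<^sup>2 * x3\<^sup>2) * (q1\<^sup>2 * z1\<^sup>2 + q2\<^sup>2 * z2\<^sup>2 + q3\<^sup>2 * z3\<^sup>2)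
      + 4 * (p1 * p2 * q1 * q2 * (x1 * x2 * z1 * z2) + p2 * p3 * q2 * q3 * (x2 * x3 * z2 * z3) + p3 * p1 * q3 * q1 * (x3 * x1 * z3 * z1)))"
    by (intro ext) (simp add: sgn_mean_def pow_pair_def power2_eq_square field_simps)
  have t: "cyc_mean (sgn_mean (pow_pair 2 2 p1 p2 p3 q1 q2 q3)) = (\<lambda>x1 x2 x3 z1 z2 z3.
      a0 * (x1\<^sup>2 * z1\<^sup>2 + x2\<^sup>2 * z2\<^sup>2 + x3\<^sup>2 * z3\<^sup>2) + a1 * (x1\<^sup>2 * z2\<^sup>2 + x2\<^sup>2 * z3\<^sup>2 + x3\<^sup>2 * z1\<^sup>2)
      + a2 * (x1\<^sup>2 * z3\<^sup>2 + x2\<^sup>2 * z1\<^sup>2 + x3\<^sup>2 * z2\<^sup>2) + k * (x1 * x2 * z1 * z2 + x2 * x3 * z2 * z3 + x3 * x1 * z3 * z1))"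
    by (intro ext) (simp add: cyc_mean_def s a0_def a1_def a2_def k_def power2_eq_square field_simps)
  have w3: "w * w * w = 1" using w by Groebner_Basis.algebra
  \<comment> \<open>The square of \<open>x1 * z1 + x2 * z2 + x3 * z3\<close> vanishes on the cone,
    so the mixed sum with coefficient \<open>k\<close> is minus half the sum of the squares.
    \<open>matF\<close> interchanges the sums with coefficients \<open>a1\<close> and
    \<open>a2\<close> up to powers of \<open>w\<close>.\<close>
  have "mono_mean w (pow_pair 2 2 p1 p2 p3 q1 q2 q3) x1 x2 x3 z1 z2 z3 =
      (a0 - k / 2) * (x1\<^sup>2 * z1\<^sup>2 + x2\<^sup>2 * z2\<^sup>2 + x3\<^sup>2 * z3\<^sup>2)
      + (a1 + w * a2) / 2 * (x1\<^sup>2 * (z2\<^sup>2 + w\<^sup>2 * z3\<^sup>2) + x2\<^sup>2 * (z3\<^sup>2 + w\<^sup>2 * z1\<^sup>2) + x3\<^sup>2 * (z1\<^sup>2 + w\<^sup>2 * z2\<^sup>2)) + 0 * 0"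
    if c: "on_cone x1 x2 x3 z1 z2 z3" for x1 x2 x3 z1 z2 z3
    using c w3 unfolding mono_mean_def F_mean_def t on_cone_def power2_eq_square
    by Groebner_Basis.algebra
  then show ?thesis by blast
qed

lemma mean41:
  assumes w: "w * w = - 1 - w"
  shows "\<exists>K1 K2 K3. \<forall>x1 x2 x3 z1 z2 z3. on_cone x1 x2 x3 z1 z2 z3 \<longrightarrow>
      mono_mean w (pow_pair 4 1 p1 p2 p3 q1 q2 q3) x1 x2 x3 z1 z2 z3 =
      K1 * (z1 * x2 * x3 * (x2\<^sup>2 - w * x3\<^sup>2) + z2 * x3 * x1 * (x3\<^sup>2 - w * x1\<^sup>2) + z3 * x1 * x2 * (x1\<^sup>2 - w * x2\<^sup>2))
      + K2 * 0 + K3 * 0"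
proof -
  define a0 where "a0 = 12 * (q1 * p2 * p3 * p1\<^sup>2 + q2 * p3 * p1 * p2\<^sup>2 + q3 * p1 * p2 * p3\<^sup>2) / 3"
  define a1 where "a1 = 4 * (q1 * p2 * p3 * p2\<^sup>2 + q2 * p3 * p1 * p3\<^sup>2 + q3 * p1 * p2 * p1\<^sup>2) / 3"
  define a2 where "a2 = 4 * (q1 * p2 * p3 * p3\<^sup>2 + q2 * p3 * p1 * p1\<^sup>2 + q3 * p1 * p2 * p2\<^sup>2) / 3"
  have p4: "y ^ 4 = y * y * (y * y)" for y :: complex by (simp add: eval_nat_numeral)
  have s: "sgn_mean (pow_pair 4 1 p1 p2 p3 q1 q2 q3) = (\<lambda>x1 x2 x3 z1 z2 z3.
      4 * (q1 * z1 * (p2 * p3 * x2 * x3) * (3 * p1\<^sup>2 * x1\<^sup>2 + p2\<^sup>2 * x2\<^sup>2 + p3\<^sup>2 * x3\<^sup>2)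
       + q2 * z2 * (p3 * p1 * x3 * x1) * (p1\<^sup>2 * x1\<^sup>2 + 3 * p2\<^sup>2 * x2\<^sup>2 + p3\<^sup>2 * x3\<^sup>2)
       + q3 * z3 * (p1 * p2 * x1 * x2) * (p1\<^sup>2 * x1\<^sup>2 + p2\<^sup>2 * x2\<^sup>2 + 3 * p3\<^sup>2 * x3\<^sup>2)))"
    by (intro ext) (simp add: sgn_mean_def pow_pair_def power2_eq_square p4 field_simps)
  have t: "cyc_mean (sgn_mean (pow_pair 4 1 p1 p2 p3 q1 q2 q3)) = (\<lambda>x1 x2 x3 z1 z2 z3.
      a0 * (x1 * x2 * x3 * (x1 * z1 + x2 * z2 + x3 * z3))
      + a1 * (z1 * x2 * x3 * x2\<^sup>2 + z2 * x3 * x1 * x3\<^sup>2 + z3 * x1 * x2 * x1\<^sup>2)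
      + a2 * (z1 * x2 * x3 * x3\<^sup>2 + z2 * x3 * x1 * x1\<^sup>2 + z3 * x1 * x2 * x2\<^sup>2))"
    by (intro ext) (unfold cyc_mean_def s a0_def a1_def a2_def power2_eq_square, simp add: field_simps)
  have w3: "w * w * w = 1" using w by Groebner_Basis.algebra
  \<comment> \<open>The sum with coefficient \<open>a0\<close> contains the equation of the cone as
    a factor; \<open>matF\<close> interchanges the other two up to scalars.\<close>
  have "mono_mean w (pow_pair 4 1 p1 p2 p3 q1 q2 q3) x1 x2 x3 z1 z2 z3 =
      (a1 - w\<^sup>2 * a2) / 2 * (z1 * x2 * x3 * (x2\<^sup>2 - w * x3\<^sup>2) + z2 * x3 * x1 * (x3\<^sup>2 - w * x1\<^sup>2) + z3 * x1 * x2 * (x1\<^sup>2 - w * x2\<^sup>2))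
      + 0 * 0 + 0 * 0"
    if c: "on_cone x1 x2 x3 z1 z2 z3" for x1 x2 x3 z1 z2 z3
    using c w3 unfolding mono_mean_def F_mean_def t on_cone_def power2_eq_square
    by Groebner_Basis.algebra
  then show ?thesis by blast
qed

text \<open>The cube is sorted by the four characters of the group of sign changes. In a product of
  two cubes \<open>sgn_mean\<close> keeps exactly the pairs of equal characters.\<close>

lemma cube_parity_split:
  fixes x1 x2 x3 p1 p2 p3 :: complex
  shows "(x1 * p1 + x2 * p2 + x3 * p3) ^ 3 =
    x1 * (p1 ^ 3 * x1\<^sup>2 + 3 * p1 * p2\<^sup>2 * x2\<^sup>2 + 3 * p1 * p3\<^sup>2 * x3\<^sup>2)
    + x2 * (3 * p2 * p1\<^sup>2 * x1\<^sup>2 + p2 ^ 3 * x2\<^sup>2 + 3 * p2 * p3\<^sup>2 * x3\<^sup>2)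
    + x3 * (3 * p3 * p1\<^sup>2 * x1\<^sup>2 + 3 * p3 * p2\<^sup>2 * x2\<^sup>2 + p3 ^ 3 * x3\<^sup>2)
    + 6 * p1 * p2 * p3 * (x1 * x2 * x3)"
  by (simp add: power3_eq_cube power2_eq_square algebra_simps)

text \<open>The cyclic orbit sum of \<open>x_i x_(i+d)^2 z_i z_(i+e)^2\<close> with indices modulo
  3; the lists of length five provide the wrap-around.\<close>

definition m33 :: "nat \<Rightarrow> nat \<Rightarrow> fun6" where
  "m33 d e x1 x2 x3 z1 z2 z3 = (let X = [x1, x2, x3, x1, x2]; Z = [z1, z2, z3, z1, z2] in
     x1 * (X ! d)\<^sup>2 * z1 * (Z ! e)\<^sup>2 + x2 * (X ! Suc d)\<^sup>2 * z2 * (Z ! Suc e)\<^sup>2 + x3 * (X ! (d + 2))\<^sup>2 * z3 * (Z ! (e + 2))\<^sup>2)"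

lemma m33_simps:
  "m33 0 0 x1 x2 x3 z1 z2 z3 = x1 * x1\<^sup>2 * z1 * z1\<^sup>2 + x2 * x2\<^sup>2 * z2 * z2\<^sup>2 + x3 * x3\<^sup>2 * z3 * z3\<^sup>2"
  "m33 0 1 x1 x2 x3 z1 z2 z3 = x1 * x1\<^sup>2 * z1 * z2\<^sup>2 + x2 * x2\<^sup>2 * z2 * z3\<^sup>2 + x3 * x3\<^sup>2 * z3 * z1\<^sup>2"
  "m33 0 2 x1 x2 x3 z1 z2 z3 = x1 * x1\<^sup>2 * z1 * z3\<^sup>2 + x2 * x2\<^sup>2 * z2 * z1\<^sup>2 + x3 * x3\<^sup>2 * z3 * z2\<^sup>2"
  "m33 1 0 x1 x2 x3 z1 z2 z3 = x1 * x2\<^sup>2 * z1 * z1\<^sup>2 + x2 * x3\<^sup>2 * z2 * z2\<^sup>2 + x3 * x1\<^sup>2 * z3 * z3\<^sup>2"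
  "m33 1 1 x1 x2 x3 z1 z2 z3 = x1 * x2\<^sup>2 * z1 * z2\<^sup>2 + x2 * x3\<^sup>2 * z2 * z3\<^sup>2 + x3 * x1\<^sup>2 * z3 * z1\<^sup>2"
  "m33 1 2 x1 x2 x3 z1 z2 z3 = x1 * x2\<^sup>2 * z1 * z3\<^sup>2 + x2 * x3\<^sup>2 * z2 * z1\<^sup>2 + x3 * x1\<^sup>2 * z3 * z2\<^sup>2"
  "m33 2 0 x1 x2 x3 z1 z2 z3 = x1 * x3\<^sup>2 * z1 * z1\<^sup>2 + x2 * x1\<^sup>2 * z2 * z2\<^sup>2 + x3 * x2\<^sup>2 * z3 * z3\<^sup>2"
  "m33 2 1 x1 x2 x3 z1 z2 z3 = x1 * x3\<^sup>2 * z1 * z2\<^sup>2 + x2 * x1\<^sup>2 * z2 * z3\<^sup>2 + x3 * x2\<^sup>2 * z3 * z1\<^sup>2"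
  "m33 2 2 x1 x2 x3 z1 z2 z3 = x1 * x3\<^sup>2 * z1 * z3\<^sup>2 + x2 * x1\<^sup>2 * z2 * z1\<^sup>2 + x3 * x2\<^sup>2 * z3 * z2\<^sup>2"
  by (simp_all add: m33_def Let_def eval_nat_numeral)

lemma cyc_mean_33:
  fixes a1 a2 a3 b1 b2 b3 c1 c2 c3 a1' a2' a3' b1' b2' b3' c1' c2' c3' k :: complex
  defines "G \<equiv> \<lambda>x1 x2 x3 z1 z2 z3. x1 * (a1 * x1\<^sup>2 + a2 * x2\<^sup>2 + a3 * x3\<^sup>2) * (z1 * (a1' * z1\<^sup>2 + a2' * z2\<^sup>2 + a3' * z3\<^sup>2))
    + x2 * (b1 * x1\<^sup>2 + b2 * x2\<^sup>2 + b3 * x3\<^sup>2) * (z2 * (b1' * z1\<^sup>2 + b2' * z2\<^sup>2 + b3' * z3\<^sup>2))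
    + x3 * (c1 * x1\<^sup>2 + c2 * x2\<^sup>2 + c3 * x3\<^sup>2) * (z3 * (c1' * z1\<^sup>2 + c2' * z2\<^sup>2 + c3' * z3\<^sup>2))
    + k * (x1 * x2 * x3 * (z1 * z2 * z3))"
  shows "\<exists>(C :: nat \<Rightarrow> nat \<Rightarrow> complex) k'. \<forall>x1 x2 x3 z1 z2 z3. cyc_mean G x1 x2 x3 z1 z2 z3 =
     C 0 0 * m33 0 0 x1 x2 x3 z1 z2 z3 + C 0 1 * m33 0 1 x1 x2 x3 z1 z2 z3 + C 0 2 * m33 0 2 x1 x2 x3 z1 z2 z3
     + C 1 0 * m33 1 0 x1 x2 x3 z1 z2 z3 + C 1 1 * m33 1 1 x1 x2 x3 z1 z2 z3 + C 1 2 * m33 1 2 x1 x2 x3 z1 z2 z3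
     + C 2 0 * m33 2 0 x1 x2 x3 z1 z2 z3 + C 2 1 * m33 2 1 x1 x2 x3 z1 z2 z3 + C 2 2 * m33 2 2 x1 x2 x3 z1 z2 z3
     + k' * (x1 * x2 * x3 * (z1 * z2 * z3))"
proof -
  define C :: "nat \<Rightarrow> nat \<Rightarrow> complex" where "C d e = ([a1, a2, a3] ! d * [a1', a2', a3'] ! e
     + [b2, b3, b1] ! d * [b2', b3', b1'] ! e + [c3, c1, c2] ! d * [c3', c1', c2'] ! e) / 3" for d e
  have C: "C 0 0 = (a1 * a1' + b2 * b2' + c3 * c3') / 3" "C 0 1 = (a1 * a2' + b2 * b3' + c3 * c1') / 3"
    "C 0 2 = (a1 * a3' + b2 * b1' + c3 * c2') / 3" "C 1 0 = (a2 * a1' + b3 * b2' + c1 * c3') / 3"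
    "C 1 1 = (a2 * a2' + b3 * b3' + c1 * c1') / 3" "C 1 2 = (a2 * a3' + b3 * b1' + c1 * c2') / 3"
    "C 2 0 = (a3 * a1' + b1 * b2' + c2 * c3') / 3" "C 2 1 = (a3 * a2' + b1 * b3' + c2 * c1') / 3"
    "C 2 2 = (a3 * a3' + b1 * b1' + c2 * c2') / 3"
    by (simp_all add: C_def eval_nat_numeral)
  show ?thesis
    by (rule exI[of _ C], rule exI[of _ k], unfold cyc_mean_def G_def C m33_simps, intro allI, simp add: algebra_simps add_divide_distrib)
qed

lemma F_mean_33:
  fixes w k :: complex and C :: "nat \<Rightarrow> nat \<Rightarrow> complex"
  assumes w: "w * w = - 1 - w" and c: "on_cone x1 x2 x3 z1 z2 z3"
    and H: "\<And>x1 x2 x3 z1 z2 z3. H x1 x2 x3 z1 z2 z3 =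
     C 0 0 * m33 0 0 x1 x2 x3 z1 z2 z3 + C 0 1 * m33 0 1 x1 x2 x3 z1 z2 z3 + C 0 2 * m33 0 2 x1 x2 x3 z1 z2 z3
     + C 1 0 * m33 1 0 x1 x2 x3 z1 z2 z3 + C 1 1 * m33 1 1 x1 x2 x3 z1 z2 z3 + C 1 2 * m33 1 2 x1 x2 x3 z1 z2 z3
     + C 2 0 * m33 2 0 x1 x2 x3 z1 z2 z3 + C 2 1 * m33 2 1 x1 x2 x3 z1 z2 z3 + C 2 2 * m33 2 2 x1 x2 x3 z1 z2 z3
     + k * (x1 * x2 * x3 * (z1 * z2 * z3))"
  shows "F_mean w H x1 x2 x3 z1 z2 z3 =
     (C 1 1 + C 2 2 - 2 * C 0 0 - 2 * k / 3) / 2 * (m33 1 1 x1 x2 x3 z1 z2 z3 + m33 2 2 x1 x2 x3 z1 z2 z3)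
     + (C 0 1 + w * C 0 2 - (C 1 2 + w * C 2 1)) / 2 * (m33 0 1 x1 x2 x3 z1 z2 z3 + w\<^sup>2 * m33 0 2 x1 x2 x3 z1 z2 z3)
     + (C 1 0 + w\<^sup>2 * C 2 0 - w\<^sup>2 * (C 1 2 + w * C 2 1)) / 2 * (m33 1 0 x1 x2 x3 z1 z2 z3 + w * m33 2 0 x1 x2 x3 z1 z2 z3)"
proof -
  have w3: "w * w * w = 1" using w by Groebner_Basis.algebra
  have c0: "x1 * z1 + x2 * z2 + x3 * z3 = 0" using c by (simp add: on_cone_def)
  let ?m = "\<lambda>d e. m33 d e x1 x2 x3 z1 z2 z3"
  let ?f = "\<lambda>d e. m33 d e (- x1) (- (w\<^sup>2 * x3)) (- (w * x2)) (- z1) (- (w * z3)) (- (w\<^sup>2 * z2))"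
  have F: "?f 0 0 = ?m 0 0" "?f 0 1 = w\<^sup>2 * ?m 0 2" "?f 0 2 = w * ?m 0 1" "?f 1 0 = w * ?m 2 0" "?f 2 0 = w\<^sup>2 * ?m 1 0"
    "?f 1 1 = ?m 2 2" "?f 2 2 = ?m 1 1" "?f 1 2 = w\<^sup>2 * ?m 2 1" "?f 2 1 = w * ?m 1 2"
    using w3 unfolding m33_simps power2_eq_square by Groebner_Basis.algebra+
  have n: "(- x1) * (- (w\<^sup>2 * x3)) * (- (w * x2)) * ((- z1) * (- (w * z3)) * (- (w\<^sup>2 * z2))) = x1 * x2 * x3 * (z1 * z2 * z3)"
    using w3 unfolding power2_eq_square by Groebner_Basis.algebra
  \<comment> \<open>These are the products of \<open>x1 * z1 + x2 * z2 + x3 * z3\<close> with four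
    cyclic forms of bidegree (2, 2): the squares \<open>(x1 * z1)\<^sup>2\<close>, the mixed
    products \<open>x1 * z1 * x2 * z2\<close>, and the two sums of type
    \<open>x1\<^sup>2 * z2\<^sup>2\<close> and \<open>x1\<^sup>2 * z3\<^sup>2\<close>.\<close>
  have R: "?m 0 0 + ?m 1 1 + ?m 2 2 = 0" "?m 1 1 + ?m 2 2 + 3 * (x1 * x2 * x3 * (z1 * z2 * z3)) = 0"
    "?m 0 1 + ?m 2 0 + ?m 1 2 = 0" "?m 0 2 + ?m 1 0 + ?m 2 1 = 0"
    using c0 unfolding m33_simps power2_eq_square by Groebner_Basis.algebra+
  show ?thesis
    unfolding F_mean_def H F n using R w3 unfolding power2_eq_square
    by Groebner_Basis.algebra
qed

lemma mean33:
  assumes w: "w * w = - 1 - w"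
  shows "\<exists>K1 K2 K3. \<forall>x1 x2 x3 z1 z2 z3. on_cone x1 x2 x3 z1 z2 z3 \<longrightarrow>
      mono_mean w (pow_pair 3 3 p1 p2 p3 q1 q2 q3) x1 x2 x3 z1 z2 z3 =
      K1 * (m33 1 1 x1 x2 x3 z1 z2 z3 + m33 2 2 x1 x2 x3 z1 z2 z3)
      + K2 * (m33 0 1 x1 x2 x3 z1 z2 z3 + w\<^sup>2 * m33 0 2 x1 x2 x3 z1 z2 z3)
      + K3 * (m33 1 0 x1 x2 x3 z1 z2 z3 + w * m33 2 0 x1 x2 x3 z1 z2 z3)"
proof -
  have par: "((u1 + u2 + u3 + u0) * (v1 + v2 + v3 + v0) + (u1 + - u2 + - u3 + u0) * (v1 + - v2 + - v3 + v0)
      + (- u1 + u2 + - u3 + u0) * (- v1 + v2 + - v3 + v0) + (- u1 + - u2 + u3 + u0) * (- v1 + - v2 + v3 + v0)) / 4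
     = u1 * v1 + u2 * v2 + u3 * v3 + u0 * v0" for u0 u1 u2 u3 v0 v1 v2 v3 :: complex
    by (simp add: field_simps)
  have s: "sgn_mean (pow_pair 3 3 p1 p2 p3 q1 q2 q3) = (\<lambda>x1 x2 x3 z1 z2 z3.
      x1 * (p1 ^ 3 * x1\<^sup>2 + 3 * p1 * p2\<^sup>2 * x2\<^sup>2 + 3 * p1 * p3\<^sup>2 * x3\<^sup>2)
       * (z1 * (q1 ^ 3 * z1\<^sup>2 + 3 * q1 * q2\<^sup>2 * z2\<^sup>2 + 3 * q1 * q3\<^sup>2 * z3\<^sup>2))
    + x2 * (3 * p2 * p1\<^sup>2 * x1\<^sup>2 + p2 ^ 3 * x2\<^sup>2 + 3 * p2 * p3\<^sup>2 * x3\<^sup>2)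
       * (z2 * (3 * q2 * q1\<^sup>2 * z1\<^sup>2 + q2 ^ 3 * z2\<^sup>2 + 3 * q2 * q3\<^sup>2 * z3\<^sup>2))
    + x3 * (3 * p3 * p1\<^sup>2 * x1\<^sup>2 + 3 * p3 * p2\<^sup>2 * x2\<^sup>2 + p3 ^ 3 * x3\<^sup>2)
       * (z3 * (3 * q3 * q1\<^sup>2 * z1\<^sup>2 + 3 * q3 * q2\<^sup>2 * z2\<^sup>2 + q3 ^ 3 * z3\<^sup>2))
    + 36 * p1 * p2 * p3 * q1 * q2 * q3 * (x1 * x2 * x3 * (z1 * z2 * z3)))"
    unfolding sgn_mean_def pow_pair_def cube_parity_split power2_minus mult_minus_left mult_minus_right minus_minus par
    by (intro ext) (simp add: mult_ac)
  obtain C :: "nat \<Rightarrow> nat \<Rightarrow> complex" and k where Ck: "\<And>x1 x2 x3 z1 z2 z3. cyc_mean (sgn_mean (pow_pair 3 3 p1 p2 p3 q1 q2 q3)) x1 x2 x3 z1 z2 z3 =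
     C 0 0 * m33 0 0 x1 x2 x3 z1 z2 z3 + C 0 1 * m33 0 1 x1 x2 x3 z1 z2 z3 + C 0 2 * m33 0 2 x1 x2 x3 z1 z2 z3
     + C 1 0 * m33 1 0 x1 x2 x3 z1 z2 z3 + C 1 1 * m33 1 1 x1 x2 x3 z1 z2 z3 + C 1 2 * m33 1 2 x1 x2 x3 z1 z2 z3
     + C 2 0 * m33 2 0 x1 x2 x3 z1 z2 z3 + C 2 1 * m33 2 1 x1 x2 x3 z1 z2 z3 + C 2 2 * m33 2 2 x1 x2 x3 z1 z2 z3
     + k * (x1 * x2 * x3 * (z1 * z2 * z3))"
    using cyc_mean_33[of "p1 ^ 3" "3 * p1 * p2\<^sup>2" "3 * p1 * p3\<^sup>2" "q1 ^ 3" "3 * q1 * q2\<^sup>2" "3 * q1 * q3\<^sup>2"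
       "3 * p2 * p1\<^sup>2" "p2 ^ 3" "3 * p2 * p3\<^sup>2" "3 * q2 * q1\<^sup>2" "q2 ^ 3" "3 * q2 * q3\<^sup>2"
       "3 * p3 * p1\<^sup>2" "3 * p3 * p2\<^sup>2" "p3 ^ 3" "3 * q3 * q1\<^sup>2" "3 * q3 * q2\<^sup>2" "q3 ^ 3" "36 * p1 * p2 * p3 * q1 * q2 * q3"]
    unfolding s by blast
  show ?thesis
    using F_mean_33[OF w _ Ck] unfolding mono_mean_def by blast
qed

text \<open>With unit vectors e1, e2, e3, these are the images under \<open>matW\<close> of the
  points (e1, e2), (e1, e3) and (e1 + e2, e3) of the cone. Invariance at these points becomes a
  system of linear equations for the remaining constants.\<close>

lemma cone_W_rows:
  "on_cone (- 1 / 2) (\<nu>\<^sub>2 / 2) (\<nu>\<^sub>1 / 2) (\<nu>\<^sub>2 / 2) (\<nu>\<^sub>1 / 2) (- 1 / 2)"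
  "on_cone (- 1 / 2) (\<nu>\<^sub>2 / 2) (\<nu>\<^sub>1 / 2) (\<nu>\<^sub>1 / 2) (- 1 / 2) (\<nu>\<^sub>2 / 2)"
  "on_cone ((- 1 + \<nu>\<^sub>2) / 2) ((\<nu>\<^sub>2 + \<nu>\<^sub>1) / 2) ((\<nu>\<^sub>1 - 1) / 2) (\<nu>\<^sub>1 / 2) (- 1 / 2) (\<nu>\<^sub>2 / 2)"
  unfolding on_cone_def \<nu>_simps(1) by (simp_all add: field_simps \<nu>_simps(2))

lemma cone_W_eval:
  assumes P: "cone_inv_W P"
  shows "P (- 1 / 2) (\<nu>\<^sub>2 / 2) (\<nu>\<^sub>1 / 2) (\<nu>\<^sub>2 / 2) (\<nu>\<^sub>1 / 2) (- 1 / 2) = P 1 0 0 0 1 0"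
  "P (- 1 / 2) (\<nu>\<^sub>2 / 2) (\<nu>\<^sub>1 / 2) (\<nu>\<^sub>1 / 2) (- 1 / 2) (\<nu>\<^sub>2 / 2) = P 1 0 0 0 0 1"
  "P ((- 1 + \<nu>\<^sub>2) / 2) ((\<nu>\<^sub>2 + \<nu>\<^sub>1) / 2) ((\<nu>\<^sub>1 - 1) / 2) (\<nu>\<^sub>1 / 2) (- 1 / 2) (\<nu>\<^sub>2 / 2) = P 1 1 0 0 0 1"
  using P[unfolded cone_inv_W_def, rule_format, of 1 0 0 0 1 0] P[unfolded cone_inv_W_def, rule_format, of 1 0 0 0 0 1]
    P[unfolded cone_inv_W_def, rule_format, of 1 1 0 0 0 1]
  by (simp_all add: on_cone_def)

theorem no_cone_invariant:
  assumes P: "cone_inv_360 w P" and w: "w * w = - 1 - w" and bi: "bihom a b P"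
    and ab: "(a, b) \<in> {(1, 1), (3, 0), (2, 2), (4, 1), (3, 3)}" and c: "on_cone x1 x2 x3 z1 z2 z3"
  shows "P x1 x2 x3 z1 z2 z3 = 0"
proof -
  define v where "v = \<nu>\<^sub>1"
  have v: "\<nu>\<^sub>1 = v" "\<nu>\<^sub>2 = - 1 - v" and vv: "v * v = 1 - v" using \<nu>_simps by (simp_all add: v_def)
  note Wp = cone_W_rows cone_W_eval[OF P[unfolded cone_inv_360_def, THEN conjunct1]]
  have ptc: "on_cone 1 0 0 0 1 0" "on_cone 1 0 0 0 0 1" "on_cone 1 1 0 0 0 1" by (simp_all add: on_cone_def)
  consider "a = 1" "b = 1" | "a = 3" "b = 0" | "a = 2" "b = 2" | "a = 4" "b = 1" | "a = 3" "b = 3" using ab by auto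
  then show ?thesis
  proof cases
    case 1
    have "\<exists>K1 K2 K3. \<forall>x1 x2 x3 z1 z2 z3. on_cone x1 x2 x3 z1 z2 z3 \<longrightarrow> P x1 x2 x3 z1 z2 z3 = K1 * 0 + K2 * 0 + K3 * 0"
      by (rule cone_reduce[OF P w bi]) (use mean11[OF w] in \<open>simp add: 1\<close>)
    then show ?thesis using c by auto
  next
    case 2
    have "\<exists>K1 K2 K3. \<forall>x1 x2 x3 z1 z2 z3. on_cone x1 x2 x3 z1 z2 z3 \<longrightarrow> P x1 x2 x3 z1 z2 z3 = K1 * 0 + K2 * 0 + K3 * 0"
      by (rule cone_reduce[OF P w bi]) (use mean30[OF w] in \<open>simp add: 2\<close>)
    then show ?thesis using c by auto
  next
    case 3
    obtain K1 K2 K3 where K: "\<And>x1 x2 x3 z1 z2 z3. on_cone x1 x2 x3 z1 z2 z3 \<Longrightarrow> P x1 x2 x3 z1 z2 z3 =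
      K1 * (x1\<^sup>2 * z1\<^sup>2 + x2\<^sup>2 * z2\<^sup>2 + x3\<^sup>2 * z3\<^sup>2)
      + K2 * (x1\<^sup>2 * (z2\<^sup>2 + w\<^sup>2 * z3\<^sup>2) + x2\<^sup>2 * (z3\<^sup>2 + w\<^sup>2 * z1\<^sup>2) + x3\<^sup>2 * (z1\<^sup>2 + w\<^sup>2 * z2\<^sup>2)) + K3 * 0"
      using cone_reduce[OF P w bi[unfolded 3] mean22[OF w]] by blast
    have e1: "K1 + (- 5 - 2 * w) * K2 = 0"
      using Wp(4)[unfolded v, unfolded K[OF Wp(1)[unfolded v]] K[OF ptc(1)] power2_eq_square] vv w
      by (simp add: field_simps) Groebner_Basis.algebra
    have e2: "K1 + (5 + 3 * w) * K2 = 0"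
      using Wp(5)[unfolded v, unfolded K[OF Wp(2)[unfolded v]] K[OF ptc(2)] power2_eq_square] vv w
      by (simp add: field_simps) Groebner_Basis.algebra
    \<comment> \<open>The difference of the two equations is \<open>5 * (2 + w) * K2\<close>, and
      \<open>2 + w\<close> has norm 3.\<close>
    have "15 * K2 = 0" "15 * K1 = 0" using e1 e2 w by Groebner_Basis.algebra+
    then show ?thesis using K[OF c] by simp
  next
    case 4
    obtain K1 K2 K3 where K: "\<And>x1 x2 x3 z1 z2 z3. on_cone x1 x2 x3 z1 z2 z3 \<Longrightarrow> P x1 x2 x3 z1 z2 z3 =
      K1 * (z1 * x2 * x3 * (x2\<^sup>2 - w * x3\<^sup>2) + z2 * x3 * x1 * (x3\<^sup>2 - w * x1\<^sup>2) + z3 * x1 * x2 * (x1\<^sup>2 - w * x2\<^sup>2))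
      + K2 * 0 + K3 * 0"
      using cone_reduce[OF P w bi[unfolded 4] mean41[OF w]] by blast
    have e1: "(v + w) * K1 = 0"
      using Wp(4)[unfolded v, unfolded K[OF Wp(1)[unfolded v]] K[OF ptc(1)] power2_eq_square] vv w
      by (simp add: field_simps) Groebner_Basis.algebra
    \<comment> \<open>\<open>(v + w) * (v + w\<^sup>2) = 2 * (1 - v)\<close>, and
      \<open>1 - v = v\<^sup>2\<close> is a unit because \<open>v * (v + 1) = 1\<close>.\<close>
    have "2 * K1 = 0" using e1 vv w by Groebner_Basis.algebra
    then show ?thesis using K[OF c] by simp
  next
    case 5
    obtain K1 K2 K3 where K: "\<And>x1 x2 x3 z1 z2 z3. on_cone x1 x2 x3 z1 z2 z3 \<Longrightarrow> P x1 x2 x3 z1 z2 z3 =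
      K1 * (m33 1 1 x1 x2 x3 z1 z2 z3 + m33 2 2 x1 x2 x3 z1 z2 z3)
      + K2 * (m33 0 1 x1 x2 x3 z1 z2 z3 + w\<^sup>2 * m33 0 2 x1 x2 x3 z1 z2 z3)
      + K3 * (m33 1 0 x1 x2 x3 z1 z2 z3 + w * m33 2 0 x1 x2 x3 z1 z2 z3)"
      using cone_reduce[OF P w bi[unfolded 5] mean33[OF w]] by blast
    have e1: "- 3 * K1 + (- 1 + 6 * v + w + 7 * v * w) * K2 + (6 + 7 * v - w + v * w) * K3 = 0"
      using Wp(4)[unfolded v, unfolded K[OF Wp(1)[unfolded v]] K[OF ptc(1)] m33_simps power2_eq_square] vv w
      by (simp add: field_simps) Groebner_Basis.algebra
    have e2: "- 3 * K1 + (7 + 6 * v + w - v * w) * K2 + (- 2 - v - w - 7 * v * w) * K3 = 0"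
      using Wp(5)[unfolded v, unfolded K[OF Wp(2)[unfolded v]] K[OF ptc(2)] m33_simps power2_eq_square] vv w
      by (simp add: field_simps) Groebner_Basis.algebra
    have e3: "3 * K1 + (9 + 18 * v + 23 * w + 9 * v * w) * K2 + (10 + v + 9 * w - v * w) * K3 = 0"
      using Wp(6)[unfolded v, unfolded K[OF Wp(3)[unfolded v]] K[OF ptc(3)] m33_simps power2_eq_square] vv w
      by (simp add: field_simps) Groebner_Basis.algebra
    have "64 * K2 = 0" "128 * K3 = 0" using e1 e2 e3 vv w by Groebner_Basis.algebra+
    then have "K2 = 0" "K3 = 0" by simp_all
    moreover have "K1 = 0" using e1 calculation by simp
    ultimately show ?thesis using K[OF c] by simp
  qed
qed

section \<open>Absence of invariants\<close>

lemma \<xi>_norm [simp]: "cmod (\<xi> n) = 1"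
  by (simp add: \<xi>_def)

lemma \<xi>_cnj: "\<xi> n * cnj (\<xi> n) = 1"
  using cmod_1_iff[of "\<xi> n"] by simp

lemma \<xi>_pow: "n > 0 \<Longrightarrow> \<xi> n ^ n = 1"
  by (simp add: \<xi>_def DeMoivre)

lemma \<xi>_2: "\<xi> 2 = - 1"
  by (simp add: \<xi>_def)

lemma \<xi>_3: "\<xi> 3 * \<xi> 3 = - 1 - \<xi> 3"
proof -
  have "\<xi> 3 ^ 3 = 1" by (rule \<xi>_pow) simp
  then have "(\<xi> 3 - 1) * (\<xi> 3 * \<xi> 3 + \<xi> 3 + 1) = 0"
    by (simp add: power3_eq_cube algebra_simps)
  moreover have "Re (\<xi> 3) = - 1 / 2" by (simp add: \<xi>_def cos_120)
  then have "\<xi> 3 \<noteq> 1" by auto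
  ultimately have "\<xi> 3 * \<xi> 3 + \<xi> 3 + 1 = 0" by simp
  then show ?thesis by Groebner_Basis.algebra
qed

lemma \<xi>_3_cnj: "cnj (\<xi> 3) = \<xi> 3 * \<xi> 3"
  using \<xi>_3 \<xi>_cnj[of 3] by Groebner_Basis.algebra

lemma \<nu>_cnj [simp]: "cnj \<nu>\<^sub>1 = \<nu>\<^sub>1" "cnj \<nu>\<^sub>2 = \<nu>\<^sub>2"
  by (simp_all add: \<nu>\<^sub>1_def \<nu>\<^sub>2_def)

lemma matA_M3: "matA n = M3 1 0 0 0 (\<xi> n) 0 0 0 (inverse (\<xi> n))"
  by (simp add: matA_def M3_def)

lemma matA_2: "matA 2 = M3 1 0 0 0 (- 1) 0 0 0 (- 1)"
  by (simp add: matA_M3 \<xi>_2)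

lemma matE_M3: "matE = M3 0 1 0 0 0 1 1 0 0"
  by (simp add: matE_def M3_def)

lemma matF_M3: "matF = M3 (- 1) 0 0 0 0 (- \<xi> 3) 0 (- (\<xi> 3)\<^sup>2) 0"
  by (simp add: matF_def M3_def)

lemma matW_M3: "matW = M3 (- 1 / 2) (\<nu>\<^sub>2 / 2) (\<nu>\<^sub>1 / 2) (\<nu>\<^sub>2 / 2) (\<nu>\<^sub>1 / 2) (- 1 / 2) (\<nu>\<^sub>1 / 2) (- 1 / 2) (\<nu>\<^sub>2 / 2)"
  by (simp add: matW_def M3_def[symmetric] M3_smult)

lemma matA_SU3: "matA n \<in> carrier SU3"
  unfolding matA_M3 by (rule M3_SU3I) (auto simp: M3_mult M3_one M3_eq_iff cmod_1_inverse \<xi>_cnj mult.commute)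

lemma matE_SU3: "matE \<in> carrier SU3"
  unfolding matE_M3 by (rule M3_SU3I) (auto simp: M3_mult M3_one M3_eq_iff)

lemma matF_SU3: "matF \<in> carrier SU3"
  unfolding matF_M3
  by (rule M3_SU3I; simp add: M3_mult M3_one M3_eq_iff \<xi>_3_cnj power2_eq_square;
      insert \<xi>_3; (intro conjI)?; Groebner_Basis.algebra)

lemma matW_SU3: "matW \<in> carrier SU3"
  unfolding matW_M3
  by (rule M3_SU3I; simp add: M3_mult M3_one M3_eq_iff;
      insert \<nu>_simps; (intro conjI)?; simp add: field_simps; Groebner_Basis.algebra)

lemma generate_SU3: "H \<subseteq> carrier SU3 \<Longrightarrow> generate SU3 H \<subseteq> carrier SU3"
  by (rule group.generate_incl[OF SU3_group])

lemma Sigma360x3_SU3: "Sigma360x3 \<subseteq> carrier SU3"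
  unfolding Sigma360x3_def by (rule generate_SU3) (auto simp: matA_SU3 matE_SU3 matW_SU3 matF_SU3)

lemma Sigma360x3_gens: "matA 2 \<in> Sigma360x3" "matE \<in> Sigma360x3" "matW \<in> Sigma360x3" "matF \<in> Sigma360x3"
  unfolding Sigma360x3_def by (auto intro: generate.incl)

text \<open>Invariance under right translation by \<open>k\<close>, which acts on the first row
  \<open>x\<close> of a group element by \<open>k\<close> and on the conjugate last row
  \<open>z\<close> by the conjugate of \<open>k\<close>.\<close>

definition cone_inv :: "complex mat \<Rightarrow> fun6 \<Rightarrow> bool" where
  "cone_inv k P \<longleftrightarrow> (\<forall>x1 x2 x3 z1 z2 z3. on_cone x1 x2 x3 z1 z2 z3 \<longrightarrow>
     P (x1 * k $$ (0, 0) + x2 * k $$ (1, 0) + x3 * k $$ (2, 0)) (x1 * k $$ (0, 1) + x2 * k $$ (1, 1) + x3 * k $$ (2, 1))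
       (x1 * k $$ (0, 2) + x2 * k $$ (1, 2) + x3 * k $$ (2, 2))
       (z1 * cnj (k $$ (0, 0)) + z2 * cnj (k $$ (1, 0)) + z3 * cnj (k $$ (2, 0)))
       (z1 * cnj (k $$ (0, 1)) + z2 * cnj (k $$ (1, 1)) + z3 * cnj (k $$ (2, 1)))
       (z1 * cnj (k $$ (0, 2)) + z2 * cnj (k $$ (1, 2)) + z3 * cnj (k $$ (2, 2))) = P x1 x2 x3 z1 z2 z3)"

text \<open>Exchanging \<open>x\<close> and \<open>z\<close> conjugates the generators. Three of
  them are real; in \<open>matF\<close> the conjugation replaces \<open>\<xi> 3\<close> by its
  square.\<close>

lemma cone_inv_360I:
  assumes "\<forall>k\<in>{matA 2, matE, matW, matF}. cone_inv k P"
  shows "cone_inv_360 (\<xi> 3) P" and "cone_inv_360 ((\<xi> 3)\<^sup>2) (\<lambda>x1 x2 x3 z1 z2 z3. P z1 z2 z3 x1 x2 x3)"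
proof -
  have A: "cone_inv (matA 2) P" and E: "cone_inv matE P" and W: "cone_inv matW P" and F: "cone_inv matF P"
    using assms by auto
  have W': "cone_inv_W P" and W'': "cone_inv_W (\<lambda>x1 x2 x3 z1 z2 z3. P z1 z2 z3 x1 x2 x3)"
  proof -
    have e: "x1 * (- 1 / 2) + x2 * (\<nu>\<^sub>2 / 2) + x3 * (\<nu>\<^sub>1 / 2) = (- x1 + \<nu>\<^sub>2 * x2 + \<nu>\<^sub>1 * x3) / 2"
      "x1 * (\<nu>\<^sub>2 / 2) + x2 * (\<nu>\<^sub>1 / 2) + x3 * (- 1 / 2) = (\<nu>\<^sub>2 * x1 + \<nu>\<^sub>1 * x2 - x3) / 2"
      "x1 * (\<nu>\<^sub>1 / 2) + x2 * (- 1 / 2) + x3 * (\<nu>\<^sub>2 / 2) = (\<nu>\<^sub>1 * x1 - x2 + \<nu>\<^sub>2 * x3) / 2" for x1 x2 x3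
      by (simp_all add: field_simps)
    have c: "cnj (- 1 / 2) = - 1 / 2" "cnj (\<nu>\<^sub>2 / 2) = \<nu>\<^sub>2 / 2" "cnj (\<nu>\<^sub>1 / 2) = \<nu>\<^sub>1 / 2" by simp_all
    show W': "cone_inv_W P"
      using W unfolding cone_inv_def cone_inv_W_def matW_M3 M3_index c e .
    have sw: "on_cone x1 x2 x3 z1 z2 z3 \<Longrightarrow> on_cone z1 z2 z3 x1 x2 x3" for x1 x2 x3 z1 z2 z3
      by (simp add: on_cone_def mult.commute)
    show "cone_inv_W (\<lambda>x1 x2 x3 z1 z2 z3. P z1 z2 z3 x1 x2 x3)"
      using W' sw unfolding cone_inv_W_def by blast
  qed
  have w4: "\<xi> 3 * \<xi> 3 * (\<xi> 3 * \<xi> 3) = \<xi> 3" using \<xi>_3 by Groebner_Basis.algebra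
  show "cone_inv_360 (\<xi> 3) P"
  proof -
    have c: "cnj (\<xi> 3) = (\<xi> 3)\<^sup>2" "cnj ((\<xi> 3)\<^sup>2) = \<xi> 3"
      using w4 by (simp_all add: \<xi>_3_cnj power2_eq_square)
    show ?thesis
      using W' A E F unfolding cone_inv_def cone_inv_360_def matA_2 matE_M3 matF_M3
      by (simp add: c mult.commute del: complex_cnj_power)
  qed
  show "cone_inv_360 ((\<xi> 3)\<^sup>2) (\<lambda>x1 x2 x3 z1 z2 z3. P z1 z2 z3 x1 x2 x3)"
  proof -
    have sw: "on_cone x1 x2 x3 z1 z2 z3 \<Longrightarrow> on_cone z1 z2 z3 x1 x2 x3" for x1 x2 x3 z1 z2 z3
      by (simp add: on_cone_def mult.commute)
    have F': "P (- x1) (- ((\<xi> 3)\<^sup>2 * x3)) (- (\<xi> 3 * x2)) (- z1) (- (\<xi> 3 * z3)) (- ((\<xi> 3)\<^sup>2 * z2)) = P x1 x2 x3 z1 z2 z3"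
      and A': "P x1 (- x2) (- x3) z1 (- z2) (- z3) = P x1 x2 x3 z1 z2 z3" and E': "P x3 x1 x2 z3 z1 z2 = P x1 x2 x3 z1 z2 z3"
      if "on_cone x1 x2 x3 z1 z2 z3" for x1 x2 x3 z1 z2 z3
      using \<open>cone_inv_360 (\<xi> 3) P\<close> that unfolding cone_inv_360_def by blast+
    have e: "((\<xi> 3)\<^sup>2)\<^sup>2 = \<xi> 3" using w4 by (simp add: power2_eq_square)
    show ?thesis
      unfolding cone_inv_360_def e
    proof (intro conjI allI impI)
      fix x1 x2 x3 z1 z2 z3 assume "on_cone x1 x2 x3 z1 z2 z3"
      note A'[OF sw[OF this]] E'[OF sw[OF this]] F'[OF sw[OF this]]
      then show "P z1 (- z2) (- z3) x1 (- x2) (- x3) = P z1 z2 z3 x1 x2 x3" "P z3 z1 z2 x3 x1 x2 = P z1 z2 z3 x1 x2 x3"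
        "P (- z1) (- ((\<xi> 3)\<^sup>2 * z3)) (- (\<xi> 3 * z2)) (- x1) (- (\<xi> 3 * x3)) (- ((\<xi> 3)\<^sup>2 * x2)) = P z1 z2 z3 x1 x2 x3"
        by blast+
    qed (rule W'')
  qed
qed

lemma bihomI:
  assumes "finite (N :: nat set)" "\<And>x1 x2 x3 z1 z2 z3. P x1 x2 x3 z1 z2 z3 =
     (\<Sum>i\<in>N. c i * pow_pair a b (p1 i) (p2 i) (p3 i) (q1 i) (q2 i) (q3 i) x1 x2 x3 z1 z2 z3)"
  shows "bihom a b P"
  unfolding bihom_def
  by (rule exI[of _ N], rule exI[of _ c], rule exI[of _ p1], rule exI[of _ p2], rule exI[of _ p3],
      rule exI[of _ q1], rule exI[of _ q2], rule exI[of _ q3], rule conjI[OF assms(1)], intro ext, rule assms(2))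

lemma bihom_swap: "bihom a b P \<Longrightarrow> bihom b a (\<lambda>x1 x2 x3 z1 z2 z3. P z1 z2 z3 x1 x2 x3)"
proof -
  assume "bihom a b P"
  then obtain N :: "nat set" and c p1 p2 p3 q1 q2 q3 where N: "finite N" and P: "P = (\<lambda>x1 x2 x3 z1 z2 z3.
     \<Sum>i\<in>N. c i * pow_pair a b (p1 i) (p2 i) (p3 i) (q1 i) (q2 i) (q3 i) x1 x2 x3 z1 z2 z3)"
    unfolding bihom_def by blast
  show ?thesis unfolding P
    by (rule bihomI[where N = N and c = c and ?p1.0 = q1 and ?p2.0 = q2 and ?p3.0 = q3 and ?q1.0 = p1 and ?q2.0 = p2 and ?q3.0 = p3])
       (simp_all add: N pow_pair_def mult.commute)
qed

lemma no_cone_invariant_360: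
  assumes P: "bihom a b P" and k: "\<forall>k\<in>{matA 2, matE, matW, matF}. cone_inv k P"
    and ab: "(a, b) \<in> interaction_labels" and c: "on_cone x1 x2 x3 z1 z2 z3"
  shows "P x1 x2 x3 z1 z2 z3 = 0"
proof -
  have w2: "(\<xi> 3)\<^sup>2 * (\<xi> 3)\<^sup>2 = - 1 - (\<xi> 3)\<^sup>2" using \<xi>_3 unfolding power2_eq_square by Groebner_Basis.algebra
  show ?thesis
  proof (cases "(a, b) \<in> {(1, 1), (3, 0), (2, 2), (4, 1), (3, 3)}")
    case True
    then show ?thesis by (rule no_cone_invariant[OF cone_inv_360I(1)[OF k] \<xi>_3 P _ c])
  next
    case False
    then have "(b, a) \<in> {(1, 1), (3, 0), (2, 2), (4, 1), (3, 3)}"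
      using ab by (auto simp: interaction_labels_def)
    then show ?thesis
      using no_cone_invariant[OF cone_inv_360I(2)[OF k] w2 bihom_swap[OF P], of z1 z2 z3 x1 x2 x3] c
      by (simp add: on_cone_def mult.commute)
  qed
qed

section \<open>From functions on the group to polynomials on the cone\<close>

lemma bihom_zero: "bihom a b (\<lambda>x1 x2 x3 z1 z2 z3. 0)"
  unfolding bihom_def by (rule exI[of _ "{}"]) simp

lemma bihom_add:
  assumes "bihom a b P"
  shows "bihom a b (\<lambda>x1 x2 x3 z1 z2 z3. P x1 x2 x3 z1 z2 z3 + c * pow_pair a b p1 p2 p3 q1 q2 q3 x1 x2 x3 z1 z2 z3)"
proof -
  obtain N :: "nat set" and c' p1' p2' p3' q1' q2' q3' where N: "finite N" and P: "P = (\<lambda>x1 x2 x3 z1 z2 z3.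
     \<Sum>i\<in>N. c' i * pow_pair a b (p1' i) (p2' i) (p3' i) (q1' i) (q2' i) (q3' i) x1 x2 x3 z1 z2 z3)"
    using assms unfolding bihom_def by blast
  obtain n where n: "n \<notin> N" using ex_new_if_finite[OF infinite_UNIV_nat N] by blast
  have s: "(\<Sum>i\<in>N. (c'(n := c)) i * pow_pair a b ((p1'(n := p1)) i) ((p2'(n := p2)) i) ((p3'(n := p3)) i)
      ((q1'(n := q1)) i) ((q2'(n := q2)) i) ((q3'(n := q3)) i) x1 x2 x3 z1 z2 z3)
    = (\<Sum>i\<in>N. c' i * pow_pair a b (p1' i) (p2' i) (p3' i) (q1' i) (q2' i) (q3' i) x1 x2 x3 z1 z2 z3)" for x1 x2 x3 z1 z2 z3
    using n by (intro sum.cong) auto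
  show ?thesis
    unfolding P
    by (rule bihomI[where N = "insert n N" and c = "c'(n := c)" and ?p1.0 = "p1'(n := p1)" and ?p2.0 = "p2'(n := p2)"
        and ?p3.0 = "p3'(n := p3)" and ?q1.0 = "q1'(n := q1)" and ?q2.0 = "q2'(n := q2)" and ?q3.0 = "q3'(n := q3)"])
       (use N n in \<open>simp_all add: s add.commute fun_upd_same del: fun_upd_apply\<close>)
qed

lemma bihom_homogeneous:
  assumes "bihom a b P"
  shows "P (r * x1) (r * x2) (r * x3) (t * z1) (t * z2) (t * z3) = r ^ a * t ^ b * P x1 x2 x3 z1 z2 z3"
proof -
  obtain N :: "nat set" and c p1 p2 p3 q1 q2 q3 where P: "P = (\<lambda>x1 x2 x3 z1 z2 z3.
     \<Sum>i\<in>N. c i * pow_pair a b (p1 i) (p2 i) (p3 i) (q1 i) (q2 i) (q3 i) x1 x2 x3 z1 z2 z3)"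
    using assms unfolding bihom_def by blast
  have "pow_pair a b p1 p2 p3 q1 q2 q3 (r * x1) (r * x2) (r * x3) (t * z1) (t * z2) (t * z3)
    = r ^ a * t ^ b * pow_pair a b p1 p2 p3 q1 q2 q3 x1 x2 x3 z1 z2 z3" for p1 p2 p3 q1 q2 q3
  proof -
    have "r * x1 * p1 + r * x2 * p2 + r * x3 * p3 = r * (x1 * p1 + x2 * p2 + x3 * p3)"
      "t * z1 * q1 + t * z2 * q2 + t * z3 * q3 = t * (z1 * q1 + z2 * q2 + z3 * q3)" by (simp_all add: algebra_simps)
    then show ?thesis by (simp add: pow_pair_def power_mult_distrib mult_ac)
  qed
  then show ?thesis unfolding P by (simp add: sum_distrib_left mult_ac)
qed

lemma bihom_degree_0:
  assumes "bihom a b P"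
  shows "a = 0 \<Longrightarrow> P x1 x2 x3 z1 z2 z3 = P x1' x2' x3' z1 z2 z3" "b = 0 \<Longrightarrow> P x1 x2 x3 z1 z2 z3 = P x1 x2 x3 z1' z2' z3'"
  using assms by (auto simp: bihom_def pow_pair_def)

lemma orthogonal_nonzero: "\<exists>z1 z2 z3. on_cone x1 x2 x3 z1 z2 z3 \<and> (z1 \<noteq> 0 \<or> z2 \<noteq> 0 \<or> z3 \<noteq> (0 :: complex))"
proof (cases "x1 = 0 \<and> x2 = 0")
  case True then show ?thesis by (intro exI[of _ 1] exI[of _ 0]) (simp add: on_cone_def)
next
  case False then show ?thesis
    by (intro exI[of _ x2] exI[of _ "- x1"] exI[of _ 0]) (auto simp: on_cone_def)
qed

lemma normalize_triple:
  assumes "x1 \<noteq> 0 \<or> x2 \<noteq> 0 \<or> x3 \<noteq> (0::complex)"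
  shows "\<exists>r y1 y2 y3. r \<noteq> 0 \<and> x1 = r * y1 \<and> x2 = r * y2 \<and> x3 = r * y3 \<and> y1 * cnj y1 + y2 * cnj y2 + y3 * cnj y3 = 1"
proof -
  define s where "s = (cmod x1)\<^sup>2 + (cmod x2)\<^sup>2 + (cmod x3)\<^sup>2"
  have "s > 0" unfolding s_def using assms
    by (elim disjE) (simp_all add: add_pos_nonneg add_nonneg_pos)
  then have rr: "complex_of_real (sqrt s) * of_real (sqrt s) = of_real s" "complex_of_real (sqrt s) \<noteq> 0"
    by (simp_all flip: of_real_mult)
  have ss: "complex_of_real s = x1 * cnj x1 + x2 * cnj x2 + x3 * cnj x3"
    by (simp only: s_def of_real_add complex_norm_square)
  let ?r = "complex_of_real (sqrt s)"
  have "x1 / ?r * cnj (x1 / ?r) + x2 / ?r * cnj (x2 / ?r) + x3 / ?r * cnj (x3 / ?r)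
    = (x1 * cnj x1 + x2 * cnj x2 + x3 * cnj x3) / (?r * ?r)" by (simp add: add_divide_distrib)
  also have "\<dots> = 1" unfolding rr ss[symmetric] using \<open>s > 0\<close> by simp
  finally show ?thesis
    using rr(2) by (intro exI[of _ ?r] exI[of _ "x1 / ?r"] exI[of _ "x2 / ?r"] exI[of _ "x3 / ?r"]) simp
qed

definition row_fun :: "fun6 \<Rightarrow> complex mat \<Rightarrow> complex" where
  "row_fun P g = P (g $$ (0, 0)) (g $$ (0, 1)) (g $$ (0, 2)) (cnj (g $$ (2, 0))) (cnj (g $$ (2, 1))) (cnj (g $$ (2, 2)))"

lemma row_fun_zero:
  assumes "\<And>x1 x2 x3 z1 z2 z3. on_cone x1 x2 x3 z1 z2 z3 \<Longrightarrow> P x1 x2 x3 z1 z2 z3 = 0" and g: "g \<in> carrier SU3"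
  shows "row_fun P g = 0"
proof -
  have "(g * mat_adjoint g) $$ (0, 2) = 0" using SU3_adjoint_right[OF g] by simp
  then have "on_cone (g $$ (0, 0)) (g $$ (0, 1)) (g $$ (0, 2)) (cnj (g $$ (2, 0))) (cnj (g $$ (2, 1))) (cnj (g $$ (2, 2)))"
    using SU3_mat[OF g] by (simp add: mult_index_3 on_cone_def del: index_mult_mat)
  then show ?thesis using assms(1) by (simp add: row_fun_def)
qed

text \<open>Group elements reach the points of the cone with both vectors of norm 1, and homogeneity
  extends the identity to all pairs of nonzero vectors. If a vector is zero and its degree is
  positive, both sides vanish. If its degree is zero, the values do not depend on it, so it may be
  replaced by a nonzero orthogonal vector.\<close>

lemma cone_inv_of_row_fun:
  assumes P: "bihom a b P" and k: "k \<in> carrier SU3"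
    and inv: "\<And>g. g \<in> carrier SU3 \<Longrightarrow> row_fun P (g * k) = row_fun P g"
  shows "cone_inv k P"
proof -
  define X where "X x1 x2 x3 j = x1 * k $$ (0, j) + x2 * k $$ (1, j) + x3 * k $$ (2, j)" for x1 x2 x3 :: complex and j
  define Z where "Z z1 z2 z3 j = z1 * cnj (k $$ (0, j)) + z2 * cnj (k $$ (1, j)) + z3 * cnj (k $$ (2, j))" for z1 z2 z3 :: complex and j
  have lin: "X (r * x1) (r * x2) (r * x3) j = r * X x1 x2 x3 j" "Z (r * x1) (r * x2) (r * x3) j = r * Z x1 x2 x3 j" for r x1 x2 x3 j
    by (simp_all add: X_def Z_def algebra_simps)
  define Q where "Q x1 x2 x3 z1 z2 z3 = P (X x1 x2 x3 0) (X x1 x2 x3 1) (X x1 x2 x3 2) (Z z1 z2 z3 0) (Z z1 z2 z3 1) (Z z1 z2 z3 2)" for x1 x2 x3 z1 z2 z3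
  have nz: "Q x1 x2 x3 z1 z2 z3 = P x1 x2 x3 z1 z2 z3"
    if c: "on_cone x1 x2 x3 z1 z2 z3" and x: "x1 \<noteq> 0 \<or> x2 \<noteq> 0 \<or> x3 \<noteq> 0" and z: "z1 \<noteq> 0 \<or> z2 \<noteq> 0 \<or> z3 \<noteq> 0" for x1 x2 x3 z1 z2 z3
  proof -
    obtain r y1 y2 y3 where r: "r \<noteq> 0" "x1 = r * y1" "x2 = r * y2" "x3 = r * y3" "y1 * cnj y1 + y2 * cnj y2 + y3 * cnj y3 = 1"
      using normalize_triple[OF x] by blast
    obtain t u1 u2 u3 where t: "t \<noteq> 0" "z1 = t * u1" "z2 = t * u2" "z3 = t * u3" "u1 * cnj u1 + u2 * cnj u2 + u3 * cnj u3 = 1"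
      using normalize_triple[OF z] by blast
    have "r * t * (y1 * u1 + y2 * u2 + y3 * u3) = 0" using c by (simp add: on_cone_def r t algebra_simps)
    then have yu: "y1 * u1 + y2 * u2 + y3 * u3 = 0" using r t by simp
    note S = SU3_first_last_row[OF r(5) t(5) yu]
    obtain d e f where g: "M3 y1 y2 y3 d e f (cnj u1) (cnj u2) (cnj u3) \<in> carrier SU3" (is "?g \<in> _")
      using S by blast
    have "row_fun P (?g * k) = row_fun P ?g" by (rule inv[OF g])
    then have "Q y1 y2 y3 u1 u2 u3 = P y1 y2 y3 u1 u2 u3"
      using SU3_mat[OF k] by (simp add: row_fun_def Q_def X_def Z_def mult_index_3 del: index_mult_mat)
    then show ?thesis
      unfolding Q_def r t lin bihom_homogeneous[OF P] by simp
  qed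
  have "Q x1 x2 x3 z1 z2 z3 = P x1 x2 x3 z1 z2 z3" if c: "on_cone x1 x2 x3 z1 z2 z3" for x1 x2 x3 z1 z2 z3
  proof -
    have hz: "P 0 0 0 z1 z2 z3 = 0 ^ a * P 0 0 0 z1 z2 z3" "P x1 x2 x3 0 0 0 = 0 ^ b * P x1 x2 x3 0 0 0"
      for x1 x2 x3 z1 z2 z3
      using bihom_homogeneous[OF P, of 0 0 0 0 1 z1 z2 z3] bihom_homogeneous[OF P, of 1 x1 x2 x3 0 0 0 0] by simp_all
    have X0: "X 0 0 0 j = 0" "Z 0 0 0 j = 0" for j by (simp_all add: X_def Z_def)
    consider "x1 \<noteq> 0 \<or> x2 \<noteq> 0 \<or> x3 \<noteq> 0" "z1 \<noteq> 0 \<or> z2 \<noteq> 0 \<or> z3 \<noteq> 0"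
      | "x1 = 0 \<and> x2 = 0 \<and> x3 = 0" "a > 0" | "z1 = 0 \<and> z2 = 0 \<and> z3 = 0" "b > 0"
      | "a = 0" "b = 0" | "a = 0" "b > 0" "x1 = 0 \<and> x2 = 0 \<and> x3 = 0" "z1 \<noteq> 0 \<or> z2 \<noteq> 0 \<or> z3 \<noteq> 0"
      | "b = 0" "a > 0" "z1 = 0 \<and> z2 = 0 \<and> z3 = 0" "x1 \<noteq> 0 \<or> x2 \<noteq> 0 \<or> x3 \<noteq> 0" by blast
    then show ?thesis
    proof cases
      case 1 then show ?thesis using nz c by blast
    next
      case 2
      have z: "(0::complex) ^ a = 0" using 2(2) by simp
      then have "P 0 0 0 z1 z2 z3 = 0" for z1 z2 z3 using hz(1)[of z1 z2 z3] unfolding z by simp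
      then show ?thesis using X0 2(1) by (simp add: Q_def)
    next
      case 3
      have z: "(0::complex) ^ b = 0" using 3(2) by simp
      then have "P x1 x2 x3 0 0 0 = 0" for x1 x2 x3 using hz(2)[of x1 x2 x3] unfolding z by simp
      then show ?thesis using X0 3(1) by (simp add: Q_def)
    next
      case 4 then show ?thesis
        using bihom_degree_0[OF P] unfolding Q_def by metis
    next
      case 5
      obtain y1 y2 y3 where y: "on_cone y1 y2 y3 z1 z2 z3" "y1 \<noteq> 0 \<or> y2 \<noteq> 0 \<or> y3 \<noteq> 0"
        using orthogonal_nonzero[of z1 z2 z3] by (auto simp: on_cone_def mult.commute)
      have "Q x1 x2 x3 z1 z2 z3 = Q y1 y2 y3 z1 z2 z3" unfolding Q_def by (rule bihom_degree_0(1)[OF P 5(1)])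
      also have "\<dots> = P y1 y2 y3 z1 z2 z3" by (rule nz[OF y 5(4)])
      also have "\<dots> = P x1 x2 x3 z1 z2 z3" by (rule bihom_degree_0(1)[OF P 5(1)])
      finally show ?thesis .
    next
      case 6
      obtain y1 y2 y3 where y: "on_cone x1 x2 x3 y1 y2 y3" "y1 \<noteq> 0 \<or> y2 \<noteq> 0 \<or> y3 \<noteq> 0"
        using orthogonal_nonzero by blast
      have "Q x1 x2 x3 z1 z2 z3 = Q x1 x2 x3 y1 y2 y3" unfolding Q_def by (rule bihom_degree_0(2)[OF P 6(1)])
      also have "\<dots> = P x1 x2 x3 y1 y2 y3" by (rule nz[OF y(1) 6(4) y(2)])
      also have "\<dots> = P x1 x2 x3 z1 z2 z3" by (rule bihom_degree_0(2)[OF P 6(1)])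
      finally show ?thesis .
    qed
  qed
  then show ?thesis by (simp add: cone_inv_def Q_def X_def Z_def)
qed

section \<open>Cyclic subspaces and their coefficient functions\<close>

context su3_rep
begin

text \<open>The span of the orbit of \<open>v\<close>, generated one orbit vector at a time, so that
  coefficient functions can be treated by induction.\<close>

inductive_set cyc :: "('i \<Rightarrow> complex) \<Rightarrow> ('i \<Rightarrow> complex) set" for v where
  cyc_zero: "0 \<in> cyc v"
| cyc_step: "w \<in> cyc v \<Longrightarrow> g \<in> carrier SU3 \<Longrightarrow> w + scl c (R g v) \<in> cyc v"

lemma cyc_invariant: assumes "v \<in> V" shows "invariant_sub (cyc v)"
proof -
  have add: "x \<in> cyc v \<Longrightarrow> w + x \<in> cyc v" if "w \<in> cyc v" for w x
  proof (induction rule: cyc.induct)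
    case cyc_zero then show ?case using that by simp
  next
    case (cyc_step x g c)
    then show ?case using cyc.cyc_step[of "w + x" v g c] by (simp add: add.assoc)
  qed
  have scl: "x \<in> cyc v \<Longrightarrow> scl d x \<in> cyc v" for x d
  proof (induction rule: cyc.induct)
    case (cyc_step x g c)
    then show ?case using cyc.cyc_step[of "scl d x" v g "d * c"] by (simp add: scl_add)
  qed (simp add: cyc_zero)
  have RR: "x \<in> cyc v \<Longrightarrow> R h x \<in> cyc v" if h: "h \<in> carrier SU3" for x h
  proof (induction rule: cyc.induct)
    case (cyc_step x g c)
    then show ?case using h cyc.cyc_step[of "R h x" v "h * g" c] by (simp add: R_add R_scl R_mult)
  qed (simp add: cyc_zero)
  have "x \<in> cyc v \<Longrightarrow> x \<in> V" for x
    by (induction rule: cyc.induct) (simp_all add: csubspaceD[OF V_csubspace])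
  then show ?thesis
    unfolding invariant_sub_def csubspace_def using add scl RR cyc_zero by blast
qed

lemma cyc_self: "v \<in> V \<Longrightarrow> v \<in> cyc v"
  using cyc_step[OF cyc_zero, where g = "1\<^sub>m 3" and c = 1 and v = v] by (simp add: R_one)

lemma cyc_subset: "invariant_sub U \<Longrightarrow> v \<in> U \<Longrightarrow> cyc v \<subseteq> U"
proof
  fix x assume U: "invariant_sub U" "v \<in> U" and "x \<in> cyc v"
  from this(3) show "x \<in> U"
    by (induction rule: cyc.induct) (use U in \<open>auto simp: invariant_sub_def csubspaceD\<close>)
qed

definition hw_functional :: "('i \<Rightarrow> complex) set \<Rightarrow> int \<times> int \<Rightarrow> (('i \<Rightarrow> complex) \<Rightarrow> complex) \<Rightarrow> bool" where
  "hw_functional U m \<phi> \<longleftrightarrow> linear_on U \<phi> \<and>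
     (\<forall>s t y. cmod s = 1 \<longrightarrow> cmod t = 1 \<longrightarrow> y \<in> U \<longrightarrow> \<phi> (R (torus s t) y) = chr m s t * \<phi> y)"

text \<open>For \<open>R h v\<close> the coefficient is given by \<open>highest_weight_coeff\<close>
  at \<open>g * h\<close>, and the two entries occurring there are linear in the first row and in
  the conjugate last row of \<open>g\<close>.\<close>

lemma cyc_coeff_bihom:
  assumes U: "invariant_sub U" and v: "v \<in> U" "v \<noteq> 0" "wt m v" and lm: "lexmax U m"
    and \<phi>: "hw_functional U m \<phi>" and w: "w \<in> cyc v"
  shows "\<exists>P. bihom (nat (fst m)) (nat (snd m)) P \<and> (\<forall>g\<in>carrier SU3. \<phi> (R g w) = row_fun P g)"
  using w
proof (induction rule: cyc.induct)
  case cyc_zero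
  have "\<phi> 0 = 0" using \<phi> linear_on_zero[OF invariantD(1)[OF U]] by (auto simp: hw_functional_def)
  then show ?case using bihom_zero by (intro exI[of _ "\<lambda>x1 x2 x3 z1 z2 z3. 0"]) (simp add: row_fun_def)
next
  case (cyc_step x h c)
  then obtain P where P: "bihom (nat (fst m)) (nat (snd m)) P" "\<And>g. g \<in> carrier SU3 \<Longrightarrow> \<phi> (R g x) = row_fun P g" by blast
  let ?P = "\<lambda>x1 x2 x3 z1 z2 z3. P x1 x2 x3 z1 z2 z3 + c * \<phi> v * pow_pair (nat (fst m)) (nat (snd m))
     (h $$ (0, 0)) (h $$ (1, 0)) (h $$ (2, 0)) (cnj (h $$ (0, 2))) (cnj (h $$ (1, 2))) (cnj (h $$ (2, 2))) x1 x2 x3 z1 z2 z3"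
  have "\<phi> (R g (x + scl c (R h v))) = row_fun ?P g" if g: "g \<in> carrier SU3" for g
  proof -
    have xU: "x \<in> U" using cyc_subset[OF U v(1)] cyc_step by blast
    have gh: "g * h \<in> carrier SU3" using g cyc_step by simp
    have "\<phi> (R g (x + scl c (R h v))) = \<phi> (R g x) + c * \<phi> (R (g * h) v)"
      using \<phi> invariantD(3)[OF U g xU] invariantD(3)[OF U gh v(1)] invariantD(1)[OF U] g cyc_step
      by (simp add: R_add R_scl R_mult hw_functional_def linear_on_def csubspaceD)
    also have "\<phi> (R (g * h) v) = ((g * h) $$ (0, 0)) ^ nat (fst m) * cnj ((g * h) $$ (2, 2)) ^ nat (snd m) * \<phi> v"
      using \<phi> highest_weight_coeff(1)[OF U v lm _ _ gh] by (simp add: hw_functional_def)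
    finally show ?thesis
      using SU3_mat[OF g] SU3_mat[OF cyc_step(2)] P(2)[OF g]
      by (simp add: row_fun_def pow_pair_def mult_index_3 del: index_mult_mat)
  qed
  then show ?case using bihom_add[OF P(1)] by blast
qed

theorem no_invariant_coeff:
  assumes U: "invariant_sub U" and v: "v \<in> U" "v \<noteq> 0" "wt m v" and lm: "lexmax U m"
    and \<phi>: "hw_functional U m \<phi>" and w: "w \<in> cyc v"
    and fixed: "\<And>k. k \<in> {matA 2, matE, matW, matF} \<Longrightarrow> R k w = w"
    and lab: "(nat (fst m), nat (snd m)) \<in> interaction_labels" and g: "g \<in> carrier SU3"
  shows "\<phi> (R g w) = 0"
proof -
  obtain P where P: "bihom (nat (fst m)) (nat (snd m)) P" "\<And>g. g \<in> carrier SU3 \<Longrightarrow> \<phi> (R g w) = row_fun P g"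
    using cyc_coeff_bihom[OF U v lm \<phi> w] by blast
  have "cone_inv k P" if k: "k \<in> {matA 2, matE, matW, matF}" for k
  proof (rule cone_inv_of_row_fun[OF P(1)])
    show kS: "k \<in> carrier SU3" using k matA_SU3 matE_SU3 matW_SU3 matF_SU3 by auto
    fix g assume g: "g \<in> carrier SU3"
    show "row_fun P (g * k) = row_fun P g"
      using g kS fixed[OF k] by (simp flip: P(2) add: R_mult)
  qed
  then have "row_fun P g = 0"
    by (intro row_fun_zero[OF _ g] no_cone_invariant_360[OF P(1) _ lab]) auto
  then show ?thesis using P(2)[OF g] by simp
qed

text \<open>In the absence of an inner product, functionals of weight \<open>m\<close> come from the
  coordinates of the weight projection.\<close>

lemma coordinate_functional:
  assumes "invariant_sub U"
  shows "hw_functional U m (\<lambda>y. wP m y i)"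
  unfolding hw_functional_def linear_on_def
proof (intro conjI allI ballI impI)
  fix s t y assume st: "cmod s = 1" "cmod t = 1" and y: "y \<in> U"
  have yV: "y \<in> V" using y assms invariantD by blast
  show "wP m (R (torus s t) y) i = chr m s t * wP m y i"
    using wtD(2)[OF wP(7)[OF yV] st] st by (simp add: wP(5) scl_apply)
qed (simp_all add: wP plus_fun_apply scl_apply)

definition irreducible_sub :: "('i \<Rightarrow> complex) set \<Rightarrow> bool" where
  "irreducible_sub U \<longleftrightarrow> invariant_sub U \<and> (\<forall>U'. invariant_sub U' \<longrightarrow> U' \<subseteq> U \<longrightarrow> U' = {0} \<or> U' = U)"

text \<open>The vectors killed by all translates of \<open>\<phi>\<close> form an invariant subspace
  that does not contain \<open>v\<close>, hence zero. A vector is thus determined by its coefficient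
  function.\<close>

lemma irreducible_separating:
  assumes irr: "irreducible_sub U" and v: "v \<in> U" "v \<noteq> 0" "wt m v"
  shows "cyc v = U" and "\<exists>\<phi>. hw_functional U m \<phi> \<and> (\<forall>y\<in>U. (\<forall>g\<in>carrier SU3. \<phi> (R g y) = 0) \<longrightarrow> y = 0)"
proof -
  have U: "invariant_sub U" using irr by (simp add: irreducible_sub_def)
  have vV: "v \<in> V" using v U invariantD by blast
  show "cyc v = U"
    using irr cyc_invariant[OF vV] cyc_subset[OF U v(1)] cyc_self[OF vV] v(2) by (auto simp: irreducible_sub_def)
  obtain i where i: "v i \<noteq> 0" using v(2) by (auto simp: fun_eq_iff zero_fun_apply)
  define \<phi> where "\<phi> = (\<lambda>y. wP m y i)"
  have \<phi>: "hw_functional U m \<phi>" unfolding \<phi>_def by (rule coordinate_functional[OF U])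
  have \<phi>v: "\<phi> v \<noteq> 0" using i wP(8)[OF v(3), of m] by (simp add: \<phi>_def)
  define K where "K = {y \<in> U. \<forall>g\<in>carrier SU3. \<phi> (R g y) = 0}"
  have "invariant_sub K"
  proof -
    have l: "linear_on U \<phi>" using \<phi> by (simp add: hw_functional_def)
    show ?thesis
      unfolding invariant_sub_def csubspace_def K_def
      using U l linear_on_zero[OF invariantD(1)[OF U] l]
      by (auto simp: invariantD csubspaceD[OF invariantD(1)[OF U]] R_add R_scl linear_on_def simp flip: R_mult)
        (use invariantD(2)[OF U] in blast)
  qed
  moreover have "v \<notin> K" 
  proof
    assume "v \<in> K"
    then have "\<phi> (R (1\<^sub>m 3) v) = 0" using SU3_one unfolding K_def by blast
    then show False using \<phi>v R_one[OF vV] by simp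
  qed
  ultimately have "K = {0}" using irr v(1) by (auto simp: irreducible_sub_def K_def)
  then have "\<forall>y\<in>U. (\<forall>g\<in>carrier SU3. \<phi> (R g y) = 0) \<longrightarrow> y = 0" unfolding K_def by blast
  then show "\<exists>\<phi>. hw_functional U m \<phi> \<and> (\<forall>y\<in>U. (\<forall>g\<in>carrier SU3. \<phi> (R g y) = 0) \<longrightarrow> y = 0)"
    using \<phi> by blast
qed

theorem irreducible_no_invariant:
  assumes irr: "irreducible_sub U" and v: "v \<in> U" "v \<noteq> 0" "wt m v" and lm: "lexmax U m"
    and lab: "(nat (fst m), nat (snd m)) \<in> interaction_labels" and w: "w \<in> U"
    and fixed: "\<And>k. k \<in> {matA 2, matE, matW, matF} \<Longrightarrow> R k w = w"
  shows "w = 0"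
proof -
  have U: "invariant_sub U" using irr by (simp add: irreducible_sub_def)
  obtain \<phi> where \<phi>: "hw_functional U m \<phi>" "\<forall>y\<in>U. (\<forall>g\<in>carrier SU3. \<phi> (R g y) = 0) \<longrightarrow> y = 0"
    using irreducible_separating(2)[OF irr v] by blast
  have "w \<in> cyc v" using irreducible_separating(1)[OF irr v] w by simp
  then show ?thesis using \<phi>(2) w no_invariant_coeff[OF U v lm \<phi>(1) _ fixed lab] by blast
qed

end

section \<open>Dominance of weights\<close>

lemma finite_lexmax:
  fixes f h :: "'a \<Rightarrow> int"
  assumes "finite S" "S \<noteq> {}"
  shows "\<exists>m\<in>S. \<forall>x\<in>S. f x < f m \<or> f x = f m \<and> h x \<le> h m"
proof -
  define S' where "S' = {x \<in> S. f x = Max (f ` S)}"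
  have "Max (f ` S) \<in> f ` S" using assms by (intro Max_in) auto
  then obtain x0 where "x0 \<in> S" "f x0 = Max (f ` S)" by (metis imageE)
  then have "S' \<noteq> {}" "finite S'" using assms by (auto simp: S'_def)
  then have "Max (h ` S') \<in> h ` S'" by (intro Max_in) auto
  then obtain m where m: "m \<in> S'" "h m = Max (h ` S')" by auto
  have "f x < f m \<or> f x = f m \<and> h x \<le> h m" if x: "x \<in> S" for x
  proof -
    have "f x \<le> f m" using m x assms by (auto simp: S'_def)
    moreover have "h x \<le> h m" if "f x = f m"
      using m x that \<open>finite S'\<close> by (auto simp: S'_def)
    ultimately show ?thesis by linarith
  qed
  moreover have "m \<in> S" using m(1) by (simp add: S'_def)
  ultimately show ?thesis by blast
qed

text \<open>Trigonometric polynomials with all weights below \<open>m\<close> in the dominance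
  order. They serve to read off the weight of a vector from its coefficient function along the
  torus.\<close>

inductive char_span :: "int \<times> int \<Rightarrow> (complex \<Rightarrow> complex \<Rightarrow> complex) \<Rightarrow> bool" for m where
  char_span_zero: "char_span m (\<lambda>s t. 0)"
| char_span_step: "char_span m f \<Longrightarrow> weight_le \<mu> m \<Longrightarrow> char_span m (\<lambda>s t. f s t + c * chr \<mu> s t)"

lemma char_span_add: "char_span m g \<Longrightarrow> char_span m f \<Longrightarrow> char_span m (\<lambda>s t. f s t + g s t)"
proof (induction rule: char_span.induct)
  case (char_span_step g \<mu> c)
  from char_span.char_span_step[OF char_span_step.IH[OF char_span_step.prems] char_span_step.hyps(2), of c]
  show ?case by (simp add: add.assoc)
qed simp

lemma char_span_cmult: "char_span m f \<Longrightarrow> char_span m (\<lambda>s t. c * f s t)"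
proof (induction rule: char_span.induct)
  case char_span_zero then show ?case by (simp add: char_span.char_span_zero)
next
  case (char_span_step f \<mu> d)
  from char_span.char_span_step[OF char_span_step.IH char_span_step.hyps(2), of "c * d"]
  show ?case by (simp add: algebra_simps)
qed

lemma weight_le_refl: "weight_le m m"
  unfolding weight_le_def by (rule exI[of _ 0], rule exI[of _ 0]) simp

lemma weight_le_add: "weight_le a b \<Longrightarrow> weight_le c d \<Longrightarrow> weight_le (fst a + fst c, snd a + snd c) (fst b + fst d, snd b + snd d)"
proof -
  assume "weight_le a b" "weight_le c d"
  then obtain x y x' y' :: nat where "fst b - fst a = 2 * int x - int y" "snd b - snd a = 2 * int y - int x"
    "fst d - fst c = 2 * int x' - int y'" "snd d - snd c = 2 * int y' - int x'" unfolding weight_le_def by blast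
  then show ?thesis unfolding weight_le_def by (intro exI[of _ "x + x'"] exI[of _ "y + y'"]) simp
qed

lemma weight_le_iff:
  "weight_le k m \<longleftrightarrow> (\<exists>a b::int. 0 \<le> a \<and> 0 \<le> b \<and> fst m - fst k = 2 * a - b \<and> snd m - snd k = 2 * b - a)"
  unfolding weight_le_def
proof (intro iffI; elim exE conjE)
  fix a b :: int assume "0 \<le> a" "0 \<le> b" "fst m - fst k = 2 * a - b" "snd m - snd k = 2 * b - a"
  then show "\<exists>a b::nat. fst m - fst k = 2 * int a - int b \<and> snd m - snd k = 2 * int b - int a"
    by (intro exI[of _ "nat a"] exI[of _ "nat b"]) simp
qed (meson of_nat_0_le_iff)

lemma chr_mult: "cmod s = 1 \<Longrightarrow> cmod t = 1 \<Longrightarrow> chr \<mu> s t * chr \<nu> s t = chr (fst \<mu> + fst \<nu>, snd \<mu> + snd \<nu>) s t"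
  by (simp add: chr_def powi_unit_simps norm_mult)

lemma chr_torus_mult: "cmod s = 1 \<Longrightarrow> cmod t = 1 \<Longrightarrow> chr \<mu> (s * s') (t * t') = chr \<mu> s t * chr \<mu> s' t'"
  by (simp add: chr_def power_int_mult_distrib mult_ac)

text \<open>Characters are multiplicative only for nonzero arguments and conjugates are inverses
  only on the circle, hence equality is demanded for unimodular arguments.\<close>

definition char_poly_on :: "int \<times> int \<Rightarrow> (complex \<Rightarrow> complex \<Rightarrow> complex) \<Rightarrow> bool" where
  "char_poly_on m f \<longleftrightarrow> (\<exists>g. char_span m g \<and> (\<forall>s t. cmod s = 1 \<longrightarrow> cmod t = 1 \<longrightarrow> f s t = g s t))"

lemma char_poly_on_cong: "char_poly_on m f \<Longrightarrow> (\<And>s t. cmod s = 1 \<Longrightarrow> cmod t = 1 \<Longrightarrow> f' s t = f s t) \<Longrightarrow> char_poly_on m f'"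
  unfolding char_poly_on_def by metis

lemma char_poly_on_add: "char_poly_on m f \<Longrightarrow> char_poly_on m g \<Longrightarrow> char_poly_on m (\<lambda>s t. f s t + g s t)"
  unfolding char_poly_on_def using char_span_add by (metis (no_types, lifting))

lemma char_poly_on_cmult: "char_poly_on m f \<Longrightarrow> char_poly_on m (\<lambda>s t. c * f s t)"
  unfolding char_poly_on_def using char_span_cmult by (metis (no_types, lifting))

lemma char_poly_on_sum: "(\<And>i. i \<in> N \<Longrightarrow> char_poly_on m (f i)) \<Longrightarrow> char_poly_on m (\<lambda>s t. \<Sum>i\<in>N. f i s t)"
proof (induction N rule: infinite_finite_induct)
  case (insert x F)
  then have "char_poly_on m (\<lambda>s t. f x s t + (\<Sum>i\<in>F. f i s t))" by (intro char_poly_on_add) auto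
  then show ?case using insert by simp
qed (auto simp: char_poly_on_def intro: char_span_zero)

lemma char_poly_on_mult_chr:
  assumes f: "char_poly_on m f" and \<mu>: "weight_le \<mu> k"
  shows "char_poly_on (fst m + fst k, snd m + snd k) (\<lambda>s t. c * chr \<mu> s t * f s t)"
proof -
  obtain g where g: "char_span m g" "\<And>s t. cmod s = 1 \<Longrightarrow> cmod t = 1 \<Longrightarrow> f s t = g s t"
    using f unfolding char_poly_on_def by blast
  from g(1) have "char_poly_on (fst m + fst k, snd m + snd k) (\<lambda>s t. c * chr \<mu> s t * g s t)"
  proof (induction rule: char_span.induct)
    case char_span_zero
    then show ?case by (auto simp: char_poly_on_def intro: char_span.char_span_zero)
  next
    case (char_span_step g \<nu> d)
    have "weight_le (fst \<mu> + fst \<nu>, snd \<mu> + snd \<nu>) (fst m + fst k, snd m + snd k)"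
      using weight_le_add[OF \<mu> char_span_step.hyps(2)] by (simp add: add.commute)
    then have "char_poly_on (fst m + fst k, snd m + snd k) (\<lambda>s t. 0 + (c * d) * chr (fst \<mu> + fst \<nu>, snd \<mu> + snd \<nu>) s t)"
      unfolding char_poly_on_def using char_span.char_span_step[OF char_span.char_span_zero] by blast
    from char_poly_on_add[OF char_span_step.IH this] show ?case
      by (rule char_poly_on_cong) (simp add: algebra_simps flip: chr_mult)
  qed
  then show ?thesis by (rule char_poly_on_cong) (simp add: g(2))
qed

lemma char_poly_on_pow:
  assumes "weight_le \<mu>1 k" "weight_le \<mu>2 k" "weight_le \<mu>3 k"
  shows "char_poly_on (int n * fst k, int n * snd k) (\<lambda>s t. (a * chr \<mu>1 s t + b * chr \<mu>2 s t + c * chr \<mu>3 s t) ^ n)"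
proof (induction n)
  case 0
  have "char_poly_on (0, 0) (\<lambda>s t. 0 + 1 * chr (0, 0) s t)"
    unfolding char_poly_on_def using char_span_step[OF char_span_zero weight_le_refl] by blast
  then show ?case by (simp add: chr_def)
next
  case (Suc n)
  let ?L = "\<lambda>s t. (a * chr \<mu>1 s t + b * chr \<mu>2 s t + c * chr \<mu>3 s t) ^ n"
  note m = char_poly_on_mult_chr[OF Suc]
  have "char_poly_on (int n * fst k + fst k, int n * snd k + snd k)
     (\<lambda>s t. a * chr \<mu>1 s t * ?L s t + b * chr \<mu>2 s t * ?L s t + c * chr \<mu>3 s t * ?L s t)"
    using m[OF assms(1), of a] m[OF assms(2), of b] m[OF assms(3), of c] by (simp add: char_poly_on_add)
  then show ?case by (simp add: algebra_simps)
qed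

lemma char_poly_on_mult:
  assumes f: "char_poly_on m f" and g: "char_poly_on k g"
  shows "char_poly_on (fst m + fst k, snd m + snd k) (\<lambda>s t. g s t * f s t)"
proof -
  obtain g' where g': "char_span k g'" "\<And>s t. cmod s = 1 \<Longrightarrow> cmod t = 1 \<Longrightarrow> g s t = g' s t"
    using g unfolding char_poly_on_def by blast
  from g'(1) have "char_poly_on (fst m + fst k, snd m + snd k) (\<lambda>s t. g' s t * f s t)"
  proof (induction rule: char_span.induct)
    case char_span_zero
    then show ?case by (auto simp: char_poly_on_def intro: char_span.char_span_zero)
  next
    case (char_span_step g \<mu> c)
    from char_poly_on_add[OF char_span_step.IH char_poly_on_mult_chr[OF f char_span_step.hyps(2), of c]]
    show ?case by (rule char_poly_on_cong) (simp add: algebra_simps)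
  qed
  then show ?thesis by (rule char_poly_on_cong) (simp add: g'(2))
qed

text \<open>Artin's argument: translating the relation by \<open>(s0, t0)\<close> and subtracting
  \<open>chr \<kappa> s0 t0\<close> times the original one removes the term of
  \<open>\<kappa>\<close>.\<close>

lemma char_independent:
  assumes "finite M" "\<And>s t. cmod s = 1 \<Longrightarrow> cmod t = 1 \<Longrightarrow> (\<Sum>\<mu>\<in>M. c \<mu> * chr \<mu> s t) = 0" "\<nu> \<in> M"
  shows "c \<nu> = 0"
  using assms
proof (induction M arbitrary: c \<nu> rule: finite_induct)
  case (insert \<kappa> M)
  have z: "c \<mu> = 0" if \<mu>: "\<mu> \<in> M" for \<mu>
  proof (rule ccontr)
    assume c0: "c \<mu> \<noteq> 0"
    have "chr \<mu> s0 t0 = chr \<kappa> s0 t0" if st0: "cmod s0 = 1" "cmod t0 = 1" for s0 t0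
    proof -
      have "(\<Sum>\<mu>\<in>M. (c \<mu> * (chr \<mu> s0 t0 - chr \<kappa> s0 t0)) * chr \<mu> s t) = 0" if st: "cmod s = 1" "cmod t = 1" for s t
      proof -
        have 1: "c \<kappa> * chr \<kappa> s t + (\<Sum>\<mu>\<in>M. c \<mu> * chr \<mu> s t) = 0"
          using insert.prems(1)[OF st] insert.hyps by simp
        have 2: "c \<kappa> * (chr \<kappa> s0 t0 * chr \<kappa> s t) + (\<Sum>\<mu>\<in>M. c \<mu> * (chr \<mu> s0 t0 * chr \<mu> s t)) = 0"
          using insert.prems(1)[of "s0 * s" "t0 * t"] insert.hyps st st0 by (simp add: norm_mult chr_torus_mult)
        have "(\<Sum>\<mu>\<in>M. (c \<mu> * (chr \<mu> s0 t0 - chr \<kappa> s0 t0)) * chr \<mu> s t)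
          = (\<Sum>\<mu>\<in>M. c \<mu> * (chr \<mu> s0 t0 * chr \<mu> s t)) - chr \<kappa> s0 t0 * (\<Sum>\<mu>\<in>M. c \<mu> * chr \<mu> s t)"
          by (simp add: sum_distrib_left algebra_simps sum_subtractf)
        then show ?thesis using 1 2 by Groebner_Basis.algebra
      qed
      then have "c \<mu> * (chr \<mu> s0 t0 - chr \<kappa> s0 t0) = 0" by (rule insert.IH[where c = "\<lambda>\<mu>. c \<mu> * (chr \<mu> s0 t0 - chr \<kappa> s0 t0)", OF _ \<mu>])
      then show ?thesis using c0 by simp
    qed
    then have "\<mu> = \<kappa>" by (rule chr_inj)
    then show False using \<mu> insert.hyps by blast
  qed
  then have "c \<kappa> * chr \<kappa> 1 1 = 0" using insert.prems(1)[of 1 1] insert.hyps by simp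
  then have "c \<kappa> = 0" by (simp add: chr_def)
  then show ?case using z insert.prems(2) by blast
qed simp

lemma char_span_finite_form:
  "char_span m f \<Longrightarrow> \<exists>M c. finite M \<and> (\<forall>\<mu>\<in>M. weight_le \<mu> m) \<and> (\<forall>s t. f s t = (\<Sum>\<mu>\<in>M. c \<mu> * chr \<mu> s t))"
proof (induction rule: char_span.induct)
  case char_span_zero then show ?case by (rule_tac x = "{}" in exI) simp
next
  case (char_span_step f \<nu> d)
  then obtain M c where M: "finite M" "\<forall>\<mu>\<in>M. weight_le \<mu> m" "\<And>s t. f s t = (\<Sum>\<mu>\<in>M. c \<mu> * chr \<mu> s t)" by blast
  define c' where "c' \<mu> = (if \<mu> \<in> M then c \<mu> else 0) + (if \<mu> = \<nu> then d else 0)" for \<mu>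
  have "f s t + d * chr \<nu> s t = (\<Sum>\<mu>\<in>insert \<nu> M. c' \<mu> * chr \<mu> s t)" for s t
  proof -
    have "(\<Sum>\<mu>\<in>insert \<nu> M. c' \<mu> * chr \<mu> s t) = (\<Sum>\<mu>\<in>insert \<nu> M. if \<mu> \<in> M then c \<mu> * chr \<mu> s t else 0)
       + (\<Sum>\<mu>\<in>insert \<nu> M. if \<mu> = \<nu> then d * chr \<nu> s t else 0)"
      unfolding sum.distrib[symmetric] by (intro sum.cong) (auto simp: c'_def algebra_simps)
    also have "(\<Sum>\<mu>\<in>insert \<nu> M. if \<mu> \<in> M then c \<mu> * chr \<mu> s t else 0) = (\<Sum>\<mu>\<in>M. c \<mu> * chr \<mu> s t)"
      using M(1) by (intro sum.mono_neutral_cong_right) auto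
    also have "(\<Sum>\<mu>\<in>insert \<nu> M. if \<mu> = \<nu> then d * chr \<nu> s t else 0) = d * chr \<nu> s t"
      using M(1) by simp
    finally show ?thesis by (simp add: M(3))
  qed
  then show ?case using M(1,2) char_span_step.hyps(2) by (intro exI[of _ "insert \<nu> M"] exI[of _ c']) auto
qed

lemma char_poly_on_weight:
  assumes f: "char_poly_on m f" and e: "\<And>s t. cmod s = 1 \<Longrightarrow> cmod t = 1 \<Longrightarrow> f s t = d * chr \<nu> s t" and d: "d \<noteq> 0"
  shows "weight_le \<nu> m"
proof -
  obtain g where g: "char_span m g" "\<And>s t. cmod s = 1 \<Longrightarrow> cmod t = 1 \<Longrightarrow> f s t = g s t"
    using f unfolding char_poly_on_def by blast
  obtain M c where M: "finite M" "\<forall>\<mu>\<in>M. weight_le \<mu> m" "\<And>s t. g s t = (\<Sum>\<mu>\<in>M. c \<mu> * chr \<mu> s t)"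
    using char_span_finite_form[OF g(1)] by blast
  have "\<nu> \<in> M"
  proof (rule ccontr)
    assume \<nu>: "\<nu> \<notin> M"
    define c' where "c' = c(\<nu> := - d)"
    have "(\<Sum>\<mu>\<in>insert \<nu> M. c' \<mu> * chr \<mu> s t) = 0" if st: "cmod s = 1" "cmod t = 1" for s t
    proof -
      have "(\<Sum>\<mu>\<in>M. c' \<mu> * chr \<mu> s t) = (\<Sum>\<mu>\<in>M. c \<mu> * chr \<mu> s t)"
        using \<nu> by (intro sum.cong) (auto simp: c'_def)
      then show ?thesis using M \<nu> g(2)[OF st] e[OF st] by (simp add: c'_def)
    qed
    then have "c' \<nu> = 0" using M(1) by (rule_tac char_independent[where M = "insert \<nu> M" and c = c']) auto
    then show False using d by (simp add: c'_def)
  qed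
  then show ?thesis using M(2) by blast
qed

text \<open>Right translation by the torus multiplies the entries of the first row by the weights of
  the standard representation, all below \<open>(1, 0)\<close>, and those of the conjugate last row
  by the dual weights, all below \<open>(0, 1)\<close>.\<close>

lemma row_fun_torus_char_poly:
  assumes P: "bihom a b P" and g: "g \<in> carrier SU3"
  shows "char_poly_on (int a, int b) (\<lambda>s t. row_fun P (g * torus s t))"
proof -
  obtain N :: "nat set" and c p1 p2 p3 q1 q2 q3 where "finite N" and PN: "P = (\<lambda>x1 x2 x3 z1 z2 z3.
     \<Sum>i\<in>N. c i * pow_pair a b (p1 i) (p2 i) (p3 i) (q1 i) (q2 i) (q3 i) x1 x2 x3 z1 z2 z3)"
    using P unfolding bihom_def by blast
  define f where "f i s t = c i *
     ((cnj (g $$ (2, 0)) * q1 i * chr (- 1, 0) s t + cnj (g $$ (2, 1)) * q2 i * chr (1, - 1) s t + cnj (g $$ (2, 2)) * q3 i * chr (0, 1) s t) ^ b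
      * (g $$ (0, 0) * p1 i * chr (1, 0) s t + g $$ (0, 1) * p2 i * chr (- 1, 1) s t + g $$ (0, 2) * p3 i * chr (0, - 1) s t) ^ a)" for i s t
  have w1: "weight_le (1, 0) (1, 0)" "weight_le (- 1, 1) (1, 0)" "weight_le (0, - 1) (1, 0)"
    unfolding weight_le_iff
    by (rule exI[of _ 0], rule exI[of _ 0], simp) (rule exI[of _ 1], rule exI[of _ 0], simp, rule exI[of _ 1], rule exI[of _ 1], simp)
  have w2: "weight_le (- 1, 0) (0, 1)" "weight_le (1, - 1) (0, 1)" "weight_le (0, 1) (0, 1)"
    unfolding weight_le_iff
    by (rule exI[of _ 1], rule exI[of _ 1], simp) (rule exI[of _ 0], rule exI[of _ 1], simp, rule exI[of _ 0], rule exI[of _ 0], simp)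
  have "char_poly_on (int a, int b) (f i)" for i
    using char_poly_on_cmult[OF char_poly_on_mult[OF char_poly_on_pow[OF w1, of a] char_poly_on_pow[OF w2, of b]], of "c i"]
    unfolding f_def[abs_def] by simp
  then have "char_poly_on (int a, int b) (\<lambda>s t. \<Sum>i\<in>N. f i s t)" by (rule char_poly_on_sum)
  then show ?thesis
  proof (rule char_poly_on_cong)
    fix s t :: complex assume st: "cmod s = 1" "cmod t = 1"
    then have i: "cnj s = inverse s" "cnj t = inverse t" "s \<noteq> 0" "t \<noteq> 0" by (auto simp: cmod_1_inverse)
    have gt: "(g * torus s t) $$ (k, 0) = g $$ (k, 0) * s" "(g * torus s t) $$ (k, 1) = g $$ (k, 1) * t"
      "(g * torus s t) $$ (k, 2) = g $$ (k, 2) * inverse (s * t)" if "k < 3" for k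
      using that SU3_mat[OF g] SU3_mat[OF torus_SU3[OF st]]
      by (simp_all add: mult_index_3 torus_M3 del: index_mult_mat)
    have ch: "chr (- 1, 0) s t = inverse s" "chr (1, - 1) s t = inverse t" "chr (0, 1) s t = s * t"
      "chr (1, 0) s t = s" "chr (- 1, 1) s t = t" "chr (0, - 1) s t = inverse (s * t)"
      using i by (simp_all add: chr_def power_int_minus field_simps)
    show "row_fun P (g * torus s t) = (\<Sum>i\<in>N. f i s t)"
      unfolding row_fun_def PN f_def pow_pair_def using i
      by (intro sum.cong refl) (simp add: gt gt[unfolded One_nat_def] ch mult_ac)
  qed
qed

context su3_rep
begin

lemma lexmax_exists:
  assumes U: "invariant_sub U" and u: "u \<in> U" "u \<noteq> 0"
  shows "\<exists>m v. v \<in> U \<and> v \<noteq> 0 \<and> wt m v \<and> lexmax U m"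
proof -
  define S where "S = {\<nu>. \<exists>y\<in>U. y \<noteq> 0 \<and> wt \<nu> y}"
  have uV: "u \<in> V" using u U invariantD by blast
  have "S \<subseteq> wM" using wP(9) by (auto simp: S_def)
  then have fS: "finite S" using wP(1) finite_subset by blast
  have "\<exists>\<nu>\<in>wM. wP \<nu> u \<noteq> 0"
  proof (rule ccontr)
    assume "\<not> (\<exists>\<nu>\<in>wM. wP \<nu> u \<noteq> 0)"
    then have "(\<Sum>\<nu>\<in>wM. wP \<nu> u) = 0" by (intro sum.neutral) auto
    then show False using wP(6)[OF uV] u(2) by (simp only:)
  qed
  then have "S \<noteq> {}" using wP(4)[OF U u(1)] wP(7)[OF uV] unfolding S_def by blast
  from finite_lexmax[OF fS this, of "\<lambda>\<nu>. fst \<nu> + 2 * snd \<nu>" "\<lambda>\<nu>. 2 * fst \<nu> + snd \<nu>"]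
  show ?thesis unfolding S_def lexmax_def by blast
qed

text \<open>Along the torus the coefficient function of \<open>y\<close> is a nonzero multiple of
  \<open>chr \<nu>\<close> and also a polynomial with weights below \<open>m\<close>, so
  independence of characters puts \<open>\<nu>\<close> below \<open>m\<close>. This upgrades the
  lexicographic maximum to a highest weight.\<close>

theorem irreducible_dominated:
  assumes irr: "irreducible_sub U" and v: "v \<in> U" "v \<noteq> 0" "wt m v" and lm: "lexmax U m"
    and y: "y \<in> U" "y \<noteq> 0" "wt \<nu> y"
  shows "weight_le \<nu> m"
proof -
  have U: "invariant_sub U" using irr by (simp add: irreducible_sub_def)
  obtain \<phi> where \<phi>: "hw_functional U m \<phi>" "\<forall>y\<in>U. (\<forall>g\<in>carrier SU3. \<phi> (R g y) = 0) \<longrightarrow> y = 0"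
    using irreducible_separating(2)[OF irr v] by blast
  have l: "linear_on U \<phi>" using \<phi>(1) by (simp add: hw_functional_def)
  have "y \<in> cyc v" using irreducible_separating(1)[OF irr v] y(1) by simp
  from cyc_coeff_bihom[OF U v lm \<phi>(1) this] obtain P where
    P: "bihom (nat (fst m)) (nat (snd m)) P" "\<And>g. g \<in> carrier SU3 \<Longrightarrow> \<phi> (R g y) = row_fun P g" by blast
  obtain g where g: "g \<in> carrier SU3" "\<phi> (R g y) \<noteq> 0" using \<phi>(2) y by blast
  have m0: "0 \<le> fst m" "0 \<le> snd m"
    using highest_weight_coeff(2,3)[OF U v lm l _ g(1)] \<phi>(1) by (auto simp: hw_functional_def)
  have "char_poly_on m (\<lambda>s t. row_fun P (g * torus s t))"
    using row_fun_torus_char_poly[OF P(1) g(1)] m0 by simp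
  then show ?thesis
  proof (rule char_poly_on_weight)
    fix s t :: complex assume st: "cmod s = 1" "cmod t = 1"
    have "row_fun P (g * torus s t) = \<phi> (R g (scl (chr \<nu> s t) y))"
      using g st wtD(2)[OF y(3) st] by (simp flip: P(2) add: R_mult)
    then show "row_fun P (g * torus s t) = \<phi> (R g y) * chr \<nu> s t"
      using l invariantD(3)[OF U g(1) y(1)] by (simp add: R_scl linear_on_def mult.commute)
  qed (rule g(2))
qed

end

section \<open>Transfer between matrix representations and function spaces\<close>

lemma vec_subspace_iff:
  "VectorSpace.subspace class_ring U (module_vec TYPE(complex) n) \<longleftrightarrow> U \<subseteq> carrier_vec n \<and> 0\<^sub>v n \<in> U \<and>
     (\<forall>u\<in>U. \<forall>v\<in>U. u + v \<in> U) \<and> (\<forall>c. \<forall>v\<in>U. c \<cdot>\<^sub>v v \<in> U)"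
  using vec_vs[where 'a = complex and n = n] vec_module[where 'a = complex and n = n]
  by (auto simp: VectorSpace.subspace_def submodule_def module_vec_simps)

definition vfun :: "complex vec \<Rightarrow> nat \<Rightarrow> complex" where
  "vfun v = (\<lambda>i. if i < dim_vec v then v $ i else 0)"

lemma vfun_add: "u \<in> carrier_vec n \<Longrightarrow> v \<in> carrier_vec n \<Longrightarrow> vfun (u + v) = vfun u + vfun v"
  by (auto simp: vfun_def fun_eq_iff plus_fun_apply)

lemma vfun_smult: "vfun (c \<cdot>\<^sub>v v) = scl c (vfun v)"
  by (auto simp: vfun_def fun_eq_iff scl_apply)

lemma vfun_zero: "vfun (0\<^sub>v n) = 0"
  by (auto simp: vfun_def fun_eq_iff zero_fun_apply)

lemma vfun_inj: "u \<in> carrier_vec n \<Longrightarrow> v \<in> carrier_vec n \<Longrightarrow> vfun u = vfun v \<longleftrightarrow> u = v"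
proof
  assume c: "u \<in> carrier_vec n" "v \<in> carrier_vec n" and e: "vfun u = vfun v"
  show "u = v"
  proof (rule eq_vecI)
    fix i assume "i < dim_vec v"
    then show "u $ i = v $ i" using fun_cong[OF e, of i] c by (simp add: vfun_def)
  qed (use c in simp)
qed simp

lemma vfun_vec: "(\<And>i. i \<ge> n \<Longrightarrow> f i = 0) \<Longrightarrow> vfun (vec n f) = f"
  by (auto simp: vfun_def fun_eq_iff)

lemma SU3_rep_su3_rep:
  assumes "SU3_rep n \<rho>"
  shows "su3_rep {..<n} (\<lambda>g i j. \<rho> g $$ (i, j))"
proof
  fix g h :: "complex mat" and i k assume "g \<in> carrier SU3" "h \<in> carrier SU3" "i \<in> {..<n}" "k \<in> {..<n}"
  then show "\<rho> (g * h) $$ (i, k) = (\<Sum>j<n. \<rho> g $$ (i, j) * \<rho> h $$ (j, k))"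
    using assms by (simp add: SU3_rep_def mat_mult_index_sum[of _ n n _ n] del: index_mult_mat)
next
  fix X :: "nat \<Rightarrow> complex mat" and g i j
  assume "\<And>n. X n \<in> carrier SU3" "g \<in> carrier SU3" "mat_tendsto 3 X g" "i \<in> {..<n}" "j \<in> {..<n}"
  then show "(\<lambda>k. \<rho> (X k) $$ (i, j)) \<longlonglongrightarrow> \<rho> g $$ (i, j)"
    using assms unfolding SU3_rep_def mat_tendsto_def by blast
qed (use assms in \<open>auto simp: SU3_rep_def\<close>)

locale mat_rep =
  fixes n :: nat and \<rho> :: "complex mat \<Rightarrow> complex mat"
  assumes rep: "SU3_rep n \<rho>"
begin

sublocale su3_rep "{..<n}" "\<lambda>g i j. \<rho> g $$ (i, j)"
  by (rule SU3_rep_su3_rep[OF rep])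

lemma rho_carrier: "g \<in> carrier SU3 \<Longrightarrow> \<rho> g \<in> carrier_mat n n"
  using rep by (simp add: SU3_rep_def)

lemma vfun_V: "v \<in> carrier_vec n \<Longrightarrow> vfun v \<in> V"
  by (auto simp: V_def vfun_def)

lemma V_vfun: "f \<in> V \<Longrightarrow> vfun (vec n f) = f"
  by (intro vfun_vec) (auto simp: V_def)

lemma R_vfun: "g \<in> carrier SU3 \<Longrightarrow> v \<in> carrier_vec n \<Longrightarrow> R g (vfun v) = vfun (\<rho> g *\<^sub>v v)"
  using rho_carrier[of g]
  by (auto simp: R_def vfun_def fun_eq_iff scalar_prod_def atLeast0LessThan intro!: sum.cong)

lemma is_weight_iff: "is_weight n \<rho> m \<longleftrightarrow> (\<exists>u. u \<noteq> 0 \<and> wt m u)"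
proof
  assume "is_weight n \<rho> m"
  then obtain v where v: "v \<in> carrier_vec n" "v \<noteq> 0\<^sub>v n"
    "\<And>s t. cmod s = 1 \<Longrightarrow> cmod t = 1 \<Longrightarrow> \<rho> (torus s t) *\<^sub>v v = chr m s t \<cdot>\<^sub>v v"
    unfolding is_weight_def chr_def by blast
  have "vfun v \<noteq> 0" using v vfun_inj[of v n "0\<^sub>v n"] by (simp add: vfun_zero)
  moreover have "wt m (vfun v)" using v by (auto simp: wt_def vfun_V R_vfun vfun_smult)
  ultimately show "\<exists>u. u \<noteq> 0 \<and> wt m u" by blast
next
  assume "\<exists>u. u \<noteq> 0 \<and> wt m u"
  then obtain u where u: "u \<noteq> 0" "wt m u" by blast
  have uV: "vfun (vec n u) = u" using V_vfun wtD(1)[OF u(2)] .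
  have "vec n u \<noteq> 0\<^sub>v n" using u(1) uV vfun_zero by metis
  moreover have "\<rho> (torus s t) *\<^sub>v vec n u = chr m s t \<cdot>\<^sub>v vec n u" if st: "cmod s = 1" "cmod t = 1" for s t
  proof -
    have "vfun (\<rho> (torus s t) *\<^sub>v vec n u) = vfun (chr m s t \<cdot>\<^sub>v vec n u)"
      using R_vfun[OF torus_SU3[OF st], of "vec n u"] wtD(2)[OF u(2) st] by (simp add: vfun_smult uV)
    then show ?thesis
      using rho_carrier[OF torus_SU3[OF st]] by (subst (asm) vfun_inj[of _ n]) auto
  qed
  ultimately show "is_weight n \<rho> m" unfolding is_weight_def chr_def by (intro bexI[of _ "vec n u"]) auto
qed

lemma irrep_irreducible:
  assumes "SU3_irrep n \<rho>"
  shows "irreducible_sub V"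
  unfolding irreducible_sub_def
proof (intro conjI allI impI)
  show "invariant_sub V" by (rule invariant_V)
  fix U' assume U': "invariant_sub U'" "U' \<subseteq> V"
  define W where "W = {v \<in> carrier_vec n. vfun v \<in> U'}"
  have "VectorSpace.subspace class_ring W (module_vec TYPE(complex) n)"
    unfolding vec_subspace_iff W_def using csubspaceD[OF invariantD(1)[OF U'(1)]]
    by (auto simp: vfun_zero vfun_add vfun_smult)
  moreover have "\<forall>g\<in>carrier SU3. \<forall>v\<in>W. \<rho> g *\<^sub>v v \<in> W"
    unfolding W_def using invariantD(3)[OF U'(1)] mult_mat_vec_carrier[OF rho_carrier] by (auto simp flip: R_vfun)
  ultimately consider "W = {0\<^sub>v n}" | "W = carrier_vec n" using assms unfolding SU3_irrep_def by blast
  then show "U' = {0} \<or> U' = V"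
  proof cases
    case 1
    have "u = 0" if "u \<in> U'" for u
    proof -
      have "vec n u \<in> W" using that U' V_vfun by (auto simp: W_def)
      then have "vec n u = 0\<^sub>v n" using 1 by blast
      then show "u = 0" using V_vfun that U' vfun_zero by (metis subsetD)
    qed
    then show ?thesis using csubspaceD(1)[OF invariantD(1)[OF U'(1)]] by blast
  next
    case 2
    have "u \<in> U'" if "u \<in> V" for u
    proof -
      have "vec n u \<in> W" using 2 by simp
      then show ?thesis using V_vfun[OF that] by (simp add: W_def)
    qed
    then show ?thesis using U' by blast
  qed
qed

lemma highest_weight_lexmax:
  assumes "is_highest_weight n \<rho> m"
  shows "lexmax V m"
  unfolding lexmax_def
proof (intro allI impI)
  fix \<nu> y assume "y \<noteq> 0" "wt \<nu> y"
  then have "weight_le \<nu> m" using assms is_weight_iff unfolding is_highest_weight_def by blast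
  then obtain a b where "0 \<le> a" "0 \<le> b" "fst m - fst \<nu> = 2 * a - b" "snd m - snd \<nu> = 2 * b - a"
    unfolding weight_le_iff by blast
  then show "fst \<nu> + 2 * snd \<nu> < fst m + 2 * snd m \<or> fst \<nu> + 2 * snd \<nu> = fst m + 2 * snd m \<and> 2 * fst \<nu> + snd \<nu> \<le> 2 * fst m + snd m"
    by auto
qed

end

theorem Sigma360x3_inaccessible:
  assumes d: "d \<in> interaction_labels"
  shows "inaccessible Sigma360x3 d"
  unfolding inaccessible_def
proof (intro allI impI notI)
  fix n \<rho> assume dr: "dynkin_irrep d n \<rho>" and "\<exists>v\<in>carrier_vec n. v \<noteq> 0\<^sub>v n \<and> (\<forall>g\<in>Sigma360x3. \<rho> g *\<^sub>v v = v)"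
  then obtain v where v: "v \<in> carrier_vec n" "v \<noteq> 0\<^sub>v n" "\<And>g. g \<in> Sigma360x3 \<Longrightarrow> \<rho> g *\<^sub>v v = v" by blast
  interpret mat_rep n \<rho> using dr by unfold_locales (simp add: dynkin_irrep_def SU3_irrep_def)
  let ?m = "(int (fst d), int (snd d))"
  have hw: "is_highest_weight n \<rho> ?m" using dr by (simp add: dynkin_irrep_def)
  obtain u where u: "u \<noteq> 0" "wt ?m u" using hw is_weight_iff unfolding is_highest_weight_def by blast
  have irr: "irreducible_sub V" using dr by (intro irrep_irreducible) (simp add: dynkin_irrep_def)
  have "vfun v = 0"
  proof (rule irreducible_no_invariant[OF irr wtD(1)[OF u(2)] u highest_weight_lexmax[OF hw]])
    show "vfun v \<in> V" by (rule vfun_V[OF v(1)])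
    show "(nat (fst ?m), nat (snd ?m)) \<in> interaction_labels" using d by simp
    fix k assume "k \<in> {matA 2, matE, matW, matF}"
    then have "k \<in> Sigma360x3" using Sigma360x3_gens by auto
    then show "R k (vfun v) = vfun v" using v R_vfun Sigma360x3_SU3 by auto
  qed
  then show False using v vfun_inj[of v n "0\<^sub>v n"] by (simp add: vfun_zero)
qed

section \<open>Unitary representations\<close>

definition cip :: "'i set \<Rightarrow> ('i \<Rightarrow> complex) \<Rightarrow> ('i \<Rightarrow> complex) \<Rightarrow> complex" where
  "cip S u v = (\<Sum>i\<in>S. cnj (u i) * v i)"

lemma cip_add: "cip S u (v + w) = cip S u v + cip S u w" "cip S (u + v) w = cip S u w + cip S v w"
  by (simp_all add: cip_def plus_fun_apply algebra_simps sum.distrib)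

lemma cip_scl: "cip S u (scl c v) = c * cip S u v" "cip S (scl c u) v = cnj c * cip S u v"
  by (simp_all add: cip_def scl_apply sum_distrib_left mult_ac)

lemma cip_zero [simp]: "cip S u 0 = 0" "cip S 0 u = 0"
  by (simp_all add: cip_def zero_fun_apply)

lemma cip_diff: "cip S u (v - w) = cip S u v - cip S u w"
  by (simp add: cip_def algebra_simps sum_subtractf)

lemma cip_sum: "cip S u (\<Sum>x\<in>X. f x) = (\<Sum>x\<in>X. cip S u (f x))"
  by (induction X rule: infinite_finite_induct) (simp_all add: cip_add)

lemma cip_cnj: "cnj (cip S u v) = cip S v u"
  by (simp add: cip_def mult.commute)

lemma cip_self: "cip S u u = of_real (\<Sum>i\<in>S. (cmod (u i))\<^sup>2)"
  by (simp add: cip_def mult.commute complex_norm_square[symmetric])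

lemma cip_self_zero: "finite S \<Longrightarrow> cip S u u = 0 \<Longrightarrow> i \<in> S \<Longrightarrow> u i = 0"
  unfolding cip_self of_real_eq_0_iff by (subst (asm) sum_nonneg_eq_0_iff) auto

definition orthonormal :: "'i set \<Rightarrow> nat \<Rightarrow> (nat \<Rightarrow> 'i \<Rightarrow> complex) \<Rightarrow> bool" where
  "orthonormal S n q \<longleftrightarrow> (\<forall>a<n. \<forall>b<n. cip S (q a) (q b) = (if a = b then 1 else 0))"

text \<open>Induction on the index set: the vectors of \<open>U\<close> vanishing at a new index form a subspace of
  codimension at most one.\<close>

lemma orthonormal_basis:
  assumes "finite S" "csubspace U" "\<And>u i. u \<in> U \<Longrightarrow> i \<notin> S \<Longrightarrow> u i = 0"
  shows "\<exists>n q. orthonormal S n q \<and> (\<forall>a<n. q a \<in> U) \<and> (\<forall>u\<in>U. u = (\<Sum>a<n. scl (cip S (q a) u) (q a)))"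
  using assms
proof (induction S arbitrary: U rule: finite_induct)
  case empty
  then have "u = 0" if "u \<in> U" for u using that by (auto simp: fun_eq_iff zero_fun_apply)
  then show ?case by (intro exI[of _ 0]) (auto simp: orthonormal_def)
next
  case (insert x S)
  note Us = insert.prems(1)
  define U0 where "U0 = {u \<in> U. u x = 0}"
  have U0: "csubspace U0"
    using Us by (auto simp: U0_def csubspace_def plus_fun_apply scl_apply zero_fun_apply)
  obtain n q where q: "orthonormal S n q" "\<And>a. a < n \<Longrightarrow> q a \<in> U0"
    "\<And>u. u \<in> U0 \<Longrightarrow> u = (\<Sum>a<n. scl (cip S (q a) u) (q a))"
  proof -
    have z: "\<And>u i. u \<in> U0 \<Longrightarrow> i \<notin> S \<Longrightarrow> u i = 0"
      subgoal for u i using insert.prems(2)[of u i] by (cases "i = x") (auto simp: U0_def) done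
    have "\<exists>n q. orthonormal S n q \<and> (\<forall>a<n. q a \<in> U0) \<and> (\<forall>u\<in>U0. u = (\<Sum>a<n. scl (cip S (q a) u) (q a)))"
      by (rule insert.IH[OF U0]) (rule z)
    then show ?thesis using that by blast
  qed
  have qx: "q a x = 0" "q a \<in> U" if "a < n" for a using q(2)[OF that] by (auto simp: U0_def)
  let ?S = "insert x S"
  have ext: "cip ?S (q a) u = cip S (q a) u" if "a < n" for a u
    using insert.hyps qx[OF that] by (simp add: cip_def)
  have on: "orthonormal ?S n q" using q(1) ext by (simp add: orthonormal_def)
  have sum0: "u = (\<Sum>a<n. scl (cip ?S (q a) u) (q a))" if "u \<in> U0" for u
    using q(3)[OF that] ext by simp
  show ?case
  proof (cases "U = U0")
    case True then show ?thesis using on q(2) sum0 by blast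
  next
    case False
    then obtain u1 where u1: "u1 \<in> U" "u1 x \<noteq> 0" by (auto simp: U0_def)
    \<comment> \<open>One step of Gram-Schmidt. The old basis vectors vanish at \<open>x\<close>, so
      the value there stays nonzero.\<close>
    define u2 where "u2 = u1 - (\<Sum>a<n. scl (cip ?S (q a) u1) (q a))"
    have u2U: "u2 \<in> U" unfolding u2_def using u1 qx Us
      by (intro csubspace_diff csubspace_sum) (auto intro: csubspaceD(3))
    have u2x: "u2 x = u1 x" by (simp add: u2_def sum_fun_apply scl_apply qx)
    have orth: "cip ?S (q b) u2 = 0" if "b < n" for b
    proof -
      have "cip ?S (q b) (\<Sum>a<n. scl (cip ?S (q a) u1) (q a)) = (\<Sum>a<n. if a = b then cip ?S (q b) u1 else 0)"
        unfolding cip_sum cip_scl using on that by (intro sum.cong) (auto simp: orthonormal_def)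
      then show ?thesis using that by (simp add: u2_def cip_diff)
    qed
    define r where "r = sqrt (\<Sum>i\<in>?S. (cmod (u2 i))\<^sup>2)"
    have "(\<Sum>i\<in>?S. (cmod (u2 i))\<^sup>2) > 0"
      using insert.hyps u2x u1 by (intro sum_pos2[of _ x]) auto
    then have r: "r > 0" "cip ?S u2 u2 = of_real (r * r)" by (simp_all add: r_def cip_self)
    define q' where "q' = q(n := scl (1 / of_real r) u2)"
    have q'n: "q' n = scl (1 / of_real r) u2" "\<And>a. a < n \<Longrightarrow> q' a = q a" by (auto simp: q'_def)
    have nn: "cip ?S (q' n) (q' n) = 1" using r by (simp add: q'n cip_scl)
    have no: "cip ?S (q a) (q' n) = 0" "cip ?S (q' n) (q a) = 0" if "a < n" for a
      using orth[OF that] cip_cnj[of ?S "q a" u2] by (simp_all add: q'n cip_scl)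
    have on': "orthonormal ?S (Suc n) q'"
      unfolding orthonormal_def
    proof (intro allI impI)
      fix a b assume "a < Suc n" "b < Suc n"
      then show "cip ?S (q' a) (q' b) = (if a = b then 1 else 0)"
        using on nn no q'n by (cases "a = n"; cases "b = n") (auto simp: orthonormal_def)
    qed
    have "u = (\<Sum>a<Suc n. scl (cip ?S (q' a) u) (q' a))" if u: "u \<in> U" for u
    proof -
      \<comment> \<open>Subtracting this multiple of the new basis vector makes the value at
        \<open>x\<close> vanish, which leads back to \<open>U0\<close>.\<close>
      define c where "c = u x * of_real r / u2 x"
      define u0 where "u0 = u - scl c (q' n)"
      have "scl c (q' n) \<in> U" using u2U Us by (simp add: q'n csubspaceD(3))
      then have "u0 \<in> U" unfolding u0_def using u Us by (intro csubspace_diff)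
      moreover have "u0 x = 0" using r u2x u1(2) by (simp add: u0_def c_def q'n scl_apply)
      ultimately have u0: "u0 \<in> U0" by (simp add: U0_def)
      have ueq: "u = u0 + scl c (q' n)" by (simp add: u0_def)
      have "cip ?S (q' n) u0 = (\<Sum>a<n. cip ?S (q a) u0 * cip ?S (q' n) (q a))"
        by (subst sum0[OF u0]) (simp add: cip_sum cip_scl)
      then have "cip ?S (q' n) u0 = 0" using no by simp
      then have "cip ?S (q' n) u = c" by (simp add: ueq cip_add cip_scl nn)
      moreover have "cip ?S (q' a) u = cip ?S (q a) u0" if "a < n" for a
        using that no by (simp add: ueq cip_add cip_scl q'n)
      ultimately show ?thesis using sum0[OF u0] q'n by (simp add: ueq)
    qed
    moreover have "q' a \<in> U" if "a < Suc n" for a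
      using that qx u2U Us by (cases "a = n") (auto simp: q'n csubspaceD(3))
    ultimately show ?thesis using on' by blast
  qed
qed

lemma cnj_powi: "cnj (z powi k) = cnj z powi k"
  by (simp add: power_int_def)

lemma adjoint_torus: "mat_adjoint (torus s t) = torus (cnj s) (cnj t)"
  by (simp add: torus_M3 M3_adjoint)

text \<open>Satisfied by the concrete tensor powers; arbitrary irreducible representations are
  handled in \<open>su3_rep\<close>.\<close>

locale su3_unitary = su3_rep I A for I :: "'i set" and A +
  assumes A_adj: "g \<in> carrier SU3 \<Longrightarrow> i \<in> I \<Longrightarrow> j \<in> I \<Longrightarrow> A (mat_adjoint g) i j = cnj (A g j i)"
begin

lemma cip_R: "g \<in> carrier SU3 \<Longrightarrow> cip I (R g u) v = cip I u (R (mat_adjoint g) v)"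
proof -
  assume g: "g \<in> carrier SU3"
  have "cip I (R g u) v = (\<Sum>i\<in>I. \<Sum>j\<in>I. cnj (A g i j) * cnj (u j) * v i)"
    by (simp add: cip_def R_def sum_distrib_right)
  also have "\<dots> = (\<Sum>j\<in>I. \<Sum>i\<in>I. cnj (A g i j) * cnj (u j) * v i)" by (rule sum.swap)
  also have "\<dots> = cip I u (R (mat_adjoint g) v)"
    unfolding cip_def R_def by (intro sum.cong refl) (simp add: A_adj[OF g] sum_distrib_left mult_ac)
  finally show ?thesis .
qed

lemma cip_positive: "u \<in> V \<Longrightarrow> cip I u u = 0 \<Longrightarrow> u = 0"
  using cip_self_zero[OF finI, of u] by (auto simp: V_def fun_eq_iff zero_fun_apply)

lemma cip_hw_functional:
  assumes "invariant_sub U" "wt m v"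
  shows "hw_functional U m (cip I v)"
  unfolding hw_functional_def linear_on_def
proof (intro conjI ballI allI impI)
  fix s t y assume st: "cmod s = 1" "cmod t = 1"
  have "cip I v (R (torus s t) y) = cip I (R (torus (cnj s) (cnj t)) v) y"
    using cip_R[of "torus (cnj s) (cnj t)" v y] st by (simp add: adjoint_torus)
  also have "\<dots> = chr m s t * cip I v y"
    using wtD(2)[OF assms(2), of "cnj s" "cnj t"] st by (simp add: cip_scl chr_def cnj_powi)
  finally show "cip I v (R (torus s t) y) = chr m s t * cip I v y" .
qed (simp_all add: cip_add cip_scl)

lemma complement_invariant:
  assumes "invariant_sub U"
  shows "invariant_sub {y \<in> V. \<forall>x\<in>U. cip I x y = 0}"
  unfolding invariant_sub_def csubspace_def
proof (intro conjI ballI allI)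
  fix g y assume g: "g \<in> carrier SU3" and y: "y \<in> {y \<in> V. \<forall>x\<in>U. cip I x y = 0}"
  have "cip I x (R g y) = 0" if "x \<in> U" for x
    using cip_R[of "mat_adjoint g" x y] invariantD(3)[OF assms, of "mat_adjoint g" x] g that y by (simp add: adjoint_adjoint)
  then show "R g y \<in> {y \<in> V. \<forall>x\<in>U. cip I x y = 0}" by simp
qed (auto simp: cip_add cip_scl csubspaceD[OF V_csubspace])

lemma ONB: "invariant_sub U \<Longrightarrow> \<exists>n q. orthonormal I n q \<and> (\<forall>a<n. q a \<in> U) \<and> (\<forall>u\<in>U. u = (\<Sum>a<n. scl (cip I (q a) u) (q a)))"
  using orthonormal_basis[OF finI, of U] by (auto simp: invariant_sub_def V_def)

lemma projection:
  assumes U: "invariant_sub U" and u: "u \<in> V"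
  shows "\<exists>p\<in>U. u - p \<in> V \<and> (\<forall>x\<in>U. cip I x (u - p) = 0)"
proof -
  obtain n q where q: "orthonormal I n q" "\<And>a. a < n \<Longrightarrow> q a \<in> U" "\<And>u. u \<in> U \<Longrightarrow> u = (\<Sum>a<n. scl (cip I (q a) u) (q a))"
    using ONB[OF U] by blast
  define p where "p = (\<Sum>a<n. scl (cip I (q a) u) (q a))"
  have pU: "p \<in> U" unfolding p_def using q(2) invariantD(1)[OF U] by (intro csubspace_sum) (auto intro: csubspaceD(3))
  have o: "cip I (q b) (u - p) = 0" if "b < n" for b
  proof -
    have "cip I (q b) p = (\<Sum>a<n. if a = b then cip I (q b) u else 0)"
      unfolding p_def cip_sum cip_scl using q(1) that by (intro sum.cong) (auto simp: orthonormal_def)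
    then show ?thesis using that by (simp add: cip_diff)
  qed
  have "cip I x (u - p) = 0" if "x \<in> U" for x
  proof -
    have "cip I (u - p) x = (\<Sum>a<n. cip I (q a) x * cip I (u - p) (q a))"
      by (subst q(3)[OF that]) (simp add: cip_sum cip_scl)
    also have "\<dots> = 0" using o cip_cnj[of I _ "u - p"] by (intro sum.neutral) (metis complex_cnj_zero lessThan_iff mult_zero_right)
    finally show ?thesis using cip_cnj[of I "u - p" x] by simp
  qed
  moreover have "u - p \<in> V" using u pU invariantD(2)[OF U] by (intro csubspace_diff[OF V_csubspace]) auto
  ultimately show ?thesis using pU by blast
qed

text \<open>Split \<open>u\<close> into \<open>p\<close> in \<open>U'\<close> and a part orthogonal
  to \<open>U'\<close>. The weight \<open>d\<close> component of \<open>p\<close> is a multiple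
  \<open>c\<close> of \<open>u\<close>. If \<open>c\<close> is nonzero then \<open>u\<close> lies in
  \<open>U'\<close>; otherwise \<open>u\<close> lies in the complement, so \<open>U'\<close> is
  orthogonal to the span of the orbit that contains it.\<close>

lemma multiplicity_one_irreducible:
  assumes Amb: "invariant_sub Amb" and u: "u \<in> Amb" "wt d u"
    and one: "\<And>y. y \<in> Amb \<Longrightarrow> wt d y \<Longrightarrow> \<exists>c. y = scl c u"
  shows "irreducible_sub (cyc u)"
  unfolding irreducible_sub_def
proof (intro conjI allI impI)
  have uV: "u \<in> V" using u(2) wtD by blast
  show "invariant_sub (cyc u)" by (rule cyc_invariant[OF uV])
  fix U' assume U': "invariant_sub U'" "U' \<subseteq> cyc u"
  obtain p where p: "p \<in> U'" "u - p \<in> V" "\<And>x. x \<in> U' \<Longrightarrow> cip I x (u - p) = 0"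
    using projection[OF U'(1) uV] by blast
  have pV: "p \<in> V" using p(1) U'(1) invariantD by blast
  have "wP d p \<in> U'" by (rule wP(4)[OF U'(1) p(1)])
  then obtain c where c: "wP d p = scl c u"
    using one wP(7)[OF pV] U'(2) cyc_subset[OF Amb u(1)] by blast
  show "U' = {0} \<or> U' = cyc u"
  proof (cases "c = 0")
    case False
    have "scl (1 / c) (scl c u) \<in> U'" using \<open>wP d p \<in> U'\<close> c csubspaceD(3)[OF invariantD(1)[OF U'(1)]] by metis
    then have "u \<in> U'" using False by simp
    then show ?thesis using cyc_subset[OF U'(1)] U'(2) by blast
  next
    case True
    define K where "K = {y \<in> V. \<forall>x\<in>U'. cip I x y = 0}"
    have K: "invariant_sub K" unfolding K_def by (rule complement_invariant[OF U'(1)])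
    have "u - p \<in> K" using p by (simp add: K_def)
    then have "wP d (u - p) \<in> K" by (rule wP(4)[OF K])
    moreover have "u = wP d (u - p)"
    proof -
      have "wP d ((u - p) + p) = wP d (u - p) + wP d p" by (rule wP(2))
      then show ?thesis using wP(8)[OF u(2), of d] c True by simp
    qed
    ultimately have "u \<in> K" by simp
    then have "U' \<subseteq> K" using cyc_subset[OF K] U'(2) by blast
    then have "x = 0" if "x \<in> U'" for x
      using that cip_positive[of x] U' invariantD(2)[OF U'(1)] by (auto simp: K_def)
    then show ?thesis using csubspaceD(1)[OF invariantD(1)[OF U'(1)]] by blast
  qed
qed

definition matrix_form :: "('i \<Rightarrow> complex) set \<Rightarrow> nat \<Rightarrow> (complex mat \<Rightarrow> complex mat) \<Rightarrow> (nat \<Rightarrow> 'i \<Rightarrow> complex) \<Rightarrow> bool" where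
  "matrix_form U n \<sigma> q \<longleftrightarrow> orthonormal I n q \<and> (\<forall>a<n. q a \<in> U) \<and> (\<forall>u\<in>U. u = (\<Sum>a<n. scl (cip I (q a) u) (q a))) \<and>
     (\<forall>g\<in>carrier SU3. \<sigma> g \<in> carrier_mat n n \<and> (\<forall>b<n. R g (q b) = (\<Sum>a<n. scl (\<sigma> g $$ (a, b)) (q a))) \<and>
       (\<forall>a<n. \<forall>b<n. \<sigma> g $$ (a, b) = cip I (q a) (R g (q b))))"

theorem irreducible_matrix_form:
  assumes irr: "irreducible_sub U" and v: "v \<in> U" "v \<noteq> 0" "wt m v" and lm: "lexmax U m"
    and m: "m = (int (fst d), int (snd d))"
  shows "\<exists>n \<sigma> q. dynkin_irrep d n \<sigma> \<and> matrix_form U n \<sigma> q"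
proof -
  have U: "invariant_sub U" using irr by (simp add: irreducible_sub_def)
  note Us = invariantD(1)[OF U]
  obtain n q where q: "orthonormal I n q" "\<And>a. a < n \<Longrightarrow> q a \<in> U" "\<And>u. u \<in> U \<Longrightarrow> u = (\<Sum>a<n. scl (cip I (q a) u) (q a))"
    using ONB[OF U] by blast
  define \<sigma> where "\<sigma> g = mat n n (\<lambda>(a, b). cip I (q a) (R g (q b)))" for g
  have Rq: "R g (q b) = (\<Sum>a<n. scl (\<sigma> g $$ (a, b)) (q a))" if "g \<in> carrier SU3" "b < n" for g b
    using q(3)[OF invariantD(3)[OF U that(1) q(2)[OF that(2)]]] that(2) by (simp add: \<sigma>_def)
  have qV: "q a \<in> V" if "a < n" for a using q(2)[OF that] invariantD(2)[OF U] by blast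
  have rep: "SU3_rep n \<sigma>"
    unfolding SU3_rep_def
  proof (intro conjI ballI allI impI)
    show "\<sigma> (1\<^sub>m 3) = 1\<^sub>m n"
      using q(1) qV by (intro eq_matI) (auto simp: \<sigma>_def R_one orthonormal_def)
    fix g h assume g: "g \<in> carrier SU3" and h: "h \<in> carrier SU3"
    show "\<sigma> (g * h) = \<sigma> g * \<sigma> h"
    proof (rule eq_matI)
      fix a b assume ab: "a < dim_row (\<sigma> g * \<sigma> h)" "b < dim_col (\<sigma> g * \<sigma> h)"
      then have ab: "a < n" "b < n" by (simp_all add: \<sigma>_def)
      have "\<sigma> (g * h) $$ (a, b) = cip I (q a) (R g (R h (q b)))" using ab g h by (simp add: \<sigma>_def R_mult)
      also have "\<dots> = (\<Sum>c<n. \<sigma> h $$ (c, b) * cip I (q a) (R g (q c)))"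
        by (subst Rq[OF h ab(2)]) (simp add: R_sum R_scl cip_sum cip_scl)
      also have "\<dots> = (\<sigma> g * \<sigma> h) $$ (a, b)"
        using ab by (subst mat_mult_index_sum[of _ n n _ n]) (auto simp: \<sigma>_def mult.commute intro!: sum.cong)
      finally show "\<sigma> (g * h) $$ (a, b) = (\<sigma> g * \<sigma> h) $$ (a, b)" .
    qed (simp_all add: \<sigma>_def)
  next
    fix X g assume g: "g \<in> carrier SU3" and X: "(\<forall>k. X k \<in> carrier SU3) \<and> mat_tendsto 3 X g"
    then have "(\<lambda>k. R (X k) w i) \<longlonglongrightarrow> R g w i" for w i by (intro R_tendsto) auto
    then show "mat_tendsto n (\<lambda>k. \<sigma> (X k)) (\<sigma> g)"
      unfolding mat_tendsto_def by (auto simp: \<sigma>_def cip_def intro!: tendsto_intros)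
  qed (simp add: \<sigma>_def)
  interpret M: mat_rep n \<sigma> by unfold_locales (rule rep)
  \<comment> \<open>\<open>emb\<close> and \<open>co\<close> are mutually inverse maps between
    coordinate functions and \<open>U\<close>; they carry subspaces and weight vectors
    across.\<close>
  define emb where "emb f = (\<Sum>a<n. scl (f a) (q a))" for f :: "nat \<Rightarrow> complex"
  define co where "co u = (\<lambda>a. if a < n then cip I (q a) u else 0)" for u
  have embU: "emb f \<in> U" for f unfolding emb_def using q(2) by (intro csubspace_sum[OF Us]) (auto intro: csubspaceD(3)[OF Us])
  have coV: "co u \<in> M.V" for u by (auto simp: M.V_def co_def)
  have emb_co: "emb (co u) = u" if "u \<in> U" for u using q(3)[OF that] by (simp add: emb_def co_def)
  have co_emb: "co (emb f) = f" if "f \<in> M.V" for f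
  proof
    fix a
    have "cip I (q a) (emb f) = (\<Sum>b<n. if b = a then f a else 0)" if "a < n"
      unfolding emb_def cip_sum cip_scl using q(1) that by (intro sum.cong) (auto simp: orthonormal_def)
    then show "co (emb f) a = f a" using that by (auto simp: co_def M.V_def)
  qed
  have emb_lin: "emb (f + g) = emb f + emb g" "emb (scl c f) = scl c (emb f)" "emb 0 = 0" for f g c
    by (simp_all add: emb_def plus_fun_apply scl_apply zero_fun_apply scl_add sum.distrib scl_sum)
  have emb_R: "emb (M.R g f) = R g (emb f)" if g: "g \<in> carrier SU3" for g f
  proof -
    have "R g (emb f) = (\<Sum>b<n. \<Sum>a<n. scl (f b * \<sigma> g $$ (a, b)) (q a))"
      unfolding emb_def R_sum R_scl using Rq[OF g] by (intro sum.cong) (auto simp: scl_sum)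
    also have "\<dots> = (\<Sum>a<n. \<Sum>b<n. scl (f b * \<sigma> g $$ (a, b)) (q a))" by (rule sum.swap)
    also have "\<dots> = (\<Sum>a<n. scl (\<Sum>b<n. f b * \<sigma> g $$ (a, b)) (q a))"
      by (intro sum.cong) (auto simp: fun_eq_iff sum_fun_apply scl_apply sum_distrib_right)
    finally show ?thesis by (simp add: emb_def M.R_def mult.commute)
  qed
  have emb_wt: "M.wt \<mu> f \<Longrightarrow> wt \<mu> (emb f)" for \<mu> f
    using embU invariantD(2)[OF U] by (auto simp: M.wt_def wt_def emb_lin simp flip: emb_R)
  have co_wt: "M.wt \<mu> (co u)" if "wt \<mu> u" "u \<in> U" for \<mu> u
  proof -
    have "M.R (torus s t) (co u) = scl (chr \<mu> s t) (co u)" if st: "cmod s = 1" "cmod t = 1" for s t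
    proof -
      have "emb (M.R (torus s t) (co u)) = emb (scl (chr \<mu> s t) (co u))"
        using st wtD(2)[OF \<open>wt \<mu> u\<close> st] by (simp add: emb_R emb_lin emb_co[OF \<open>u \<in> U\<close>])
      then show ?thesis using co_emb[OF M.R_in_V] co_emb[OF csubspaceD(3)[OF M.V_csubspace coV]] by metis
    qed
    then show ?thesis by (simp add: M.wt_def coV)
  qed
  have emb_nz: "f \<in> M.V \<Longrightarrow> f \<noteq> 0 \<Longrightarrow> emb f \<noteq> 0" for f
    using co_emb[of f] co_emb[OF csubspaceD(1)[OF M.V_csubspace]] emb_lin(3) by metis
  have npos: "n > 0" using q(3)[OF v(1)] v(2) by (cases n) auto
  have irrep: "SU3_irrep n \<sigma>"
    unfolding SU3_irrep_def
  proof (intro conjI allI impI rep npos)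
    fix W assume W: "VectorSpace.subspace class_ring W (module_vec TYPE(complex) n) \<and> (\<forall>g\<in>carrier SU3. \<forall>v\<in>W. \<sigma> g *\<^sub>v v \<in> W)"
    then have W': "W \<subseteq> carrier_vec n" "0\<^sub>v n \<in> W" "\<And>u v. u \<in> W \<Longrightarrow> v \<in> W \<Longrightarrow> u + v \<in> W" "\<And>c v. v \<in> W \<Longrightarrow> c \<cdot>\<^sub>v v \<in> W"
      "\<And>g v. g \<in> carrier SU3 \<Longrightarrow> v \<in> W \<Longrightarrow> \<sigma> g *\<^sub>v v \<in> W"
      unfolding vec_subspace_iff by auto
    define U' where "U' = (\<lambda>w. emb (vfun w)) ` W"
    have "invariant_sub U'"
      unfolding invariant_sub_def csubspace_def
    proof (intro conjI ballI allI)
      have "emb (vfun (0\<^sub>v n)) = 0" by (simp add: vfun_zero emb_lin)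
      then show "0 \<in> U'" unfolding U'_def using W'(2) by (metis image_eqI)
      show "U' \<subseteq> V" unfolding U'_def using embU invariantD(2)[OF U] by blast
      fix x y assume "x \<in> U'" "y \<in> U'"
      then obtain a b where ab: "x = emb (vfun a)" "y = emb (vfun b)" "a \<in> W" "b \<in> W" by (auto simp: U'_def)
      then have "x + y = emb (vfun (a + b))" using W'(1) by (subst vfun_add[of _ n]) (auto simp: emb_lin)
      then show "x + y \<in> U'" unfolding U'_def using W'(3)[OF ab(3,4)] by blast
    next
      fix c x assume "x \<in> U'"
      then obtain a where a: "x = emb (vfun a)" "a \<in> W" by (auto simp: U'_def)
      then have "scl c x = emb (vfun (c \<cdot>\<^sub>v a))" by (simp add: vfun_smult emb_lin)
      then show "scl c x \<in> U'" unfolding U'_def using W'(4)[OF a(2)] by blast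
    next
      fix g x assume g: "g \<in> carrier SU3" and "x \<in> U'"
      then obtain a where a: "x = emb (vfun a)" "a \<in> W" by (auto simp: U'_def)
      then have "R g x = emb (vfun (\<sigma> g *\<^sub>v a))" using W'(1) g by (simp add: emb_R[symmetric] M.R_vfun subsetD)
      then show "R g x \<in> U'" unfolding U'_def using W'(5)[OF g a(2)] by blast
    qed
    moreover have "U' \<subseteq> U" unfolding U'_def using embU by blast
    ultimately consider "U' = {0}" | "U' = U" using irr unfolding irreducible_sub_def by blast
    then show "W = {0\<^sub>v n} \<or> W = carrier_vec n"
    proof cases
      case 1
      have "w = 0\<^sub>v n" if w: "w \<in> W" for w
      proof -
        have "emb (vfun w) = 0" using 1 w by (auto simp: U'_def)
        then have "vfun w = vfun (0\<^sub>v n)" using emb_nz[OF M.vfun_V] w W'(1) by (auto simp: vfun_zero)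
        then show ?thesis using vfun_inj w W'(1) by (metis subsetD zero_carrier_vec)
      qed
      then show ?thesis using W'(2) by blast
    next
      case 2
      have "w \<in> W" if w: "w \<in> carrier_vec n" for w
      proof -
        have "emb (vfun w) \<in> U'" using 2 embU by simp
        then obtain w' where w': "w' \<in> W" "emb (vfun w) = emb (vfun w')" by (auto simp: U'_def)
        then have "vfun w = vfun w'" using co_emb[OF M.vfun_V] w W'(1) by (metis subsetD)
        then show ?thesis using vfun_inj w w'(1) W'(1) by (metis subsetD)
      qed
      then show ?thesis using W'(1) by blast
    qed
  qed
  have hw: "is_highest_weight n \<sigma> m"
    unfolding is_highest_weight_def
  proof (intro conjI allI impI)
    have "co v \<noteq> 0" using emb_co[OF v(1)] emb_lin(3) v(2) by metis
    then show "is_weight n \<sigma> m" using co_wt[OF v(3,1)] M.is_weight_iff by blast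
    fix k assume "is_weight n \<sigma> k"
    then obtain f where f: "f \<noteq> 0" "M.wt k f" using M.is_weight_iff by blast
    then show "weight_le k m"
      using irreducible_dominated[OF irr v lm embU emb_nz emb_wt] M.wtD(1) by blast
  qed
  have "dynkin_irrep d n \<sigma>" using irrep hw m by (simp add: dynkin_irrep_def)
  moreover have "matrix_form U n \<sigma> q"
    unfolding matrix_form_def using q Rq by (auto simp: \<sigma>_def)
  ultimately show ?thesis by blast
qed

text \<open>By \<open>irreducible_dominated\<close> the lexicographic maximum of
  \<open>cyc u\<close> lies above the weight of \<open>u\<close>, and \<open>top\<close> then forces
  the two to agree.\<close>

theorem multiplicity_one_irrep:
  assumes Amb: "invariant_sub Amb" and u: "u \<in> Amb" "u \<noteq> 0" "wt (int (fst d), int (snd d)) u"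
    and one: "\<And>y. y \<in> Amb \<Longrightarrow> wt (int (fst d), int (snd d)) y \<Longrightarrow> \<exists>c. y = scl c u"
    and top: "\<And>\<nu> y. y \<in> Amb \<Longrightarrow> y \<noteq> 0 \<Longrightarrow> wt \<nu> y \<Longrightarrow> weight_le (int (fst d), int (snd d)) \<nu> \<Longrightarrow> \<nu> = (int (fst d), int (snd d))"
  shows "irreducible_sub (cyc u)" and "\<exists>n \<sigma> q. dynkin_irrep d n \<sigma> \<and> matrix_form (cyc u) n \<sigma> q"
proof -
  have uV: "u \<in> V" using u(3) wtD by blast
  show irr: "irreducible_sub (cyc u)" by (rule multiplicity_one_irreducible[OF Amb u(1,3) one])
  obtain m v where v: "v \<in> cyc u" "v \<noteq> 0" "wt m v" and lm: "lexmax (cyc u) m"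
    using lexmax_exists[OF cyc_invariant[OF uV] cyc_self[OF uV] u(2)] by blast
  have "weight_le (int (fst d), int (snd d)) m"
    by (rule irreducible_dominated[OF irr v lm cyc_self[OF uV] u(2,3)])
  then have "m = (int (fst d), int (snd d))"
    using top v cyc_subset[OF Amb u(1)] by blast
  then show "\<exists>n \<sigma> q. dynkin_irrep d n \<sigma> \<and> matrix_form (cyc u) n \<sigma> q"
    using irreducible_matrix_form[OF irr v lm] by blast
qed

end

section \<open>Tensor powers\<close>

text \<open>An entry of a Kronecker power, with row and column written as lists of the indices of
  the factors; the value 1 is the empty product.\<close>

fun tw :: "('a \<Rightarrow> 'b \<Rightarrow> complex) \<Rightarrow> 'a list \<Rightarrow> 'b list \<Rightarrow> complex" where
  "tw k (x # L) (y # M) = k x y * tw k L M"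
| "tw k _ _ = 1"

fun lists_of :: "'a set \<Rightarrow> nat \<Rightarrow> 'a list set" where
  "lists_of J 0 = {[]}"
| "lists_of J (Suc K) = (\<lambda>(x, L). x # L) ` (J \<times> lists_of J K)"

lemma lists_of_iff: "L \<in> lists_of J K \<longleftrightarrow> length L = K \<and> set L \<subseteq> J"
  by (induction K arbitrary: L) (auto simp: image_iff length_Suc_conv)

lemma finite_lists_of: "finite J \<Longrightarrow> finite (lists_of J K)"
  by (induction K) auto

lemma sum_lists_of_Suc: "(\<Sum>L\<in>lists_of J (Suc K). f L) = (\<Sum>x\<in>J. \<Sum>L\<in>lists_of J K. f (x # L))"
  by (simp add: sum.reindex inj_on_def sum.cartesian_product case_prod_beta)

text \<open>Kronecker powers are multiplicative: a sum over lists of a product over positions is a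
  product of sums.\<close>

lemma tw_compose:
  "length L = K \<Longrightarrow> length M = K \<Longrightarrow>
   (\<Sum>N\<in>lists_of J K. tw a L N * tw b N M) = tw (\<lambda>x z. \<Sum>y\<in>J. a x y * b y z) L M"
proof (induction K arbitrary: L M)
  case (Suc K)
  then obtain x L' z M' where LM: "L = x # L'" "M = z # M'" "length L' = K" "length M' = K" by (auto simp: length_Suc_conv)
  have "(\<Sum>N\<in>lists_of J (Suc K). tw a L N * tw b N M)
    = (\<Sum>y\<in>J. \<Sum>N\<in>lists_of J K. (a x y * b y z) * (tw a L' N * tw b N M'))"
    unfolding sum_lists_of_Suc LM by (intro sum.cong refl) simp
  also have "\<dots> = (\<Sum>y\<in>J. a x y * b y z) * tw (\<lambda>x z. \<Sum>y\<in>J. a x y * b y z) L' M'"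
    by (simp add: Suc.IH[OF LM(3,4)] sum_distrib_left[symmetric] sum_distrib_right)
  finally show ?case by (simp add: LM)
qed simp

lemma tw_cong: "(\<And>x y. x \<in> set L \<Longrightarrow> y \<in> set M \<Longrightarrow> a x y = b x y) \<Longrightarrow> tw a L M = tw b L M"
  by (induction a L M rule: tw.induct) auto

lemma tw_delta: "length L = length M \<Longrightarrow> tw (\<lambda>x y. if x = y then c x else 0) L M = (if L = M then prod_list (map c L) else 0)"
  by (induction L M rule: list_induct2) auto

lemma tw_transpose_cnj: "tw (\<lambda>x y. cnj (a y x)) L M = cnj (tw a M L)"
  by (induction "\<lambda>x y. cnj (a y x)" L M rule: tw.induct) auto

lemma prod_list_ones: "prod_list (map (\<lambda>x. 1 :: complex) L) = 1"
  by (induction L) simp_all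

lemma su3_rep_tensor_power:
  assumes "su3_rep J a"
  shows "su3_rep (lists_of J K) (\<lambda>g. tw (a g))"
proof -
  interpret su3_rep J a by fact
  show ?thesis
  proof
    show "finite (lists_of J K)" by (rule finite_lists_of[OF finI])
    fix L M assume L: "L \<in> lists_of J K" and M: "M \<in> lists_of J K"
    have "tw (a (1\<^sub>m 3)) L M = tw (\<lambda>x y. if x = y then 1 else 0) L M"
      by (intro tw_cong A_one) (use L M in \<open>auto simp: lists_of_iff\<close>)
    then show "tw (a (1\<^sub>m 3)) L M = (if L = M then 1 else 0)"
      using L M prod_list_ones[of L] by (auto simp: tw_delta lists_of_iff)
    fix g h assume "g \<in> carrier SU3" "h \<in> carrier SU3"
    then have "tw (a (g * h)) L M = tw (\<lambda>x z. \<Sum>y\<in>J. a g x y * a h y z) L M"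
      by (intro tw_cong A_mult) (use L M in \<open>auto simp: lists_of_iff\<close>)
    then show "tw (a (g * h)) L M = (\<Sum>N\<in>lists_of J K. tw (a g) L N * tw (a h) N M)"
      using L M by (simp add: tw_compose lists_of_iff)
  next
    fix X :: "nat \<Rightarrow> complex mat" and g L M
    assume X: "\<And>n. X n \<in> carrier SU3" "g \<in> carrier SU3" "mat_tendsto 3 X g" and "L \<in> lists_of J K" "M \<in> lists_of J K"
    then show "(\<lambda>n. tw (a (X n)) L M) \<longlonglongrightarrow> tw (a g) L M"
    proof (induction K arbitrary: L M)
      case (Suc K)
      then obtain x L' z M' where LM: "L = x # L'" "M = z # M'" "L' \<in> lists_of J K" "M' \<in> lists_of J K" "x \<in> J" "z \<in> J" by auto
      show ?case using Suc.IH[OF X LM(3,4)] A_cont[OF X LM(5,6)] by (auto simp: LM intro!: tendsto_intros)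
    qed simp
  qed
qed

lemma su3_unitary_tensor_power:
  assumes "su3_unitary J a"
  shows "su3_unitary (lists_of J K) (\<lambda>g. tw (a g))"
proof -
  interpret su3_unitary J a by fact
  interpret T: su3_rep "lists_of J K" "\<lambda>g. tw (a g)" by (rule su3_rep_tensor_power[OF su3_rep_axioms])
  show ?thesis
  proof
    fix g L M assume g: "g \<in> carrier SU3" and L: "L \<in> lists_of J K" and M: "M \<in> lists_of J K"
    have "tw (a (mat_adjoint g)) L M = tw (\<lambda>x y. cnj (a g y x)) L M"
      by (intro tw_cong A_adj[OF g]) (use L M in \<open>auto simp: lists_of_iff\<close>)
    then show "tw (a (mat_adjoint g)) L M = cnj (tw (a g) M L)" by (simp add: tw_transpose_cnj)
  qed
qed

text \<open>The tensor product of a representation with its conjugate. For the defining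
  representation this is conjugation of operators, with matrix units indexed by pairs.\<close>

definition dbl :: "(complex mat \<Rightarrow> 'i \<Rightarrow> 'i \<Rightarrow> complex) \<Rightarrow> complex mat \<Rightarrow> 'i \<times> 'i \<Rightarrow> 'i \<times> 'i \<Rightarrow> complex" where
  "dbl a g x y = a g (fst x) (fst y) * cnj (a g (snd x) (snd y))"

lemma su3_unitary_dbl:
  assumes "su3_unitary J a"
  shows "su3_unitary (J \<times> J) (dbl a)"
proof -
  interpret su3_unitary J a by fact
  show ?thesis
  proof
    show "finite (J \<times> J)" using finI by simp
    fix x y assume x: "x \<in> J \<times> J" and y: "y \<in> J \<times> J"
    then show "dbl a (1\<^sub>m 3) x y = (if x = y then 1 else 0)" by (cases x; cases y) (simp add: dbl_def A_one)
    fix g h assume g: "g \<in> carrier SU3" and h: "h \<in> carrier SU3"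
    have "dbl a (g * h) x y = (\<Sum>k\<in>J. a g (fst x) k * a h k (fst y)) * (\<Sum>l\<in>J. cnj (a g (snd x) l) * cnj (a h l (snd y)))"
      using x y g h by (auto simp: dbl_def A_mult)
    also have "\<dots> = (\<Sum>k\<in>J. \<Sum>l\<in>J. dbl a g x (k, l) * dbl a h (k, l) y)"
      unfolding sum_product dbl_def by (intro sum.cong refl) (simp add: mult_ac)
    finally show "dbl a (g * h) x y = (\<Sum>z\<in>J \<times> J. dbl a g x z * dbl a h z y)"
      by (simp add: sum.cartesian_product case_prod_beta)
    show "dbl a (mat_adjoint g) x y = cnj (dbl a g y x)" using x y g by (auto simp: dbl_def A_adj)
  next
    fix X :: "nat \<Rightarrow> complex mat" and g x y
    assume "\<And>n. X n \<in> carrier SU3" "g \<in> carrier SU3" "mat_tendsto 3 X g" "x \<in> J \<times> J" "y \<in> J \<times> J"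
    then show "(\<lambda>n. dbl a (X n) x y) \<longlonglongrightarrow> dbl a g x y"
      unfolding dbl_def by (auto intro!: tendsto_intros A_cont)
  qed
qed

lemma su3_unitary_defining: "su3_unitary {..<3} (\<lambda>g i j. g $$ (i, j))"
proof
  fix g h :: "complex mat" and i k assume "g \<in> carrier SU3" "h \<in> carrier SU3" "i \<in> {..<3::nat}" "k \<in> {..<3::nat}"
  then show "(g * h) $$ (i, k) = (\<Sum>j<3. g $$ (i, j) * h $$ (j, k))"
    using mat_mult_index_sum[OF SU3_mat SU3_mat] by simp
next
  fix X :: "nat \<Rightarrow> complex mat" and g i j
  assume "mat_tendsto 3 X g" "i \<in> {..<3::nat}" "j \<in> {..<3::nat}"
  then show "(\<lambda>n. X n $$ (i, j)) \<longlonglongrightarrow> g $$ (i, j)" by (simp add: mat_tendsto_def)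
next
  fix g :: "complex mat" and i j assume "g \<in> carrier SU3" "i \<in> {..<3::nat}" "j \<in> {..<3::nat}"
  then show "mat_adjoint g $$ (i, j) = cnj (g $$ (j, i))"
    using SU3_mat[of g] by auto
qed auto

text \<open>Digits in base \<open>n\<close>, most significant first, matching the \<open>div\<close>
  and \<open>mod\<close> in \<open>tensor_mat\<close>.\<close>

fun dig :: "nat \<Rightarrow> nat \<Rightarrow> nat \<Rightarrow> nat list" where
  "dig n 0 r = []"
| "dig n (Suc K) r = (r div n ^ K) # dig n K (r mod n ^ K)"

lemma dig_lists: "r < n ^ K \<Longrightarrow> dig n K r \<in> lists_of {..<n} K"
proof (induction K arbitrary: r)
  case (Suc K)
  then have "n > 0" by (cases n) auto
  then have "r mod n ^ K < n ^ K" by simp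
  moreover have "r div n ^ K < n" using Suc.prems by (simp add: less_mult_imp_div_less)
  ultimately show ?case using Suc.IH by auto
qed simp

lemma dig_inj: "r < n ^ K \<Longrightarrow> r' < n ^ K \<Longrightarrow> dig n K r = dig n K r' \<Longrightarrow> r = r'"
proof (induction K arbitrary: r r')
  case (Suc K)
  then have "n > 0" by (cases n) auto
  then have "r mod n ^ K = r' mod n ^ K" using Suc by (intro Suc.IH) auto
  moreover have "r div n ^ K = r' div n ^ K" using Suc.prems by simp
  ultimately show ?case by (metis div_mult_mod_eq)
qed simp

lemma card_lists_of: "finite J \<Longrightarrow> card (lists_of J K) = card J ^ K"
  by (induction K) (simp_all add: card_image inj_on_def card_cartesian_product)

lemma dig_bij: "bij_betw (dig n K) {..<n ^ K} (lists_of {..<n} K)"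
proof -
  have inj: "inj_on (dig n K) {..<n ^ K}" using dig_inj by (auto simp: inj_on_def)
  moreover have "dig n K ` {..<n ^ K} = lists_of {..<n} K"
    using dig_lists by (intro card_subset_eq) (auto simp: finite_lists_of card_image[OF inj] card_lists_of)
  ultimately show ?thesis by (simp add: bij_betw_def)
qed

lemma tensor_power_Suc: "tensor_power (Suc K) M = M \<otimes>\<^sub>m tensor_power K M"
  by (simp add: tensor_power_def tensor_list_def)

lemma tensor_power_0: "tensor_power 0 M = 1\<^sub>m 1"
  by (simp add: tensor_power_def tensor_list_def)

lemma tensor_power_carrier: "M \<in> carrier_mat n m \<Longrightarrow> tensor_power K M \<in> carrier_mat (n ^ K) (m ^ K)"
  by (induction K) (auto simp: tensor_power_0 tensor_power_Suc tensor_mat_def)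

lemma tensor_power_index:
  assumes M: "M \<in> carrier_mat n m"
  shows "r < n ^ K \<Longrightarrow> c < m ^ K \<Longrightarrow> tensor_power K M $$ (r, c) = tw (\<lambda>i j. M $$ (i, j)) (dig n K r) (dig m K c)"
proof (induction K arbitrary: r c)
  case (Suc K)
  then have "n > 0" "m > 0" by (cases n; simp) (cases m; use Suc in simp)
  then have "r mod n ^ K < n ^ K" "c mod m ^ K < m ^ K" by simp_all
  then show ?case
    using Suc M tensor_power_carrier[OF M, of K] by (auto simp: tensor_power_Suc tensor_mat_def)
qed (simp add: tensor_power_0)

text \<open>The weights L1, L2, L3 of the coordinate vectors in Dynkin coordinates; their sum is
  zero.\<close>

definition qw :: "nat \<Rightarrow> int \<times> int" where
  "qw i = (if i = 0 then (1, 0) else if i = 1 then (- 1, 1) else (0, - 1))"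

lemma torus_qw:
  assumes "i < 3" "j < 3" "cmod s = 1" "cmod t = 1"
  shows "torus s t $$ (i, j) = (if i = j then chr (qw i) s t else 0)"
proof -
  have "s \<noteq> 0" "t \<noteq> 0" using assms by auto
  then show ?thesis using assms(1,2)
    by (auto simp: less_3_cases torus_M3 qw_def chr_def power_int_minus field_simps)
qed

definition pw :: "nat \<times> nat \<Rightarrow> int \<times> int" where
  "pw x = (fst (qw (fst x)) - fst (qw (snd x)), snd (qw (fst x)) - snd (qw (snd x)))"

lemma chr_diff: "cmod s = 1 \<Longrightarrow> cmod t = 1 \<Longrightarrow> chr \<mu> s t * cnj (chr \<nu> s t) = chr (fst \<mu> - fst \<nu>, snd \<mu> - snd \<nu>) s t"
proof -
  assume st: "cmod s = 1" "cmod t = 1"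
  have "cnj (chr \<nu> s t) = chr (- fst \<nu>, - snd \<nu>) s t"
    using st powi_unit_simps(2)[of s] powi_unit_simps(2)[of t] powi_unit_simps(2)[of "s * t"]
    by (simp add: chr_def norm_mult cnj_powi power_int_minus flip: power_int_inverse)
  then show ?thesis using chr_mult[OF st, of \<mu> "(- fst \<nu>, - snd \<nu>)"] by simp
qed

definition lw :: "(nat \<times> nat) list \<Rightarrow> int \<times> int" where
  "lw L = (\<Sum>x\<leftarrow>L. fst (pw x), \<Sum>x\<leftarrow>L. snd (pw x))"

abbreviation P3 :: "(nat \<times> nat) set" where "P3 \<equiv> {..<3} \<times> {..<3}"

abbreviation adjk :: "complex mat \<Rightarrow> nat \<times> nat \<Rightarrow> nat \<times> nat \<Rightarrow> complex" where
  "adjk \<equiv> dbl (\<lambda>g i j. g $$ (i, j))"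

lemma adjk_torus:
  assumes "x \<in> P3" "y \<in> P3" "cmod s = 1" "cmod t = 1"
  shows "adjk (torus s t) x y = (if x = y then chr (pw x) s t else 0)"
  using assms by (cases x; cases y) (simp add: dbl_def torus_qw pw_def chr_diff)

lemma prod_list_chr: "cmod s = 1 \<Longrightarrow> cmod t = 1 \<Longrightarrow> prod_list (map (\<lambda>x. chr (pw x) s t) L) = chr (lw L) s t"
  by (induction L) (simp_all add: lw_def chr_mult, simp add: chr_def)

global_interpretation adj: su3_unitary P3 adjk
  by (rule su3_unitary_dbl[OF su3_unitary_defining])

text \<open>Each factor is the full nine-dimensional space of operators rather than its adjoint
  part. The torus is then diagonal, and a weight vector is a function supported on lists of one
  weight.\<close>

locale adj_power = fixes K :: nat
begin

sublocale su3_unitary "lists_of P3 K" "\<lambda>g. tw (adjk g)"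
  by (rule su3_unitary_tensor_power) (rule adj.su3_unitary_axioms)

lemma R_torus: "cmod s = 1 \<Longrightarrow> cmod t = 1 \<Longrightarrow> L \<in> lists_of P3 K \<Longrightarrow> R (torus s t) f L = chr (lw L) s t * f L"
proof -
  assume st: "cmod s = 1" "cmod t = 1" and L: "L \<in> lists_of P3 K"
  have "tw (adjk (torus s t)) L M = (if L = M then chr (lw L) s t else 0)" if M: "M \<in> lists_of P3 K" for M
  proof -
    have "tw (adjk (torus s t)) L M = tw (\<lambda>x y. if x = y then chr (pw x) s t else 0) L M"
      by (intro tw_cong adjk_torus[OF _ _ st]) (use L M in \<open>auto simp: lists_of_iff\<close>)
    then show ?thesis using L M by (simp add: tw_delta lists_of_iff prod_list_chr[OF st])
  qed
  then show ?thesis using L finI by (simp add: R_def if_distrib[of "\<lambda>x. x * _"] cong: if_cong)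
qed

lemma wt_support: "wt d f \<Longrightarrow> f L \<noteq> 0 \<Longrightarrow> L \<in> lists_of P3 K \<and> lw L = d"
proof -
  assume d: "wt d f" and nz: "f L \<noteq> 0"
  have L: "L \<in> lists_of P3 K" using wtD(1)[OF d] nz by (auto simp: V_def)
  have "chr (lw L) s t = chr d s t" if st: "cmod s = 1" "cmod t = 1" for s t
    using fun_cong[OF wtD(2)[OF d st], of L] R_torus[OF st L, of f] nz by (simp add: scl_apply)
  then show ?thesis using L chr_inj by blast
qed

lemma wtI: "f \<in> V \<Longrightarrow> (\<And>L. f L \<noteq> 0 \<Longrightarrow> lw L = d) \<Longrightarrow> wt d f"
  unfolding wt_def
proof (intro conjI allI impI ext)
  fix s t :: complex and L assume f: "f \<in> V" "\<And>L. f L \<noteq> 0 \<Longrightarrow> lw L = d" and st: "cmod s = 1" "cmod t = 1"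
  show "R (torus s t) f L = scl (chr d s t) f L"
  proof (cases "L \<in> lists_of P3 K")
    case True
    then show ?thesis using R_torus[OF st True, of f] f(2)[of L] by (cases "f L = 0") (auto simp: scl_apply)
  next
    case False then show ?thesis using f(1) by (simp add: R_def V_def scl_apply)
  qed
qed

end

definition basis_fun :: "'a \<Rightarrow> 'a \<Rightarrow> complex" where
  "basis_fun x y = (if y = x then 1 else 0)"

lemma dominated_labels:
  assumes "weight_le (int a, int b) (3, 3)" "(a, b) \<noteq> (0, 0)"
  shows "(a, b) \<in> interaction_labels"
proof -
  obtain x y where xy: "0 \<le> x" "0 \<le> y" "3 - int a = 2 * x - y" "3 - int b = 2 * y - x"
    using assms(1) unfolding weight_le_iff by auto
  \<comment> \<open>Twice the first equation plus the second gives
    \<open>9 - 2 * int a - int b = 3 * x\<close>, and symmetrically for \<open>y\<close>.\<close>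
  then have "x \<le> 3" "y \<le> 3" by linarith+
  then have "x \<in> {0, 1, 2, 3}" "y \<in> {0, 1, 2, 3}" using xy by auto
  moreover have "a = nat (3 - 2 * x + y)" "b = nat (3 - 2 * y + x)" "3 - 2 * x + y \<ge> 0" "3 - 2 * y + x \<ge> 0" using xy by auto
  ultimately show ?thesis using assms(2) unfolding interaction_labels_def by (elim insertE emptyE; simp)
qed

text \<open>Induction on the number of factors, where the torus need not be diagonal on
  \<open>J\<close>: a coordinate of the weight \<open>\<nu>\<close> part of \<open>f\<close> in the
  first factor is a vector of weight \<open>d\<close> minus \<open>\<nu>\<close> in the remaining
  factors.\<close>

lemma tensor_power_weight_bound:
  assumes rep: "su3_rep J a" and bound: "\<And>\<nu> y. su3_rep.wt J a \<nu> y \<Longrightarrow> y \<noteq> 0 \<Longrightarrow> weight_le \<nu> m"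
    and f: "su3_rep.wt (lists_of J K) (\<lambda>g. tw (a g)) d f" "f \<noteq> 0"
  shows "weight_le d (int K * fst m, int K * snd m)"
proof -
  interpret su3_rep J a by fact
  note TR = su3_rep_tensor_power[OF rep]
  show ?thesis using f
  proof (induction K arbitrary: d f)
    case 0
    interpret T: su3_rep "lists_of J 0" "\<lambda>g. tw (a g)" by (rule TR)
    obtain x where "f x \<noteq> 0" using 0(2) by (auto simp: fun_eq_iff zero_fun_apply)
    moreover have "f x = 0" if "x \<notin> lists_of J 0" for x using T.wtD(1)[OF 0(1)] that unfolding T.V_def by blast
    ultimately have f0: "f [] \<noteq> 0" by (metis lists_of.simps(1) singletonD)
    have "chr (0, 0) s t = chr d s t" if st: "cmod s = 1" "cmod t = 1" for s t
    proof -
      have "T.R (torus s t) f [] = f []" unfolding T.R_def by simp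
      then show ?thesis using fun_cong[OF T.wtD(2)[OF 0(1) st], of "[]"] f0 by (simp add: scl_apply chr_def)
    qed
    then have "d = (0, 0)" using chr_inj by metis
    then show ?case by (simp add: weight_le_refl)
  next
    case (Suc K)
    interpret T: su3_rep "lists_of J (Suc K)" "\<lambda>g. tw (a g)" by (rule TR)
    interpret T': su3_rep "lists_of J K" "\<lambda>g. tw (a g)" by (rule TR)
    \<comment> \<open>\<open>f\<close> as a family of vectors of the first factor, indexed by the
      lists for the remaining ones.\<close>
    define col where "col M = (\<lambda>x. if x \<in> J then f (x # M) else 0)" for M
    have colV: "col M \<in> V" for M by (simp add: col_def V_def)
    have key: "(\<Sum>M\<in>lists_of J K. scl (tw (a (torus s t)) L M) (R (torus s t) (col M))) = scl (chr d s t) (col L)"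
      if st: "cmod s = 1" "cmod t = 1" and L: "L \<in> lists_of J K" for s t L
    proof
      fix x
      show "(\<Sum>M\<in>lists_of J K. scl (tw (a (torus s t)) L M) (R (torus s t) (col M))) x = scl (chr d s t) (col L) x"
      proof (cases "x \<in> J")
        case True
        have "(\<Sum>M\<in>lists_of J K. scl (tw (a (torus s t)) L M) (R (torus s t) (col M))) x
          = (\<Sum>M\<in>lists_of J K. \<Sum>y\<in>J. tw (a (torus s t)) L M * (a (torus s t) x y * f (y # M)))"
          using True by (simp add: sum_fun_apply scl_apply R_def col_def sum_distrib_left)
        also have "\<dots> = (\<Sum>y\<in>J. \<Sum>M\<in>lists_of J K. tw (a (torus s t)) L M * (a (torus s t) x y * f (y # M)))"
          by (rule sum.swap)
        also have "\<dots> = T.R (torus s t) f (x # L)"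
          using True L by (simp add: T.R_def sum_lists_of_Suc mult_ac del: lists_of.simps) (auto simp: image_iff)
        also have "\<dots> = scl (chr d s t) (col L) x"
          using fun_cong[OF T.wtD(2)[OF Suc.prems(1) st], of "x # L"] True by (simp add: scl_apply col_def)
        finally show ?thesis .
      next
        case False then show ?thesis by (simp add: sum_fun_apply scl_apply R_def col_def)
      qed
    qed
    obtain L0 where "f L0 \<noteq> 0" using Suc.prems(2) by (auto simp: fun_eq_iff zero_fun_apply)
    moreover from this have "L0 \<in> lists_of J (Suc K)" using T.wtD(1)[OF Suc.prems(1)] unfolding T.V_def by blast
    ultimately obtain x0 M0 where M0: "x0 \<in> J" "M0 \<in> lists_of J K" "f (x0 # M0) \<noteq> 0" by auto
    then have "col M0 x0 \<noteq> 0" by (simp add: col_def)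
    then have "(\<Sum>\<nu>\<in>wM. wP \<nu> (col M0) x0) \<noteq> 0"
      using fun_cong[OF wP(6)[OF colV[of M0]], of x0] by (simp add: sum_fun_apply)
    then obtain \<nu> where \<nu>: "wP \<nu> (col M0) x0 \<noteq> 0" by (meson sum.neutral)
    then have "wP \<nu> (col M0) \<noteq> 0" by (auto simp: zero_fun_apply)
    then have le1: "weight_le \<nu> m" using bound wP(7)[OF colV] by blast
    define h where "h M = (if M \<in> lists_of J K then wP \<nu> (col M) x0 else 0)" for M
    have hV: "h \<in> T'.V" by (auto simp: h_def T'.V_def)
    have wPsum: "wP \<nu> (\<Sum>x\<in>S. F x) = (\<Sum>x\<in>S. wP \<nu> (F x))" for S and F :: "'a list \<Rightarrow> 'a \<Rightarrow> complex"
    proof (induction S rule: infinite_finite_induct)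
      case (insert x S) then show ?case by (simp add: wP(2))
    qed (use wP(3)[of \<nu> 0 0] in simp_all)
    have "T'.wt (fst d - fst \<nu>, snd d - snd \<nu>) h"
      unfolding T'.wt_def
    proof (intro conjI allI impI ext hV)
      fix s t :: complex and L assume st: "cmod s = 1" "cmod t = 1"
      show "T'.R (torus s t) h L = scl (chr (fst d - fst \<nu>, snd d - snd \<nu>) s t) h L"
      proof (cases "L \<in> lists_of J K")
        case True
        have "wP \<nu> (\<Sum>M\<in>lists_of J K. scl (tw (a (torus s t)) L M) (R (torus s t) (col M)))
            = (\<Sum>M\<in>lists_of J K. scl (tw (a (torus s t)) L M * chr \<nu> s t) (wP \<nu> (col M)))"
          using wtD(2)[OF wP(7)[OF colV] st] by (simp add: wPsum wP(3) wP(5)[OF st])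
        then have "(\<Sum>M\<in>lists_of J K. tw (a (torus s t)) L M * chr \<nu> s t * wP \<nu> (col M) x0) = chr d s t * wP \<nu> (col L) x0"
          unfolding key[OF st True] wP(3) by (auto simp: fun_eq_iff sum_fun_apply scl_apply)
        then have e: "chr \<nu> s t * T'.R (torus s t) h L = chr d s t * h L"
          using True by (simp add: T'.R_def h_def sum_distrib_left mult_ac)
        have "chr d s t = chr \<nu> s t * chr (fst d - fst \<nu>, snd d - snd \<nu>) s t"
          using chr_mult[OF st, of \<nu> "(fst d - fst \<nu>, snd d - snd \<nu>)"] by simp
        then have "chr \<nu> s t * T'.R (torus s t) h L = chr \<nu> s t * (chr (fst d - fst \<nu>, snd d - snd \<nu>) s t * h L)"
          using e by (simp add: mult.assoc)
        then show ?thesis using chr_nz[OF st, of \<nu>] by (simp add: scl_apply)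
      next
        case False then show ?thesis by (simp add: T'.R_def h_def scl_apply)
      qed
    qed
    moreover have "h \<noteq> 0" using \<nu> M0(2) by (auto simp: h_def fun_eq_iff zero_fun_apply)
    ultimately have "weight_le (fst d - fst \<nu>, snd d - snd \<nu>) (int K * fst m, int K * snd m)" by (rule Suc.IH)
    from weight_le_add[OF this le1] show ?case by (simp add: algebra_simps)
  qed
qed

text \<open>The intertwiner is injective, so it carries a highest weight vector to a nonzero vector
  of the same weight, and the weights of the power lie below \<open>(K, K)\<close>.\<close>

theorem occurs_in_power_labels:
  assumes occ: "occurs_in_power d (1, 1) K" and K: "K \<le> 3" and d: "d \<noteq> (0, 0)"
  shows "d \<in> interaction_labels"
proof -
  obtain m \<sigma> n \<rho> where \<sigma>: "dynkin_irrep d m \<sigma>" and \<rho>: "dynkin_irrep (1, 1) n \<rho>"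
    and oc: "occurs_in m \<sigma> (n ^ K) (\<lambda>g. tensor_power K (\<rho> g))"
    using occ unfolding occurs_in_power_def by blast
  obtain T where T: "T \<in> carrier_mat (n ^ K) m" "\<And>v. v \<in> carrier_vec m \<Longrightarrow> T *\<^sub>v v = 0\<^sub>v (n ^ K) \<Longrightarrow> v = 0\<^sub>v m"
    "\<And>g. g \<in> carrier SU3 \<Longrightarrow> tensor_power K (\<rho> g) * T = T * \<sigma> g"
    using oc unfolding occurs_in_def by blast
  interpret S: mat_rep m \<sigma> using \<sigma> by unfold_locales (simp add: dynkin_irrep_def SU3_irrep_def)
  interpret N: mat_rep n \<rho> using \<rho> by unfold_locales (simp add: dynkin_irrep_def SU3_irrep_def)
  let ?d = "(int (fst d), int (snd d))"
  interpret TP: su3_rep "lists_of {..<n} K" "\<lambda>g. tw (\<lambda>i j. \<rho> g $$ (i, j))"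
    by (rule su3_rep_tensor_power) (rule N.su3_rep_axioms)
  obtain y where y: "y \<in> carrier_vec m" "y \<noteq> 0\<^sub>v m"
    "\<And>s t. cmod s = 1 \<Longrightarrow> cmod t = 1 \<Longrightarrow> \<sigma> (torus s t) *\<^sub>v y = chr ?d s t \<cdot>\<^sub>v y"
    using \<sigma> unfolding dynkin_irrep_def is_highest_weight_def is_weight_def chr_def by auto
  define z where "z = T *\<^sub>v y"
  have zc: "z \<in> carrier_vec (n ^ K)" using T(1) y(1) by (simp add: z_def)
  have zw: "tensor_power K (\<rho> (torus s t)) *\<^sub>v z = chr ?d s t \<cdot>\<^sub>v z" if st: "cmod s = 1" "cmod t = 1" for s t
  proof -
    note c = tensor_power_carrier[OF N.rho_carrier[OF torus_SU3[OF st]], of K] S.rho_carrier[OF torus_SU3[OF st]]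
    have "tensor_power K (\<rho> (torus s t)) *\<^sub>v z = (T * \<sigma> (torus s t)) *\<^sub>v y"
      unfolding z_def T(3)[OF torus_SU3[OF st], symmetric] using c T(1) y(1) by simp
    also have "\<dots> = T *\<^sub>v (chr ?d s t \<cdot>\<^sub>v y)" using c T(1) y(1) y(3)[OF st] by simp
    finally show ?thesis using T(1) y(1) by (simp add: z_def mult_mat_vec)
  qed
  note bij = dig_bij[of n K]
  define f where "f L = (if L \<in> lists_of {..<n} K then z $ (inv_into {..<n ^ K} (dig n K) L) else 0)" for L
  have fd: "f (dig n K r) = z $ r" if "r < n ^ K" for r
    using that dig_lists bij by (simp add: f_def bij_betw_def)
  have "TP.wt ?d f"
    unfolding TP.wt_def
  proof (intro conjI allI impI ext)
    show "f \<in> TP.V" by (auto simp: f_def TP.V_def)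
    fix s t :: complex and L assume st: "cmod s = 1" "cmod t = 1"
    show "TP.R (torus s t) f L = scl (chr ?d s t) f L"
    proof (cases "L \<in> lists_of {..<n} K")
      case True
      then obtain r where r: "r < n ^ K" "L = dig n K r" using bij by (auto simp: bij_betw_def)
      note c = N.rho_carrier[OF torus_SU3[OF st]]
      have "TP.R (torus s t) f L = (\<Sum>c<n ^ K. tw (\<lambda>i j. \<rho> (torus s t) $$ (i, j)) L (dig n K c) * f (dig n K c))"
        unfolding TP.R_def using True sum.reindex_bij_betw[OF bij, of "\<lambda>M. tw (\<lambda>i j. \<rho> (torus s t) $$ (i, j)) L M * f M"] by simp
      also have "\<dots> = (\<Sum>c<n ^ K. tensor_power K (\<rho> (torus s t)) $$ (r, c) * z $ c)"
        using r by (intro sum.cong refl) (simp add: fd tensor_power_index[OF c])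
      also have "\<dots> = (tensor_power K (\<rho> (torus s t)) *\<^sub>v z) $ r"
        using r zc tensor_power_carrier[OF c, of K] by (auto simp: scalar_prod_def atLeast0LessThan intro!: sum.cong)
      also have "\<dots> = chr ?d s t * f L" unfolding zw[OF st] using zc r by (simp add: fd)
      finally show ?thesis by (simp add: scl_apply)
    next
      case False then show ?thesis by (simp add: TP.R_def f_def scl_apply)
    qed
  qed
  moreover have "f \<noteq> 0"
  proof
    assume "f = 0"
    then have "z $ r = 0" if "r < n ^ K" for r using fd[OF that] by (simp add: zero_fun_apply)
    then have "z = 0\<^sub>v (n ^ K)" using zc by (intro eq_vecI) auto
    then show False using T(2)[OF y(1)] y(2) by (simp add: z_def)
  qed
  moreover have "weight_le \<nu> (1, 1)" if "N.wt \<nu> u" "u \<noteq> 0" for \<nu> u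
  proof -
    have "is_highest_weight n \<rho> (1, 1)" using \<rho> unfolding dynkin_irrep_def by simp
    then show ?thesis using that N.is_weight_iff[of \<nu>] unfolding is_highest_weight_def by blast
  qed
  ultimately have "weight_le ?d (int K * 1, int K * 1)"
    using tensor_power_weight_bound[OF N.su3_rep_axioms, of "(1, 1)" K ?d f] by simp
  moreover have "weight_le (int K, int K) (3, 3)"
    unfolding weight_le_iff using K by (intro exI[of _ "3 - int K"]) simp
  ultimately have "weight_le ?d (3, 3)"
    unfolding weight_le_iff by (elim exE conjE) (rename_tac a b c e, rule_tac x = "a + c" in exI, rule_tac x = "b + e" in exI, simp)
  then show ?thesis using dominated_labels[of "fst d" "snd d"] d by simp
qed

section \<open>Occurrence in powers of the adjoint representation\<close>

lemma sum_scl_apply: "u = (\<Sum>a\<in>X. scl (c a) (q a)) \<Longrightarrow> u i = (\<Sum>a\<in>X. c a * q a i)"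
  by (simp add: sum_fun_apply scl_apply)

context adj_power
begin

lemma basis_fun_V: "L \<in> lists_of P3 K \<Longrightarrow> basis_fun L \<in> V"
  by (auto simp: basis_fun_def V_def)

lemma support_irrep:
  assumes Amb: "invariant_sub Amb" and u: "u \<in> Amb" "u \<noteq> 0" "\<And>L. u L \<noteq> 0 \<Longrightarrow> lw L = (int (fst d), int (snd d))"
    and one: "\<And>y. y \<in> Amb \<Longrightarrow> (\<And>L. y L \<noteq> 0 \<Longrightarrow> weight_le (int (fst d), int (snd d)) (lw L)) \<Longrightarrow> \<exists>c. y = scl c u"
  shows "\<exists>n \<sigma> q. dynkin_irrep d n \<sigma> \<and> matrix_form (cyc u) n \<sigma> q"
proof (rule multiplicity_one_irrep(2)[OF Amb u(1,2)])
  show uw: "wt (int (fst d), int (snd d)) u" using wtI[OF _ u(3)] u(1) invariantD(2)[OF Amb] by blast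
  fix y assume y: "y \<in> Amb"
  show "\<exists>c. y = scl c u" if "wt (int (fst d), int (snd d)) y"
    using one[OF y] wt_support[OF that] weight_le_refl by metis
  fix \<nu> assume \<nu>: "y \<noteq> 0" "wt \<nu> y" "weight_le (int (fst d), int (snd d)) \<nu>"
  then obtain c where c: "y = scl c u" using one[OF y] wt_support[OF \<nu>(2)] by metis
  have "wt (int (fst d), int (snd d)) y" unfolding c
    using wtI[of "scl c u"] csubspaceD(3)[OF V_csubspace wtD(1)[OF uw], of c] u(3) by (auto simp: scl_apply)
  then show "\<nu> = (int (fst d), int (snd d))" using wt_unique[OF \<nu>(2)] \<nu>(1) by blast
qed

text \<open>Parseval's identity, available because the basis element itself lies in
  \<open>U\<close>.\<close>

lemma orthonormal_expansion:
  assumes "matrix_form U n \<sigma> q" "basis_fun L \<in> U" "L \<in> lists_of P3 K"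
  shows "(\<Sum>e<n. q e L * cnj (q e M)) = (if L = M then 1 else 0)"
proof -
  have "basis_fun L = (\<Sum>e<n. scl (cip (lists_of P3 K) (q e) (basis_fun L)) (q e))"
    using assms unfolding matrix_form_def by blast
  then have "basis_fun L M = (\<Sum>e<n. cip (lists_of P3 K) (q e) (basis_fun L) * q e M)"
    by (rule sum_scl_apply)
  moreover have "cip (lists_of P3 K) (q e) (basis_fun L) = cnj (q e L)" for e
    using assms(3) finI by (simp add: cip_def basis_fun_def if_distrib[of "\<lambda>z. _ * z"] cong: if_cong)
  ultimately have "(\<Sum>e<n. cnj (q e L) * q e M) = (if L = M then 1 else 0)" by (auto simp: basis_fun_def split: if_splits)
  from arg_cong[OF this, of cnj] show ?thesis by (simp split: if_splits)
qed

text \<open>Taking inner products with the basis \<open>q\<close> intertwines the tensor power with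
  \<open>\<sigma>\<close>; this is the conjugate of the expansion of
  \<open>R (mat_adjoint g) (q e)\<close>.\<close>

lemma matrix_form_dual:
  assumes U: "invariant_sub U" and q: "matrix_form U n \<sigma> q" and g: "g \<in> carrier SU3" and e: "e < n" and L: "L \<in> lists_of P3 K"
  shows "(\<Sum>f<n. \<sigma> g $$ (e, f) * cnj (q f L)) = (\<Sum>M\<in>lists_of P3 K. cnj (q e M) * tw (adjk g) M L)"
proof -
  let ?I = "lists_of P3 K"
  have qe: "q f \<in> U" if "f < n" for f using q that unfolding matrix_form_def by blast
  have g': "mat_adjoint g \<in> carrier SU3" using g by simp
  have s: "\<sigma> g $$ (e, f) = cnj (cip ?I (q f) (R (mat_adjoint g) (q e)))" if f: "f < n" for f
  proof -
    have "\<sigma> g $$ (e, f) = cip ?I (q e) (R g (q f))" using q g e f unfolding matrix_form_def by blast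
    also have "\<dots> = cip ?I (R (mat_adjoint g) (q e)) (q f)" by (simp add: cip_R[OF g'] adjoint_adjoint)
    finally show ?thesis by (simp add: cip_cnj)
  qed
  have "R (mat_adjoint g) (q e) = (\<Sum>f<n. scl (cip ?I (q f) (R (mat_adjoint g) (q e))) (q f))"
    using q invariantD(3)[OF U g' qe[OF e]] unfolding matrix_form_def by blast
  then have "R (mat_adjoint g) (q e) L = (\<Sum>f<n. cip ?I (q f) (R (mat_adjoint g) (q e)) * q f L)"
    by (rule sum_scl_apply)
  then have "cnj (R (mat_adjoint g) (q e) L) = (\<Sum>f<n. \<sigma> g $$ (e, f) * cnj (q f L))"
    by (simp add: s)
  moreover have "cnj (R (mat_adjoint g) (q e) L) = (\<Sum>M\<in>?I. cnj (q e M) * tw (adjk g) M L)"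
    using L unfolding R_def by (simp add: A_adj[OF g L] mult.commute cong: sum.cong)
  ultimately show ?thesis by simp
qed

end

lemma lists_of_1: "(\<Sum>L\<in>lists_of J (Suc 0). f L) = (\<Sum>x\<in>J. f [x])"
  unfolding sum_lists_of_Suc by simp

text \<open>The intertwiner is the \<open>K\<close>-th tensor power of the projection onto the adjoint representation, restricted to the span of the
  orbit of \<open>u\<close>. It does not vanish because \<open>u\<close> has a nonzero coordinate whose tensor factors lie in the adjoint representation.\<close>

lemma occurs_of_matrix_form:
  fixes K :: nat
  assumes u: "u \<in> su3_rep.V (lists_of P3 K)" and d: "dynkin_irrep d n \<sigma>"
    and q: "su3_unitary.matrix_form (lists_of P3 K) (\<lambda>g. tw (adjk g)) (su3_rep.cyc (lists_of P3 K) (\<lambda>g. tw (adjk g)) u) n \<sigma> q"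
    and e: "dynkin_irrep (1, 1) n' \<rho>" and U1: "su3_rep.invariant_sub (lists_of P3 (Suc 0)) (\<lambda>g. tw (adjk g)) U1"
    and p: "su3_unitary.matrix_form (lists_of P3 (Suc 0)) (\<lambda>g. tw (adjk g)) U1 n' \<rho> p"
    and L0: "L0 \<in> lists_of P3 K" "u L0 \<noteq> 0" "\<And>x. x \<in> set L0 \<Longrightarrow> basis_fun [x] \<in> U1"
  shows "occurs_in_power d (1, 1) K"
proof -
  interpret A: adj_power K .
  interpret B: adj_power "Suc 0" .
  let ?I = "lists_of P3 K"
  let ?C = "lists_of {..<n'} K"
  define k where "k e x = cnj (p e [x])" for e x
  have \<rho>c: "\<rho> g \<in> carrier_mat n' n'" if "g \<in> carrier SU3" for g using p that unfolding B.matrix_form_def by blast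
  have \<sigma>c: "\<sigma> g \<in> carrier_mat n n" if "g \<in> carrier SU3" for g using q that unfolding A.matrix_form_def by blast
  have dual: "(\<Sum>f<n'. \<rho> g $$ (e, f) * k f x) = (\<Sum>y\<in>P3. k e y * adjk g y x)" if g: "g \<in> carrier SU3" "e < n'" "x \<in> P3" for g e x
    using B.matrix_form_dual[OF U1 p g(1,2), of "[x]"] g(3) by (simp add: lists_of_1 lists_of_iff k_def del: lists_of.simps)
  define T where "T = mat (n' ^ K) n (\<lambda>(r, a). \<Sum>L\<in>?I. tw k (dig n' K r) L * q a L)"
  have Tc: "T \<in> carrier_mat (n' ^ K) n" by (simp add: T_def)
  note bij = dig_bij[of n' K]
  have inter: "tensor_power K (\<rho> g) * T = T * \<sigma> g" if g: "g \<in> carrier SU3" for g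
  proof (rule eq_matI)
    note c = tensor_power_carrier[OF \<rho>c[OF g], of K]
    fix r b assume "r < dim_row (T * \<sigma> g)" "b < dim_col (T * \<sigma> g)"
    then have r: "r < n' ^ K" and b: "b < n" using Tc \<sigma>c[OF g] by auto
    have len: "length (dig n' K r) = K" "set (dig n' K r) \<subseteq> {..<n'}" using dig_lists[OF r] by (simp_all add: lists_of_iff)
    have "(tensor_power K (\<rho> g) * T) $$ (r, b) = (\<Sum>c<n' ^ K. tw (\<lambda>i j. \<rho> g $$ (i, j)) (dig n' K r) (dig n' K c) * (\<Sum>L\<in>?I. tw k (dig n' K c) L * q b L))"
      unfolding mat_mult_index_sum[OF c Tc r b]
      using r b by (intro sum.cong refl) (simp add: tensor_power_index[OF \<rho>c[OF g]] T_def)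
    also have "\<dots> = (\<Sum>C\<in>?C. tw (\<lambda>i j. \<rho> g $$ (i, j)) (dig n' K r) C * (\<Sum>L\<in>?I. tw k C L * q b L))"
      by (rule sum.reindex_bij_betw[OF bij])
    also have "\<dots> = (\<Sum>L\<in>?I. (\<Sum>C\<in>?C. tw (\<lambda>i j. \<rho> g $$ (i, j)) (dig n' K r) C * tw k C L) * q b L)"
      unfolding sum_distrib_left sum_distrib_right by (subst sum.swap) (simp add: mult_ac)
    also have "\<dots> = (\<Sum>L\<in>?I. (\<Sum>M\<in>?I. tw k (dig n' K r) M * tw (adjk g) M L) * q b L)"
    proof (intro sum.cong refl arg_cong2[of _ _ _ _ "(*)"])
      fix L assume L: "L \<in> ?I"
      then have lL: "length L = K" "set L \<subseteq> P3" by (simp_all add: lists_of_iff)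
      show "(\<Sum>C\<in>?C. tw (\<lambda>i j. \<rho> g $$ (i, j)) (dig n' K r) C * tw k C L) = (\<Sum>M\<in>?I. tw k (dig n' K r) M * tw (adjk g) M L)"
        unfolding tw_compose[OF len(1) lL(1)] by (intro tw_cong dual[OF g]) (use len lL in auto)
    qed
    also have "\<dots> = (\<Sum>M\<in>?I. tw k (dig n' K r) M * A.R g (q b) M)"
      unfolding sum_distrib_right by (subst sum.swap) (simp add: A.R_def sum_distrib_left mult_ac)
    also have "\<dots> = (\<Sum>M\<in>?I. \<Sum>a<n. tw k (dig n' K r) M * q a M * \<sigma> g $$ (a, b))"
    proof (intro sum.cong refl)
      fix M
      have "A.R g (q b) = (\<Sum>a<n. scl (\<sigma> g $$ (a, b)) (q a))" using q g b unfolding A.matrix_form_def by blast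
      then show "tw k (dig n' K r) M * A.R g (q b) M = (\<Sum>a<n. tw k (dig n' K r) M * q a M * \<sigma> g $$ (a, b))"
        by (simp add: sum_fun_apply scl_apply sum_distrib_left mult_ac)
    qed
    also have "\<dots> = (T * \<sigma> g) $$ (r, b)"
      unfolding mat_mult_index_sum[OF Tc \<sigma>c[OF g] r b]
      by (subst sum.swap) (use r in \<open>simp add: T_def sum_distrib_right\<close>)
    finally show "(tensor_power K (\<rho> g) * T) $$ (r, b) = (T * \<sigma> g) $$ (r, b)" .
  qed (use Tc \<sigma>c[OF g] tensor_power_carrier[OF \<rho>c[OF g], of K] in auto)
  \<comment> \<open>The kernel is an invariant subspace, so by irreducibility \<open>T\<close> is
    injective as soon as it is nonzero.\<close>
  define Ker where "Ker = {v \<in> carrier_vec n. T *\<^sub>v v = 0\<^sub>v (n' ^ K)}"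
  have "VectorSpace.subspace class_ring Ker (module_vec TYPE(complex) n)"
    unfolding vec_subspace_iff Ker_def using Tc by (auto simp: mult_add_distrib_mat_vec mult_mat_vec)
  moreover have "\<sigma> g *\<^sub>v v \<in> Ker" if "g \<in> carrier SU3" "v \<in> Ker" for g v
  proof -
    note c = tensor_power_carrier[OF \<rho>c[OF that(1)], of K] \<sigma>c[OF that(1)]
    have v: "v \<in> carrier_vec n" "T *\<^sub>v v = 0\<^sub>v (n' ^ K)" using that(2) by (auto simp: Ker_def)
    have "T *\<^sub>v (\<sigma> g *\<^sub>v v) = tensor_power K (\<rho> g) *\<^sub>v (T *\<^sub>v v)"
      using inter[OF that(1)] c Tc v(1) by (metis assoc_mult_mat_vec)
    also have "\<dots> = 0\<^sub>v (n' ^ K)" unfolding v(2) using c by (intro eq_vecI) auto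
    finally show ?thesis using c v by (simp add: Ker_def)
  qed
  moreover have "Ker \<noteq> carrier_vec n"
  proof
    assume all: "Ker = carrier_vec n"
    have T0: "(\<Sum>L\<in>?I. tw k C L * q a L) = 0" if C: "C \<in> ?C" and a: "a < n" for C a
    proof -
      obtain r where r: "r < n' ^ K" "C = dig n' K r" using C bij by (auto simp: bij_betw_def)
      have "unit_vec n a \<in> Ker" by (simp add: all)
      then have "(T *\<^sub>v unit_vec n a) $ r = 0" using r by (simp add: Ker_def)
      moreover have "(T *\<^sub>v unit_vec n a) $ r = T $$ (r, a)" using r a Tc by simp
      ultimately show ?thesis using r a by (simp add: T_def)
    qed
    have "u = (\<Sum>a<n. scl (cip ?I (q a) u) (q a))" using q A.cyc_self[OF u] unfolding A.matrix_form_def by blast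
    then have uL: "u L = (\<Sum>a<n. cip ?I (q a) u * q a L)" for L
      by (rule sum_scl_apply)
    have C0: "(\<Sum>L\<in>?I. tw k C L * u L) = 0" if C: "C \<in> ?C" for C
    proof -
      have "(\<Sum>L\<in>?I. tw k C L * u L) = (\<Sum>L\<in>?I. \<Sum>a<n. cip ?I (q a) u * (tw k C L * q a L))"
        by (intro sum.cong refl) (subst uL, simp only: sum_distrib_left mult.left_commute)
      also have "\<dots> = (\<Sum>a<n. \<Sum>L\<in>?I. cip ?I (q a) u * (tw k C L * q a L))" by (rule sum.swap)
      also have "\<dots> = (\<Sum>a<n. cip ?I (q a) u * (\<Sum>L\<in>?I. tw k C L * q a L))" by (simp only: sum_distrib_left)
      also have "\<dots> = 0" using T0[OF C] by (intro sum.neutral) auto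
      finally show ?thesis .
    qed
    have lL0: "length L0 = K" "set L0 \<subseteq> P3" using L0(1) by (simp_all add: lists_of_iff)
    \<comment> \<open>The entries of \<open>L0\<close> give basis elements inside \<open>U1\<close>,
      where the projection is the identity; contracting with \<open>p\<close> therefore recovers the
      coordinate \<open>u L0\<close>.\<close>
    have del: "(\<Sum>C\<in>?C. tw (\<lambda>x e. p e [x]) L0 C * tw k C L) = (if L0 = L then 1 else 0)" if L: "L \<in> ?I" for L
    proof -
      have lL: "length L = K" using L by (simp add: lists_of_iff)
      have "(\<Sum>C\<in>?C. tw (\<lambda>x e. p e [x]) L0 C * tw k C L) = tw (\<lambda>x y. if x = y then 1 else 0) L0 L"
        unfolding tw_compose[OF lL0(1) lL]
      proof (rule tw_cong)
        fix x y assume x: "x \<in> set L0"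
        then have "[x] \<in> lists_of P3 (Suc 0)" using lL0 by (auto simp: lists_of_iff)
        then show "(\<Sum>e<n'. p e [x] * k e y) = (if x = y then 1 else 0)"
          using B.orthonormal_expansion[OF p L0(3)[OF x], of "[y]"] by (simp add: k_def)
      qed
      then show ?thesis using tw_delta[of L0 L "\<lambda>x. 1"] lL lL0 prod_list_ones[of L0] by (cases "L0 = L") auto
    qed
    have "u L0 = (\<Sum>L\<in>?I. (\<Sum>C\<in>?C. tw (\<lambda>x e. p e [x]) L0 C * tw k C L) * u L)"
      using del L0(1) A.finI by (simp add: if_distrib[of "\<lambda>z. z * _"] cong: if_cong)
    also have "\<dots> = (\<Sum>C\<in>?C. tw (\<lambda>x e. p e [x]) L0 C * (\<Sum>L\<in>?I. tw k C L * u L))"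
      unfolding sum_distrib_left sum_distrib_right by (subst sum.swap) (simp add: mult_ac)
    finally show False using C0 L0(2) by simp
  qed
  ultimately have "Ker = {0\<^sub>v n}" using d unfolding dynkin_irrep_def SU3_irrep_def by blast
  then have "occurs_in n \<sigma> (n' ^ K) (\<lambda>g. tensor_power K (\<rho> g))"
    unfolding occurs_in_def using Tc inter by (intro bexI[OF _ Tc]) (auto simp: Ker_def)
  then show ?thesis using d e unfolding occurs_in_power_def by blast
qed

lemma weight_le_functionals:
  assumes "weight_le d \<nu>"
  shows "2 * fst d + snd d \<le> 2 * fst \<nu> + snd \<nu>" "fst d + 2 * snd d \<le> fst \<nu> + 2 * snd \<nu>"
proof -
  obtain a b :: nat where "fst \<nu> - fst d = 2 * int a - int b" "snd \<nu> - snd d = 2 * int b - int a"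
    using assms unfolding weight_le_def by blast
  then show "2 * fst d + snd d \<le> 2 * fst \<nu> + snd \<nu>" "fst d + 2 * snd d \<le> fst \<nu> + 2 * snd \<nu>" by linarith+
qed

text \<open>\<open>fa\<close> and \<open>fb\<close> are the coefficients of the first and second
  simple root in the weight of a matrix unit, see \<open>lw_functionals\<close>. They are at most 1,
  which makes lists of extremal weight easy to enumerate.\<close>

definition fa :: "nat \<times> nat \<Rightarrow> int" where
  "fa x = (if fst x = 0 then 1 else 0) - (if snd x = 0 then 1 else 0)"

definition fb :: "nat \<times> nat \<Rightarrow> int" where
  "fb x = (if snd x = 2 then 1 else 0) - (if fst x = 2 then 1 else 0)"

lemma lw_functionals:
  "set L \<subseteq> P3 \<Longrightarrow> 2 * fst (lw L) + snd (lw L) = 3 * (\<Sum>x\<leftarrow>L. fa x) \<and> fst (lw L) + 2 * snd (lw L) = 3 * (\<Sum>x\<leftarrow>L. fb x)"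
proof (induction L)
  case (Cons x L)
  obtain i j where x: "x = (i, j)" "i < 3" "j < 3" using Cons.prems by (cases x) auto
  have "2 * fst (pw x) + snd (pw x) = 3 * fa x \<and> fst (pw x) + 2 * snd (pw x) = 3 * fb x"
    using x by (auto simp: less_3_cases pw_def qw_def fa_def fb_def)
  then show ?case using Cons by (simp add: lw_def)
qed (simp add: lw_def)

lemma fa_fb:
  assumes "x \<in> P3"
  shows "fa x \<le> 1" "fb x \<le> 1" "fa x = 1 \<Longrightarrow> fb x \<in> {0, 1}" "fb x = 1 \<Longrightarrow> fa x \<in> {0, 1}"
    "fa x = 1 \<Longrightarrow> fb x = 1 \<Longrightarrow> x = (0, 2)" "fa x = 1 \<Longrightarrow> fb x = 0 \<Longrightarrow> x = (0, 1)" "fa x = 0 \<Longrightarrow> fb x = 1 \<Longrightarrow> x = (1, 2)"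
  using assms by (cases x; auto simp: less_3_cases fa_def fb_def)+

text \<open>The weight of the matrix unit \<open>(0, 2)\<close> is the highest root, which is a
  simple weight, so its orbit spans the adjoint representation. Signed permutation matrices of
  determinant 1 carry it to the two simple root vectors.\<close>

lemma adjoint_sub:
  shows "\<exists>n \<rho> p. dynkin_irrep (1, 1) n \<rho> \<and> su3_unitary.matrix_form (lists_of P3 (Suc 0)) (\<lambda>g. tw (adjk g))
      (su3_rep.cyc (lists_of P3 (Suc 0)) (\<lambda>g. tw (adjk g)) (basis_fun [(0, 2)])) n \<rho> p"
    and "x \<in> {(0, 2), (0, 1), (1, 2)} \<Longrightarrow> basis_fun [x] \<in> su3_rep.cyc (lists_of P3 (Suc 0)) (\<lambda>g. tw (adjk g)) (basis_fun [(0, 2)])"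
    and "su3_rep.invariant_sub (lists_of P3 (Suc 0)) (\<lambda>g. tw (adjk g)) (su3_rep.cyc (lists_of P3 (Suc 0)) (\<lambda>g. tw (adjk g)) (basis_fun [(0, 2)]))"
proof -
  interpret B: adj_power "Suc 0" .
  have L: "[(0, 2)] \<in> lists_of P3 (Suc 0)" by (simp add: lists_of_iff del: lists_of.simps)
  note uV = B.basis_fun_V[OF L]
  show inv: "B.invariant_sub (B.cyc (basis_fun [(0, 2)]))" by (rule B.cyc_invariant[OF uV])
  show "\<exists>n \<rho> p. dynkin_irrep (1, 1) n \<rho> \<and> B.matrix_form (B.cyc (basis_fun [(0, 2)])) n \<rho> p"
  proof (rule B.support_irrep[OF B.invariant_V uV])
    show "basis_fun [(0 :: nat, 2 :: nat)] \<noteq> 0" by (auto simp: fun_eq_iff basis_fun_def zero_fun_apply)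
    show "basis_fun [(0 :: nat, 2 :: nat)] L \<noteq> 0 \<Longrightarrow> lw L = (int (fst (1, 1)), int (snd (1, 1)))" for L
      by (auto simp: basis_fun_def lw_def pw_def qw_def split: if_splits)
    fix y assume y: "y \<in> B.V" "\<And>L. y L \<noteq> 0 \<Longrightarrow> weight_le (int (fst (1, 1)), int (snd (1, 1))) (lw L)"
    have "y L = 0" if "L \<noteq> [(0, 2)]" for L
    proof (rule ccontr)
      assume nz: "y L \<noteq> 0"
      then have "L \<in> lists_of P3 (Suc 0)" using y(1) unfolding B.V_def by blast
      then obtain x where x: "L = [x]" "x \<in> P3" by (auto simp: lists_of_iff length_Suc_conv)
      have "1 \<le> fa x" "1 \<le> fb x"
        using weight_le_functionals[OF y(2)[OF nz]] lw_functionals[of L] x by auto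
      then show False using fa_fb[OF x(2)] that x(1) by simp
    qed
    then have "y = scl (y [(0, 2)]) (basis_fun [(0, 2)])" by (auto simp: fun_eq_iff scl_apply basis_fun_def)
    then show "\<exists>c. y = scl c (basis_fun [(0, 2)])" by blast
  qed
  have move: "basis_fun [x] \<in> B.cyc (basis_fun [(0, 2)])" if g: "g \<in> carrier SU3"
    and e: "\<And>i j. i < 3 \<Longrightarrow> j < 3 \<Longrightarrow> g $$ (i, 0) * cnj (g $$ (j, 2)) = (if (i, j) = x then 1 else 0)" and x: "x \<in> P3" for g x
  proof -
    have "B.R g (basis_fun [(0, 2)]) M = basis_fun [x] M" for M
    proof (cases "M \<in> lists_of P3 (Suc 0)")
      case True
      then obtain i j where M: "M = [(i, j)]" "i < 3" "j < 3" by (auto simp: lists_of_iff length_Suc_conv)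
      have "B.R g (basis_fun [(0, 2)]) M = (\<Sum>y\<in>P3. adjk g (i, j) y * basis_fun [(0, 2)] [y])"
        using True M unfolding B.R_def lists_of_1 by simp
      also have "\<dots> = adjk g (i, j) (0, 2)" by (simp add: basis_fun_def if_distrib[of "\<lambda>z. _ * z"] cong: if_cong)
      also have "\<dots> = basis_fun [x] M" using e[OF M(2,3)] by (simp add: dbl_def basis_fun_def M(1))
      finally show ?thesis .
    next
      case False
      then show ?thesis using x unfolding B.R_def by (auto simp: basis_fun_def lists_of_iff simp del: lists_of.simps)
    qed
    then have "basis_fun [x] = B.R g (basis_fun [(0, 2)])" by auto
    then show ?thesis using B.invariantD(3)[OF inv g B.cyc_self[OF uV]] by simp
  qed
  have "basis_fun [(0, 1)] \<in> B.cyc (basis_fun [(0, 2)])"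
    by (rule move[of "M3 1 0 0 0 0 1 0 (- 1) 0"]) (auto intro!: M3_SU3I simp: M3_mult M3_one less_3_cases)
  moreover have "basis_fun [(1, 2)] \<in> B.cyc (basis_fun [(0, 2)])"
    by (rule move[of "M3 0 (- 1) 0 1 0 0 0 0 1"]) (auto intro!: M3_SU3I simp: M3_mult M3_one less_3_cases)
  ultimately show "x \<in> {(0, 2), (0, 1), (1, 2)} \<Longrightarrow> basis_fun [x] \<in> B.cyc (basis_fun [(0, 2)])"
    using B.cyc_self[OF uV] by blast
qed

text \<open>Reduces occurrence to a count of supports: a weight of multiplicity one with nothing
  above it in \<open>Amb\<close>, seen at a list of positive root vectors, all of which lie in the
  adjoint part.\<close>

lemma occurs_of_support:
  fixes K :: nat
  assumes Amb: "su3_rep.invariant_sub (lists_of P3 K) (\<lambda>g. tw (adjk g)) Amb"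
    and u: "u \<in> Amb" "\<And>L. u L \<noteq> 0 \<Longrightarrow> lw L = (int (fst d), int (snd d))"
    and one: "\<And>y. y \<in> Amb \<Longrightarrow> (\<And>L. y L \<noteq> 0 \<Longrightarrow> weight_le (int (fst d), int (snd d)) (lw L)) \<Longrightarrow> \<exists>c. y = scl c u"
    and L0: "L0 \<in> lists_of P3 K" "u L0 \<noteq> 0" "set L0 \<subseteq> {(0, 2), (0, 1), (1, 2)}"
  shows "occurs_in_power d (1, 1) K"
proof -
  interpret A: adj_power K .
  have uV: "u \<in> A.V" using A.invariantD(2)[OF Amb] u(1) by blast
  have "u \<noteq> 0" using L0(2) by (auto simp: zero_fun_apply)
  then obtain n \<sigma> q where "dynkin_irrep d n \<sigma>" "A.matrix_form (A.cyc u) n \<sigma> q"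
    using A.support_irrep[OF Amb u(1) _ u(2) one] by blast
  moreover obtain n' \<rho> p where "dynkin_irrep (1, 1) n' \<rho>" "su3_unitary.matrix_form (lists_of P3 (Suc 0)) (\<lambda>g. tw (adjk g))
      (su3_rep.cyc (lists_of P3 (Suc 0)) (\<lambda>g. tw (adjk g)) (basis_fun [(0, 2)])) n' \<rho> p" using adjoint_sub(1) by blast
  ultimately show ?thesis
    by (rule occurs_of_matrix_form[OF uV _ _ _ adjoint_sub(3) _ L0(1,2) adjoint_sub(2)]) (use L0(3) in blast)
qed

lemma sum_fa_fb:
  "set L \<subseteq> P3 \<Longrightarrow> (\<Sum>x\<leftarrow>L. fa x) \<le> int (length L) \<and> (\<Sum>x\<leftarrow>L. fb x) \<le> int (length L) \<and>
    ((\<Sum>x\<leftarrow>L. fa x) = int (length L) \<longrightarrow> (\<Sum>x\<leftarrow>L. fb x) = int (length L) \<longrightarrow> L = replicate (length L) (0, 2))"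
proof (induction L)
  case (Cons x L)
  have x: "x \<in> P3" using Cons.prems by simp
  have IH: "(\<Sum>x\<leftarrow>L. fa x) \<le> int (length L)" "(\<Sum>x\<leftarrow>L. fb x) \<le> int (length L)"
    "(\<Sum>x\<leftarrow>L. fa x) = int (length L) \<Longrightarrow> (\<Sum>x\<leftarrow>L. fb x) = int (length L) \<Longrightarrow> L = replicate (length L) (0, 2)"
    using Cons by simp_all
  show ?case
  proof (intro conjI impI)
    assume a: "(\<Sum>x\<leftarrow>x # L. fa x) = int (length (x # L))" and b: "(\<Sum>x\<leftarrow>x # L. fb x) = int (length (x # L))"
    have "fa x = 1" "(\<Sum>x\<leftarrow>L. fa x) = int (length L)" using a IH(1) fa_fb(1)[OF x] by simp_all
    moreover have "fb x = 1" "(\<Sum>x\<leftarrow>L. fb x) = int (length L)" using b IH(2) fa_fb(2)[OF x] by simp_all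
    ultimately show "x # L = replicate (length (x # L)) (0, 2)" using IH(3) fa_fb(5)[OF x] by simp
  qed (use IH(1,2) fa_fb(1,2)[OF x] in simp_all)
qed simp

lemma lw_replicate: "lw (replicate K (0, 2)) = (int K, int K)"
  by (induction K) (simp_all add: lw_def pw_def qw_def)

abbreviation top_list :: "nat \<Rightarrow> (nat \<times> nat) list" where
  "top_list K \<equiv> replicate K (0, 2)"

lemma (in adj_power) top_list_support:
  "top_list K \<in> lists_of P3 K" "basis_fun (top_list K) L \<noteq> 0 \<Longrightarrow> lw L = (int (fst (K, K)), int (snd (K, K)))"
  "y \<in> V \<Longrightarrow> (\<And>L. y L \<noteq> 0 \<Longrightarrow> weight_le (int (fst (K, K)), int (snd (K, K))) (lw L)) \<Longrightarrow> \<exists>c. y = scl c (basis_fun (top_list K))"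
proof -
  show "top_list K \<in> lists_of P3 K" by (auto simp: lists_of_iff)
  show "basis_fun (top_list K) L \<noteq> 0 \<Longrightarrow> lw L = (int (fst (K, K)), int (snd (K, K)))"
    by (auto simp: basis_fun_def lw_replicate split: if_splits)
  assume y: "y \<in> V" "\<And>L. y L \<noteq> 0 \<Longrightarrow> weight_le (int (fst (K, K)), int (snd (K, K))) (lw L)"
  have "y L = 0" if "L \<noteq> top_list K" for L
  proof (rule ccontr)
    assume nz: "y L \<noteq> 0"
    then have "L \<in> lists_of P3 K" using y(1) unfolding V_def by blast
    then have LL: "length L = K" "set L \<subseteq> P3" by (simp_all add: lists_of_iff)
    have "int K \<le> (\<Sum>x\<leftarrow>L. fa x)" "int K \<le> (\<Sum>x\<leftarrow>L. fb x)"
      using weight_le_functionals[OF y(2)[OF nz]] lw_functionals[OF LL(2)] by auto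
    then show False using sum_fa_fb[OF LL(2)] that unfolding LL(1) by linarith
  qed
  then have "y = scl (y (top_list K)) (basis_fun (top_list K))" by (auto simp: fun_eq_iff scl_apply basis_fun_def)
  then show "\<exists>c. y = scl c (basis_fun (top_list K))" by blast
qed

lemma occurs_diagonal: "K > 0 \<Longrightarrow> occurs_in_power (K, K) (1, 1) K"
proof -
  assume K: "K > 0"
  interpret A: adj_power K .
  show ?thesis
    by (rule occurs_of_support[OF A.invariant_V A.basis_fun_V[OF A.top_list_support(1)] A.top_list_support(2,3) A.top_list_support(1)])
       (auto simp: basis_fun_def)
qed

text \<open>Antisymmetry in the first two tensor factors excludes the weights above \<open>d\<close> and makes the weight \<open>d\<close> simple.\<close>

lemma occurs_antisymmetric:
  fixes k :: nat and w :: "nat \<times> nat"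
  defines "M0 \<equiv> replicate k (0 :: nat, 2 :: nat)"
  assumes w: "w \<in> {(0, 1), (1, 2)}" and lw: "lw (w # (0, 2) # M0) = (int (fst d), int (snd d))"
    and top: "\<And>x y M. x \<in> P3 \<Longrightarrow> y \<in> P3 \<Longrightarrow> M \<in> lists_of P3 k \<Longrightarrow> x \<noteq> y \<Longrightarrow> weight_le (int (fst d), int (snd d)) (lw (x # y # M)) \<Longrightarrow>
      {x, y} = {w, (0, 2)} \<and> M = M0"
  shows "occurs_in_power d (1, 1) (Suc (Suc k))"
proof -
  let ?K = "Suc (Suc k)"
  let ?L1 = "w # (0, 2) # M0" and ?L2 = "(0, 2) # w # M0"
  interpret A: adj_power ?K .
  have L: "?L1 \<in> lists_of P3 ?K" "?L2 \<in> lists_of P3 ?K" using w by (auto simp: lists_of_iff M0_def simp del: lists_of.simps)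
  have ne: "w \<noteq> (0, 2)" using w by auto
  define Amb where "Amb = {f \<in> A.V. \<forall>x y M. f (x # y # M) = - f (y # x # M)}"
  have Amb: "A.invariant_sub Amb"
    unfolding A.invariant_sub_def csubspace_def
  proof (intro conjI ballI allI)
    fix g f assume g: "g \<in> carrier SU3" and f: "f \<in> Amb"
    have "A.R g f (x # y # M) = - A.R g f (y # x # M)" for x y M
    proof (cases "x \<in> P3 \<and> y \<in> P3 \<and> M \<in> lists_of P3 k")
      case True
      then have m: "x # y # M \<in> lists_of P3 ?K" "y # x # M \<in> lists_of P3 ?K" by (auto simp: lists_of_iff simp del: lists_of.simps)
      have "A.R g f (x # y # M) = (\<Sum>x'\<in>P3. \<Sum>y'\<in>P3. \<Sum>M'\<in>lists_of P3 k. adjk g x x' * (adjk g y y' * tw (adjk g) M M') * f (x' # y' # M'))"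
        using m(1) unfolding A.R_def sum_lists_of_Suc by simp
      also have "\<dots> = (\<Sum>y'\<in>P3. \<Sum>x'\<in>P3. \<Sum>M'\<in>lists_of P3 k. adjk g x x' * (adjk g y y' * tw (adjk g) M M') * f (x' # y' # M'))"
        by (rule sum.swap)
      also have "\<dots> = (\<Sum>y'\<in>P3. \<Sum>x'\<in>P3. \<Sum>M'\<in>lists_of P3 k. - (adjk g y y' * (adjk g x x' * tw (adjk g) M M') * f (y' # x' # M')))"
      proof (intro sum.cong refl)
        fix y' x' M'
        have "f (x' # y' # M') = - f (y' # x' # M')" using f unfolding Amb_def by blast
        then show "adjk g x x' * (adjk g y y' * tw (adjk g) M M') * f (x' # y' # M') = - (adjk g y y' * (adjk g x x' * tw (adjk g) M M') * f (y' # x' # M'))" by simp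
      qed
      also have "\<dots> = - A.R g f (y # x # M)"
        using m(2) unfolding A.R_def sum_lists_of_Suc by (simp add: sum_negf)
      finally show ?thesis .
    next
      case False
      then have "x # y # M \<notin> lists_of P3 ?K" "y # x # M \<notin> lists_of P3 ?K" by (auto simp: lists_of_iff simp del: lists_of.simps)
      then show ?thesis unfolding A.R_def by simp
    qed
    then show "A.R g f \<in> Amb" unfolding Amb_def using A.R_in_V by blast
  next
    fix f h assume f: "f \<in> Amb" "h \<in> Amb"
    have "(f + h) (x # y # M) = - (f + h) (y # x # M)" for x y M
    proof -
      have "f (x # y # M) = - f (y # x # M)" "h (x # y # M) = - h (y # x # M)" using f unfolding Amb_def by blast+
      then show ?thesis by (simp add: plus_fun_apply)
    qed
    then show "f + h \<in> Amb" using f csubspaceD(2)[OF A.V_csubspace] unfolding Amb_def by blast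
  next
    fix c f assume f: "f \<in> Amb"
    have "scl c f (x # y # M) = - scl c f (y # x # M)" for x y M
    proof -
      have "f (x # y # M) = - f (y # x # M)" using f unfolding Amb_def by blast
      then show ?thesis by (simp add: scl_apply)
    qed
    then show "scl c f \<in> Amb" using f csubspaceD(3)[OF A.V_csubspace] unfolding Amb_def by blast
  qed (auto simp: Amb_def zero_fun_apply csubspaceD(1)[OF A.V_csubspace] simp del: lists_of.simps)
  \<comment> \<open>The wedge of \<open>w\<close> with the highest root vector, tensored with
    further copies of the latter.\<close>
  define u :: "(nat \<times> nat) list \<Rightarrow> complex" where "u L = (if L = ?L1 then 1 else if L = ?L2 then -1 else 0)" for L
  have uA: "u \<in> Amb"
  proof -
    have "u (x # y # M) = - u (y # x # M)" for x y M using ne by (auto simp: u_def)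
    moreover have "u \<in> A.V" using L unfolding A.V_def u_def by auto
    ultimately show ?thesis unfolding Amb_def by blast
  qed
  show ?thesis
  proof (rule occurs_of_support[OF Amb uA _ _ L(1)])
    have "lw ?L2 = lw ?L1" by (simp add: lw_def)
    then show "u L \<noteq> 0 \<Longrightarrow> lw L = (int (fst d), int (snd d))" for L
      using lw by (simp add: u_def split: if_splits)
    fix y assume y: "y \<in> Amb" "\<And>L. y L \<noteq> 0 \<Longrightarrow> weight_le (int (fst d), int (snd d)) (lw L)"
    have anti: "y (a # b # M) = - y (b # a # M)" for a b M using y(1) unfolding Amb_def by blast
    have z: "y L = 0" if nL: "L \<noteq> ?L1" "L \<noteq> ?L2" for L
    proof (rule ccontr)
      assume nz: "y L \<noteq> 0"
      then have "L \<in> lists_of P3 ?K" using y(1) unfolding Amb_def A.V_def by blast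
      then obtain a b M where M: "L = a # b # M" "a \<in> P3" "b \<in> P3" "M \<in> lists_of P3 k" by auto
      have "a \<noteq> b" using anti[of a b M] nz M(1) by auto
      then have "{a, b} = {w, (0, 2)}" "M = M0" using top[OF M(2-4)] y(2)[OF nz] M(1) by auto
      then show False using nL M(1) by (auto simp: doubleton_eq_iff)
    qed
    have "y L = scl (y ?L1) u L" for L
      using z[of L] anti[of "(0, 2)" w M0] by (simp add: u_def scl_apply)
    then show "\<exists>c. y = scl c u" by blast
  qed (use w in \<open>auto simp: u_def M0_def\<close>)
qed

text \<open>Powers of the highest root vector give the labels with equal entries. Its wedge with a
  simple root vector has weight \<open>(3, 0)\<close> or \<open>(0, 3)\<close>, and one more factor
  \<open>(0, 2)\<close> gives \<open>(4, 1)\<close> or \<open>(1, 4)\<close>.\<close>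

lemma interaction_labels_occur:
  assumes "d \<in> interaction_labels"
  shows "\<exists>K\<le>3. occurs_in_power d (1, 1) K"
proof -
  note wf = weight_le_functionals and lf = lw_functionals
  \<comment> \<open>\<open>a\<close> and \<open>b\<close> are the simple root coefficients of the
    label, (2, 1) for \<open>(3, 0)\<close> and (1, 2) for \<open>(0, 3)\<close>. The entry 2 is the
    maximum for two factors and so pins down both of them.\<close>
  have two: "{x, y} = {w, (0, 2)}" if x: "x \<in> P3" "y \<in> P3" "x \<noteq> y" "fa x + fa y \<ge> a" "fb x + fb y \<ge> b" "w = (if a = 2 then (0, 1) else (1, 2))"
    "(a, b) \<in> {(2, 1), (1, 2)}" for x y w :: "nat \<times> nat" and a b :: int
  proof -
    note f = fa_fb[OF x(1)] fa_fb[OF x(2)]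
    consider "a = 2" "b = 1" "fa x = 1" "fa y = 1" | "a = 1" "b = 2" "fb x = 1" "fb y = 1" using x(4,5,7) f(1,2,8,9) by auto
    then show ?thesis
    proof cases
      case 1
      then have "fb x \<in> {0, 1}" "fb y \<in> {0, 1}" using f(3,10) by blast+
      then show ?thesis using 1 x(3,5,6) f(5,6,12,13) by auto
    next
      case 2
      then have "fa x \<in> {0, 1}" "fa y \<in> {0, 1}" using f(4,11) by blast+
      then show ?thesis using 2 x(3,4,6) f(5,7,12,14) by auto
    qed
  qed
  have fz: "z = (0, 2)" if h: "z \<in> P3" "x \<in> P3" "y \<in> P3" "x \<noteq> y" "fa x + fa y + fa z \<ge> a" "fb x + fb y + fb z \<ge> b" "(a, b) \<in> {(3, 2), (2, 3)}" for x y z a b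
  proof -
    note f = fa_fb[OF h(2)] fa_fb[OF h(3)] fa_fb[OF h(1)]
    consider "b = 2" "fa x = 1" "fa y = 1" "fa z = 1" | "a = 2" "fb x = 1" "fb y = 1" "fb z = 1" using h(5-7) f(1,2,8,9,15,16) by auto
    then show ?thesis
    proof cases
      case 1
      then have "fb x \<in> {0, 1}" "fb y \<in> {0, 1}" "fb z \<in> {0, 1}" using f(3,10,17) by blast+
      then show ?thesis using 1 h(4,6) f(5,12,19) by auto
    next
      case 2
      then have "fa x \<in> {0, 1}" "fa y \<in> {0, 1}" "fa z \<in> {0, 1}" using f(4,11,18) by blast+
      then show ?thesis using 2 h(4,5) f(5,12,19) by auto
    qed
  qed
  have k0: "occurs_in_power (int_d) (1, 1) (Suc (Suc 0))" if d: "(int_d, w, a, b) \<in> {((3, 0), (0, 1), 2, 1), ((0, 3), (1, 2), 1, 2)}" for int_d :: "nat \<times> nat" and w :: "nat \<times> nat" and a b :: int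
  proof (rule occurs_antisymmetric[where w = w])
    fix x y M assume x: "x \<in> P3" "y \<in> P3" "x \<noteq> y" and M: "M \<in> lists_of P3 0" and wl: "weight_le (int (fst int_d), int (snd int_d)) (lw (x # y # M))"
    have "fa x + fa y \<ge> a" "fb x + fb y \<ge> b" using wf[OF wl] lf[of "[x, y]"] x M d by auto
    moreover have "w = (if a = 2 then (0, 1) else (1, 2))" "(a, b) \<in> {(2, 1), (1, 2)}" using d by auto
    ultimately show "{x, y} = {w, (0, 2)} \<and> M = replicate 0 (0, 2)" using two[OF x] M by simp
  qed (use d in \<open>auto simp: lw_def pw_def qw_def\<close>)
  have k1: "occurs_in_power (int_d) (1, 1) (Suc (Suc (Suc 0)))" if d: "(int_d, w, a, b) \<in> {((4, 1), (0, 1), 3, 2), ((1, 4), (1, 2), 2, 3)}" for int_d :: "nat \<times> nat" and w :: "nat \<times> nat" and a b :: int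
  proof (rule occurs_antisymmetric[where w = w])
    fix x y M assume x: "x \<in> P3" "y \<in> P3" "x \<noteq> y" and M: "M \<in> lists_of P3 (Suc 0)" and wl: "weight_le (int (fst int_d), int (snd int_d)) (lw (x # y # M))"
    obtain z where z: "M = [z]" "z \<in> P3" using M by auto
    have s: "fa x + fa y + fa z \<ge> a" "fb x + fb y + fb z \<ge> b" using wf[OF wl] lf[of "[x, y, z]"] x z d by auto
    have zz: "z = (0, 2)" using fz[OF z(2) x s] d by auto
    then have "fa x + fa y \<ge> a - 1" "fb x + fb y \<ge> b - 1" using s by (auto simp: fa_def fb_def)
    moreover have "w = (if a - 1 = 2 then (0, 1) else (1, 2))" "(a - 1, b - 1) \<in> {(2, 1), (1, 2)}" using d by auto
    ultimately show "{x, y} = {w, (0, 2)} \<and> M = replicate (Suc 0) (0, 2)" using two[OF x] z zz by simp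
  qed (use d in \<open>auto simp: lw_def pw_def qw_def\<close>)
  have "occurs_in_power (1, 1) (1, 1) 1" "occurs_in_power (2, 2) (1, 1) 2" "occurs_in_power (3, 3) (1, 1) 3" by (rule occurs_diagonal; simp)+
  moreover have "occurs_in_power (3, 0) (1, 1) 2" "occurs_in_power (0, 3) (1, 1) 2" using k0 by (simp_all add: numeral_2_eq_2)
  moreover have "occurs_in_power (4, 1) (1, 1) 3" "occurs_in_power (1, 4) (1, 1) 3" using k1 by (simp_all add: numeral_3_eq_3)
  moreover have le: "K \<le> 3 \<Longrightarrow> occurs_in_power d (1, 1) K \<Longrightarrow> \<exists>K\<le>3. occurs_in_power d (1, 1) K" for K by blast
  ultimately show ?thesis using assms le[of 1] le[of 2] le[of 3] unfolding interaction_labels_def by auto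
qed

section \<open>Decoupling\<close>

text \<open>Operators on \<open>K\<close> qutrits are vectors in the \<open>K\<close>-th tensor power of \<open>V \<otimes> V\<^sup>*\<close>: \<open>pd\<close> turns a pair of row and column into
  the list of the pairs of their ternary digits.\<close>

definition pd :: "nat \<Rightarrow> nat \<times> nat \<Rightarrow> (nat \<times> nat) list" where
  "pd K x = zip (dig 3 K (fst x)) (dig 3 K (snd x))"

abbreviation sq :: "nat \<Rightarrow> (nat \<times> nat) set" where "sq K \<equiv> {..<3 ^ K} \<times> {..<3 ^ K}"

lemma dig_props: "r < n ^ K \<Longrightarrow> length (dig n K r) = K \<and> set (dig n K r) \<subseteq> {..<n}"
  using dig_lists[of r n K] by (simp add: lists_of_iff)

lemma pd_bij: "bij_betw (pd K) (sq K) (lists_of P3 K)"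
proof -
  have "pd K x \<in> lists_of P3 K" if "x \<in> sq K" for x
  proof -
    have x: "fst x < 3 ^ K" "snd x < 3 ^ K" using that by auto
    have "set (pd K x) \<subseteq> set (dig 3 K (fst x)) \<times> set (dig 3 K (snd x))" unfolding pd_def by (auto dest: set_zip_leftD set_zip_rightD)
    then show ?thesis using dig_props[OF x(1)] dig_props[OF x(2)] by (auto simp: lists_of_iff pd_def dest!: subsetD)
  qed
  then have sub: "pd K ` sq K \<subseteq> lists_of P3 K" by blast
  have inj: "inj_on (pd K) (sq K)"
  proof (rule inj_onI)
    fix x y assume x: "x \<in> sq K" and y: "y \<in> sq K" and e: "pd K x = pd K y"
    have b: "fst x < 3 ^ K" "snd x < 3 ^ K" "fst y < 3 ^ K" "snd y < 3 ^ K" using x y by auto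
    note l = dig_props[OF b(1)] dig_props[OF b(2)] dig_props[OF b(3)] dig_props[OF b(4)]
    have "dig 3 K (fst x) = dig 3 K (fst y)" using arg_cong[OF e, of "map fst"] l by (simp add: pd_def)
    moreover have "dig 3 K (snd x) = dig 3 K (snd y)" using arg_cong[OF e, of "map snd"] l by (simp add: pd_def)
    ultimately show "x = y" using dig_inj[of _ 3 K] b by (auto simp: prod_eq_iff)
  qed
  have "card (sq K) = card (lists_of P3 K)" by (simp add: card_lists_of card_cartesian_product flip: power_mult_distrib)
  then have "pd K ` sq K = lists_of P3 K" by (intro card_subset_eq[OF _ sub]) (simp_all add: finite_lists_of card_image[OF inj])
  then show ?thesis using inj by (simp add: bij_betw_def)
qed

lemma tw_zip:
  assumes "length a = K" "length b = K" "length c = K" "length d = K"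
  shows "tw (dbl k g) (zip a b) (zip c d) = tw (k g) a c * cnj (tw (k g) b d)"
  using assms
proof (induction K arbitrary: a b c d)
  case (Suc K)
  then show ?case by (auto simp: length_Suc_conv dbl_def)
qed simp

definition mf :: "nat \<Rightarrow> complex mat \<Rightarrow> (nat \<times> nat) list \<Rightarrow> complex" where
  "mf K M L = (if L \<in> lists_of P3 K then M $$ inv_into (sq K) (pd K) L else 0)"

lemma mf_pd: "x \<in> sq K \<Longrightarrow> mf K M (pd K x) = M $$ x"
  using pd_bij[of K] by (auto simp: mf_def bij_betw_def)

lemma pd_surj: "L \<in> lists_of P3 K \<Longrightarrow> \<exists>x\<in>sq K. L = pd K x"
  using pd_bij[of K] unfolding bij_betw_def by blast

lemma mf_eqI: "f \<in> su3_rep.V (lists_of P3 K) \<Longrightarrow> h \<in> su3_rep.V (lists_of P3 K) \<Longrightarrow> (\<And>x. x \<in> sq K \<Longrightarrow> f (pd K x) = h (pd K x)) \<Longrightarrow> f = h"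
proof
  interpret A: adj_power K .
  fix L assume f: "f \<in> A.V" "h \<in> A.V" and e: "\<And>x. x \<in> sq K \<Longrightarrow> f (pd K x) = h (pd K x)"
  show "f L = h L"
  proof (cases "L \<in> lists_of P3 K")
    case True
    then obtain x where "x \<in> sq K" "L = pd K x" using pd_surj by blast
    then show ?thesis using e by simp
  next
    case False then show ?thesis using f unfolding A.V_def by simp
  qed
qed

lemma mf_V: "mf K M \<in> su3_rep.V (lists_of P3 K)"
proof -
  interpret A: adj_power K .
  show ?thesis unfolding A.V_def mf_def by simp
qed

lemma sum_pd: "(\<Sum>L\<in>lists_of P3 K. f L) = (\<Sum>r<3 ^ K. \<Sum>c<3 ^ K. f (pd K (r, c)))"
  unfolding sum.reindex_bij_betw[OF pd_bij, symmetric] by (simp add: sum.cartesian_product)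

lemma tensor_power_unitary:
  assumes g: "g \<in> carrier SU3"
  shows "tensor_power K (mat_adjoint g) = mat_adjoint (tensor_power K g)"
    and "tensor_power K (mat_adjoint g) * tensor_power K g = 1\<^sub>m (3 ^ K)"
proof -
  interpret D: su3_unitary "lists_of {..<3} K" "\<lambda>g. tw (\<lambda>i j. g $$ (i, j))"
    by (rule su3_unitary_tensor_power[OF su3_unitary_defining])
  have g': "mat_adjoint g \<in> carrier SU3" using g by simp
  note c = tensor_power_carrier[OF SU3_mat[OF g], of K] tensor_power_carrier[OF SU3_mat[OF g'], of K]
  note ix = tensor_power_index[OF SU3_mat[OF g], of _ K] tensor_power_index[OF SU3_mat[OF g'], of _ K]
  have dl: "dig 3 K r \<in> lists_of {..<3} K" if "r < 3 ^ K" for r using dig_lists[OF that] .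
  show "tensor_power K (mat_adjoint g) = mat_adjoint (tensor_power K g)"
    using c by (intro eq_matI) (auto simp: ix D.A_adj[OF g dl dl])
  show "tensor_power K (mat_adjoint g) * tensor_power K g = 1\<^sub>m (3 ^ K)"
  proof (rule eq_matI)
    fix i j assume "i < dim_row (1\<^sub>m (3 ^ K) :: complex mat)" "j < dim_col (1\<^sub>m (3 ^ K) :: complex mat)"
    then have ij: "i < 3 ^ K" "j < 3 ^ K" by simp_all
    have "(tensor_power K (mat_adjoint g) * tensor_power K g) $$ (i, j)
      = (\<Sum>k<3 ^ K. tw (\<lambda>i j. mat_adjoint g $$ (i, j)) (dig 3 K i) (dig 3 K k) * tw (\<lambda>i j. g $$ (i, j)) (dig 3 K k) (dig 3 K j))"
      unfolding mat_mult_index_sum[OF c(2,1) ij] using ij by (intro sum.cong refl) (simp add: ix)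
    also have "\<dots> = (\<Sum>L\<in>lists_of {..<3} K. tw (\<lambda>i j. mat_adjoint g $$ (i, j)) (dig 3 K i) L * tw (\<lambda>i j. g $$ (i, j)) L (dig 3 K j))"
      by (rule sum.reindex_bij_betw[OF dig_bij])
    also have "\<dots> = (if i = j then 1 else 0)"
    proof -
      have "dig 3 K i = dig 3 K j \<longleftrightarrow> i = j" using dig_inj[OF ij] by blast
      then show ?thesis
        using D.A_mult[OF g' g dl[OF ij(1)] dl[OF ij(2)]] D.A_one[OF dl[OF ij(1)] dl[OF ij(2)]] SU3_adjoint_left[OF g] by simp
    qed
    finally show "(tensor_power K (mat_adjoint g) * tensor_power K g) $$ (i, j) = 1\<^sub>m (3 ^ K) $$ (i, j)" using ij by simp
  qed (use c in auto)
qed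

lemma R_mf:
  assumes g: "g \<in> carrier SU3" and M: "M \<in> carrier_mat (3 ^ K) (3 ^ K)" and r: "r < 3 ^ K" and c: "c < 3 ^ K"
  shows "su3_rep.R (lists_of P3 K) (\<lambda>g. tw (adjk g)) g (mf K M) (pd K (r, c)) = (tensor_power K g * M * mat_adjoint (tensor_power K g)) $$ (r, c)"
proof -
  interpret A: adj_power K .
  note ix = tensor_power_index[OF SU3_mat[OF g], of _ K]
  note tc = tensor_power_carrier[OF SU3_mat[OF g], of K]
  have len: "length (dig 3 K k) = K" if "k < 3 ^ K" for k using dig_props[OF that] by simp
  have "pd K (r, c) \<in> lists_of P3 K" using pd_bij[of K] r c by (auto simp: bij_betw_def)
  then have "A.R g (mf K M) (pd K (r, c)) = (\<Sum>k<3 ^ K. \<Sum>l<3 ^ K. tw (adjk g) (pd K (r, c)) (pd K (k, l)) * mf K M (pd K (k, l)))"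
    unfolding A.R_def sum_pd by simp
  also have "\<dots> = (\<Sum>k<3 ^ K. \<Sum>l<3 ^ K. tensor_power K g $$ (r, k) * cnj (tensor_power K g $$ (c, l)) * M $$ (k, l))"
  proof (intro sum.cong refl)
    fix k l assume "k \<in> {..<3 ^ K :: nat}" "l \<in> {..<3 ^ K :: nat}"
    then have k: "k < 3 ^ K" "l < 3 ^ K" by simp_all
    have "tw (adjk g) (pd K (r, c)) (pd K (k, l)) = tensor_power K g $$ (r, k) * cnj (tensor_power K g $$ (c, l))"
      unfolding pd_def fst_conv snd_conv tw_zip[OF len[OF r] len[OF c] len[OF k(1)] len[OF k(2)]] using r c k by (simp add: ix)
    then show "tw (adjk g) (pd K (r, c)) (pd K (k, l)) * mf K M (pd K (k, l)) = tensor_power K g $$ (r, k) * cnj (tensor_power K g $$ (c, l)) * M $$ (k, l)"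
      using k by (simp add: mf_pd)
  qed
  also have "\<dots> = (\<Sum>l<3 ^ K. (\<Sum>k<3 ^ K. tensor_power K g $$ (r, k) * M $$ (k, l)) * cnj (tensor_power K g $$ (c, l)))"
    by (subst sum.swap) (simp add: sum_distrib_left sum_distrib_right mult_ac)
  also have "\<dots> = (\<Sum>l<3 ^ K. (tensor_power K g * M) $$ (r, l) * mat_adjoint (tensor_power K g) $$ (l, c))"
    using c tc by (intro sum.cong refl arg_cong2[of _ _ _ _ "(*)"]) (simp_all add: mat_mult_index_sum[OF tc M r] del: index_mult_mat)
  also have "\<dots> = (tensor_power K g * M * mat_adjoint (tensor_power K g)) $$ (r, c)"
    using mat_mult_index_sum[OF mult_carrier_mat[OF tc M] mat_adjoint_carrier[OF tc] r c] by simp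
  finally show ?thesis .
qed

section \<open>Product operators and the weights of interactions\<close>

fun pf :: "('a \<Rightarrow> complex) list \<Rightarrow> 'a list \<Rightarrow> complex" where
  "pf (f # fs) (x # L) = f x * pf fs L"
| "pf _ _ = 1"

lemma pf_tw: "length L = K \<Longrightarrow> length fs = K \<Longrightarrow>
  (\<Sum>M\<in>lists_of J K. tw a L M * pf fs M) = pf (map (\<lambda>f x. \<Sum>y\<in>J. a x y * f y) fs) L"
proof (induction K arbitrary: L fs)
  case (Suc K)
  then obtain x L' f fs' where LM: "L = x # L'" "fs = f # fs'" "length L' = K" "length fs' = K" by (auto simp: length_Suc_conv)
  have "(\<Sum>M\<in>lists_of J (Suc K). tw a L M * pf fs M) = (\<Sum>y\<in>J. \<Sum>M\<in>lists_of J K. (a x y * f y) * (tw a L' M * pf fs' M))"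
    unfolding sum_lists_of_Suc LM by (intro sum.cong refl) simp
  also have "\<dots> = (\<Sum>y\<in>J. a x y * f y) * pf (map (\<lambda>f x. \<Sum>y\<in>J. a x y * f y) fs') L'"
    by (simp add: Suc.IH[OF LM(3,4)] sum_distrib_left[symmetric] sum_distrib_right)
  finally show ?case by (simp add: LM)
qed simp

lemma pf_nonzero: "pf fs L \<noteq> 0 \<Longrightarrow> length fs = length L \<Longrightarrow> i < length L \<Longrightarrow> (fs ! i) (L ! i) \<noteq> 0"
  by (induction fs L arbitrary: i rule: pf.induct) (auto simp: nth_Cons split: nat.splits)

lemma tensor_list_carrier: "(\<And>M. M \<in> set Ms \<Longrightarrow> M \<in> carrier_mat 3 3) \<Longrightarrow> tensor_list Ms \<in> carrier_mat (3 ^ length Ms) (3 ^ length Ms)"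
proof (induction Ms)
  case (Cons M Ms)
  then have "tensor_list Ms \<in> carrier_mat (3 ^ length Ms) (3 ^ length Ms)" "M \<in> carrier_mat 3 3" by simp_all
  then show ?case by (auto simp: tensor_list_def tensor_mat_def)
qed (simp add: tensor_list_def)

lemma tensor_list_index: "(\<And>M. M \<in> set Ms \<Longrightarrow> M \<in> carrier_mat 3 3) \<Longrightarrow> r < 3 ^ length Ms \<Longrightarrow> c < 3 ^ length Ms \<Longrightarrow>
  tensor_list Ms $$ (r, c) = pf (map ($$) Ms) (pd (length Ms) (r, c))"
proof (induction Ms arbitrary: r c)
  case (Cons M Ms)
  have t: "tensor_list Ms \<in> carrier_mat (3 ^ length Ms) (3 ^ length Ms)" "M \<in> carrier_mat 3 3"
    using tensor_list_carrier[of Ms] Cons.prems by simp_all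
  have e: "tensor_list (M # Ms) = M \<otimes>\<^sub>m tensor_list Ms" by (simp add: tensor_list_def)
  have "r mod 3 ^ length Ms < 3 ^ length Ms" "c mod 3 ^ length Ms < 3 ^ length Ms" by simp_all
  then have "tensor_list Ms $$ (r mod 3 ^ length Ms, c mod 3 ^ length Ms) = pf (map ($$) Ms) (pd (length Ms) (r mod 3 ^ length Ms, c mod 3 ^ length Ms))"
    using Cons by simp
  then show ?case
    using Cons.prems(2,3) carrier_matD[OF t(1)] carrier_matD[OF t(2)] unfolding e by (simp add: tensor_mat_def pd_def)
qed (simp add: tensor_list_def pd_def)

definition offdiag :: "(nat \<times> nat) list \<Rightarrow> nat" where
  "offdiag L = length (filter (\<lambda>x. fst x \<noteq> snd x) L)"

text \<open>A diagonal matrix unit has weight zero and an off-diagonal one has a root as its weight,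
  which lies below the highest root \<open>(1, 1)\<close>.\<close>

lemma lw_offdiag: "set L \<subseteq> P3 \<Longrightarrow> weight_le (lw L) (int (offdiag L), int (offdiag L))"
proof (induction L)
  case Nil then show ?case by (simp add: lw_def offdiag_def weight_le_refl)
next
  case (Cons x L)
  obtain i j where x: "x = (i, j)" "i < 3" "j < 3" using Cons.prems by (cases x) auto
  define e :: int where "e = (if i = j then 0 else 1)"
  have "weight_le (pw x) (e, e)"
    unfolding weight_le_iff e_def using x
    by (auto simp: less_3_cases pw_def qw_def intro: exI[of _ 0] exI[of _ 1] exI[of _ 2])
  moreover have "lw (x # L) = (fst (pw x) + fst (lw L), snd (pw x) + snd (lw L))" by (simp add: lw_def)
  moreover have "int (offdiag (x # L)) = e + int (offdiag L)" by (simp add: offdiag_def e_def x)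
  ultimately show ?case using weight_le_add[of "pw x" "(e, e)" "lw L" "(int (offdiag L), int (offdiag L))"] Cons by simp
qed

text \<open>Conjugation fixes the identity, whose off-diagonal entries vanish.\<close>

lemma conj_identity:
  assumes g: "g \<in> carrier SU3" and x: "x \<in> P3" "fst x \<noteq> snd x"
  shows "(\<Sum>y\<in>P3. adjk g x y * 1\<^sub>m 3 $$ y) = 0"
proof -
  obtain i j where ij: "x = (i, j)" "i < 3" "j < 3" "i \<noteq> j" using x by (cases x) auto
  have "(\<Sum>y\<in>P3. adjk g x y * 1\<^sub>m 3 $$ y) = (\<Sum>k<3. \<Sum>l<3. adjk g x (k, l) * 1\<^sub>m 3 $$ (k, l))"
    unfolding sum.cartesian_product by (intro sum.cong) auto
  also have "\<dots> = (\<Sum>k<3. g $$ (i, k) * cnj (g $$ (j, k)))"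
    by (simp add: ij dbl_def sum_lessThan_3)
  also have "\<dots> = (g * mat_adjoint g) $$ (i, j)"
    using ij SU3_mat[OF g] by (subst mat_mult_index_sum[of _ 3 3 _ 3]) auto
  also have "\<dots> = 0" using ij by (simp add: SU3_adjoint_right[OF g] del: index_mult_mat)
  finally show ?thesis .
qed

context adj_power
begin

text \<open>An invariant form of acting on at most \<open>J\<close> sites: no conjugate has a
  component with more than \<open>J\<close> off-diagonal factors. It bounds the weights in terms of
  \<open>J\<close>, whatever the number \<open>K\<close> of qutrits.\<close>

definition body_sub :: "nat \<Rightarrow> ((nat \<times> nat) list \<Rightarrow> complex) set" where
  "body_sub J = {f \<in> V. \<forall>g\<in>carrier SU3. \<forall>L. offdiag L > J \<longrightarrow> R g f L = 0}"

lemma body_sub_invariant: "invariant_sub (body_sub J)"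
  unfolding invariant_sub_def csubspace_def
proof (intro conjI ballI allI)
  fix g f assume g: "g \<in> carrier SU3" and f: "f \<in> body_sub J"
  have "R h (R g f) L = 0" if "h \<in> carrier SU3" "offdiag L > J" for h L
    using f that g unfolding body_sub_def by (simp flip: R_mult)
  then show "R g f \<in> body_sub J" by (simp add: body_sub_def)
qed (auto simp: body_sub_def R_add R_scl scl_apply zero_fun_apply plus_fun_apply csubspaceD[OF V_csubspace] simp del: lists_of.simps)

lemma body_sub_weight:
  assumes "f \<in> body_sub J" "f \<noteq> 0" "wt \<nu> f"
  shows "\<exists>c\<le>J. weight_le \<nu> (int c, int c)"
proof -
  obtain L where L: "f L \<noteq> 0" using assms(2) by (auto simp: fun_eq_iff zero_fun_apply)
  have "R (1\<^sub>m 3) f L \<noteq> 0" using assms(1) L by (simp add: body_sub_def R_one)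
  moreover have "R (1\<^sub>m 3) f L = 0" if "offdiag L > J" using assms(1) SU3_one that unfolding body_sub_def by blast
  ultimately have "offdiag L \<le> J" by linarith
  moreover have "lw L = \<nu>" "set L \<subseteq> P3" using wt_support[OF assms(3) L] by (auto simp: lists_of_iff)
  ultimately show ?thesis using lw_offdiag by blast
qed

lemma mf_add: "A \<in> carrier_mat (3 ^ K) (3 ^ K) \<Longrightarrow> B \<in> carrier_mat (3 ^ K) (3 ^ K) \<Longrightarrow> mf K (A + B) = mf K A + mf K B"
  by (rule mf_eqI[OF mf_V csubspaceD(2)[OF V_csubspace mf_V mf_V]]) (auto simp: plus_fun_apply mf_pd)

lemma mf_smult: "A \<in> carrier_mat (3 ^ K) (3 ^ K) \<Longrightarrow> mf K (c \<cdot>\<^sub>m A) = scl c (mf K A)"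
  by (rule mf_eqI[OF mf_V csubspaceD(3)[OF V_csubspace mf_V]]) (auto simp: scl_apply mf_pd)

lemma mf_zero: "mf K (0\<^sub>m (3 ^ K) (3 ^ K)) = 0"
  by (rule mf_eqI[OF mf_V csubspaceD(1)[OF V_csubspace]]) (auto simp: zero_fun_apply mf_pd)

lemma body_product_sub:
  assumes "M \<in> body_products K J"
  shows "M \<in> carrier_mat (3 ^ K) (3 ^ K)" "mf K M \<in> body_sub J"
proof -
  obtain Ms S where Ms: "M = tensor_list Ms" "length Ms = K" and S: "S \<subseteq> {..<K}" "card S = J"
    and i: "\<And>i. i \<in> S \<Longrightarrow> Ms ! i \<in> carrier_mat 3 3" "\<And>i. i < K \<Longrightarrow> i \<notin> S \<Longrightarrow> Ms ! i = 1\<^sub>m 3"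
    using assms unfolding body_products_def by blast
  have c: "X \<in> carrier_mat 3 3" if X: "X \<in> set Ms" for X
  proof -
    obtain k where k: "k < K" "X = Ms ! k" using X Ms(2) by (auto simp: in_set_conv_nth)
    show ?thesis using i(1)[of k] i(2)[OF k(1)] k by (cases "k \<in> S") auto
  qed
  show "M \<in> carrier_mat (3 ^ K) (3 ^ K)" using tensor_list_carrier[of Ms] c Ms by simp
  have e: "mf K M L = pf (map ($$) Ms) L" if L: "L \<in> lists_of P3 K" for L
  proof -
    obtain x where x: "x \<in> sq K" "L = pd K x" using pd_surj[OF L] by blast
    then have "tensor_list Ms $$ (fst x, snd x) = pf (map ($$) Ms) (pd K (fst x, snd x))"
      using tensor_list_index[of Ms "fst x" "snd x"] c Ms(2) by auto
    then show ?thesis using x Ms(1) mf_pd[OF x(1)] by simp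
  qed
  have "R g (mf K M) L = 0" if g: "g \<in> carrier SU3" and L: "offdiag L > J" for g L
  proof (rule ccontr)
    assume nz: "R g (mf K M) L \<noteq> 0"
    then have LK: "L \<in> lists_of P3 K" unfolding R_def by metis
    then have len: "length L = K" "set L \<subseteq> P3" by (simp_all add: lists_of_iff)
    have "R g (mf K M) L = (\<Sum>N\<in>lists_of P3 K. tw (adjk g) L N * pf (map ($$) Ms) N)"
      using LK unfolding R_def by (simp add: e del: lists_of.simps cong: sum.cong)
    also have "\<dots> = pf (map (\<lambda>f x. \<Sum>y\<in>P3. adjk g x y * f y) (map ($$) Ms)) L"
      by (rule pf_tw) (use len Ms(2) in simp_all)
    finally have nz': "pf (map (\<lambda>f x. \<Sum>y\<in>P3. adjk g x y * f y) (map ($$) Ms)) L \<noteq> 0" using nz by simp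
    \<comment> \<open>At a site outside \<open>S\<close> the factor is the identity, so an
      off-diagonal entry there would make the product vanish.\<close>
    have "{i. i < length L \<and> fst (L ! i) \<noteq> snd (L ! i)} \<subseteq> S"
    proof (rule subsetI, rule ccontr)
      fix k assume k: "k \<in> {i. i < length L \<and> fst (L ! i) \<noteq> snd (L ! i)}" "k \<notin> S"
      then have kK: "k < K" "L ! k \<in> P3" using len nth_mem[of k L] by auto
      have "(\<Sum>y\<in>P3. adjk g (L ! k) y * Ms ! k $$ y) \<noteq> 0" using pf_nonzero[OF nz', of k] kK(1) len(1) Ms(2) by simp
      then show False using conj_identity[OF g kK(2)] k i(2)[OF kK(1)] by simp
    qed
    then have "offdiag L \<le> card S"
      unfolding offdiag_def length_filter_conv_card using S(1) finite_subset[OF S(1)] by (intro card_mono) auto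
    then show False using L S(2) by simp
  qed
  then show "mf K M \<in> body_sub J" using mf_V unfolding body_sub_def by blast
qed

lemma body_interaction_sub:
  assumes "M \<in> body_interactions K J"
  shows "M \<in> carrier_mat (3 ^ K) (3 ^ K)" "mf K M \<in> body_sub J"
proof -
  interpret m: Module.module class_ring "module_mat TYPE(complex) (3 ^ K) (3 ^ K)"
    using matrix_vs[where 'a = complex, of "3 ^ K" "3 ^ K"] unfolding vectorspace_def by blast
  note inv = invariantD(1)[OF body_sub_invariant[of J]]
  define N where "N = {M \<in> carrier_mat (3 ^ K) (3 ^ K). mf K M \<in> body_sub J}"
  have "submodule class_ring N (module_mat TYPE(complex) (3 ^ K) (3 ^ K))"
    unfolding submodule_def module_mat_simps N_def
    using m.module_axioms csubspaceD[OF inv] by (auto simp: mf_add mf_smult mf_zero)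
  moreover have "body_products K J \<subseteq> N" using body_product_sub by (auto simp: N_def)
  ultimately have "body_interactions K J \<subseteq> N" unfolding body_interactions_def by (intro m.span_is_subset)
  then show "M \<in> carrier_mat (3 ^ K) (3 ^ K)" "mf K M \<in> body_sub J" using assms by (auto simp: N_def)
qed

lemma trace_mf:
  assumes "P \<in> carrier_mat (3 ^ K) (3 ^ K)" "M \<in> carrier_mat (3 ^ K) (3 ^ K)"
  shows "mat_trace (mat_adjoint P * M) = cip (lists_of P3 K) (mf K P) (mf K M)"
proof -
  have "mat_trace (mat_adjoint P * M) = (\<Sum>c<3 ^ K. \<Sum>r<3 ^ K. cnj (P $$ (r, c)) * M $$ (r, c))"
    unfolding mat_trace_def using assms
    by (intro sum.cong) (auto simp: mat_mult_index_sum[of _ "3 ^ K" "3 ^ K" _ "3 ^ K"] simp del: index_mult_mat(1))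
  also have "\<dots> = cip (lists_of P3 K) (mf K P) (mf K M)"
    unfolding cip_def sum_pd by (subst sum.swap) (simp add: mf_pd)
  finally show ?thesis .
qed

lemma fixed_commutes:
  assumes P: "P \<in> carrier_mat (3 ^ K) (3 ^ K)" and g: "g \<in> carrier SU3" and fx: "R g (mf K P) = mf K P"
  shows "P * tensor_power K g = tensor_power K g * P"
proof -
  note tc = tensor_power_carrier[OF SU3_mat[OF g], of K]
  let ?a = "mat_adjoint (tensor_power K g)"
  have ac: "?a \<in> carrier_mat (3 ^ K) (3 ^ K)" using tc by simp
  have eq: "tensor_power K g * P * ?a = P"
  proof (rule eq_matI)
    fix r c assume "r < dim_row P" "c < dim_col P"
    then have rc: "r < 3 ^ K" "c < 3 ^ K" using P by simp_all
    show "(tensor_power K g * P * ?a) $$ (r, c) = P $$ (r, c)"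
      using R_mf[OF g P rc] fx mf_pd[of "(r, c)" K P] rc by simp
  qed (use P tc in auto)
  have "P * tensor_power K g = tensor_power K g * P * ?a * tensor_power K g" by (simp add: eq)
  also have "\<dots> = tensor_power K g * P * (?a * tensor_power K g)"
    by (rule assoc_mult_mat[OF mult_carrier_mat[OF tc P] ac tc])
  also have "\<dots> = tensor_power K g * P"
    unfolding tensor_power_unitary(1)[OF g, symmetric] tensor_power_unitary(2)[OF g] by (rule right_mult_one_mat[OF mult_carrier_mat[OF tc P]])
  finally show ?thesis .
qed

text \<open>For weight zero, \<open>highest_weight_coeff\<close> says that \<open>v\<close> has the
  same inner product with \<open>R g v\<close> as with itself. The norms agree as well, so the
  difference has norm zero.\<close>

lemma zero_weight_fixed:
  assumes U: "invariant_sub U" and v: "v \<in> U" "v \<noteq> 0" "wt (0, 0) v" and lm: "lexmax U (0, 0)" and g: "g \<in> carrier SU3"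
  shows "R g v = v"
proof -
  let ?I = "lists_of P3 K"
  have vV: "v \<in> V" using v(1) invariantD(2)[OF U] by blast
  note hw = cip_hw_functional[OF U v(3), unfolded hw_functional_def]
  have e: "cip ?I v (R g v) = cip ?I v v"
    using highest_weight_coeff(1)[OF U v lm, of "cip ?I v" g] hw g by auto
  have "cip ?I (R g v) (R g v) = cip ?I v v" by (simp add: cip_R[OF g] R_inv_cancel[OF g vV])
  moreover have "cip ?I (R g v) v = cip ?I v v" using cip_cnj[of ?I v "R g v"] cip_cnj[of ?I v v] e by simp
  moreover have "cip ?I (x - y) z = cip ?I x z - cip ?I y z" for x y z by (simp add: cip_def algebra_simps sum_subtractf)
  ultimately have "cip ?I (R g v - v) (R g v - v) = 0" using e by (simp add: cip_diff)
  moreover have "R g v - v \<in> V" using vV by (intro csubspace_diff[OF V_csubspace]) auto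
  ultimately have "R g v - v = 0" by (intro cip_positive)
  then show ?thesis by simp
qed

lemma conj_average_zero:
  assumes G: "G \<subseteq> carrier SU3" "finite G" "\<And>g h. g \<in> G \<Longrightarrow> h \<in> G \<Longrightarrow> g * h \<in> G"
    and gens: "{matA 2, matE, matW, matF} \<subseteq> G"
    and J: "J \<le> 3" and M: "mf K M \<in> body_sub J" "M \<in> carrier_mat (3 ^ K) (3 ^ K)" "anisotropic K M"
  shows "(\<Sum>g\<in>G. R g (mf K M)) = 0"
proof (rule ccontr)
  let ?I = "lists_of P3 K"
  define w where "w = (\<Sum>g\<in>G. R g (mf K M))"
  assume "(\<Sum>g\<in>G. R g (mf K M)) \<noteq> 0"
  then have nz: "w \<noteq> 0" by (simp add: w_def)
  note inv = body_sub_invariant[of J]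
  have wB: "w \<in> body_sub J" unfolding w_def using G(1) invariantD(3)[OF inv _ M(1)] by (intro csubspace_sum invariantD(1)[OF inv]) blast
  have wV: "w \<in> V" using wB invariantD(2)[OF inv] by blast
  have fixed: "R k w = w" if k: "k \<in> G" for k
  proof -
    have kS: "k \<in> carrier SU3" using k G(1) by blast
    have inj: "inj_on ((*) k) G"
    proof (rule inj_onI)
      fix x y assume x: "x \<in> G" "y \<in> G" "k * x = k * y"
      then have "x \<in> carrier SU3" "y \<in> carrier SU3" using G(1) by blast+
      moreover have "mat_adjoint k * (k * y) = y" if "y \<in> carrier SU3" for y
        using assoc_mult_mat[of "mat_adjoint k" 3 3 k 3 y 3] SU3_adjoint_left[OF kS] SU3_mat[OF kS] SU3_mat[OF that] by simp
      ultimately show "x = y" using x(3) by metis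
    qed
    have im: "(*) k ` G = G" using G(2,3) k by (intro card_subset_eq) (auto simp: card_image[OF inj])
    have "R k w = (\<Sum>g\<in>G. R (k * g) (mf K M))"
      unfolding w_def R_sum using G(1) kS by (intro sum.cong refl) (auto simp: R_mult)
    also have "\<dots> = (\<Sum>g\<in>(*) k ` G. R g (mf K M))" by (simp add: sum.reindex[OF inj])
    finally show ?thesis by (simp add: im w_def)
  qed
  define U where "U = cyc w"
  have U: "invariant_sub U" and wU: "w \<in> U" using cyc_invariant[OF wV] cyc_self[OF wV] by (simp_all add: U_def)
  have UB: "U \<subseteq> body_sub J" unfolding U_def by (rule cyc_subset[OF inv wB])
  obtain m v where v: "v \<in> U" "v \<noteq> 0" "wt m v" and lm: "lexmax U m" using lexmax_exists[OF U wU nz] by blast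
  have vV: "v \<in> V" using v(3) wtD by blast
  note hwf = cip_hw_functional[OF U v(3)]
  note hwf' = hwf[unfolded hw_functional_def]
  have m0: "0 \<le> fst m" "0 \<le> snd m" using highest_weight_coeff(2,3)[OF U v lm, of "cip ?I v" "1\<^sub>m 3"] hwf' by auto
  obtain c where c: "c \<le> J" "weight_le m (int c, int c)" using body_sub_weight[of v J m] v UB by blast
  have m3: "weight_le m (3, 3)"
  proof -
    obtain a b where "0 \<le> a" "0 \<le> b" "int c - fst m = 2 * a - b" "int c - snd m = 2 * b - a"
      using c(2) unfolding weight_le_iff by auto
    then show ?thesis unfolding weight_le_iff using c(1) J
      by (intro exI[of _ "a + 3 - int c"] exI[of _ "b + 3 - int c"]) auto
  qed
  \<comment> \<open>It is enough that \<open>v\<close> is orthogonal to the orbit of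
    \<open>w\<close>, because \<open>v\<close> lies in the span of that orbit.\<close>
  have "cip ?I v (R h w) = 0" if h: "h \<in> carrier SU3" for h
  proof (cases "m = (0, 0)")
    case False
    have mn: "m = (int (nat (fst m)), int (nat (snd m)))" using m0 by (simp add: prod_eq_iff)
    have "(nat (fst m), nat (snd m)) \<noteq> (0, 0)" using False mn by (metis Pair_inject of_nat_0)
    then have lab: "(nat (fst m), nat (snd m)) \<in> interaction_labels"
      using dominated_labels[of "nat (fst m)" "nat (snd m)"] m3 mn by simp
    note cv = cyc_invariant[OF vV]
    \<comment> \<open>The orthogonal projection of \<open>w\<close> to \<open>cyc v\<close> is again
      fixed by \<open>G\<close> and lies where \<open>no_invariant_coeff\<close> applies; the
      complementary part is orthogonal to \<open>v\<close>.\<close>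
    obtain p where p: "p \<in> cyc v" "w - p \<in> V" "\<And>x. x \<in> cyc v \<Longrightarrow> cip ?I x (w - p) = 0" using projection[OF cv wV] by blast
    define Q where "Q = {y \<in> V. \<forall>x\<in>cyc v. cip ?I x y = 0}"
    have Q: "invariant_sub Q" unfolding Q_def by (rule complement_invariant[OF cv])
    have wp: "w - p \<in> Q" using p by (simp add: Q_def)
    have pf: "R k p = p" if k: "k \<in> G" for k
    proof -
      have kS: "k \<in> carrier SU3" using k G(1) by blast
      have a: "R k p - p \<in> cyc v" by (rule csubspace_diff[OF invariantD(1)[OF cv] invariantD(3)[OF cv kS p(1)] p(1)])
      have "(w - p) - R k (w - p) \<in> Q" by (rule csubspace_diff[OF invariantD(1)[OF Q] wp invariantD(3)[OF Q kS wp]])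
      moreover have "(w - p) - R k (w - p) = R k p - p" by (simp add: R_diff fixed[OF k])
      ultimately have "cip ?I (R k p - p) (R k p - p) = 0" using a by (simp add: Q_def)
      moreover have "R k p - p \<in> V" using a invariantD(2)[OF cv] by blast
      ultimately have "R k p - p = 0" by (intro cip_positive)
      then show ?thesis by simp
    qed
    have "cip ?I v (R h p) = 0"
      by (rule no_invariant_coeff[OF U v lm hwf p(1) pf lab h]) (use gens in blast)
    moreover have "cip ?I v (R h (w - p)) = 0"
      using invariantD(3)[OF Q h wp] cyc_self[OF vV] by (simp add: Q_def)
    ultimately show ?thesis by (simp add: R_diff cip_diff)
  next
    case True
    \<comment> \<open>Here \<open>v\<close> is fixed by all of SU(3). Read as an operator it
      commutes with the group, so anisotropy makes it orthogonal to \<open>M\<close> and to all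
      conjugates of \<open>M\<close>.\<close>
    have fx: "R g v = v" if "g \<in> carrier SU3" for g using zero_weight_fixed[OF U v(1,2)] v(3) lm that True by simp
    define P where "P = mat (3 ^ K) (3 ^ K) (\<lambda>x. v (pd K x))"
    have P: "P \<in> carrier_mat (3 ^ K) (3 ^ K)" by (simp add: P_def)
    have Pv: "mf K P = v" by (rule mf_eqI[OF mf_V vV]) (auto simp: mf_pd P_def)
    have "\<forall>g\<in>carrier SU3. P * tensor_power K g = tensor_power K g * P" using fixed_commutes[OF P] fx Pv by auto
    then have z: "cip ?I v (mf K M) = 0" using M(3) trace_mf[OF P M(2)] P Pv unfolding anisotropic_def by auto
    have "cip ?I v (R g (mf K M)) = 0" if "g \<in> carrier SU3" for g
      using cip_R[of "mat_adjoint g" v "mf K M"] fx[of "mat_adjoint g"] that z by (simp add: adjoint_adjoint)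
    moreover have "R h w = (\<Sum>g\<in>G. R (h * g) (mf K M))"
      unfolding w_def R_sum using G(1) h by (intro sum.cong refl) (auto simp: R_mult)
    ultimately show ?thesis using G(1) h by (simp add: cip_sum subset_iff)
  qed
  moreover have "cip ?I v x = 0" if hyp: "\<And>h. h \<in> carrier SU3 \<Longrightarrow> cip ?I v (R h w) = 0" and x: "x \<in> cyc w" for x
    using x by (induction rule: cyc.induct) (simp_all add: cip_add cip_scl hyp)
  ultimately have "cip ?I v v = 0" using v(1) unfolding U_def by blast
  then show False using cip_positive[OF vV] v(2) by blast
qed

end

theorem Sigma360x3_decouples:
  assumes fin: "finite Sigma360x3" and K: "K \<in> {1, 2, 3}" and M: "M \<in> body_interactions N K" "anisotropic N M"
  shows "decouples Sigma360x3 N M"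
proof -
  interpret A: adj_power N .
  have sg: "subgroup Sigma360x3 SU3" unfolding Sigma360x3_def
    using matA_SU3 matE_SU3 matW_SU3 matF_SU3 by (intro group.generate_is_subgroup[OF SU3_group]) auto
  note S = Sigma360x3_SU3
  have inv: "mat_adjoint g \<in> Sigma360x3" if "g \<in> Sigma360x3" for g
    using subgroup.m_inv_closed[OF sg that] SU3_inv[of g] that S by auto
  note Mb = A.body_interaction_sub[OF M(1)]
  have z: "(\<Sum>g\<in>Sigma360x3. A.R g (mf N M)) = 0"
    using subgroup.m_closed[OF sg] Sigma360x3_gens K
    by (intro A.conj_average_zero[OF S fin _ _ _ Mb(2,1) M(2)]) auto
  have "(\<Sum>g\<in>Sigma360x3. (mat_adjoint (tensor_power N g) * M * tensor_power N g) $$ (r, c)) = 0"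
    if rc: "r < 3 ^ N" "c < 3 ^ N" for r c
  proof -
    have "(\<Sum>g\<in>Sigma360x3. (mat_adjoint (tensor_power N g) * M * tensor_power N g) $$ (r, c))
      = (\<Sum>g\<in>Sigma360x3. A.R (mat_adjoint g) (mf N M) (pd N (r, c)))"
    proof (rule sum.cong[OF refl])
      fix g assume "g \<in> Sigma360x3"
      then have g: "g \<in> carrier SU3" "mat_adjoint g \<in> carrier SU3" using S by auto
      show "(mat_adjoint (tensor_power N g) * M * tensor_power N g) $$ (r, c) = A.R (mat_adjoint g) (mf N M) (pd N (r, c))"
        unfolding R_mf[OF g(2) Mb(1) rc] tensor_power_unitary(1)[OF g(1)] adjoint_adjoint ..
    qed
    \<comment> \<open>\<open>twirl\<close> has the adjoint on the left, \<open>R\<close> has it on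
      the right; inversion permutes the group.\<close>
    also have "\<dots> = (\<Sum>g\<in>Sigma360x3. A.R g (mf N M) (pd N (r, c)))"
      by (rule sum.reindex_bij_witness[of _ mat_adjoint mat_adjoint]) (simp_all add: inv adjoint_adjoint)
    also have "\<dots> = (\<Sum>g\<in>Sigma360x3. A.R g (mf N M)) (pd N (r, c))" by (simp only: sum_fun_apply)
    finally show ?thesis by (simp add: z zero_fun_apply)
  qed
  then have "twirl Sigma360x3 N M = 0 \<cdot>\<^sub>m 1\<^sub>m (3 ^ N)" unfolding twirl_def by (intro eq_matI) auto
  then show ?thesis unfolding decouples_def by blast
qed

section \<open>Finiteness of \<open>\<Sigma>(360\<times>3)\<close>\<close>

definition conic :: "complex mat \<Rightarrow> complex mat \<Rightarrow> complex mat" where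
  "conic g Q = transpose_mat g * Q * g"

lemma M3_transpose: "transpose_mat (M3 a b c d e f g h i) = M3 a d g b e h c f i"
  by (rule mat3_eqI) simp_all

lemma conic_smult: "g \<in> carrier_mat 3 3 \<Longrightarrow> Q \<in> carrier_mat 3 3 \<Longrightarrow> conic g (c \<cdot>\<^sub>m Q) = c \<cdot>\<^sub>m conic g Q"
  unfolding conic_def by (subst mult_smult_distrib[of _ 3 3 _ 3], auto, subst mult_smult_assoc_mat[of _ 3 3 _ 3], auto)

lemma conic_mult:
  assumes "g \<in> carrier_mat 3 3" "h \<in> carrier_mat 3 3" "Q \<in> carrier_mat 3 3"
  shows "conic (g * h) Q = conic h (conic g Q)"
proof -
  have t: "transpose_mat g \<in> carrier_mat 3 3" "transpose_mat h \<in> carrier_mat 3 3" using assms by auto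
  note c = mult_carrier_mat[of _ 3 3 _ 3]
  show ?thesis unfolding conic_def transpose_mult[OF assms(1,2)]
    by (simp only: assoc_mult_mat[of _ 3 3 _ 3 _ 3] c t assms)
qed

lemma conic_one: "Q \<in> carrier_mat 3 3 \<Longrightarrow> conic (1\<^sub>m 3) Q = Q"
  by (simp add: conic_def)

text \<open>Wiman's six conics: the invariant conic \<open>x\<^sup>2 + y\<^sup>2 + z\<^sup>2\<close> of the icosahedral subgroup has six images,
  which are permuted by the group up to cube roots of unity.\<close>

definition wiman_orbit :: "complex \<Rightarrow> complex \<Rightarrow> complex mat" where
  "wiman_orbit e f = (let \<nu> = \<nu>\<^sub>1; \<omega> = \<xi> 3; a = e * (1 + 2 * \<nu> + \<omega> * (\<nu> - 1)); b = f * (1 - \<nu> + \<omega> * (2 + \<nu>));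
      c = e * f * (- 2 - \<nu> + \<omega> * (- 1 - 2 * \<nu>))
    in M3 (\<nu> + \<omega> * (1 + 2 * \<nu>)) a b a (1 + \<nu> - \<omega> * \<nu>) c b c (- 1 - 2 * \<nu> + \<omega> * (- 1 - \<nu>)))"

text \<open>The common factor 4 absorbs the two denominators of \<open>matW\<close>; the last four
  conics differ by the signs \<open>e\<close>, \<open>f\<close> of the second and third
  coordinates.\<close>

definition wiman :: "nat \<Rightarrow> complex mat" where
  "wiman j = (if j = 0 then M3 4 0 0 0 4 0 0 0 4 else if j = 1 then M3 4 0 0 0 (4 * \<xi> 3) 0 0 0 (4 * (- 1 - \<xi> 3))
     else wiman_orbit (if j = 2 \<or> j = 3 then 1 else - 1) (if j = 2 \<or> j = 4 then 1 else - 1))"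

lemma wiman_simps:
  "wiman 0 = M3 4 0 0 0 4 0 0 0 4" "wiman 1 = M3 4 0 0 0 (4 * \<xi> 3) 0 0 0 (4 * (- 1 - \<xi> 3))"
  "wiman 2 = wiman_orbit 1 1" "wiman 3 = wiman_orbit 1 (- 1)" "wiman 4 = wiman_orbit (- 1) 1" "wiman 5 = wiman_orbit (- 1) (- 1)"
  by (simp_all add: wiman_def)

definition cube_roots :: "complex set" where
  "cube_roots = {1, \<xi> 3, - 1 - \<xi> 3}"

definition conics :: "complex mat set" where
  "conics = {c \<cdot>\<^sub>m wiman j | c j. c \<in> cube_roots \<and> j \<in> {0, 1, 2, 3, 4, 5}}"

lemma wiman_carrier: "wiman j \<in> carrier_mat 3 3"
  by (simp add: wiman_def wiman_orbit_def Let_def)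

lemma cube_roots_mult: "c \<in> cube_roots \<Longrightarrow> d \<in> cube_roots \<Longrightarrow> c * d \<in> cube_roots"
proof -
  have "\<xi> 3 * (- 1 - \<xi> 3) = 1" "(- 1 - \<xi> 3) * (- 1 - \<xi> 3) = \<xi> 3" "(- 1 - \<xi> 3) * \<xi> 3 = 1"
    using \<xi>_3 by Groebner_Basis.algebra+
  then show "c \<in> cube_roots \<Longrightarrow> d \<in> cube_roots \<Longrightarrow> c * d \<in> cube_roots"
    using \<xi>_3 unfolding cube_roots_def by (elim insertE emptyE) simp_all
qed

text \<open>One half is treated as a symbol \<open>h\<close> with \<open>2 * h = 1\<close>, so that
  the entries are polynomials for \<open>algebra\<close>.\<close>

lemma matW_half: "2 * h = 1 \<Longrightarrow> matW = M3 (- h) (h * (- 1 - \<nu>\<^sub>1)) (h * \<nu>\<^sub>1) (h * (- 1 - \<nu>\<^sub>1)) (h * \<nu>\<^sub>1) (- h) (h * \<nu>\<^sub>1) (- h) (h * (- 1 - \<nu>\<^sub>1))"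
proof -
  assume "2 * h = 1"
  then have h: "h = 1 / 2" by (simp add: eq_divide_eq mult.commute)
  show ?thesis unfolding h by (simp add: matW_M3 \<nu>_simps(1))
qed

lemma conic_A:
  shows "conic (matA 2) (wiman 0) = 1 \<cdot>\<^sub>m wiman 0"
    "conic (matA 2) (wiman 1) = 1 \<cdot>\<^sub>m wiman 1"
    "conic (matA 2) (wiman 2) = 1 \<cdot>\<^sub>m wiman 5"
    "conic (matA 2) (wiman 3) = 1 \<cdot>\<^sub>m wiman 4"
    "conic (matA 2) (wiman 4) = 1 \<cdot>\<^sub>m wiman 3"
    "conic (matA 2) (wiman 5) = 1 \<cdot>\<^sub>m wiman 2"
proof -
  note m = wiman_simps wiman_orbit_def Let_def conic_def matA_2 M3_transpose M3_mult M3_smult M3_eq_iff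
  show "conic (matA 2) (wiman 0) = 1 \<cdot>\<^sub>m wiman 0"
    by (simp only: m; (intro conjI)?; (simp; fail | insert \<xi>_3; Groebner_Basis.algebra))
  show "conic (matA 2) (wiman 1) = 1 \<cdot>\<^sub>m wiman 1"
    by (simp only: m; (intro conjI)?; (simp; fail | insert \<xi>_3; Groebner_Basis.algebra))
  show "conic (matA 2) (wiman 2) = 1 \<cdot>\<^sub>m wiman 5"
    by (simp only: m; (intro conjI)?; (simp; fail | insert \<xi>_3; Groebner_Basis.algebra))
  show "conic (matA 2) (wiman 3) = 1 \<cdot>\<^sub>m wiman 4"
    by (simp only: m; (intro conjI)?; (simp; fail | insert \<xi>_3; Groebner_Basis.algebra))
  show "conic (matA 2) (wiman 4) = 1 \<cdot>\<^sub>m wiman 3"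
    by (simp only: m; (intro conjI)?; (simp; fail | insert \<xi>_3; Groebner_Basis.algebra))
  show "conic (matA 2) (wiman 5) = 1 \<cdot>\<^sub>m wiman 2"
    by (simp only: m; (intro conjI)?; (simp; fail | insert \<xi>_3; Groebner_Basis.algebra))
qed

lemma conic_E:
  shows "conic matE (wiman 0) = 1 \<cdot>\<^sub>m wiman 0"
    "conic matE (wiman 1) = (- 1 - \<xi> 3) \<cdot>\<^sub>m wiman 1"
    "conic matE (wiman 2) = \<xi> 3 \<cdot>\<^sub>m wiman 2"
    "conic matE (wiman 3) = \<xi> 3 \<cdot>\<^sub>m wiman 5"
    "conic matE (wiman 4) = \<xi> 3 \<cdot>\<^sub>m wiman 3"
    "conic matE (wiman 5) = \<xi> 3 \<cdot>\<^sub>m wiman 4"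
proof -
  note m = wiman_simps wiman_orbit_def Let_def conic_def matE_M3 M3_transpose M3_mult M3_smult M3_eq_iff
  show "conic matE (wiman 0) = 1 \<cdot>\<^sub>m wiman 0"
    by (simp only: m; (intro conjI)?; (simp; fail | insert \<xi>_3; Groebner_Basis.algebra))
  show "conic matE (wiman 1) = (- 1 - \<xi> 3) \<cdot>\<^sub>m wiman 1"
    by (simp only: m; (intro conjI)?; (simp; fail | insert \<xi>_3; Groebner_Basis.algebra))
  show "conic matE (wiman 2) = \<xi> 3 \<cdot>\<^sub>m wiman 2"
    by (simp only: m; (intro conjI)?; (simp; fail | insert \<xi>_3; Groebner_Basis.algebra))
  show "conic matE (wiman 3) = \<xi> 3 \<cdot>\<^sub>m wiman 5"
    by (simp only: m; (intro conjI)?; (simp; fail | insert \<xi>_3; Groebner_Basis.algebra))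
  show "conic matE (wiman 4) = \<xi> 3 \<cdot>\<^sub>m wiman 3"
    by (simp only: m; (intro conjI)?; (simp; fail | insert \<xi>_3; Groebner_Basis.algebra))
  show "conic matE (wiman 5) = \<xi> 3 \<cdot>\<^sub>m wiman 4"
    by (simp only: m; (intro conjI)?; (simp; fail | insert \<xi>_3; Groebner_Basis.algebra))
qed

lemma conic_F:
  shows "conic matF (wiman 0) = 1 \<cdot>\<^sub>m wiman 1"
    "conic matF (wiman 1) = 1 \<cdot>\<^sub>m wiman 0"
    "conic matF (wiman 2) = 1 \<cdot>\<^sub>m wiman 2"
    "conic matF (wiman 3) = 1 \<cdot>\<^sub>m wiman 4"
    "conic matF (wiman 4) = 1 \<cdot>\<^sub>m wiman 3"
    "conic matF (wiman 5) = 1 \<cdot>\<^sub>m wiman 5"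
proof -
  note m = wiman_simps wiman_orbit_def Let_def conic_def matF_M3 power2_eq_square M3_transpose M3_mult M3_smult M3_eq_iff
  show "conic matF (wiman 0) = 1 \<cdot>\<^sub>m wiman 1"
    by (simp only: m; (intro conjI)?; (simp; fail | insert \<xi>_3; Groebner_Basis.algebra))
  show "conic matF (wiman 1) = 1 \<cdot>\<^sub>m wiman 0"
    by (simp only: m; (intro conjI)?; (simp; fail | insert \<xi>_3; Groebner_Basis.algebra))
  show "conic matF (wiman 2) = 1 \<cdot>\<^sub>m wiman 2"
    by (simp only: m; (intro conjI)?; (simp; fail | insert \<xi>_3; Groebner_Basis.algebra))
  show "conic matF (wiman 3) = 1 \<cdot>\<^sub>m wiman 4"
    by (simp only: m; (intro conjI)?; (simp; fail | insert \<xi>_3; Groebner_Basis.algebra))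
  show "conic matF (wiman 4) = 1 \<cdot>\<^sub>m wiman 3"
    by (simp only: m; (intro conjI)?; (simp; fail | insert \<xi>_3; Groebner_Basis.algebra))
  show "conic matF (wiman 5) = 1 \<cdot>\<^sub>m wiman 5"
    by (simp only: m; (intro conjI)?; (simp; fail | insert \<xi>_3; Groebner_Basis.algebra))
qed

lemma conic_W:
  assumes h: "2 * h = (1 :: complex)"
  shows "conic matW (wiman 0) = 1 \<cdot>\<^sub>m wiman 0"
    "conic matW (wiman 1) = 1 \<cdot>\<^sub>m wiman 2"
    "conic matW (wiman 2) = 1 \<cdot>\<^sub>m wiman 1"
    "conic matW (wiman 3) = (- 1 - \<xi> 3) \<cdot>\<^sub>m wiman 4"
    "conic matW (wiman 4) = \<xi> 3 \<cdot>\<^sub>m wiman 3"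
    "conic matW (wiman 5) = 1 \<cdot>\<^sub>m wiman 5"
proof -
  note m = wiman_simps wiman_orbit_def Let_def conic_def matW_half[OF h] M3_transpose M3_mult M3_smult M3_eq_iff
  show "conic matW (wiman 0) = 1 \<cdot>\<^sub>m wiman 0"
    by (simp only: m; (intro conjI)?; (simp; fail | insert h \<xi>_3 \<nu>_simps(2); Groebner_Basis.algebra))
  show "conic matW (wiman 1) = 1 \<cdot>\<^sub>m wiman 2"
    by (simp only: m; (intro conjI)?; (simp; fail | insert h \<xi>_3 \<nu>_simps(2); Groebner_Basis.algebra))
  show "conic matW (wiman 2) = 1 \<cdot>\<^sub>m wiman 1"
    by (simp only: m; (intro conjI)?; (simp; fail | insert h \<xi>_3 \<nu>_simps(2); Groebner_Basis.algebra))
  show "conic matW (wiman 3) = (- 1 - \<xi> 3) \<cdot>\<^sub>m wiman 4"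
    by (simp only: m; (intro conjI)?; (simp; fail | insert h \<xi>_3 \<nu>_simps(2); Groebner_Basis.algebra))
  show "conic matW (wiman 4) = \<xi> 3 \<cdot>\<^sub>m wiman 3"
    by (simp only: m; (intro conjI)?; (simp; fail | insert h \<xi>_3 \<nu>_simps(2); Groebner_Basis.algebra))
  show "conic matW (wiman 5) = 1 \<cdot>\<^sub>m wiman 5"
    by (simp only: m; (intro conjI)?; (simp; fail | insert h \<xi>_3 \<nu>_simps(2); Groebner_Basis.algebra))
qed

lemma conicsI: "c \<in> cube_roots \<Longrightarrow> j \<in> {0, 1, 2, 3, 4, 5} \<Longrightarrow> c \<cdot>\<^sub>m wiman j \<in> conics"
  unfolding conics_def by blast

lemma conics_carrier: "Q \<in> conics \<Longrightarrow> Q \<in> carrier_mat 3 3"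
  using wiman_carrier by (auto simp: conics_def)

lemma conics_closed:
  assumes g: "g \<in> {matA 2, matE, matW, matF}" and Q: "Q \<in> conics"
  shows "conic g Q \<in> conics"
proof -
  have gc: "g \<in> carrier_mat 3 3" using g matA_SU3 matE_SU3 matW_SU3 matF_SU3 SU3_mat by blast
  have half: "2 * (1 / 2) = (1 :: complex)" by simp
  have six: "conic g (wiman j) \<in> conics" if "j \<in> {0, 1, 2, 3, 4, 5}" for j
    using g that
    by (elim insertE emptyE; hypsubst; simp only: conic_A conic_E conic_F conic_W[OF half]; (intro conicsI)?; simp add: cube_roots_def)
  obtain c j where Q': "Q = c \<cdot>\<^sub>m wiman j" "c \<in> cube_roots" "j \<in> {0, 1, 2, 3, 4, 5}" using Q unfolding conics_def by blast
  obtain d i where d: "conic g (wiman j) = d \<cdot>\<^sub>m wiman i" "d \<in> cube_roots" "i \<in> {0, 1, 2, 3, 4, 5}"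
    using six[OF Q'(3)] unfolding conics_def by blast
  have "conic g Q = (c * d) \<cdot>\<^sub>m wiman i"
    unfolding Q'(1) conic_smult[OF gc wiman_carrier] d(1) by (rule eq_matI) auto
  then show ?thesis using cube_roots_mult[OF Q'(2) d(2)] d(3) unfolding conics_def by blast
qed

lemma finite_conics: "finite conics"
  unfolding conics_def by (rule finite_image_set2) (simp_all add: cube_roots_def)

lemma M3_add: "M3 a b c d e f g h i + M3 a' b' c' d' e' f' g' h' i' = M3 (a + a') (b + b') (c + c') (d + d') (e + e') (f + f') (g + g') (h + h') (i + i')"
  by (rule mat3_eqI) simp_all

lemma conic_add: "g \<in> carrier_mat 3 3 \<Longrightarrow> Q \<in> carrier_mat 3 3 \<Longrightarrow> Q' \<in> carrier_mat 3 3 \<Longrightarrow> conic g (Q + Q') = conic g Q + conic g Q'"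
  unfolding conic_def by (subst mult_add_distrib_mat[of _ 3 3 _ 3], auto, subst add_mult_distrib_mat[of _ 3 3 _ _ 3], auto)

text \<open>Signed sums of the last four conics isolate the three products of two different
  coordinates. A matrix preserving all three is diagonal with pairwise products of its entries equal
  to 1, and determinant 1 leaves only the identity.\<close>

lemma conic_fixed_one:
  assumes k: "k \<in> carrier SU3" and fx: "\<And>Q. Q \<in> conics \<Longrightarrow> conic k Q = Q"
  shows "k = 1\<^sub>m 3"
proof -
  obtain a b c d e f g h i where kM: "k = M3 a b c d e f g h i" using M3_surj[OF SU3_mat[OF k]] by blast
  note kc = SU3_mat[OF k]
  have w: "conic k (wiman j) = wiman j" if "j \<in> {2, 3, 4, 5}" for j
  proof -
    have "1 \<cdot>\<^sub>m wiman j \<in> conics" using that by (intro conicsI) (auto simp: cube_roots_def)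
    moreover have "1 \<cdot>\<^sub>m wiman j = wiman j" by (rule eq_matI) auto
    ultimately show ?thesis using fx by simp
  qed
  define o1 where "o1 = 1 + 2 * \<nu>\<^sub>1 + \<xi> 3 * (\<nu>\<^sub>1 - 1)"
  define o2 where "o2 = 1 - \<nu>\<^sub>1 + \<xi> 3 * (2 + \<nu>\<^sub>1)"
  define o3 where "o3 = - 2 - \<nu>\<^sub>1 + \<xi> 3 * (- 1 - 2 * \<nu>\<^sub>1)"
  \<comment> \<open>Explicit cofactors with product 6 show that the off-diagonal coefficients are
    nonzero.\<close>
  have "o1 * (2 + \<nu>\<^sub>1 + \<xi> 3 - \<xi> 3 * \<nu>\<^sub>1) = 6" "o2 * (- 1 - 2 * \<nu>\<^sub>1 - 2 * \<xi> 3 - \<xi> 3 * \<nu>\<^sub>1) = 6" "o3 * (- 1 + \<nu>\<^sub>1 + \<xi> 3 + 2 * \<xi> 3 * \<nu>\<^sub>1) = 6"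
    unfolding o1_def o2_def o3_def using \<xi>_3 \<nu>_simps(2) by Groebner_Basis.algebra+
  then have nz: "o1 \<noteq> 0" "o2 \<noteq> 0" "o3 \<noteq> 0" by auto
  define p where "p = \<nu>\<^sub>1 + \<xi> 3 * (1 + 2 * \<nu>\<^sub>1)"
  define q where "q = 1 + \<nu>\<^sub>1 - \<xi> 3 * \<nu>\<^sub>1"
  define r where "r = - 1 - 2 * \<nu>\<^sub>1 + \<xi> 3 * (- 1 - \<nu>\<^sub>1)"
  have orb: "wiman_orbit x y = M3 p (x * o1) (y * o2) (x * o1) q (x * y * o3) (y * o2) (x * y * o3) r" for x y
    by (simp add: wiman_orbit_def Let_def o1_def o2_def o3_def p_def q_def r_def)
  have comb: "conic k (t \<cdot>\<^sub>m (wiman 2 + x \<cdot>\<^sub>m wiman 3 + y \<cdot>\<^sub>m wiman 4 + z \<cdot>\<^sub>m wiman 5)) = t \<cdot>\<^sub>m (wiman 2 + x \<cdot>\<^sub>m wiman 3 + y \<cdot>\<^sub>m wiman 4 + z \<cdot>\<^sub>m wiman 5)" for t x y z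
    using wiman_carrier by (simp add: conic_add conic_smult kc w)
  \<comment> \<open>The signs 1, 1, -1, -1 of the four conics are those of \<open>e\<close>; only
    the entries with \<open>o1\<close> survive, with multiplicity 4.\<close>
  have "conic k (M3 0 1 0 1 0 0 0 0 0) = M3 0 1 0 1 0 0 0 0 0"
    using comb[of "1 / (4 * o1)" 1 "- 1" "- 1"] nz by (simp add: wiman_simps orb M3_smult M3_add)
  then have 1: "a * d = 0" "b * e = 0" "a * e + b * d = 1"
    by (auto simp: kM conic_def M3_transpose M3_mult M3_eq_iff algebra_simps)
  have "conic k (M3 0 0 1 0 0 0 1 0 0) = M3 0 0 1 0 0 0 1 0 0"
    using comb[of "1 / (4 * o2)" "- 1" 1 "- 1"] nz by (simp add: wiman_simps orb M3_smult M3_add)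
  then have 2: "a * g = 0" "b * h = 0" "c * i = 0" "a * i + c * g = 1"
    by (auto simp: kM conic_def M3_transpose M3_mult M3_eq_iff algebra_simps)
  have "conic k (M3 0 0 0 0 0 1 0 1 0) = M3 0 0 0 0 0 1 0 1 0"
    using comb[of "1 / (4 * o3)" "- 1" "- 1" 1] nz by (simp add: wiman_simps orb M3_smult M3_add)
  then have 3: "e * h = 0" "f * i = 0" "e * i + f * h = 1"
    by (auto simp: kM conic_def M3_transpose M3_mult M3_eq_iff algebra_simps)
  have det: "a * (e * i - f * h) - b * (d * i - f * g) + c * (d * h - e * g) = 1"
    using k by (simp add: kM SU3_carrier_iff M3_det)
  have "a \<noteq> 0" using 1 2(2) 3(3) by auto
  then have dg: "d = 0" "g = 0" using 1 2 by auto
  then have ei: "a * e = 1" "a * i = 1" using 1 2 by auto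
  then have z: "b = 0" "h = 0" "c = 0" "f = 0" using 1(2) 2(3) 3(1,2) by auto
  then have "a = 1" "e = 1" "i = 1" using ei 3(3) det dg by auto
  then show ?thesis using dg z by (simp add: kM M3_one)
qed

text \<open>The elements of SU(3) mapping the finite set \<open>conics\<close> to itself contain the
  generators and are closed under products and inverses. By \<open>conic_fixed_one\<close> they are
  determined by their action on that set.\<close>

theorem finite_Sigma360x3: "finite Sigma360x3"
proof -
  define T where "T = {g \<in> carrier SU3. \<forall>Q\<in>conics. conic g Q \<in> conics}"
  have cancel: "conic (mat_adjoint g) (conic g Q) = Q" "conic g (conic (mat_adjoint g) Q) = Q" if "g \<in> carrier SU3" "Q \<in> conics" for g Q
    using that conic_mult[of g "mat_adjoint g" Q] conic_mult[of "mat_adjoint g" g Q]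
    by (simp_all add: SU3_mat conics_carrier conic_one SU3_adjoint_left SU3_adjoint_right)
  have invT: "mat_adjoint g \<in> T" if "g \<in> T" for g
  proof -
    have g: "g \<in> carrier SU3" "conic g ` conics \<subseteq> conics" using that by (auto simp: T_def)
    have "inj_on (conic g) conics" by (rule inj_on_inverseI[where g = "conic (mat_adjoint g)"]) (rule cancel(1)[OF g(1)])
    then have "conic g ` conics = conics" using endo_inj_surj[OF finite_conics g(2)] by blast
    then have "conic (mat_adjoint g) Q \<in> conics" if "Q \<in> conics" for Q
    proof -
      have "Q \<in> conic g ` conics" using that \<open>conic g ` conics = conics\<close> by (simp only:)
      then show ?thesis using cancel(1)[OF g(1)] by (elim imageE) simp
    qed
    then show ?thesis using g by (simp add: T_def)
  qed
  have gens: "{matA 2, matE, matW, matF} \<subseteq> T"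
    using conics_closed matA_SU3 matE_SU3 matW_SU3 matF_SU3 unfolding T_def by blast
  have "g \<in> T" if "g \<in> Sigma360x3" for g
    using that unfolding Sigma360x3_def
  proof (induction rule: generate.induct)
    case one show ?case by (simp add: T_def conic_one conics_carrier)
  next
    case (incl h) then show ?case using gens by blast
  next
    case (inv h)
    then have "h \<in> T" using gens by blast
    then show ?case using invT SU3_inv[of h] by (auto simp: T_def)
  next
    case (eng g h)
    then show ?case by (auto simp: T_def conic_mult SU3_mat conics_carrier)
  qed
  moreover have "finite T"
  proof (rule inj_on_finite[of "\<lambda>g. restrict (conic g) conics" _ "conics \<rightarrow>\<^sub>E conics"])
    show "inj_on (\<lambda>g. restrict (conic g) conics) T"
    proof (rule inj_onI)
      fix g h assume gh: "g \<in> T" "h \<in> T" and e: "restrict (conic g) conics = restrict (conic h) conics"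
      have S: "g \<in> carrier SU3" "h \<in> carrier SU3" using gh by (auto simp: T_def)
      have "conic (g * mat_adjoint h) Q = Q" if Q: "Q \<in> conics" for Q
      proof -
        have "conic g Q = conic h Q" using fun_cong[OF e, of Q] Q by simp
        then show ?thesis using cancel(1)[OF S(2) Q] conic_mult[of g "mat_adjoint h" Q] S Q by (simp add: SU3_mat conics_carrier)
      qed
      then have "g * mat_adjoint h = 1\<^sub>m 3" using S by (intro conic_fixed_one) auto
      then have "g * mat_adjoint h * h = h" using left_mult_one_mat[OF SU3_mat[OF S(2)]] by simp
      then show "g = h" using S SU3_mat[OF S(1)] SU3_mat[OF S(2)] SU3_adjoint_left[OF S(2)]
        by (simp add: assoc_mult_mat[of g 3 3 "mat_adjoint h" 3 h 3])
    qed
    show "(\<lambda>g. restrict (conic g) conics) ` T \<subseteq> conics \<rightarrow>\<^sub>E conics" by (auto simp: T_def)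
    show "finite (conics \<rightarrow>\<^sub>E conics)" by (rule finite_PiE) (simp_all add: finite_conics)
  qed
  ultimately show ?thesis using finite_subset[of Sigma360x3 T] by blast
qed

section \<open>Invariants of the other groups\<close>

definition lin3 :: "(complex \<Rightarrow> complex \<Rightarrow> complex \<Rightarrow> complex) \<Rightarrow> bool" where
  "lin3 f \<longleftrightarrow> (\<exists>a :: nat \<Rightarrow> complex. \<forall>x1 x2 x3. f x1 x2 x3 = a 0 * x1 + a 1 * x2 + a 2 * x3)"

lemma lin3_combination: "lin3 (\<lambda>x1 x2 x3. a * x1 + b * x2 + c * x3)"
  unfolding lin3_def by (rule exI[of _ "\<lambda>i. if i = 0 then a else if i = 1 then b else c"]) simp

lemma lin3_proj: "lin3 (\<lambda>x1 x2 x3. x1)" "lin3 (\<lambda>x1 x2 x3. x2)" "lin3 (\<lambda>x1 x2 x3. x3)"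
  using lin3_combination[of 1 0 0] lin3_combination[of 0 1 0] lin3_combination[of 0 0 1] by simp_all

definition col_fun :: "fun6 \<Rightarrow> complex mat \<Rightarrow> complex" where
  "col_fun P g = P (g $$ (0, 0)) (g $$ (1, 0)) (g $$ (2, 0)) (cnj (g $$ (0, 2))) (cnj (g $$ (1, 2))) (cnj (g $$ (2, 2)))"

global_interpretation adj3: adj_power 3 .

abbreviation "hw33 \<equiv> basis_fun (top_list 3)"

text \<open>The model of \<open>(3, 3)\<close> is the cyclic span of \<open>hw33\<close>. A linear functional on it is a bihomogeneous polynomial of
  bidegree \<open>(3, 3)\<close> in the first column and the conjugate of the last column of \<open>g\<close>.\<close>

definition realized :: "fun6 \<Rightarrow> bool" where
  "realized P \<longleftrightarrow> (\<exists>\<psi>. linear_on UNIV \<psi> \<and> (\<forall>g\<in>carrier SU3. \<psi> (adj3.R g hw33) = col_fun P g))"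

lemma realized_add: "realized P \<Longrightarrow> realized Q \<Longrightarrow> realized (\<lambda>x1 x2 x3 z1 z2 z3. P x1 x2 x3 z1 z2 z3 + Q x1 x2 x3 z1 z2 z3)"
  unfolding realized_def
proof (elim exE conjE)
  fix \<phi> \<psi> assume "linear_on UNIV \<phi>" "\<forall>g\<in>carrier SU3. \<phi> (adj3.R g hw33) = col_fun P g"
    "linear_on UNIV \<psi>" "\<forall>g\<in>carrier SU3. \<psi> (adj3.R g hw33) = col_fun Q g"
  then show "\<exists>\<chi>. linear_on UNIV \<chi> \<and> (\<forall>g\<in>carrier SU3. \<chi> (adj3.R g hw33) = col_fun (\<lambda>x1 x2 x3 z1 z2 z3. P x1 x2 x3 z1 z2 z3 + Q x1 x2 x3 z1 z2 z3) g)"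
    by (intro exI[of _ "\<lambda>y. \<phi> y + \<psi> y"]) (simp add: linear_on_def col_fun_def algebra_simps)
qed

lemma realized_scale: "realized P \<Longrightarrow> realized (\<lambda>x1 x2 x3 z1 z2 z3. c * P x1 x2 x3 z1 z2 z3)"
  unfolding realized_def
proof (elim exE conjE)
  fix \<phi> assume "linear_on UNIV \<phi>" "\<forall>g\<in>carrier SU3. \<phi> (adj3.R g hw33) = col_fun P g"
  then show "\<exists>\<chi>. linear_on UNIV \<chi> \<and> (\<forall>g\<in>carrier SU3. \<chi> (adj3.R g hw33) = col_fun (\<lambda>x1 x2 x3 z1 z2 z3. c * P x1 x2 x3 z1 z2 z3) g)"
    by (intro exI[of _ "\<lambda>y. c * \<phi> y"]) (simp add: linear_on_def col_fun_def algebra_simps)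
qed

lemma R_hw33:
  assumes L: "L \<in> lists_of P3 3"
  shows "adj3.R g hw33 L = tw (adjk g) L (top_list 3)"
proof -
  have "adj3.R g hw33 L = (\<Sum>M\<in>lists_of P3 3. tw (adjk g) L M * hw33 M)" using L unfolding adj3.R_def by simp
  also have "\<dots> = (\<Sum>M\<in>lists_of P3 3. if M = top_list 3 then tw (adjk g) L (top_list 3) else 0)"
    by (intro sum.cong refl) (simp add: basis_fun_def)
  finally show ?thesis using adj3.finI adj3.top_list_support(1) by simp
qed

lemma sum_lin3: "(\<Sum>x\<in>P3. a (fst x) * b (snd x) * adjk g x (0, 2)) =
  (a 0 * g $$ (0, 0) + a 1 * g $$ (1, 0) + a 2 * g $$ (2, 0)) * (b 0 * cnj (g $$ (0, 2)) + b 1 * cnj (g $$ (1, 2)) + b 2 * cnj (g $$ (2, 2)))"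
proof -
  have "(\<Sum>x\<in>P3. a (fst x) * b (snd x) * adjk g x (0, 2)) = (\<Sum>i<3. \<Sum>j<3. a i * b j * adjk g (i, j) (0, 2))"
    unfolding sum.cartesian_product by (intro sum.cong) auto
  then show ?thesis by (simp add: sum_lessThan_3 dbl_def algebra_simps)
qed

text \<open>\<open>R g hw33\<close> is the third tensor power of the first column of
  \<open>g\<close> times its conjugate last column, so a product functional evaluates to a product
  of linear forms in these columns.\<close>

lemma realized_prod:
  assumes "lin3 f" "lin3 f'" "lin3 f''" "lin3 h" "lin3 h'" "lin3 h''"
  shows "realized (\<lambda>x1 x2 x3 z1 z2 z3. f x1 x2 x3 * f' x1 x2 x3 * f'' x1 x2 x3 * (h z1 z2 z3 * h' z1 z2 z3 * h'' z1 z2 z3))"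
proof -
  obtain a a' a'' b b' b'' :: "nat \<Rightarrow> complex" where
    f: "\<And>x y z. f x y z = a 0 * x + a 1 * y + a 2 * z" "\<And>x y z. f' x y z = a' 0 * x + a' 1 * y + a' 2 * z" "\<And>x y z. f'' x y z = a'' 0 * x + a'' 1 * y + a'' 2 * z"
    and h: "\<And>x y z. h x y z = b 0 * x + b 1 * y + b 2 * z" "\<And>x y z. h' x y z = b' 0 * x + b' 1 * y + b' 2 * z" "\<And>x y z. h'' x y z = b'' 0 * x + b'' 1 * y + b'' 2 * z"
    using assms unfolding lin3_def by metis
  define \<psi> where "\<psi> w = (\<Sum>L\<in>lists_of P3 3. pf [\<lambda>x. a (fst x) * b (snd x), \<lambda>x. a' (fst x) * b' (snd x), \<lambda>x. a'' (fst x) * b'' (snd x)] L * w L)"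
    for w :: "(nat \<times> nat) list \<Rightarrow> complex"
  have "linear_on UNIV \<psi>"
    by (simp add: linear_on_def \<psi>_def plus_fun_apply scl_apply algebra_simps sum.distrib sum_distrib_left)
  moreover have "\<psi> (adj3.R g hw33) = col_fun (\<lambda>x1 x2 x3 z1 z2 z3. f x1 x2 x3 * f' x1 x2 x3 * f'' x1 x2 x3 * (h z1 z2 z3 * h' z1 z2 z3 * h'' z1 z2 z3)) g" for g
  proof -
    let ?S = "\<lambda>a b. \<Sum>x\<in>P3. a (fst x) * b (snd x) * adjk g x (0, 2)"
    have "\<psi> (adj3.R g hw33) = (\<Sum>L\<in>lists_of P3 3. pf [\<lambda>x. a (fst x) * b (snd x), \<lambda>x. a' (fst x) * b' (snd x), \<lambda>x. a'' (fst x) * b'' (snd x)] L * tw (adjk g) L (top_list 3))"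
      unfolding \<psi>_def by (intro sum.cong refl) (simp add: R_hw33)
    also have "\<dots> = (\<Sum>x\<in>P3. \<Sum>y\<in>P3. \<Sum>z\<in>P3. (a (fst x) * b (snd x) * adjk g x (0, 2)) * ((a' (fst y) * b' (snd y) * adjk g y (0, 2)) * (a'' (fst z) * b'' (snd z) * adjk g z (0, 2))))"
      unfolding numeral_3_eq_3 sum_lists_of_Suc by (intro sum.cong refl) (simp add: mult_ac)
    also have "\<dots> = ?S a b * (?S a' b' * ?S a'' b'')"
      by (simp only: sum_distrib_left[symmetric] sum_distrib_right[symmetric])
    finally show ?thesis unfolding sum_lin3 by (simp add: col_fun_def f h mult_ac)
  qed
  ultimately show ?thesis unfolding realized_def by blast
qed

text \<open>Here \<open>k\<close> acts by left translation, hence on columns, and invariance is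
  required for all arguments, whereas \<open>cone_inv\<close> concerns rows and only the
  cone.\<close>

definition inv33 :: "complex mat \<Rightarrow> fun6 \<Rightarrow> bool" where
  "inv33 k P \<longleftrightarrow> (\<forall>x1 x2 x3 z1 z2 z3.
     P (k $$ (0, 0) * x1 + k $$ (0, 1) * x2 + k $$ (0, 2) * x3) (k $$ (1, 0) * x1 + k $$ (1, 1) * x2 + k $$ (1, 2) * x3)
       (k $$ (2, 0) * x1 + k $$ (2, 1) * x2 + k $$ (2, 2) * x3)
       (cnj (k $$ (0, 0)) * z1 + cnj (k $$ (0, 1)) * z2 + cnj (k $$ (0, 2)) * z3) (cnj (k $$ (1, 0)) * z1 + cnj (k $$ (1, 1)) * z2 + cnj (k $$ (1, 2)) * z3)
       (cnj (k $$ (2, 0)) * z1 + cnj (k $$ (2, 1)) * z2 + cnj (k $$ (2, 2)) * z3) = P x1 x2 x3 z1 z2 z3)"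

text \<open>The functional realising \<open>P\<close> is invariant under \<open>H\<close> on the
  whole cyclic span because it is so on the orbit of \<open>hw33\<close>. Its Riesz vector is then
  fixed by the group, and \<open>g0\<close> shows that it is nonzero.\<close>

theorem not_inaccessible_33:
  assumes H: "H \<subseteq> carrier SU3" and P: "realized P" "\<And>k. k \<in> H \<Longrightarrow> inv33 k P" and g0: "g0 \<in> carrier SU3" "col_fun P g0 \<noteq> 0"
  shows "\<not> inaccessible (generate SU3 H) (3, 3)"
proof
  assume ina: "inaccessible (generate SU3 H) (3, 3)"
  let ?I = "lists_of P3 3"
  have uV: "hw33 \<in> adj3.V" by (rule adj3.basis_fun_V[OF adj3.top_list_support(1)])
  have "hw33 \<noteq> 0" by (auto simp: fun_eq_iff basis_fun_def zero_fun_apply)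
  then obtain n \<sigma> q where d: "dynkin_irrep (3, 3) n \<sigma>" and mq: "adj3.matrix_form (adj3.cyc hw33) n \<sigma> q"
    using adj3.support_irrep[OF adj3.invariant_V uV _ adj3.top_list_support(2,3)] by blast
  obtain \<psi> where \<psi>: "linear_on UNIV \<psi>" "\<And>g. g \<in> carrier SU3 \<Longrightarrow> \<psi> (adj3.R g hw33) = col_fun P g"
    using P(1) unfolding realized_def by blast
  have lin: "\<psi> (u + v) = \<psi> u + \<psi> v" "\<psi> (scl c u) = c * \<psi> u" "\<psi> 0 = 0" for u v c
    using \<psi>(1) linear_on_zero[of UNIV \<psi>] by (simp_all add: linear_on_def csubspace_def)
  have lsum: "\<psi> (\<Sum>a<m. scl (c a) (y a)) = (\<Sum>a<m. c a * \<psi> (y a))" for m :: nat and c y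
    by (induction m) (simp_all add: lin)
  note U = adj3.cyc_invariant[OF uV]
  have inv\<psi>: "\<psi> (adj3.R k w) = \<psi> w" if k: "k \<in> H" and w: "w \<in> adj3.cyc hw33" for k w
  proof -
    have kS: "k \<in> carrier SU3" using k H by blast
    have key: "\<psi> (adj3.R (k * g) hw33) = \<psi> (adj3.R g hw33)" if g: "g \<in> carrier SU3" for g
    proof -
      note ix = mult_index_3[OF SU3_mat[OF kS] SU3_mat[OF g]]
      have "col_fun P (k * g) = col_fun P g"
        using P(2)[OF k] unfolding inv33_def by (simp add: col_fun_def ix del: index_mult_mat)
      then show ?thesis using kS g by (simp add: \<psi>(2))
    qed
    show ?thesis using w
      by (induction rule: adj3.cyc.induct) (simp_all add: lin adj3.R_add adj3.R_scl adj3.R_mult[OF kS, symmetric] key)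
  qed
  have qU: "q a \<in> adj3.cyc hw33" if "a < n" for a using mq that unfolding adj3.matrix_form_def by blast
  \<comment> \<open>The Riesz vector of \<open>\<psi>\<close> in the orthonormal basis
    \<open>q\<close>.\<close>
  define v where "v = vec n (\<lambda>a. cnj (\<psi> (q a)))"
  have vc: "v \<in> carrier_vec n" by (simp add: v_def)
  have \<sigma>c: "\<sigma> g \<in> carrier_mat n n" if "g \<in> carrier SU3" for g using mq that unfolding adj3.matrix_form_def by blast
  have Rq: "adj3.R g (q b) = (\<Sum>a<n. scl (\<sigma> g $$ (a, b)) (q a))" if "g \<in> carrier SU3" "b < n" for g b
    using mq that unfolding adj3.matrix_form_def by blast
  have coef: "\<sigma> g $$ (a, b) = cip ?I (q a) (adj3.R g (q b))" if "g \<in> carrier SU3" "a < n" "b < n" for g a b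
    using mq that unfolding adj3.matrix_form_def by blast
  have fixk: "\<sigma> k *\<^sub>v v = v" if kS: "k \<in> carrier SU3" and inv: "\<And>w. w \<in> adj3.cyc hw33 \<Longrightarrow> \<psi> (adj3.R (mat_adjoint k) w) = \<psi> w" for k
  proof (rule eq_vecI)
    fix a assume "a < dim_vec v"
    then have a: "a < n" by (simp add: v_def)
    have k': "mat_adjoint k \<in> carrier SU3" using kS by simp
    have cj: "\<sigma> k $$ (a, b) = cnj (\<sigma> (mat_adjoint k) $$ (b, a))" if b: "b < n" for b
      using coef[OF kS a b] coef[OF k' b a] adj3.cip_R[OF kS, of "q b" "q a"] by (simp add: cip_cnj flip: cip_cnj[of _ "adj3.R k (q b)" "q a"])
    have "(\<sigma> k *\<^sub>v v) $ a = (\<Sum>b<n. \<sigma> k $$ (a, b) * cnj (\<psi> (q b)))"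
      using \<sigma>c[OF kS] a by (simp add: v_def scalar_prod_def atLeast0LessThan)
    also have "\<dots> = cnj (\<psi> (adj3.R (mat_adjoint k) (q a)))"
      unfolding Rq[OF k' a] lsum by (simp add: cj)
    finally show "(\<sigma> k *\<^sub>v v) $ a = v $ a" using inv[OF qU[OF a]] a by (simp add: v_def)
  qed (use \<sigma>c[OF kS] in \<open>simp add: v_def\<close>)
  have inv': "\<psi> (adj3.R (mat_adjoint k) w) = \<psi> w" if "k \<in> H" "w \<in> adj3.cyc hw33" for k w
  proof -
    have kS: "k \<in> carrier SU3" using that H by blast
    then have "adj3.R k (adj3.R (mat_adjoint k) w) = w"
      using that(2) adj3.invariantD(2)[OF U] adj3.R_inv_cancel[of "mat_adjoint k" w] by (auto simp: adjoint_adjoint)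
    then show ?thesis using inv\<psi>[OF that(1) adj3.invariantD(3)[OF U _ that(2)], of "mat_adjoint k"] kS by simp
  qed
  have fixG: "\<sigma> g *\<^sub>v v = v" if "g \<in> generate SU3 H" for g
    using that
  proof (induction rule: generate.induct)
    case one
    have a1: "mat_adjoint (1\<^sub>m 3) = (1\<^sub>m 3 :: complex mat)" by (simp add: M3_one M3_adjoint)
    have "\<psi> (adj3.R (mat_adjoint (1\<^sub>m 3)) w) = \<psi> w" if "w \<in> adj3.cyc hw33" for w
      unfolding a1 using adj3.R_one[of w] adj3.invariantD(2)[OF U] that by auto
    then show ?case using fixk[OF SU3_one] by simp
  next
    case (incl h) then show ?case using fixk[of h] inv'[of h] H by blast
  next
    case (inv h)
    then have "h \<in> carrier SU3" using H by blast
    then show ?case using fixk[of "mat_adjoint h"] inv\<psi>[OF inv] by (simp add: SU3_inv adjoint_adjoint)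
  next
    case (eng g h)
    then have S: "g \<in> carrier SU3" "h \<in> carrier SU3" using generate_SU3[OF H] by blast+
    then have "\<sigma> (g * h) = \<sigma> g * \<sigma> h" using d unfolding dynkin_irrep_def SU3_irrep_def SU3_rep_def by blast
    then show ?case using eng \<sigma>c[OF S(1)] \<sigma>c[OF S(2)] vc by simp
  qed
  have "v \<noteq> 0\<^sub>v n"
  proof
    assume v0: "v = 0\<^sub>v n"
    have z: "\<psi> (q a) = 0" if "a < n" for a
    proof -
      have "cnj (\<psi> (q a)) = v $ a" using that by (simp add: v_def)
      then show ?thesis using that by (simp add: v0)
    qed
    have e: "adj3.R g0 hw33 = (\<Sum>a<n. scl (cip ?I (q a) (adj3.R g0 hw33)) (q a))"
      using mq adj3.invariantD(3)[OF U g0(1) adj3.cyc_self[OF uV]] unfolding adj3.matrix_form_def by blast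
    have "\<psi> (adj3.R g0 hw33) = 0" by (subst e) (simp add: lsum z)
    then show False using g0 \<psi>(2) by simp
  qed
  then show False using ina d vc fixG unfolding inaccessible_def by blast
qed

section \<open>The generators of the other groups\<close>

lemma \<xi>_3_rect: "\<xi> 3 = Complex (- 1 / 2) (sqrt 3 / 2)"
  by (simp add: \<xi>_def complex_eq_iff cos_120 sin_120)

definition cV :: complex where
  "cV = 1 / (complex_of_real (sqrt 3) * \<i>)"

text \<open>\<open>2 * \<xi> 3 + 1\<close> is a square root of -3, so the prefactor of
  \<open>matV\<close> and \<open>matX\<close> is algebraic over \<open>\<xi> 3\<close> and can be
  eliminated by polynomial identities.\<close>

lemma cV: "cV * (2 * \<xi> 3 + 1) = 1" "cnj cV = - cV"
proof -
  have "2 * \<xi> 3 + 1 = complex_of_real (sqrt 3) * \<i>" by (simp add: \<xi>_3_rect complex_eq_iff)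
  then show "cV * (2 * \<xi> 3 + 1) = 1" by (simp add: cV_def)
  show "cnj cV = - cV" by (simp add: cV_def)
qed

lemma matV_M3: "matV = M3 cV cV cV cV (cV * \<xi> 3) (cV * (\<xi> 3 * \<xi> 3)) cV (cV * (\<xi> 3 * \<xi> 3)) (cV * \<xi> 3)"
  by (simp add: matV_def cV_def M3_def[symmetric] M3_smult power2_eq_square)

lemma matX_M3: "matX = M3 cV cV (cV * (\<xi> 3 * \<xi> 3)) cV (cV * \<xi> 3) (cV * \<xi> 3) (cV * \<xi> 3) cV (cV * \<xi> 3)"
  by (simp add: matX_def cV_def M3_def[symmetric] M3_smult power2_eq_square)

lemma matD_M3: "matD = M3 (\<xi> 9 ^ 2) 0 0 0 (\<xi> 9 ^ 2) 0 0 0 (\<xi> 9 ^ 2 * \<xi> 3)"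
  by (simp add: matD_def M3_def)

lemma matY_M3: "matY = M3 (\<xi> 7) 0 0 0 (\<xi> 7 ^ 2) 0 0 0 (\<xi> 7 ^ 4)"
  by (simp add: matY_def M3_def)

lemma matB_M3: "matB = M3 0 0 (- 1) 0 (- 1) 0 (- 1) 0 0"
  by (simp add: matB_def M3_def)

lemma matB_SU3: "matB \<in> carrier SU3"
  unfolding matB_M3 by (rule M3_SU3I) (auto simp: M3_mult M3_one)

lemma matV_SU3: "matV \<in> carrier SU3"
  unfolding matV_M3
  by (rule M3_SU3I; (simp only: complex_cnj_mult \<xi>_3_cnj cV(2) M3_mult M3_one M3_eq_iff)?;
      (intro conjI)?; insert \<xi>_3 cV(1); Groebner_Basis.algebra)

lemma matX_SU3: "matX \<in> carrier SU3"
  unfolding matX_M3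
  by (rule M3_SU3I; (simp only: complex_cnj_mult \<xi>_3_cnj cV(2) M3_mult M3_one M3_eq_iff)?;
      (intro conjI)?; insert \<xi>_3 cV(1); Groebner_Basis.algebra)

lemma matD_SU3: "matD \<in> carrier SU3"
proof -
  have "\<xi> 9 ^ 3 = \<xi> 3" by (simp add: \<xi>_def DeMoivre)
  then have 1: "\<xi> 9 ^ 2 * (\<xi> 9 ^ 2 * (\<xi> 9 ^ 2 * \<xi> 3)) = 1"
  proof -
    have "\<xi> 9 ^ 2 * (\<xi> 9 ^ 2 * (\<xi> 9 ^ 2 * \<xi> 3)) = \<xi> 9 ^ 3 * \<xi> 9 ^ 3 * \<xi> 3" by (simp add: power2_eq_square power3_eq_cube mult_ac)
    also have "\<dots> = \<xi> 3 * \<xi> 3 * \<xi> 3" by (simp only: \<open>\<xi> 9 ^ 3 = \<xi> 3\<close>)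
    also have "\<dots> = 1" using \<xi>_3 by Groebner_Basis.algebra
    finally show ?thesis .
  qed
  have "\<xi> 9 ^ 2 * cnj (\<xi> 9 ^ 2) = 1" using \<xi>_cnj[of 9] by (simp add: power_mult_distrib[symmetric])
  then show ?thesis unfolding matD_M3
    using 1 \<xi>_3 by (intro M3_SU3I) (auto simp: M3_mult M3_one M3_eq_iff \<xi>_3_cnj mult.assoc, Groebner_Basis.algebra+)
qed

lemma matY_SU3: "matY \<in> carrier SU3"
proof -
  have "\<xi> 7 ^ 7 = 1" by (rule \<xi>_pow) simp
  then have 1: "\<xi> 7 * (\<xi> 7 ^ 2 * \<xi> 7 ^ 4) = 1" by Groebner_Basis.algebra
  have c: "cnj (\<xi> 7) * \<xi> 7 = 1" using \<xi>_cnj[of 7] by (simp add: mult.commute)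
  then have "cnj (\<xi> 7) ^ 2 * \<xi> 7 ^ 2 = 1" "cnj (\<xi> 7) ^ 4 * \<xi> 7 ^ 4 = 1" by (simp_all add: power_mult_distrib[symmetric])
  then show ?thesis unfolding matY_M3 using 1 c by (intro M3_SU3I) (simp_all add: M3_mult M3_one M3_eq_iff)
qed

section \<open>Invariant forms of bidegree (3, 3)\<close>

definition product_form :: fun6 where
  "product_form x1 x2 x3 z1 z2 z3 = x1 * x2 * x3 * (z1 * z2 * z3)"

lemma realized_product: "realized product_form"
  unfolding product_form_def[abs_def] by (intro realized_prod lin3_proj)

text \<open>A monomial unitary matrix multiplies \<open>x1 * x2 * x3\<close> by a number of modulus
  1 and \<open>z1 * z2 * z3\<close> by its conjugate.\<close>

lemma inv33_product: "inv33 (matA n) product_form" "inv33 matE product_form" "inv33 matB product_form"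
proof -
  have "\<xi> n \<noteq> 0" using \<xi>_norm[of n] by force
  then show "inv33 (matA n) product_form" by (simp add: inv33_def matA_M3 product_form_def)
qed (simp_all add: inv33_def matE_M3 matB_M3 product_form_def)

definition axis_form :: "complex \<Rightarrow> complex \<Rightarrow> complex \<Rightarrow> fun6" where
  "axis_form a b c x1 x2 x3 z1 z2 z3 = (a * x1 + b * x2 + c * x3) * (a * x1 + b * x2 + c * x3) * (a * x1 + b * x2 + c * x3) *
     ((a * z1 + b * z2 + c * z3) * (a * z1 + b * z2 + c * z3) * (a * z1 + b * z2 + c * z3))"

text \<open>The sum runs over the six fivefold axes of the icosahedron.\<close>

definition icosahedral_form :: fun6 where
  "icosahedral_form x1 x2 x3 z1 z2 z3 =
     axis_form 0 1 \<nu>\<^sub>1 x1 x2 x3 z1 z2 z3 + (axis_form 0 1 (- \<nu>\<^sub>1) x1 x2 x3 z1 z2 z3 + (axis_form \<nu>\<^sub>1 0 1 x1 x2 x3 z1 z2 z3 +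
     (axis_form (- \<nu>\<^sub>1) 0 1 x1 x2 x3 z1 z2 z3 + (axis_form 1 \<nu>\<^sub>1 0 x1 x2 x3 z1 z2 z3 + axis_form 1 (- \<nu>\<^sub>1) 0 x1 x2 x3 z1 z2 z3))))"

lemma realized_icosahedral: "realized icosahedral_form"
  unfolding icosahedral_form_def[abs_def] axis_form_def by (intro realized_add realized_prod lin3_combination)

lemma axis_form_subst:
  "axis_form a b c (u11 * x1 + u12 * x2 + u13 * x3) (u21 * x1 + u22 * x2 + u23 * x3) (u31 * x1 + u32 * x2 + u33 * x3)
     (u11 * z1 + u12 * z2 + u13 * z3) (u21 * z1 + u22 * z2 + u23 * z3) (u31 * z1 + u32 * z2 + u33 * z3)
   = axis_form (a * u11 + b * u21 + c * u31) (a * u12 + b * u22 + c * u32) (a * u13 + b * u23 + c * u33) x1 x2 x3 z1 z2 z3"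
proof -
  have "a * (u11 * x1 + u12 * x2 + u13 * x3) + b * (u21 * x1 + u22 * x2 + u23 * x3) + c * (u31 * x1 + u32 * x2 + u33 * x3)
    = (a * u11 + b * u21 + c * u31) * x1 + (a * u12 + b * u22 + c * u32) * x2 + (a * u13 + b * u23 + c * u33) * x3" for x1 x2 x3
    by (simp add: algebra_simps)
  then show ?thesis by (simp only: axis_form_def)
qed

lemma axis_form_neg: "axis_form (- a) (- b) (- c) x1 x2 x3 z1 z2 z3 = axis_form a b c x1 x2 x3 z1 z2 z3"
proof -
  have "- a * x + - b * y + - c * z = - (a * x + b * y + c * z)" for x y z by simp
  then show ?thesis by (simp only: axis_form_def mult_minus_left mult_minus_right minus_minus)
qed

lemma inv33_icosahedral: "inv33 matE icosahedral_form" "inv33 (matA 2 * matW) icosahedral_form"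
proof -
  show "inv33 matE icosahedral_form"
    by (simp add: inv33_def matE_M3 icosahedral_form_def axis_form_def add_ac)
  have AW: "matA 2 * matW = M3 (- 1 / 2) (\<nu>\<^sub>2 / 2) (\<nu>\<^sub>1 / 2) (- (\<nu>\<^sub>2 / 2)) (- (\<nu>\<^sub>1 / 2)) (1 / 2) (- (\<nu>\<^sub>1 / 2)) (1 / 2) (- (\<nu>\<^sub>2 / 2))"
    by (simp add: matA_2 matW_M3 M3_mult)
  have cn: "cnj (- 1 / 2) = - 1 / 2" "cnj (\<nu>\<^sub>2 / 2) = \<nu>\<^sub>2 / 2" "cnj (\<nu>\<^sub>1 / 2) = \<nu>\<^sub>1 / 2" "cnj (- (\<nu>\<^sub>2 / 2)) = - (\<nu>\<^sub>2 / 2)"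
    "cnj (- (\<nu>\<^sub>1 / 2)) = - (\<nu>\<^sub>1 / 2)" "cnj (1 / 2) = 1 / 2" by simp_all
  have ax: "axis_form a b c (- 1 / 2 * x1 + \<nu>\<^sub>2 / 2 * x2 + \<nu>\<^sub>1 / 2 * x3) (- (\<nu>\<^sub>2 / 2) * x1 + - (\<nu>\<^sub>1 / 2) * x2 + 1 / 2 * x3) (- (\<nu>\<^sub>1 / 2) * x1 + 1 / 2 * x2 + - (\<nu>\<^sub>2 / 2) * x3)
       (- 1 / 2 * z1 + \<nu>\<^sub>2 / 2 * z2 + \<nu>\<^sub>1 / 2 * z3) (- (\<nu>\<^sub>2 / 2) * z1 + - (\<nu>\<^sub>1 / 2) * z2 + 1 / 2 * z3) (- (\<nu>\<^sub>1 / 2) * z1 + 1 / 2 * z2 + - (\<nu>\<^sub>2 / 2) * z3)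
     = axis_form a' b' c' x1 x2 x3 z1 z2 z3"
    if "- a - b * \<nu>\<^sub>2 - c * \<nu>\<^sub>1 = 2 * a'" "a * \<nu>\<^sub>2 - b * \<nu>\<^sub>1 + c = 2 * b'" "a * \<nu>\<^sub>1 + b - c * \<nu>\<^sub>2 = 2 * c'"
    for a b c a' b' c' x1 x2 x3 z1 z2 z3
  proof -
    have "a * (- 1 / 2) + b * - (\<nu>\<^sub>2 / 2) + c * - (\<nu>\<^sub>1 / 2) = a'" "a * (\<nu>\<^sub>2 / 2) + b * - (\<nu>\<^sub>1 / 2) + c * (1 / 2) = b'"
      "a * (\<nu>\<^sub>1 / 2) + b * (1 / 2) + c * - (\<nu>\<^sub>2 / 2) = c'"
      using that by (simp_all add: field_simps)
    then show ?thesis by (simp only: axis_form_subst)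
  qed
  note n = \<nu>_simps
  \<comment> \<open>Each triple of equations sends one axis to an axis or to its negative; the total
    degree six makes the sign harmless.\<close>
  have axes: "- 0 - 1 * \<nu>\<^sub>2 - \<nu>\<^sub>1 * \<nu>\<^sub>1 = 2 * \<nu>\<^sub>1" "0 * \<nu>\<^sub>2 - 1 * \<nu>\<^sub>1 + \<nu>\<^sub>1 = 2 * 0" "0 * \<nu>\<^sub>1 + 1 - \<nu>\<^sub>1 * \<nu>\<^sub>2 = 2 * 1"
    "- 0 - 1 * \<nu>\<^sub>2 - (- \<nu>\<^sub>1) * \<nu>\<^sub>1 = 2 * 1" "0 * \<nu>\<^sub>2 - 1 * \<nu>\<^sub>1 + (- \<nu>\<^sub>1) = 2 * (- \<nu>\<^sub>1)" "0 * \<nu>\<^sub>1 + 1 - (- \<nu>\<^sub>1) * \<nu>\<^sub>2 = 2 * 0"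
    "- \<nu>\<^sub>1 - 0 * \<nu>\<^sub>2 - 1 * \<nu>\<^sub>1 = 2 * (- \<nu>\<^sub>1)" "\<nu>\<^sub>1 * \<nu>\<^sub>2 - 0 * \<nu>\<^sub>1 + 1 = 2 * 0" "\<nu>\<^sub>1 * \<nu>\<^sub>1 + 0 - 1 * \<nu>\<^sub>2 = 2 * 1"
    "- (- \<nu>\<^sub>1) - 0 * \<nu>\<^sub>2 - 1 * \<nu>\<^sub>1 = 2 * 0" "(- \<nu>\<^sub>1) * \<nu>\<^sub>2 - 0 * \<nu>\<^sub>1 + 1 = 2 * 1" "(- \<nu>\<^sub>1) * \<nu>\<^sub>1 + 0 - 1 * \<nu>\<^sub>2 = 2 * \<nu>\<^sub>1"
    "- 1 - \<nu>\<^sub>1 * \<nu>\<^sub>2 - 0 * \<nu>\<^sub>1 = 2 * (- 0)" "1 * \<nu>\<^sub>2 - \<nu>\<^sub>1 * \<nu>\<^sub>1 + 0 = 2 * (- 1)" "1 * \<nu>\<^sub>1 + \<nu>\<^sub>1 - 0 * \<nu>\<^sub>2 = 2 * (- (- \<nu>\<^sub>1))"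
    "- 1 - (- \<nu>\<^sub>1) * \<nu>\<^sub>2 - 0 * \<nu>\<^sub>1 = 2 * (- 1)" "1 * \<nu>\<^sub>2 - (- \<nu>\<^sub>1) * \<nu>\<^sub>1 + 0 = 2 * (- \<nu>\<^sub>1)" "1 * \<nu>\<^sub>1 + (- \<nu>\<^sub>1) - 0 * \<nu>\<^sub>2 = 2 * (- 0)"
    by ((insert n; (simp; fail | Groebner_Basis.algebra))+)
  show "inv33 (matA 2 * matW) icosahedral_form"
    unfolding inv33_def AW M3_index icosahedral_form_def cn
    by (intro allI, simp only: ax[OF axes(1-3)] ax[OF axes(4-6)] ax[OF axes(7-9)] ax[OF axes(10-12)] ax[OF axes(13-15)] ax[OF axes(16-18)] axis_form_neg) (simp add: add_ac)
qed

text \<open>Together with \<open>hess2\<close> it spans the Hesse pencil of cubics, which the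
  Hessian group maps to itself.\<close>

definition hess1 :: "complex \<Rightarrow> complex \<Rightarrow> complex \<Rightarrow> complex" where
  "hess1 x y z = x * x * x + y * y * y + z * z * z"

definition hess2 :: "complex \<Rightarrow> complex \<Rightarrow> complex \<Rightarrow> complex" where
  "hess2 x y z = x * y * z"

text \<open>The invariant Hermitian pairing on the pencil, with \<open>z\<close> in place of the
  conjugate variables. The constant 18 is the ratio of the squared norms 3 and 1/6 of
  \<open>hess1\<close> and \<open>hess2\<close> in the unitarily invariant inner product on
  cubics.\<close>

definition hessian_form :: fun6 where
  "hessian_form x1 x2 x3 z1 z2 z3 = hess1 x1 x2 x3 * hess1 z1 z2 z3 + 18 * (hess2 x1 x2 x3 * hess2 z1 z2 z3)"

lemma realized_cong: "realized P \<Longrightarrow> (\<And>x1 x2 x3 z1 z2 z3. Q x1 x2 x3 z1 z2 z3 = P x1 x2 x3 z1 z2 z3) \<Longrightarrow> realized Q"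
  by (simp add: realized_def col_fun_def)

lemma realized_hessian: "realized hessian_form"
proof (rule realized_cong)
  show "realized (\<lambda>x1 x2 x3 z1 z2 z3. x1 * x1 * x1 * (z1 * z1 * z1) + (x1 * x1 * x1 * (z2 * z2 * z2) + (x1 * x1 * x1 * (z3 * z3 * z3) +
     (x2 * x2 * x2 * (z1 * z1 * z1) + (x2 * x2 * x2 * (z2 * z2 * z2) + (x2 * x2 * x2 * (z3 * z3 * z3) +
     (x3 * x3 * x3 * (z1 * z1 * z1) + (x3 * x3 * x3 * (z2 * z2 * z2) + (x3 * x3 * x3 * (z3 * z3 * z3) + 18 * (x1 * x2 * x3 * (z1 * z2 * z3)))))))))))"
    by (intro realized_add realized_scale realized_prod lin3_proj)
qed (simp add: hessian_form_def hess1_def hess2_def algebra_simps)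

lemma hess_V:
  assumes "w * w = - 1 - w"
  shows "hess1 (c * x + c * y + c * z) (c * x + c * w * y + c * (w * w) * z) (c * x + c * (w * w) * y + c * w * z) = c * c * c * (3 * hess1 x y z + 18 * hess2 x y z)"
    "hess2 (c * x + c * y + c * z) (c * x + c * w * y + c * (w * w) * z) (c * x + c * (w * w) * y + c * w * z) = c * c * c * (hess1 x y z - 3 * hess2 x y z)"
  unfolding hess1_def hess2_def using assms by Groebner_Basis.algebra+

lemma hess_X:
  assumes "w * w = - 1 - w"
  shows "hess1 (c * x + c * y + c * (w * w) * z) (c * x + c * w * y + c * w * z) (c * w * x + c * y + c * w * z) = c * c * c * (3 * hess1 x y z + 18 * (w * w) * hess2 x y z)"
    "hess2 (c * x + c * y + c * (w * w) * z) (c * x + c * w * y + c * w * z) (c * w * x + c * y + c * w * z) = c * c * c * (w * hess1 x y z - 3 * hess2 x y z)"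
  unfolding hess1_def hess2_def using assms by Groebner_Basis.algebra+

lemma inv33_hessian: "inv33 matC hessian_form" "inv33 matD hessian_form" "inv33 matV hessian_form" "inv33 matX hessian_form"
proof -
  define w where "w = \<xi> 3"
  \<comment> \<open>The second equation is the hypothesis of \<open>hess_V\<close> and
    \<open>hess_X\<close> for \<open>w * w\<close>, since the variables \<open>z\<close> are
    transformed by the conjugate matrix.\<close>
  have w: "w * w = - 1 - w" "w * w * (w * w) = - 1 - w * w" using \<xi>_3 by (simp add: w_def, unfold w_def) (use \<xi>_3 in Groebner_Basis.algebra)
  have w4: "w * w * (w * w) = w" using w(1) by Groebner_Basis.algebra
  have cw: "cnj w = w * w" by (simp add: w_def \<xi>_3_cnj)
  have c: "cV * (2 * w + 1) = 1" using cV(1) by (simp add: w_def)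
  have cc: "cV * cV * 3 = - 1" using c w(1) by Groebner_Basis.algebra
  have w3: "w * w * w = 1" using w(1) by Groebner_Basis.algebra
  show "inv33 matV hessian_form"
    unfolding inv33_def matV_M3 M3_index w_def[symmetric] complex_cnj_mult cw cV(2) w4 hessian_form_def
  proof (intro allI)
    fix x1 x2 x3 z1 z2 z3
    note z = hess_V[OF w(2), of "- cV" z1 z2 z3, unfolded w4]
    show "hess1 (cV * x1 + cV * x2 + cV * x3) (cV * x1 + cV * w * x2 + cV * (w * w) * x3) (cV * x1 + cV * (w * w) * x2 + cV * w * x3) *
      hess1 (- cV * z1 + - cV * z2 + - cV * z3) (- cV * z1 + - cV * (w * w) * z2 + - cV * w * z3) (- cV * z1 + - cV * w * z2 + - cV * (w * w) * z3) +
      18 * (hess2 (cV * x1 + cV * x2 + cV * x3) (cV * x1 + cV * w * x2 + cV * (w * w) * x3) (cV * x1 + cV * (w * w) * x2 + cV * w * x3) *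
      hess2 (- cV * z1 + - cV * z2 + - cV * z3) (- cV * z1 + - cV * (w * w) * z2 + - cV * w * z3) (- cV * z1 + - cV * w * z2 + - cV * (w * w) * z3)) =
      hess1 x1 x2 x3 * hess1 z1 z2 z3 + 18 * (hess2 x1 x2 x3 * hess2 z1 z2 z3)"
      unfolding hess_V[OF w(1)] z using cc by Groebner_Basis.algebra
  qed
  show "inv33 matX hessian_form"
    unfolding inv33_def matX_M3 M3_index w_def[symmetric] complex_cnj_mult cw cV(2) w4 hessian_form_def
  proof (intro allI)
    fix x1 x2 x3 z1 z2 z3
    note z = hess_X[OF w(2), of "- cV" z1 z2 z3, unfolded w4]
    show "hess1 (cV * x1 + cV * x2 + cV * (w * w) * x3) (cV * x1 + cV * w * x2 + cV * w * x3) (cV * w * x1 + cV * x2 + cV * w * x3) *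
      hess1 (- cV * z1 + - cV * z2 + - cV * w * z3) (- cV * z1 + - cV * (w * w) * z2 + - cV * (w * w) * z3) (- cV * (w * w) * z1 + - cV * z2 + - cV * (w * w) * z3) +
      18 * (hess2 (cV * x1 + cV * x2 + cV * (w * w) * x3) (cV * x1 + cV * w * x2 + cV * w * x3) (cV * w * x1 + cV * x2 + cV * w * x3) *
      hess2 (- cV * z1 + - cV * z2 + - cV * w * z3) (- cV * z1 + - cV * (w * w) * z2 + - cV * (w * w) * z3) (- cV * (w * w) * z1 + - cV * z2 + - cV * (w * w) * z3)) =
      hess1 x1 x2 x3 * hess1 z1 z2 z3 + 18 * (hess2 x1 x2 x3 * hess2 z1 z2 z3)"
      unfolding hess_X[OF w(1)] z using cc w(1) by Groebner_Basis.algebra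
  qed
  have diag: "inv33 (M3 s 0 0 0 s' 0 0 0 s'') hessian_form"
    if "s' * s' * s' = s * s * s" "s'' * s'' * s'' = s * s * s" "cnj s' * cnj s' * cnj s' = cnj s * cnj s * cnj s" "cnj s'' * cnj s'' * cnj s'' = cnj s * cnj s * cnj s"
      "s * s * s * (cnj s * cnj s * cnj s) = 1" "s * s' * s'' * (cnj s * cnj s' * cnj s'') = 1" for s s' s''
    using that unfolding inv33_def M3_index hessian_form_def hess1_def hess2_def complex_cnj_zero
    by (intro allI) Groebner_Basis.algebra
  have iw: "inverse w = w * w" using w3 by (intro inverse_unique) (simp add: mult.assoc)
  show "inv33 matC hessian_form"
    unfolding matC_def matA_M3 w_def[symmetric] iw
    by (rule diag; (simp only: complex_cnj_one complex_cnj_mult cw)?; (simp; fail | insert w(1); Groebner_Basis.algebra))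
  define s where "s = \<xi> 9 ^ 2"
  have s: "s * cnj s = 1" using \<xi>_cnj[of 9] by (simp add: s_def power_mult_distrib[symmetric])
  show "inv33 matD hessian_form"
    unfolding matD_M3 s_def[symmetric] w_def[symmetric]
    by (rule diag; (simp only: complex_cnj_mult cw)?; insert w(1) s; Groebner_Basis.algebra)
qed

definition klein1 :: "complex \<Rightarrow> complex \<Rightarrow> complex \<Rightarrow> complex" where
  "klein1 x y z = 3 * (x * x * z) + y * y * y"

text \<open>\<open>klein1 x y z\<close>, \<open>klein1 y z x\<close>, \<open>klein1 z x y\<close> are the partial derivatives of the Klein quartic
  \<open>x\<^sup>3 z + y\<^sup>3 x + z\<^sup>3 y\<close>.\<close>

definition klein_form :: fun6 where
  "klein_form x1 x2 x3 z1 z2 z3 = klein1 x1 x2 x3 * klein1 z1 z2 z3 + klein1 x2 x3 x1 * klein1 z2 z3 z1 + klein1 x3 x1 x2 * klein1 z3 z1 z2"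

lemma realized_klein: "realized klein_form"
proof (rule realized_cong)
  show "realized (\<lambda>x1 x2 x3 z1 z2 z3.
      (9 * (x1 * x1 * x3 * (z1 * z1 * z3)) + (3 * (x1 * x1 * x3 * (z2 * z2 * z2)) + (3 * (x2 * x2 * x2 * (z1 * z1 * z3)) + x2 * x2 * x2 * (z2 * z2 * z2)))) +
     ((9 * (x2 * x2 * x1 * (z2 * z2 * z1)) + (3 * (x2 * x2 * x1 * (z3 * z3 * z3)) + (3 * (x3 * x3 * x3 * (z2 * z2 * z1)) + x3 * x3 * x3 * (z3 * z3 * z3)))) +
      (9 * (x3 * x3 * x2 * (z3 * z3 * z2)) + (3 * (x3 * x3 * x2 * (z1 * z1 * z1)) + (3 * (x1 * x1 * x1 * (z3 * z3 * z2)) + x1 * x1 * x1 * (z1 * z1 * z1))))))"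
    by (intro realized_add realized_scale realized_prod lin3_proj)
qed (simp add: klein_form_def klein1_def algebra_simps)

lemma \<xi>_7_sum: "\<xi> 7 ^ 6 + \<xi> 7 ^ 5 + \<xi> 7 ^ 4 + \<xi> 7 ^ 3 + \<xi> 7 ^ 2 + \<xi> 7 + 1 = 0"
proof -
  have "\<xi> 7 ^ 7 = 1" by (rule \<xi>_pow) simp
  then have "(\<xi> 7 - 1) * (\<xi> 7 ^ 6 + \<xi> 7 ^ 5 + \<xi> 7 ^ 4 + \<xi> 7 ^ 3 + \<xi> 7 ^ 2 + \<xi> 7 + 1) = 0" by Groebner_Basis.algebra
  moreover have "\<xi> 7 \<noteq> 1"
  proof
    assume "\<xi> 7 = 1"
    then have "sin (2 * pi / 7) = 0" by (simp add: \<xi>_def complex_eq_iff)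
    moreover have "sin (2 * pi / 7) > 0" by (intro sin_gt_zero) simp_all
    ultimately show False by simp
  qed
  ultimately show ?thesis by simp
qed

text \<open>The square of the Gauss sum is -7 by algebra; its sign is decided by the imaginary part,
  which is positive because the sines of \<open>pi / 7\<close> and \<open>2 * pi / 7\<close> are in
  increasing order.\<close>

lemma gauss_sum_7: "\<xi> 7 + \<xi> 7 ^ 2 + \<xi> 7 ^ 4 - \<xi> 7 ^ 3 - \<xi> 7 ^ 5 - \<xi> 7 ^ 6 = \<i> * complex_of_real (sqrt 7)"
proof -
  let ?S = "\<xi> 7 + \<xi> 7 ^ 2 + \<xi> 7 ^ 4 - \<xi> 7 ^ 3 - \<xi> 7 ^ 5 - \<xi> 7 ^ 6"
  have sq: "?S * ?S = - 7" using \<xi>_7_sum by Groebner_Basis.algebra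
  have "Im (\<xi> 7 ^ k) = sin (real k * (2 * pi / 7))" for k by (simp add: \<xi>_def DeMoivre)
  note im = this[of 1] this[of 2] this[of 3] this[of 4] this[of 5] this[of 6]
  have p: "sin (2 * pi / 7) > 0" "sin (4 * pi / 7) > 0" by (intro sin_gt_zero; simp)+
  have "sin (pi / 7) < sin (2 * pi / 7)" by (rule sin_monotone_2pi) (insert pi_gt_zero, linarith+)
  note p = p this
  have s: "sin (6 * pi / 7) = sin (pi / 7)" "sin (8 * pi / 7) = - sin (pi / 7)" "sin (10 * pi / 7) = - sin (4 * pi / 7)" "sin (12 * pi / 7) = - sin (2 * pi / 7)"
    using sin_pi_minus[of "pi / 7"] sin_periodic_pi[of "pi / 7"] sin_2pi_minus[of "4 * pi / 7"] sin_2pi_minus[of "2 * pi / 7"]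
    by (simp_all add: field_simps)
  have "Im ?S > 0" using im p s by (simp add: field_simps)
  have "(?S - \<i> * complex_of_real (sqrt 7)) * (?S + \<i> * complex_of_real (sqrt 7)) = 0"
  proof -
    have "\<i> * complex_of_real (sqrt 7) * (\<i> * complex_of_real (sqrt 7)) = - 7"
      by (simp add: complex_eq_iff)
    then show ?thesis using sq by Groebner_Basis.algebra
  qed
  moreover have "?S + \<i> * complex_of_real (sqrt 7) \<noteq> 0"
  proof
    assume "?S + \<i> * complex_of_real (sqrt 7) = 0"
    then have "Im (?S + \<i> * complex_of_real (sqrt 7)) = 0" by simp
    then have "Im ?S + sqrt 7 = 0" by simp
    moreover have "sqrt 7 \<ge> (0 :: real)" by simp
    ultimately show False using \<open>Im ?S > 0\<close> by linarith
  qed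
  ultimately have "?S - \<i> * complex_of_real (sqrt 7) = 0" by (simp only: mult_eq_0_iff) blast
  then show ?thesis by simp
qed

text \<open>The entries are the three real roots of t^3 + t^2 - 1/7, hence their elementary
  symmetric functions; the last equation is only cyclically symmetric and records the order of the
  roots.\<close>

lemma matZ_entries:
  obtains a b c :: complex where "matZ = M3 a b c b c a c a b" "cnj a = a" "cnj b = b" "cnj c = c"
    "a + b + c = - 1" "a * b + b * c + c * a = 0" "7 * (a * b * c) = 1" "7 * (a * a * b + b * b * c + c * c * a) = - 2"
proof -
  define x where "x = \<xi> 7"
  define r where "r = \<i> / complex_of_real (sqrt 7)"
  have x: "x ^ 6 + x ^ 5 + x ^ 4 + x ^ 3 + x ^ 2 + x + 1 = 0" using \<xi>_7_sum by (simp add: x_def)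
  have r: "r * (x + x ^ 2 + x ^ 4 - x ^ 3 - x ^ 5 - x ^ 6) = - 1" unfolding x_def gauss_sum_7 by (simp add: r_def)
  have cr: "cnj r = - r" by (simp add: r_def)
  have "x * cnj x = 1" using \<xi>_cnj[of 7] by (simp add: x_def)
  then have cx: "cnj x = x ^ 6" using x by Groebner_Basis.algebra
  define a where "a = r * (x ^ 4 - x ^ 3)"
  define b where "b = r * (x ^ 2 - x ^ 5)"
  define c where "c = r * (x - x ^ 6)"
  have "matZ = M3 a b c b c a c a b"
    by (simp add: matZ_def M3_def[symmetric] M3_smult a_def b_def c_def r_def x_def)
  moreover have "cnj a = a" "cnj b = b" "cnj c = c"
    unfolding a_def b_def c_def complex_cnj_mult complex_cnj_diff complex_cnj_power cr cx using x by Groebner_Basis.algebra+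
  moreover have "a + b + c = - 1" "a * b + b * c + c * a = 0" "7 * (a * b * c) = 1" "7 * (a * a * b + b * b * c + c * c * a) = - 2"
    unfolding a_def b_def c_def using x r by Groebner_Basis.algebra+
  ultimately show ?thesis using that by blast
qed

lemma matZ_SU3: "matZ \<in> carrier SU3"
proof -
  obtain a b c where Z: "matZ = M3 a b c b c a c a b" "cnj a = a" "cnj b = b" "cnj c = c"
    "a + b + c = - 1" "a * b + b * c + c * a = 0" by (rule matZ_entries)
  show ?thesis unfolding Z(1)
  proof (rule M3_SU3I)
    have "a * a + b * b + c * c = 1" using Z(5,6) by Groebner_Basis.algebra
    then show "M3 (cnj a) (cnj b) (cnj c) (cnj b) (cnj c) (cnj a) (cnj c) (cnj a) (cnj b) * M3 a b c b c a c a b = 1\<^sub>m 3"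
      using Z(6) by (simp add: Z(2-4) M3_mult M3_one M3_eq_iff algebra_simps)
    show "a * (c * b - a * a) - b * (b * b - a * c) + c * (b * a - c * c) = 1"
      using Z(5,6) by Groebner_Basis.algebra
  qed
qed

text \<open>Invariance of the Klein quartic expressed by its gradient: the matrix is symmetric and
  orthogonal, so it transforms the gradient in the same way as the coordinates.\<close>

lemma klein1_Z:
  assumes "a + b + c = (- 1 :: complex)" "a * b + b * c + c * a = 0" "7 * (a * b * c) = 1" "7 * (a * a * b + b * b * c + c * c * a) = - 2"
  shows "klein1 (a * x + b * y + c * z) (b * x + c * y + a * z) (c * x + a * y + b * z) = a * klein1 x y z + b * klein1 y z x + c * klein1 z x y"
  unfolding klein1_def using assms by Groebner_Basis.algebra

text \<open>For \<open>matZ\<close> both gradients are multiplied by the same orthogonal matrix,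
  which preserves their bilinear product; \<open>matY\<close> only introduces phases that cancel
  between \<open>x\<close> and \<open>z\<close>.\<close>

lemma inv33_klein: "inv33 matY klein_form" "inv33 matZ klein_form"
proof -
  obtain a b c where Z: "matZ = M3 a b c b c a c a b" "cnj a = a" "cnj b = b" "cnj c = c"
    "a + b + c = - 1" "a * b + b * c + c * a = 0" "7 * (a * b * c) = 1" "7 * (a * a * b + b * b * c + c * c * a) = - 2" by (rule matZ_entries)
  have Z': "b + c + a = - 1" "b * c + c * a + a * b = 0" "7 * (b * c * a) = 1" "7 * (b * b * c + c * c * a + a * a * b) = - 2"
    and Z'': "c + a + b = - 1" "c * a + a * b + b * c = 0" "7 * (c * a * b) = 1" "7 * (c * c * a + a * a * b + b * b * c) = - 2"
    using Z(5-8) by (simp_all add: algebra_simps)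
  have k: "klein1 (a * x + b * y + c * z) (b * x + c * y + a * z) (c * x + a * y + b * z) = a * klein1 x y z + b * klein1 y z x + c * klein1 z x y"
    "klein1 (b * x + c * y + a * z) (c * x + a * y + b * z) (a * x + b * y + c * z) = b * klein1 x y z + c * klein1 y z x + a * klein1 z x y"
    "klein1 (c * x + a * y + b * z) (a * x + b * y + c * z) (b * x + c * y + a * z) = c * klein1 x y z + a * klein1 y z x + b * klein1 z x y" for x y z
    by (rule klein1_Z[OF Z(5-8)], rule klein1_Z[OF Z'], rule klein1_Z[OF Z''])
  show "inv33 matZ klein_form"
    unfolding inv33_def Z(1) M3_index Z(2-4) klein_form_def k using Z(5,6) by (intro allI) Groebner_Basis.algebra
  define s where "s = \<xi> 7"
  define t where "t = cnj s"
  have "s ^ 7 = 1" unfolding s_def by (rule \<xi>_pow) simp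
  then have "s * s * s * s * s * s * s = 1" by (simp add: eval_nat_numeral mult_ac)
  moreover have st: "s * t = 1" using \<xi>_cnj[of 7] by (simp add: s_def t_def)
  ultimately show "inv33 matY klein_form"
    unfolding inv33_def matY_M3 M3_index klein_form_def klein1_def complex_cnj_power complex_cnj_zero s_def[symmetric] t_def[symmetric]
    by (intro allI) Groebner_Basis.algebra
qed

lemma col_fun_matV: "col_fun P matV = P cV cV cV (- cV) (- cV * \<xi> 3) (- cV * (\<xi> 3 * \<xi> 3))"
proof -
  have "\<xi> 3 * \<xi> 3 * (\<xi> 3 * \<xi> 3) = \<xi> 3" using \<xi>_3 by Groebner_Basis.algebra
  then show ?thesis by (simp only: col_fun_def matV_M3 M3_index complex_cnj_mult cV(2) \<xi>_3_cnj)
qed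

text \<open>One test element serves all four forms. For the last two a multiplier in the ring of
  \<open>\<xi> 3\<close> and \<open>\<nu>\<^sub>1\<close> turns the value into a nonzero integer
  multiple of \<open>s\<close>.\<close>

lemma forms_nonzero:
  "col_fun product_form matV \<noteq> 0" "col_fun icosahedral_form matV \<noteq> 0" "col_fun hessian_form matV \<noteq> 0" "col_fun klein_form matV \<noteq> 0"
proof -
  have c: "cV \<noteq> 0" using cV(1) by auto
  have w: "\<xi> 3 * \<xi> 3 * \<xi> 3 = 1" using \<xi>_3 by Groebner_Basis.algebra
  define s where "s = cV * cV * cV * (cV * cV * cV)"
  have s0: "s \<noteq> 0" using c by (simp add: s_def)
  have "col_fun product_form matV = - s"
    unfolding col_fun_matV product_form_def s_def using w by Groebner_Basis.algebra
  then show "col_fun product_form matV \<noteq> 0" using s0 by simp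
  have "col_fun hessian_form matV = - 27 * s"
    unfolding col_fun_matV hessian_form_def hess1_def hess2_def s_def using w by Groebner_Basis.algebra
  then show "col_fun hessian_form matV \<noteq> 0" using s0 by simp
  have "col_fun klein_form matV * (1 + 3 * \<xi> 3) = - 84 * s"
    unfolding col_fun_matV klein_form_def klein1_def s_def using \<xi>_3 by Groebner_Basis.algebra
  then show "col_fun klein_form matV \<noteq> 0" using s0 by auto
  have "col_fun icosahedral_form matV * (- 8 - 5 * \<nu>\<^sub>1 - 9 * \<xi> 3 - 6 * \<nu>\<^sub>1 * \<xi> 3) = - 96 * s"
    unfolding col_fun_matV icosahedral_form_def axis_form_def s_def using \<xi>_3 \<nu>_simps(2) by Groebner_Basis.algebra
  then show "col_fun icosahedral_form matV \<noteq> 0" using s0 by auto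
qed

lemma others_not_inaccessible:
  "\<not> inaccessible (Delta3 n) (3, 3)" "\<not> inaccessible (Delta6 n) (3, 3)" "\<not> inaccessible Sigma60 (3, 3)"
  "\<not> inaccessible Sigma168 (3, 3)" "\<not> inaccessible Sigma36x3 (3, 3)" "\<not> inaccessible Sigma72x3 (3, 3)"
  "\<not> inaccessible Sigma216x3 (3, 3)"
proof -
  note S = matA_SU3 matB_SU3 matE_SU3 matD_SU3 matV_SU3 matX_SU3 matY_SU3 matZ_SU3 SU3_mult[OF matA_SU3 matW_SU3]
  have C: "matC \<in> carrier SU3" unfolding matC_def by (rule matA_SU3)
  note main = not_inaccessible_33[OF _ _ _ matV_SU3]
  show "\<not> inaccessible (Delta3 n) (3, 3)" unfolding Delta3_def
    by (rule main[OF _ realized_product _ forms_nonzero(1)]) (use S inv33_product in auto)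
  show "\<not> inaccessible (Delta6 n) (3, 3)" unfolding Delta6_def
    by (rule main[OF _ realized_product _ forms_nonzero(1)]) (use S inv33_product in auto)
  show "\<not> inaccessible Sigma60 (3, 3)" unfolding Sigma60_def
    by (rule main[OF _ realized_icosahedral _ forms_nonzero(2)]) (use S inv33_icosahedral in auto)
  show "\<not> inaccessible Sigma168 (3, 3)" unfolding Sigma168_def
    by (rule main[OF _ realized_klein _ forms_nonzero(4)]) (use S inv33_klein in auto)
  show "\<not> inaccessible Sigma36x3 (3, 3)" unfolding Sigma36x3_def
    by (rule main[OF _ realized_hessian _ forms_nonzero(3)]) (use S C inv33_hessian in auto)
  show "\<not> inaccessible Sigma72x3 (3, 3)" unfolding Sigma72x3_def
    by (rule main[OF _ realized_hessian _ forms_nonzero(3)]) (use S inv33_hessian in auto)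
  show "\<not> inaccessible Sigma216x3 (3, 3)" unfolding Sigma216x3_def
    by (rule main[OF _ realized_hessian _ forms_nonzero(3)]) (use S inv33_hessian in auto)
qed

theorem mainTheorem6:
  shows "subgroup Sigma360x3 SU3 \<and> finite Sigma360x3 \<and>
    (\<forall>d \<in> interaction_labels. inaccessible Sigma360x3 d) \<and>
    {d. d \<noteq> (0, 0) \<and> (\<exists>K \<le> 3. occurs_in_power d (1, 1) K)} = interaction_labels \<and>
    (\<forall>N. \<forall>K \<in> {1, 2, 3}. \<forall>M \<in> body_interactions N K.
       anisotropic N M \<longrightarrow> decouples Sigma360x3 N M) \<and>
    {G \<in> candidate_groups. \<forall>d \<in> interaction_labels. inaccessible G d} = {Sigma360x3}"
proof (intro conjI)
  show "subgroup Sigma360x3 SU3" unfolding Sigma360x3_def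
    using matA_SU3 matE_SU3 matW_SU3 matF_SU3 by (intro group.generate_is_subgroup[OF SU3_group]) auto
  show "finite Sigma360x3" by (rule finite_Sigma360x3)
  show ina: "\<forall>d\<in>interaction_labels. inaccessible Sigma360x3 d" using Sigma360x3_inaccessible by blast
  have "(0, 0) \<notin> interaction_labels" by (simp add: interaction_labels_def)
  then show "{d. d \<noteq> (0, 0) \<and> (\<exists>K\<le>3. occurs_in_power d (1, 1) K)} = interaction_labels"
    using occurs_in_power_labels interaction_labels_occur by blast
  show "\<forall>N. \<forall>K\<in>{1, 2, 3}. \<forall>M\<in>body_interactions N K. anisotropic N M \<longrightarrow> decouples Sigma360x3 N M"
    using Sigma360x3_decouples[OF finite_Sigma360x3] by blast
  have "(3, 3) \<in> interaction_labels" by (simp add: interaction_labels_def)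
  then show "{G \<in> candidate_groups. \<forall>d\<in>interaction_labels. inaccessible G d} = {Sigma360x3}"
    using ina others_not_inaccessible unfolding candidate_groups_def by blast
qed

end
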